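(* Let $k\ge 1$ and $m>k$ be integers. Then the map $$\Xi_{\mathfrak Q,m,k}:\mathfrak S_{m,k}\to \mathfrak K_{\mathfrak Q,m,k},\qquad \Xi_{\mathfrak Q,m,k}(\mathcal S):=\frac1{(k+1)!}\sum_{\alpha,\beta}g\bigl(\mathcal S(\mathcal R)\wedge e^\alpha\wedge\bar e^\beta,\Omega^{k+1}\bigr)\,e_\alpha\circ\bar e_\beta ,$$ is an isomorphism (of complex vector spaces). In other words, every $S_2^+$-valued curvature identity of order $2k$ which is given universally by contracting indices in pairs, which is generically non-zero in complex dimension $m>k$, and which vanishes in complex dimension $k$, is of the form $\Xi_{\mathfrak Q,m,k}(\mathcal S)$ with $\mathcal S\in\mathfrak S_{m,k}$.
   Context: Kähler manifolds. $(M,g,J)$ is a Kähler manifold of complex dimension $m$: $J$ is an integrable complex structure, $g$ a $J$-invariant Riemannian metric, and $\Omega(x,y):=g(x,Jy)$ satisfies $d\Omega=0$. $\nabla$ is the Levi-Civita connection, $\mathcal R(x,y)=\nabla_x\nabla_y-\nabla_y\nabla_x-\nabla_{[x,y]}$ and $R(x,y,z,w)=g(\mathcal R(x,y)z,w)$. Since $\mathcal R(x,y)$ commutes with $J$, $\mathcal R$ is regarded as an $m\times m$ complex matrix of 2-forms (endomorphisms of the complex vector bundle $(TM,J)$). The metric is extended complex bilinearly to complexified tensors and $g(\cdot,\cdot)$ also denotes the induced (bilinear) pairing of differential forms. $\{e_\alpha\}_{\alpha=1}^m$ is a local unitary frame of type $(1,0)$, with conjugates $\bar e_\alpha$ and dual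 coframe $e^\alpha,\bar e^\alpha$; $\circ$ is the symmetric product. $S_+^2M$ is the bundle of $J$-invariant symmetric covariant 2-tensors and $S_2^+M$ is its dual (invariants are allowed complex coefficients). Invariant polynomials. $\mathfrak S_m$ is the ring of polynomial maps $\mathcal S:M_m(\mathbb C)\to\mathbb C$ with $\mathcal S(ABA^{-1})=\mathcal S(B)$ for all $A\in GL_m(\mathbb C)$, $B\in M_m(\mathbb C)$; $\mathfrak S_{m,k}\subset\mathfrak S_m$ is the subspace homogeneous of degree $k$. For $\mathcal S\in\mathfrak S_{m,k}$, $\mathcal S(\mathcal R)$ is the complex valued $2k$-form obtained by evaluating $\mathcal S$ on the matrix of 2-forms $\mathcal R$. Universal local formulas. For collections $A=(\alpha_1,\dots,\alpha_a)$ and $B=(\beta_1,\dots,\beta_b)$ of indices in $\{1,\dots,m\}$ put $g(A;B):=\partial_{z_{\alpha_2}}\cdots\partial_{z_{\alpha_a}}\partial_{\bar z_{\beta_2}}\cdots\partial_{\bar z_{\beta_b}}g_{\alpha_1\bar\beta_1}$, where $g_{\alpha\bar\beta}=g(\partial_{z_\alpha},\partial_{\bar z_\beta})$; by $d\Omega=0$ this does not depend on the order of the indices within $A$ or within $B$. Indices in $A$ are called holomorphic, indices in $B$ anti-holomorphic. At a point $P$ one uses local holomorphic coordinates centered at $P$ with $g_{\alpha\bar\beta}(P)=\delta_{\alpha\beta}$ and $g(A;B)(P)=0$ for $|B|=1$, $2\le|A|\le n$ ($n$ large); these are unique up to $U(m)$ to high order, and the remaining jets $g(A;B)(P)$, $|A|,|B|\ge2$,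 can be prescribed arbitrarily subject to $g(B;A)=\overline{g(A;B)}$. For instance $R(\partial_{z_{\alpha_1}},\partial_{\bar z_{\beta_1}},\partial_{\bar z_{\beta_2}},\partial_{z_{\alpha_2}})(P)=g(\alpha_1,\alpha_2;\beta_1,\beta_2)(P)$. Let $\mathfrak P_m$ be the complex polynomial algebra in the formal variables $g(A;B)$ with $|A|\ge2$, $|B|\ge2$, and let $\mathfrak Q_m$ be the free $\mathfrak P_m$-module of all $\sum_{\alpha,\beta}\mathcal P^{\alpha\bar\beta}\,\partial_{z_\alpha}\circ\partial_{\bar z_\beta}$ with $\mathcal P^{\alpha\bar\beta}\in\mathfrak P_m$. The group $U(m)$ acts by substituting $\partial_{z_\alpha}\mapsto T\partial_{z_\alpha}$, $\partial_{\bar z_\alpha}\mapsto\overline{T}\partial_{\bar z_\alpha}$ simultaneously and multilinearly in all holomorphic and anti-holomorphic indices (so $g(\cdot;\cdot)$ is treated as a tensor symmetric in holomorphic and in anti-holomorphic slots). The order of a monomial is $\sum_i(|A_i|+|B_i|-2)$, the sum running over its factors $g(A_i;B_i)$. $\mathfrak Q^U_{m,k}$ is the space of $U(m)$-invariant elements of $\mathfrak Q_m$ homogeneous of order $2k$; such elements are identified with the $S_2^+$-valued local formulas they define on Kähler manifolds of complex dimension $m$ (so $\Xi_{\mathfrak Q,m,k}(\mathcal S)$ is regarded as an element of $\mathfrak Q^U_{m,k}$). Restriction. For $\nu<m$, $r_{m,\nu}$ sends a monomial to itself if no holomorphic or anti-holomorphic index $>\nu$ occurs in it (including in the factor $\partial_{z_\alpha}\circ\partial_{\bar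 z_\beta}$), and to $0$ otherwise; it is extended linearly to $r_{m,\nu}:\mathfrak Q^U_{m,k}\to\mathfrak Q^U_{\nu,k}$. Finally $\mathfrak K_{\mathfrak Q,m,k}:=\ker(r_{m,k})\cap\mathfrak Q^U_{m,k}$ is the space of $S_2^+$-valued universal invariants of order $2k$ which vanish when restricted from complex dimension $m$ to complex dimension $k$. *)

theory Defs
  imports
    "HOL-Library.Poly_Mapping"
    "HOL-Library.Multiset"
    "HOL-Analysis.Function_Topology"
    "HOL-Analysis.Derivative"
    "Jordan_Normal_Form.Determinant"
    "Jordan_Normal_Form.Schur_Decomposition"
begin

text \<open>
  Indices run over \<open>{..<m}\<close> instead of \<open>{1..m}\<close>. The complexified coordinate frame is
  enumerated by \<open>{..<2 * m}\<close>: the even number \<open>2 * \<alpha>\<close> stands for \<open>\<partial>\<^sub>z\<close> with index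
  \<open>\<alpha>\<close> (type (1,0)) and the odd number \<open>2 * \<beta> + 1\<close> for \<open>\<partial>\<^sub>z\<close> conjugate with index
  \<open>\<beta>\<close> (type (0,1)); the same encoding is used for the dual coframe.
\<close>

section \<open>Multivariate polynomials\<close>

type_synonym 'v poly_over = "('v \<Rightarrow>\<^sub>0 nat) \<Rightarrow>\<^sub>0 complex"

definition pconst :: "complex \<Rightarrow> 'v poly_over" where
  "pconst c = Poly_Mapping.single 0 c"

definition pvar :: "'v \<Rightarrow> 'v poly_over" where
  "pvar v = Poly_Mapping.single (Poly_Mapping.single v 1) 1"

text \<open>The homomorphism extending \<open>emb\<close> on constants and sending the variable \<open>v\<close> to \<open>x v\<close>.\<close>

definition peval :: "(complex \<Rightarrow> 'a::comm_ring_1) \<Rightarrow> ('v \<Rightarrow> 'a) \<Rightarrow> 'v poly_over \<Rightarrow> 'a" where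
  "peval emb x p = (\<Sum>\<mu>\<in>Poly_Mapping.keys p. emb (Poly_Mapping.lookup p \<mu>) *
     (\<Prod>v\<in>Poly_Mapping.keys \<mu>. x v ^ Poly_Mapping.lookup \<mu> v))"


section \<open>Invariant polynomials on matrices\<close>

text \<open>
  Since the complex numbers are infinite, polynomial maps on \<open>m \<times> m\<close> matrices are the same as
  polynomials in the \<open>m\<^sup>2\<close> matrix entries; the variable \<open>(i, j)\<close> is the entry in row \<open>i\<close> and
  column \<open>j\<close>.
\<close>

definition mat_poly :: "(nat \<times> nat) poly_over \<Rightarrow> complex mat \<Rightarrow> complex" where
  "mat_poly S B = peval (\<lambda>c. c) (\<lambda>(i, j). B $$ (i, j)) S"

definition inv_polys :: "nat \<Rightarrow> nat \<Rightarrow> (nat \<times> nat) poly_over set" where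
  "inv_polys m k = {S.
     (\<forall>\<mu>\<in>Poly_Mapping.keys S. Poly_Mapping.keys \<mu> \<subseteq> {..<m} \<times> {..<m} \<and>
        (\<Sum>v\<in>Poly_Mapping.keys \<mu>. Poly_Mapping.lookup \<mu> v) = k) \<and>
     (\<forall>A\<in>carrier_mat m m. \<forall>A'\<in>carrier_mat m m. \<forall>B\<in>carrier_mat m m.
        A * A' = 1\<^sub>m m \<and> A' * A = 1\<^sub>m m \<longrightarrow> mat_poly S (A * B * A') = mat_poly S B)}"


section \<open>Universal local formulas\<close>

text \<open>
  The variable \<open>(A, B)\<close> is \<open>g(A;B)\<close>; as the order of the indices within \<open>A\<close> and within \<open>B\<close> is
  immaterial, index collections are multisets.
\<close>

type_synonym jet_var = "nat multiset \<times> nat multiset"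
type_synonym jet_poly = "jet_var poly_over"

text \<open>
  An element \<open>Q\<close> of the free module is given by its coefficients: \<open>Q \<alpha> \<beta>\<close> is the coefficient of the
  symmetric product of \<open>\<partial>\<^sub>z\<close> (index \<open>\<alpha>\<close>) with the conjugate of \<open>\<partial>\<^sub>z\<close> (index \<open>\<beta>\<close>).
\<close>

type_synonym jet_tensor = "nat \<Rightarrow> nat \<Rightarrow> jet_poly"

definition jet_monom :: "nat \<Rightarrow> (jet_var \<Rightarrow>\<^sub>0 nat) \<Rightarrow> bool" where
  "jet_monom m \<mu> \<longleftrightarrow> (\<forall>(A, B)\<in>Poly_Mapping.keys \<mu>.
     set_mset A \<subseteq> {..<m} \<and> set_mset B \<subseteq> {..<m} \<and> 2 \<le> size A \<and> 2 \<le> size B)"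

definition jet_order :: "(jet_var \<Rightarrow>\<^sub>0 nat) \<Rightarrow> nat" where
  "jet_order \<mu> = (\<Sum>(A, B)\<in>Poly_Mapping.keys \<mu>.
     Poly_Mapping.lookup \<mu> (A, B) * (size A + size B - 2))"

definition jet_tensors :: "nat \<Rightarrow> jet_tensor set" where
  "jet_tensors m = {Q. (\<forall>\<alpha> \<beta>. (m \<le> \<alpha> \<or> m \<le> \<beta>) \<longrightarrow> Q \<alpha> \<beta> = 0) \<and>
     (\<forall>\<alpha> \<beta>. \<forall>\<mu>\<in>Poly_Mapping.keys (Q \<alpha> \<beta>). jet_monom m \<mu>)}"

definition homogeneous_of_order :: "nat \<Rightarrow> jet_tensor \<Rightarrow> bool" where
  "homogeneous_of_order n Q \<longleftrightarrow>
     (\<forall>\<alpha> \<beta>. \<forall>\<mu>\<in>Poly_Mapping.keys (Q \<alpha> \<beta>). jet_order \<mu> = n)"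

text \<open>
  The matrix \<open>T\<close> sends \<open>\<partial>\<^sub>z\<close> with index \<open>\<alpha>\<close> to the combination of the \<open>\<partial>\<^sub>z\<close> with coefficients
  \<open>T $$ (\<gamma>, \<alpha>)\<close>, and the conjugate frame accordingly; \<open>g(A;B)\<close> is expanded multilinearly.
\<close>

definition act_var :: "nat \<Rightarrow> complex mat \<Rightarrow> jet_var \<Rightarrow> jet_poly" where
  "act_var m T = (\<lambda>(A, B).
     let as = sorted_list_of_multiset A; bs = sorted_list_of_multiset B in
     \<Sum>cs\<in>{cs. length cs = length as \<and> set cs \<subseteq> {..<m}}.
     \<Sum>ds\<in>{ds. length ds = length bs \<and> set ds \<subseteq> {..<m}}.
       pconst ((\<Prod>i<length as. T $$ (cs ! i, as ! i)) *
               (\<Prod>j<length bs. cnj (T $$ (ds ! j, bs ! j)))) *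
       pvar (mset cs, mset ds))"

definition act_tensor :: "nat \<Rightarrow> complex mat \<Rightarrow> jet_tensor \<Rightarrow> jet_tensor" where
  "act_tensor m T Q = (\<lambda>\<gamma> \<delta>. if \<gamma> < m \<and> \<delta> < m
     then \<Sum>\<alpha><m. \<Sum>\<beta><m. pconst (T $$ (\<gamma>, \<alpha>) * cnj (T $$ (\<delta>, \<beta>))) *
            peval pconst (act_var m T) (Q \<alpha> \<beta>)
     else 0)"

definition unitary_group :: "nat \<Rightarrow> complex mat set" where
  "unitary_group m = {T \<in> carrier_mat m m. T * mat_adjoint T = 1\<^sub>m m \<and> mat_adjoint T * T = 1\<^sub>m m}"

definition invariant_jet_tensors :: "nat \<Rightarrow> nat \<Rightarrow> jet_tensor set" where
  "invariant_jet_tensors m k = {Q \<in> jet_tensors m.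
     homogeneous_of_order (2 * k) Q \<and> (\<forall>T\<in>unitary_group m. act_tensor m T Q = Q)}"

definition restrict_poly :: "nat \<Rightarrow> jet_poly \<Rightarrow> jet_poly" where
  "restrict_poly \<nu> p = (\<Sum>\<mu>\<in>Poly_Mapping.keys p.
     if \<forall>(A, B)\<in>Poly_Mapping.keys \<mu>. set_mset A \<subseteq> {..<\<nu>} \<and> set_mset B \<subseteq> {..<\<nu>}
     then Poly_Mapping.single \<mu> (Poly_Mapping.lookup p \<mu>) else 0)"

definition restrict_tensor :: "nat \<Rightarrow> jet_tensor \<Rightarrow> jet_tensor" where
  "restrict_tensor \<nu> Q = (\<lambda>\<alpha> \<beta>. if \<alpha> < \<nu> \<and> \<beta> < \<nu> then restrict_poly \<nu> (Q \<alpha> \<beta>) else 0)"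

definition restriction_kernel :: "nat \<Rightarrow> nat \<Rightarrow> jet_tensor set" where
  "restriction_kernel m k =
     {Q \<in> invariant_jet_tensors m k. restrict_tensor k Q = (\<lambda>\<alpha> \<beta>. 0)}"


section \<open>Exterior algebra\<close>

text \<open>
  A form with coefficients in a commutative ring is given by its coefficients with respect to the
  basis of the exterior algebra consisting of the increasingly ordered wedge products of coframe
  elements; \<open>\<omega> I\<close> is the coefficient of the product over the finite set \<open>I\<close>.
\<close>

type_synonym 'a form = "nat set \<Rightarrow> 'a"

definition shuffle_sign :: "nat set \<Rightarrow> nat set \<Rightarrow> 'a::comm_ring_1" where
  "shuffle_sign I J = (- 1) ^ card {(i, j). i \<in> I \<and> j \<in> J \<and> j < i}"

definition wedge :: "'a::comm_ring_1 form \<Rightarrow> 'a form \<Rightarrow> 'a form" (infixl \<open>\<and>\<^sub>w\<close> 70) where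
  "\<omega> \<and>\<^sub>w \<eta> = (\<lambda>K. \<Sum>I\<in>Pow K. shuffle_sign I (K - I) * \<omega> I * \<eta> (K - I))"

definition unit_form :: "'a::comm_ring_1 form" where
  "unit_form = (\<lambda>K. if K = {} then 1 else 0)"

definition covec :: "nat \<Rightarrow> 'a::comm_ring_1 form" where
  "covec a = (\<lambda>K. if K = {a} then 1 else 0)"

definition wedge_list :: "'a::comm_ring_1 form list \<Rightarrow> 'a form" where
  "wedge_list \<omega>s = foldr (\<and>\<^sub>w) \<omega>s unit_form"

definition wedge_power :: "'a::comm_ring_1 form \<Rightarrow> nat \<Rightarrow> 'a form" where
  "wedge_power \<omega> n = wedge_list (replicate n \<omega>)"

text \<open>The 2-form with values \<open>w a b\<close> on pairs of frame vectors (\<open>w\<close> is meant to be alternating).\<close>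

definition two_form :: "nat \<Rightarrow> (nat \<Rightarrow> nat \<Rightarrow> 'a::comm_ring_1) \<Rightarrow> 'a form" where
  "two_form m w = (\<lambda>K. \<Sum>b<2 * m. \<Sum>a<b. w a b * (covec a \<and>\<^sub>w covec b) K)"

text \<open>
  Evaluation of a matrix polynomial on a matrix of 2-forms. As 2-forms commute with each other, the
  order of the factors is immaterial.
\<close>

definition mat_poly_form ::
  "(complex \<Rightarrow> 'a::comm_ring_1) \<Rightarrow> nat \<Rightarrow> (nat \<times> nat) poly_over \<Rightarrow> (nat \<Rightarrow> nat \<Rightarrow> 'a form) \<Rightarrow> 'a form"
  where
  "mat_poly_form emb m S X = (\<lambda>K. \<Sum>\<mu>\<in>Poly_Mapping.keys S. emb (Poly_Mapping.lookup S \<mu>) *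
     wedge_list [wedge_power (X i j) (Poly_Mapping.lookup \<mu> (i, j)). i \<leftarrow> [0..<m], j \<leftarrow> [0..<m]] K)"

text \<open>
  The values of the complex bilinear metric on a unitary frame of type (1,0) and its conjugates, and
  likewise on the dual coframe: a frame element is paired nontrivially only with its own conjugate.
\<close>

definition unitary_metric :: "nat \<Rightarrow> nat \<Rightarrow> complex" where
  "unitary_metric a b = (if a div 2 = b div 2 \<and> a \<noteq> b then 1 else 0)"

text \<open>\<open>J\<close> acts on the frame vector \<open>b\<close> as the scalar \<open>J_eigen b\<close>.\<close>

definition J_eigen :: "nat \<Rightarrow> complex" where
  "J_eigen b = (if even b then \<i> else - \<i>)"

definition kaehler_2form :: "nat \<Rightarrow> complex form" where
  "kaehler_2form m = two_form m (\<lambda>a b. unitary_metric a b * J_eigen b)"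

text \<open>
  The bilinear pairing of forms induced by the metric, the pairing of two decomposable forms being the
  determinant of the pairings of their factors.
\<close>

definition form_pairing ::
  "(complex \<Rightarrow> 'a::comm_ring_1) \<Rightarrow> nat \<Rightarrow> 'a form \<Rightarrow> complex form \<Rightarrow> 'a" where
  "form_pairing emb m \<omega> \<eta> =
     (\<Sum>I\<in>Pow {..<2 * m}. \<Sum>J\<in>{J \<in> Pow {..<2 * m}. card J = card I}.
        \<omega> I * emb (\<eta> J * Determinant.det (mat (card I) (card I)
          (\<lambda>(i, j). unitary_metric (sorted_list_of_set I ! i) (sorted_list_of_set J ! j)))))"


section \<open>The map \<open>\<Xi>\<close>\<close>

text \<open>
  \<open>X \<delta> \<gamma>\<close> is the 2-form in row \<open>\<delta>\<close> and column \<open>\<gamma>\<close> of the curvature matrix with respect to a unitary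
  frame. Coefficients are complex numbers (curvature at a point of a Kaehler manifold) or elements of
  the algebra of formal jet variables.
\<close>

definition Xi_of_curvature ::
  "(complex \<Rightarrow> 'a::comm_ring_1) \<Rightarrow> nat \<Rightarrow> nat \<Rightarrow> (nat \<Rightarrow> nat \<Rightarrow> 'a form) \<Rightarrow> (nat \<times> nat) poly_over
    \<Rightarrow> nat \<Rightarrow> nat \<Rightarrow> 'a" where
  "Xi_of_curvature emb m k X S = (\<lambda>\<alpha> \<beta>. if \<alpha> < m \<and> \<beta> < m
     then emb (1 / fact (k + 1)) *
       form_pairing emb m (mat_poly_form emb m S X \<and>\<^sub>w covec (2 * \<alpha>) \<and>\<^sub>w covec (2 * \<beta> + 1))
         (wedge_power (kaehler_2form m) (k + 1))
     else 0)"

text \<open>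
  The curvature matrix in terms of the jet variables. The entry in row \<open>\<delta>\<close> and column \<open>\<gamma>\<close> has the
  value \<open>R(x, y, \<partial>\<^sub>z, w)\<close> on \<open>(x, y)\<close>, where \<open>\<partial>\<^sub>z\<close> has index \<open>\<gamma>\<close> and \<open>w\<close> is the conjugate of
  \<open>\<partial>\<^sub>z\<close> with index \<open>\<delta>\<close>. Skew-symmetry in the last two arguments is responsible for the sign in
  comparison with \<open>R(\<alpha>\<^sub>1, \<beta>\<^sub>1, \<beta>\<^sub>2, \<alpha>\<^sub>2) = g(\<alpha>\<^sub>1, \<alpha>\<^sub>2; \<beta>\<^sub>1, \<beta>\<^sub>2)\<close>.
\<close>

definition jet_curvature :: "nat \<Rightarrow> nat \<Rightarrow> nat \<Rightarrow> jet_poly form" where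
  "jet_curvature m \<delta> \<gamma> = two_form m (\<lambda>a b.
     if even a \<and> odd b then - pvar ({#a div 2, \<gamma>#}, {#b div 2, \<delta>#})
     else if odd a \<and> even b then pvar ({#b div 2, \<gamma>#}, {#a div 2, \<delta>#})
     else 0)"

definition Xi :: "nat \<Rightarrow> nat \<Rightarrow> (nat \<times> nat) poly_over \<Rightarrow> jet_tensor" where
  "Xi m k = Xi_of_curvature pconst m k (jet_curvature m)"


section \<open>Kaehler metrics in local holomorphic coordinates\<close>

text \<open>
  A point of complex \<open>m\<close>-space is a function \<open>z :: nat \<Rightarrow> complex\<close> vanishing on all \<open>i \<ge> m\<close>; the
  topology is the product topology.
\<close>

definition polydisc :: "nat \<Rightarrow> real \<Rightarrow> (nat \<Rightarrow> complex) set" where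
  "polydisc m \<epsilon> = {z. (\<forall>i<m. cmod (z i) < \<epsilon>) \<and> (\<forall>i\<ge>m. z i = 0)}"

text \<open>
  The real coordinate line through \<open>z\<close> in the \<open>j\<close>-th complex coordinate, in the real (\<open>u = 1\<close>) or
  imaginary (\<open>u = \<i>\<close>) direction, and the corresponding partial derivative.
\<close>

definition coord_line :: "complex \<Rightarrow> nat \<Rightarrow> (nat \<Rightarrow> complex) \<Rightarrow> real \<Rightarrow> (nat \<Rightarrow> complex)" where
  "coord_line u j z t = z(j := z j + of_real t * u)"

definition pderivative ::
  "complex \<Rightarrow> nat \<Rightarrow> ((nat \<Rightarrow> complex) \<Rightarrow> complex) \<Rightarrow> (nat \<Rightarrow> complex) \<Rightarrow> complex" where
  "pderivative u j f z = vector_derivative (\<lambda>t. f (coord_line u j z t)) (at 0)"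

primrec times_cont_diff ::
  "nat \<Rightarrow> nat \<Rightarrow> (nat \<Rightarrow> complex) set \<Rightarrow> ((nat \<Rightarrow> complex) \<Rightarrow> complex) \<Rightarrow> bool" where
  "times_cont_diff 0 m U f \<longleftrightarrow> continuous_on U f"
| "times_cont_diff (Suc n) m U f \<longleftrightarrow> continuous_on U f \<and>
     (\<forall>j<m. \<forall>u\<in>{1, \<i>}.
        (\<forall>z\<in>U. (\<lambda>t. f (coord_line u j z t)) differentiable (at 0)) \<and>
        times_cont_diff n m U (pderivative u j f))"

definition smooth :: "nat \<Rightarrow> (nat \<Rightarrow> complex) set \<Rightarrow> ((nat \<Rightarrow> complex) \<Rightarrow> complex) \<Rightarrow> bool" where
  "smooth m U f \<longleftrightarrow> (\<forall>n. times_cont_diff n m U f)"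

definition dz :: "nat \<Rightarrow> ((nat \<Rightarrow> complex) \<Rightarrow> complex) \<Rightarrow> (nat \<Rightarrow> complex) \<Rightarrow> complex" where
  "dz j f = (\<lambda>z. (pderivative 1 j f z - \<i> * pderivative \<i> j f z) / 2)"

definition dzbar :: "nat \<Rightarrow> ((nat \<Rightarrow> complex) \<Rightarrow> complex) \<Rightarrow> (nat \<Rightarrow> complex) \<Rightarrow> complex" where
  "dzbar j f = (\<lambda>z. (pderivative 1 j f z + \<i> * pderivative \<i> j f z) / 2)"

definition frame_deriv :: "nat \<Rightarrow> ((nat \<Rightarrow> complex) \<Rightarrow> complex) \<Rightarrow> (nat \<Rightarrow> complex) \<Rightarrow> complex" where
  "frame_deriv a = (if even a then dz (a div 2) else dzbar (a div 2))"

text \<open>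
  A \<open>J\<close>-invariant metric is given by the functions \<open>g \<alpha> \<beta>\<close>, the values of the complex bilinear
  extension on \<open>\<partial>\<^sub>z\<close> (index \<open>\<alpha>\<close>) and the conjugate of \<open>\<partial>\<^sub>z\<close> (index \<open>\<beta>\<close>); \<open>frame_metric g\<close> is its
  full Gram matrix on the complexified coordinate frame.
\<close>

type_synonym hermitian_metric = "nat \<Rightarrow> nat \<Rightarrow> (nat \<Rightarrow> complex) \<Rightarrow> complex"

definition frame_metric :: "hermitian_metric \<Rightarrow> nat \<Rightarrow> nat \<Rightarrow> (nat \<Rightarrow> complex) \<Rightarrow> complex" where
  "frame_metric g a b =
     (if even a \<and> odd b then g (a div 2) (b div 2)
      else if odd a \<and> even b then g (b div 2) (a div 2)
      else (\<lambda>z. 0))"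

definition kaehler_metric :: "nat \<Rightarrow> real \<Rightarrow> hermitian_metric \<Rightarrow> bool" where
  "kaehler_metric m \<epsilon> g \<longleftrightarrow>
     (\<forall>\<alpha><m. \<forall>\<beta><m. smooth m (polydisc m \<epsilon>) (g \<alpha> \<beta>)) \<and>
     (\<forall>z\<in>polydisc m \<epsilon>.
        (\<forall>\<alpha><m. \<forall>\<beta><m. g \<beta> \<alpha> z = cnj (g \<alpha> \<beta> z)) \<and>
        (\<forall>v. (\<exists>\<alpha><m. v \<alpha> \<noteq> 0) \<longrightarrow> 0 < Re (\<Sum>\<alpha><m. \<Sum>\<beta><m. g \<alpha> \<beta> z * v \<alpha> * cnj (v \<beta>)))) \<and>
     (let \<Omega> = (\<lambda>a b z. frame_metric g a b z * J_eigen b) in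
      \<forall>z\<in>polydisc m \<epsilon>. \<forall>a<2 * m. \<forall>b<2 * m. \<forall>c<2 * m.
        frame_deriv a (\<Omega> b c) z + frame_deriv b (\<Omega> c a) z + frame_deriv c (\<Omega> a b) z = 0)"

definition metric_jet :: "hermitian_metric \<Rightarrow> jet_var \<Rightarrow> complex" where
  "metric_jet g = (\<lambda>(A, B).
     let as = sorted_list_of_multiset A; bs = sorted_list_of_multiset B in
     foldr dz (tl as) (foldr dzbar (tl bs) (g (hd as) (hd bs))) (\<lambda>_. 0))"

definition normal_coordinates :: "nat \<Rightarrow> nat \<Rightarrow> hermitian_metric \<Rightarrow> bool" where
  "normal_coordinates m n g \<longleftrightarrow>
     (\<forall>\<alpha><m. \<forall>\<beta><m. g \<alpha> \<beta> (\<lambda>_. 0) = (if \<alpha> = \<beta> then 1 else 0)) \<and>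
     (\<forall>A B. set_mset A \<subseteq> {..<m} \<and> set_mset B \<subseteq> {..<m} \<and> size B = 1 \<and> 2 \<le> size A \<and> size A \<le> n
        \<longrightarrow> metric_jet g (A, B) = 0)"

text \<open>
  The Levi-Civita connection, extended complex linearly: covariant differentiation of the frame vector
  \<open>b\<close> in the direction of the frame vector \<open>a\<close> has the components \<open>\<Gamma> c a b\<close>. The frame being a
  coordinate frame, vanishing torsion means symmetry in \<open>a\<close> and \<open>b\<close>.
\<close>

type_synonym christoffel = "nat \<Rightarrow> nat \<Rightarrow> nat \<Rightarrow> (nat \<Rightarrow> complex) \<Rightarrow> complex"

definition levi_civita :: "nat \<Rightarrow> real \<Rightarrow> hermitian_metric \<Rightarrow> christoffel \<Rightarrow> bool" where
  "levi_civita m \<epsilon> g \<Gamma> \<longleftrightarrow>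
     (\<forall>a<2 * m. \<forall>b<2 * m. \<forall>c<2 * m.
        smooth m (polydisc m \<epsilon>) (\<Gamma> c a b) \<and>
        (\<forall>z\<in>polydisc m \<epsilon>. \<Gamma> c a b z = \<Gamma> c b a z \<and>
           frame_deriv a (frame_metric g b c) z =
             (\<Sum>d<2 * m. \<Gamma> d a b z * frame_metric g d c z + \<Gamma> d a c z * frame_metric g b d z)))"

text \<open>The \<open>d\<close>-component of the curvature operator of the frame vectors \<open>a\<close>, \<open>b\<close> applied to \<open>c\<close>.\<close>

definition curvature ::
  "nat \<Rightarrow> christoffel \<Rightarrow> nat \<Rightarrow> nat \<Rightarrow> nat \<Rightarrow> nat \<Rightarrow> (nat \<Rightarrow> complex) \<Rightarrow> complex" where
  "curvature m \<Gamma> d a b c z =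
     frame_deriv a (\<Gamma> d b c) z - frame_deriv b (\<Gamma> d a c) z +
     (\<Sum>e<2 * m. \<Gamma> d a e z * \<Gamma> e b c z - \<Gamma> d b e z * \<Gamma> e a c z)"

text \<open>
  The curvature at the origin as a matrix of 2-forms: the tangent bundle with the complex structure
  \<open>J\<close> is identified with the bundle of vectors of type (1,0).
\<close>

definition curvature_matrix :: "nat \<Rightarrow> christoffel \<Rightarrow> nat \<Rightarrow> nat \<Rightarrow> complex form" where
  "curvature_matrix m \<Gamma> \<delta> \<gamma> =
     two_form m (\<lambda>a b. curvature m \<Gamma> (2 * \<delta>) a b (2 * \<gamma>) (\<lambda>_. 0))"

text \<open>
  The \<open>S\<^sub>2\<^sup>+\<close>-valued invariant at the origin of normal coordinates, where the coordinate frame is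
  unitary.
\<close>

definition Xi_geometric :: "nat \<Rightarrow> nat \<Rightarrow> christoffel \<Rightarrow> (nat \<times> nat) poly_over \<Rightarrow> nat \<Rightarrow> nat \<Rightarrow> complex"
  where
  "Xi_geometric m k \<Gamma> = Xi_of_curvature (\<lambda>c. c) m k (curvature_matrix m \<Gamma>)"

text \<open>\<open>Q\<close> evaluated at the origin of normal coordinates of a Kaehler metric.\<close>

definition local_formula :: "jet_tensor \<Rightarrow> hermitian_metric \<Rightarrow> nat \<Rightarrow> nat \<Rightarrow> complex" where
  "local_formula Q g \<alpha> \<beta> = peval (\<lambda>c. c) (metric_jet g) (Q \<alpha> \<beta>)"

end

theory Submission
  imports Defs
begin

text \<open>
  The value of an invariant on jets of the form \<open>\<Sum>j<k. t j * u j \<otimes> \<dots> \<otimes> u j \<otimes> w j \<otimes> \<dots> \<otimes> w j\<close>, contracted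
  with one more pair \<open>u k\<close>, \<open>w k\<close>, determines the invariant. By density of the unitary group in the
  space of all matrices it is a function \<open>\<Phi>\<close> of the Gram matrix of the pairings of the \<open>u i\<close> with the
  \<open>w j\<close>. An invariant vanishes in dimension \<open>k\<close> iff \<open>\<Phi>\<close> vanishes on all singular Gram matrices of size
  \<open>k + 1\<close>. Setting \<open>t j = 0\<close> for one \<open>j\<close> then gives zero, so every monomial has at least \<open>k\<close> factors, and
  order \<open>2 * k\<close> leaves exactly \<open>k\<close> curvature variables. Hence \<open>\<Phi>\<close> is quadratic in the rows and columns
  with index less than \<open>k\<close> and linear in the last ones, and it is the product of the determinant with a
  polynomial multilinear in the first \<open>k\<close> rows and columns. On the other hand, for the image of an
  invariant polynomial \<open>S\<close> the function \<open>\<Phi>\<close> is a nonzero constant times the determinant times the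
  polarization of \<open>S\<close>, and every such multilinear polynomial arises in this way.
\<close>

section \<open>Polynomials and their values\<close>

text \<open>A matrix of size \<open>k + 1\<close> is singular iff it is the Gram matrix of vectors
  in dimension \<open>k\<close>; this is what links restriction with the determinant. Divisibility
  by the determinant is obtained row by row instead of from irreducibility: a quadratic form in one
  row that vanishes on the zero set of a nonzero linear form is that linear form times another one.
  The remaining rows must leave the linear form nonzero. Hence the detour through diagonally
  dominant matrices, where rows can be replaced independently of each other and the determinant
  never vanishes. Both there and in the passage from unitary to arbitrary matrices, polynomial
  identities are extended along curves, so that only polynomials in one variable are involved. The
  last two sections treat the remaining part of the claim, that the formal map is the geometric one:
  at the origin of normal coordinates the relevant Christoffel symbols vanish, so the curvature
  there consists of second derivatives of the metric.\<close>

abbreviation ev :: "('v \<Rightarrow> complex) \<Rightarrow> 'v poly_over \<Rightarrow> complex" where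
  "ev \<equiv> peval (\<lambda>c. c)"

text \<open>The factors of a monomial with multiplicity. Products over multisets can be split,
  listed and treated by induction more easily than exponent functions.\<close>

definition mono_mset :: "('v \<Rightarrow>\<^sub>0 nat) \<Rightarrow> 'v multiset" where
  "mono_mset \<mu> = (\<Sum>v\<in>Poly_Mapping.keys \<mu>. replicate_mset (Poly_Mapping.lookup \<mu> v) v)"

lemma count_mono_mset [simp]: "count (mono_mset \<mu>) v = Poly_Mapping.lookup \<mu> v"
proof -
  have "count (mono_mset \<mu>) v =
      (\<Sum>v'\<in>Poly_Mapping.keys \<mu>. if v = v' then Poly_Mapping.lookup \<mu> v' else 0)"
    unfolding mono_mset_def count_sum by (intro sum.cong) auto
  also have "\<dots> = Poly_Mapping.lookup \<mu> v"
    by (simp add: sum.delta' in_keys_iff)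
  finally show ?thesis .
qed

lemma set_mono_mset [simp]: "set_mset (mono_mset \<mu>) = Poly_Mapping.keys \<mu>"
  by (auto simp: set_mset_def in_keys_iff)

lemma mono_mset_add: "mono_mset (\<mu> + \<nu>) = mono_mset \<mu> + mono_mset \<nu>"
  by (rule multiset_eqI) (simp add: lookup_add)

lemma mono_mset_zero [simp]: "mono_mset 0 = {#}"
  by (rule multiset_eqI) simp

lemma mono_mset_single [simp]: "mono_mset (Poly_Mapping.single v n) = replicate_mset n v"
  by (rule multiset_eqI) (auto simp: lookup_single when_def)

lemma mono_mset_inject: "mono_mset \<mu> = mono_mset \<nu> \<longleftrightarrow> \<mu> = \<nu>"
  by (metis count_mono_mset poly_mapping_eqI)

lemma size_mono_mset:
  "size (mono_mset \<mu>) = (\<Sum>v\<in>Poly_Mapping.keys \<mu>. Poly_Mapping.lookup \<mu> v)"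
  by (simp add: mono_mset_def size_multiset_sum)

lemma prod_mset_image_sum:
  "finite I \<Longrightarrow> \<Prod>\<^sub># (image_mset x (\<Sum>i\<in>I. N i)) = (\<Prod>i\<in>I. \<Prod>\<^sub># (image_mset x (N i)))"
  by (induction rule: finite_induct) auto

lemma prod_monomial:
  "(\<Prod>v\<in>Poly_Mapping.keys \<mu>. x v ^ Poly_Mapping.lookup \<mu> v) =
    \<Prod>\<^sub># (image_mset x (mono_mset \<mu>))"
  by (simp add: mono_mset_def prod_mset_image_sum)

lemma poly_mapping_sum_single:
  fixes p :: "'a \<Rightarrow>\<^sub>0 'b::comm_monoid_add"
  shows "p = (\<Sum>\<mu>\<in>Poly_Mapping.keys p. Poly_Mapping.single \<mu> (Poly_Mapping.lookup p \<mu>))"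
  by (rule poly_mapping_eqI) (simp add: lookup_sum lookup_single when_def in_keys_iff)

lemma poly_mapping_add_induct:
  fixes p :: "'a \<Rightarrow>\<^sub>0 'b::comm_monoid_add"
  assumes "P 0" "\<And>\<mu> c. P (Poly_Mapping.single \<mu> c)" "\<And>p q. P p \<Longrightarrow> P q \<Longrightarrow> P (p + q)"
  shows "P p"
proof -
  have "P (\<Sum>\<mu>\<in>K. Poly_Mapping.single \<mu> (Poly_Mapping.lookup p \<mu>))" if "finite K" for K
    using that by (induction rule: finite_induct) (auto intro: assms)
  from this[of "Poly_Mapping.keys p"] show ?thesis
    by (simp flip: poly_mapping_sum_single)
qed

lemma peval_mset:
  "peval emb x p =
    (\<Sum>\<mu>\<in>Poly_Mapping.keys p. emb (Poly_Mapping.lookup p \<mu>) * \<Prod>\<^sub># (image_mset x (mono_mset \<mu>)))"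
  by (simp add: peval_def prod_monomial)

lemma peval_cong:
  assumes "\<And>\<mu> v. \<mu> \<in> Poly_Mapping.keys p \<Longrightarrow> v \<in> Poly_Mapping.keys \<mu> \<Longrightarrow> x v = y v"
  shows "peval emb x p = peval emb y p"
  unfolding peval_def using assms by (intro sum.cong arg_cong2[where f = "(*)"] prod.cong) auto

text \<open>Two instances matter: the identity, for values at complex arguments, and
  \<open>pconst\<close>, for substituting polynomials into polynomials.\<close>

locale coeff_hom = comm_ring_hom hom for hom :: "complex \<Rightarrow> 'a::comm_ring_1"
begin

lemma peval_superset:
  assumes "finite Z" "Poly_Mapping.keys p \<subseteq> Z"
  shows "peval hom x p =
    (\<Sum>\<mu>\<in>Z. hom (Poly_Mapping.lookup p \<mu>) * \<Prod>\<^sub># (image_mset x (mono_mset \<mu>)))"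
  unfolding peval_mset using assms
  by (intro sum.mono_neutral_left) (auto simp: in_keys_iff)

lemma peval_single:
  "peval hom x (Poly_Mapping.single \<mu> c) = hom c * \<Prod>\<^sub># (image_mset x (mono_mset \<mu>))"
  by (subst peval_superset[of "{\<mu>}"]) auto

lemma peval_zero: "peval hom x 0 = 0"
  by (simp add: peval_mset)

lemma peval_add: "peval hom x (p + q) = peval hom x p + peval hom x q"
proof -
  let ?Z = "Poly_Mapping.keys p \<union> Poly_Mapping.keys q"
  have "Poly_Mapping.keys (p + q) \<subseteq> ?Z"
    by (rule Poly_Mapping.keys_add)
  then show ?thesis
    by (subst (1 2 3) peval_superset[of ?Z])
      (auto simp: lookup_add hom_add algebra_simps sum.distrib)
qed

lemma peval_mult: "peval hom x (p * q) = peval hom x p * peval hom x q"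
proof (induction p rule: poly_mapping_add_induct)
  case (2 \<mu> c)
  show ?case
  proof (induction q rule: poly_mapping_add_induct)
    case (2 \<nu> d)
    show ?case
      by (simp add: mult_single peval_single mono_mset_add hom_mult algebra_simps)
  qed (auto simp: peval_zero peval_add algebra_simps)
qed (auto simp: peval_zero peval_add algebra_simps)

lemma peval_one: "peval hom x 1 = 1"
  by (simp flip: single_one add: peval_single)

lemma comm_ring_hom_peval: "comm_ring_hom (peval hom x)"
  by unfold_locales (simp_all add: peval_zero peval_one peval_add peval_mult)

lemma peval_pconst: "peval hom x (pconst c) = hom c"
  by (simp add: pconst_def peval_single)

lemma peval_pvar: "peval hom x (pvar v) = x v"
  by (simp add: pvar_def peval_single)

end

lemma coeff_hom_id: "coeff_hom (\<lambda>c. c)"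
  by unfold_locales auto

lemma coeff_hom_pconst: "coeff_hom pconst"
  by unfold_locales (auto simp: pconst_def single_add mult_single)

interpretation pconst_hom: comm_ring_hom pconst
  using coeff_hom_pconst by (simp only: coeff_hom_def)

interpretation ev_hom: comm_ring_hom "ev x" for x
  by (rule coeff_hom.comm_ring_hom_peval[OF coeff_hom_id])

lemma ev_pconst [simp]: "ev x (pconst c) = c"
  by (rule coeff_hom.peval_pconst[OF coeff_hom_id])

lemma ev_pvar [simp]: "ev x (pvar v) = x v"
  by (rule coeff_hom.peval_pvar[OF coeff_hom_id])

lemma ev_minus: "ev x (p - q) = ev x p - ev x q"
  using ev_hom.hom_add[of x "p - q" q] by simp

text \<open>Turns the action of a matrix on a formal tensor, which is a substitution, into a change
  of the point of evaluation.\<close>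

lemma ev_peval: "ev x (peval pconst y p) = ev (\<lambda>v. ev x (y v)) p"
  by (simp add: peval_mset[of pconst] peval_mset[of _ "\<lambda>v. ev x (y v)"] ev_hom.hom_sum ev_hom.hom_mult
      ev_hom.hom_prod_mset image_mset.compositionality o_def)

text \<open>Induction on a finite set of variables. With all other values fixed, the sum is a
  polynomial in the value of \<open>v\<close> that vanishes everywhere, so the coefficient of each
  power vanishes; that coefficient is a combination of monomials in fewer variables.\<close>

lemma monomials_independent:
  fixes c :: "'a multiset \<Rightarrow> complex"
  assumes "finite S" "\<And>X. (\<Sum>N\<in>S. c N * \<Prod>\<^sub># (image_mset X N)) = 0" "N \<in> S"
  shows "c N = 0"
proof -
  have "\<forall>N\<in>S. c N = 0"
    if "finite V" "finite S" "\<And>N. N \<in> S \<Longrightarrow> set_mset N \<subseteq> V"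
      "\<And>X. (\<Sum>N\<in>S. c N * \<Prod>\<^sub># (image_mset X N)) = 0"
    for V :: "'a set" and S and c :: "'a multiset \<Rightarrow> complex"
    using that
  proof (induction V arbitrary: S c rule: finite_induct)
    case empty
    then have "S \<subseteq> {{#}}"
      by auto
    with empty show ?case
      by (cases "S = {}") (auto simp: subset_singleton_iff)
  next
    case (insert v V)
    let ?r = "\<lambda>N. filter_mset (\<lambda>w. w \<noteq> v) N"
    have N_eq: "N = ?r N + replicate_mset (count N v) v" for N
      by (rule multiset_eqI) auto
    show ?case
    proof
      fix N0 assume N0: "N0 \<in> S"
      let ?e = "count N0 v"
      let ?Se = "{N \<in> S. count N v = ?e}"
      \<comment> \<open>The exponent of \<open>v\<close> is the same throughout \<open>?Se\<close>,
        so deleting \<open>v\<close> loses no information.\<close>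
      have inj: "inj_on ?r ?Se"
        by (rule inj_onI) (metis (mono_tags, lifting) N_eq mem_Collect_eq)
      have "\<forall>N\<in>?r ` ?Se. c (N + replicate_mset ?e v) = 0"
      proof (rule insert.IH)
        show "finite (?r ` ?Se)"
          using insert.prems by auto
        show "set_mset N \<subseteq> V" if "N \<in> ?r ` ?Se" for N
          using that insert.prems(2) by fastforce
      next
        fix X :: "'a \<Rightarrow> complex"
        define P where "P = (\<Sum>N\<in>S. monom (c N * \<Prod>\<^sub># (image_mset X (?r N))) (count N v))"
        have img: "image_mset (X(v := z)) (?r N) = image_mset X (?r N)" for N z
          by (rule image_mset_cong) auto
        have "poly P z = 0" for z
        proof -
          have prod_X: "\<Prod>\<^sub># (image_mset (X(v := z)) N) = \<Prod>\<^sub># (image_mset X (?r N)) * z ^ count N v" for N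
            by (subst N_eq) (simp add: img del: image_mset_filter_mset_swap)
          have "poly P z = (\<Sum>N\<in>S. c N * (\<Prod>\<^sub># (image_mset X (?r N)) * z ^ count N v))"
            by (simp add: P_def poly_sum poly_monom mult.assoc)
          also have "\<dots> = 0"
            using insert.prems(3)[of "X(v := z)"] unfolding prod_X .
          finally show ?thesis .
        qed
        then have "P = 0"
          using poly_all_0_iff_0 by blast
        then have "0 = coeff P ?e"
          by simp
        also have "\<dots> = (\<Sum>N\<in>S. if count N v = ?e then c N * \<Prod>\<^sub># (image_mset X (?r N)) else 0)"
          unfolding P_def coeff_sum by (intro sum.cong refl) simp
        finally have "(\<Sum>N\<in>?Se. c N * \<Prod>\<^sub># (image_mset X (?r N))) = 0"
          using insert.prems(1) by (simp add: sum.inter_filter)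
        moreover have "c N = c (?r N + replicate_mset ?e v)" if "N \<in> ?Se" for N
          using that N_eq[of N] by (metis (mono_tags, lifting) mem_Collect_eq)
        ultimately show "(\<Sum>N\<in>?r ` ?Se. c (N + replicate_mset ?e v) * \<Prod>\<^sub># (image_mset X N)) = 0"
          by (simp add: sum.reindex[OF inj])
      qed
      then show "c N0 = 0"
        using N0 N_eq[of N0] by (metis (mono_tags, lifting) imageI mem_Collect_eq)
    qed
  qed
  from this[of "\<Union> (set_mset ` S)" S c] assms show ?thesis
    by auto
qed

lemma poly_coeffs_zero:
  fixes c :: "('v \<Rightarrow>\<^sub>0 nat) \<Rightarrow> complex"
  assumes "finite K" "\<And>x. (\<Sum>\<mu>\<in>K. c \<mu> * \<Prod>\<^sub># (image_mset x (mono_mset \<mu>))) = 0" "\<mu> \<in> K"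
  shows "c \<mu> = 0"
proof -
  have inj: "inj_on mono_mset K"
    by (rule inj_onI) (simp add: mono_mset_inject)
  have "c (the_inv_into K mono_mset (mono_mset \<mu>)) = 0"
  proof (rule monomials_independent[where S = "mono_mset ` K" and c = "\<lambda>N. c (the_inv_into K mono_mset N)"])
    fix X
    show "(\<Sum>N\<in>mono_mset ` K. c (the_inv_into K mono_mset N) * \<Prod>\<^sub># (image_mset X N)) = 0"
      using assms(2)[of X] by (simp add: sum.reindex[OF inj] the_inv_into_f_f[OF inj])
  qed (use assms in auto)
  then show ?thesis
    using assms by (simp add: the_inv_into_f_f[OF inj])
qed

text \<open>Complex values separate formal polynomials, so identities such as the linearity of
  \<open>Xi\<close> can be checked after evaluation.\<close>

lemma ev_eq_0_imp:
  assumes "\<And>x. ev x p = 0"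
  shows "p = 0"
proof -
  have "\<mu> \<in> Poly_Mapping.keys p \<Longrightarrow> Poly_Mapping.lookup p \<mu> = 0" for \<mu>
    using poly_coeffs_zero[of "Poly_Mapping.keys p" "Poly_Mapping.lookup p" \<mu>] assms
    by (simp add: peval_mset)
  then show ?thesis
    by (metis in_keys_iff keys_eq_empty subset_empty subsetI)
qed

lemma ev_eq_imp:
  assumes "\<And>x. ev x p = ev x q"
  shows "p = q"
  using ev_eq_0_imp[of "p - q"] assms by (simp add: ev_minus)

text \<open>Doubling all variables multiplies a monomial of degree \<open>d\<close> by
  \<open>2 ^ d\<close>. By independence its coefficient times \<open>2 ^ d - 2 ^ k\<close> is zero,
  and different powers of 2 have different absolute values.\<close>

lemma homogeneous_imp_size:
  assumes hom: "\<And>x. ev (\<lambda>v. 2 * x v) p = 2 ^ k * ev x p" and \<mu>: "\<mu> \<in> Poly_Mapping.keys p"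
  shows "size (mono_mset \<mu>) = k"
proof -
  have scale: "\<Prod>\<^sub># (image_mset (\<lambda>v. 2 * x v) N) = 2 ^ size N * \<Prod>\<^sub># (image_mset x N)"
    for x :: "'a \<Rightarrow> complex" and N
    by (induction N) auto
  have "Poly_Mapping.lookup p \<mu> * (2 ^ size (mono_mset \<mu>) - 2 ^ k) = 0"
  proof (rule poly_coeffs_zero[where K = "Poly_Mapping.keys p"
      and c = "\<lambda>\<mu>. Poly_Mapping.lookup p \<mu> * (2 ^ size (mono_mset \<mu>) - 2 ^ k)"])
    fix x
    show "(\<Sum>\<mu>\<in>Poly_Mapping.keys p. Poly_Mapping.lookup p \<mu> * (2 ^ size (mono_mset \<mu>) - 2 ^ k) *
        \<Prod>\<^sub># (image_mset x (mono_mset \<mu>))) = 0"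
      using hom[of x]
      unfolding peval_mset scale by (simp add: sum_distrib_left algebra_simps sum_subtractf)
  qed (use \<mu> in auto)
  then have "(2::complex) ^ size (mono_mset \<mu>) = 2 ^ k"
    using \<mu> by (simp add: in_keys_iff)
  then have "norm ((2::complex) ^ size (mono_mset \<mu>)) = norm ((2::complex) ^ k)"
    by simp
  then show ?thesis
    by (simp add: norm_power)
qed

text \<open>Setting the variables outside \<open>V\<close> to zero keeps the value but removes
  exactly the monomials that involve them; by independence there are none.\<close>

lemma depends_only_imp_keys:
  fixes p :: "'v poly_over"
  assumes dep: "\<And>x y. (\<And>v. v \<in> V \<Longrightarrow> x v = y v) \<Longrightarrow> ev x p = ev y p"
    and \<mu>: "\<mu> \<in> Poly_Mapping.keys p"
  shows "Poly_Mapping.keys \<mu> \<subseteq> V"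
proof (rule ccontr)
  assume not_sub: "\<not> Poly_Mapping.keys \<mu> \<subseteq> V"
  let ?c = "\<lambda>\<mu>. Poly_Mapping.lookup p \<mu> * (if Poly_Mapping.keys \<mu> \<subseteq> V then 0 else 1)"
  have "?c \<mu> = 0"
  proof (rule poly_coeffs_zero[where K = "Poly_Mapping.keys p" and c = ?c])
    fix x
    define y :: "'v \<Rightarrow> complex" where "y = (\<lambda>v. if v \<in> V then x v else 0)"
    have prod_y: "\<Prod>\<^sub># (image_mset y N) = (if set_mset N \<subseteq> V then \<Prod>\<^sub># (image_mset x N) else 0)" for N
      by (induction N) (auto simp: y_def)
    have "ev x p - ev y p = 0"
      using dep[of x y] by (simp add: y_def)
    also have "ev x p - ev y p = (\<Sum>\<mu>\<in>Poly_Mapping.keys p. ?c \<mu> * \<Prod>\<^sub># (image_mset x (mono_mset \<mu>)))"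
      unfolding peval_mset sum_subtractf[symmetric] by (intro sum.cong) (auto simp: prod_y)
    finally show "(\<Sum>\<mu>\<in>Poly_Mapping.keys p. ?c \<mu> * \<Prod>\<^sub># (image_mset x (mono_mset \<mu>))) = 0" .
  qed (use \<mu> in auto)
  with not_sub \<mu> show False
    by (simp add: in_keys_iff)
qed

section \<open>Sums over lists\<close>

abbreviation lists_over :: "nat \<Rightarrow> 'a set \<Rightarrow> 'a list set" where
  "lists_over n A \<equiv> {xs. length xs = n \<and> set xs \<subseteq> A}"

lemma finite_lists_over [simp]: "finite A \<Longrightarrow> finite (lists_over n A)"
  using finite_lists_length_eq[of A n] by (simp add: conj_commute)

lemma lists_over_Suc: "lists_over (Suc n) A = (\<lambda>(x, xs). x # xs) ` (A \<times> lists_over n A)"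
  by (auto simp: image_iff length_Suc_conv)

lemma sum_lists_over_Suc:
  "(\<Sum>xs\<in>lists_over (Suc n) A. f xs) = (\<Sum>x\<in>A. \<Sum>xs\<in>lists_over n A. f (x # xs))"
proof -
  have inj: "inj_on (\<lambda>(x, xs). x # xs) (A \<times> lists_over n A)"
    by (auto simp: inj_on_def)
  show ?thesis
    unfolding lists_over_Suc sum.reindex[OF inj] by (simp add: sum.cartesian_product case_prod_beta)
qed

lemma sum_prod_lists_over:
  fixes h :: "nat \<Rightarrow> 'b \<Rightarrow> 'a::comm_semiring_1"
  shows "(\<Sum>xs\<in>lists_over n A. \<Prod>i<n. h i (xs ! i)) = (\<Prod>i<n. \<Sum>x\<in>A. h i x)"
proof (induction n arbitrary: h)
  case 0
  have "lists_over 0 A = {[]}"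
    by auto
  then show ?case
    by simp
next
  case (Suc n)
  have "(\<Sum>xs\<in>lists_over (Suc n) A. \<Prod>i<Suc n. h i (xs ! i)) =
      (\<Sum>x\<in>A. \<Sum>xs\<in>lists_over n A. h 0 x * (\<Prod>i<n. h (Suc i) (xs ! i)))"
    unfolding sum_lists_over_Suc by (simp add: prod.lessThan_Suc_shift del: prod.lessThan_Suc)
  also have "\<dots> = (\<Sum>x\<in>A. h 0 x) * (\<Prod>i<n. \<Sum>x\<in>A. h (Suc i) x)"
    by (simp add: Suc.IH[of "\<lambda>i. h (Suc i)"] flip: sum_distrib_left sum_distrib_right)
  finally show ?case
    by (simp add: prod.lessThan_Suc_shift del: prod.lessThan_Suc)
qed

text \<open>Permutations of \<open>{..<k}\<close> as lists: a list of length \<open>k\<close> that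
  takes all \<open>k\<close> values cannot repeat one.\<close>

abbreviation perm_lists :: "nat \<Rightarrow> nat list set" where
  "perm_lists k \<equiv> {xs. length xs = k \<and> set xs = {..<k}}"

lemma finite_perm_lists [simp]: "finite (perm_lists k)"
  by (rule finite_subset[OF _ finite_lists_over[of "{..<k}" k]]) auto

lemma distinct_perm_list: "xs \<in> perm_lists k \<Longrightarrow> distinct xs"
  by (simp add: card_distinct)

text \<open>For \<open>j\<close> outside \<open>A\<close>, the sets \<open>I\<close> and
  \<open>insert j I\<close> contain \<open>A\<close> simultaneously and carry opposite signs, so
  they cancel in pairs.\<close>

lemma alternating_sum_supersets:
  assumes "A \<subseteq> {..<k}"
  shows "(\<Sum>I\<in>Pow {..<k}. if A \<subseteq> I then (-1) ^ (k - card I) else 0) =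
    (if A = {..<k} then 1 else (0::complex))"
proof (cases "A = {..<k}")
  case True
  have "(\<Sum>I\<in>Pow {..<k}. if A \<subseteq> I then (-1) ^ (k - card I) else (0::complex)) =
      (\<Sum>I\<in>{A}. (-1) ^ (k - card I))"
    using True by (intro sum.mono_neutral_cong_right) auto
  with True show ?thesis
    by simp
next
  case False
  then obtain j where j: "j < k" "j \<notin> A"
    using assms by auto
  let ?V = "{..<k} - {j}" and ?g = "\<lambda>I. if A \<subseteq> I then (-1) ^ (k - card I) else (0::complex)"
  have "Pow {..<k} = Pow (insert j ?V)"
    using j by (simp add: insert_absorb)
  also have "\<dots> = Pow ?V \<union> insert j ` Pow ?V"
    by (rule Pow_insert)
  finally have split: "Pow {..<k} = Pow ?V \<union> insert j ` Pow ?V" .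
  have inj: "inj_on (insert j) (Pow ?V)"
    by (rule inj_onI) (auto simp: set_eq_iff)
  have "(\<Sum>I\<in>Pow {..<k}. ?g I) = (\<Sum>I\<in>Pow ?V. ?g I) + (\<Sum>I\<in>insert j ` Pow ?V. ?g I)"
    unfolding split by (rule sum.union_disjoint) auto
  also have "(\<Sum>I\<in>insert j ` Pow ?V. ?g I) = (\<Sum>I\<in>Pow ?V. ?g (insert j I))"
    by (simp add: sum.reindex[OF inj])
  also have "\<dots> = (\<Sum>I\<in>Pow ?V. - ?g I)"
  proof (rule sum.cong[OF refl])
    fix I assume I: "I \<in> Pow ?V"
    then have fin: "finite I" and "j \<notin> I"
      by (auto intro: finite_subset)
    have "card I < k"
      using psubset_card_mono[of "{..<k}" I] I j by auto
    then have "k - card I = Suc (k - card (insert j I))"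
      using fin \<open>j \<notin> I\<close> by simp
    moreover have "A \<subseteq> insert j I \<longleftrightarrow> A \<subseteq> I"
      using j by auto
    ultimately show "?g (insert j I) = - ?g I"
      by simp
  qed
  finally show ?thesis
    using False by (simp add: sum_negf)
qed

text \<open>Each product of sums expands over choice lists with entries in \<open>I\<close>. The
  alternating sum over the sets \<open>I\<close> that contain the entries of a list vanishes unless
  the list takes every value, that is, unless it is a permutation. This is the polarization formula,
  used for matrix polynomials as well as for jets.\<close>

lemma inclusion_exclusion_perm_lists:
  fixes h :: "nat \<Rightarrow> nat \<Rightarrow> complex"
  shows "(\<Sum>I\<in>Pow {..<k}. (-1) ^ (k - card I) * (\<Prod>i<k. \<Sum>j\<in>I. h i j)) =
    (\<Sum>xs\<in>perm_lists k. \<Prod>i<k. h i (xs ! i))"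
proof -
  have "(\<Sum>I\<in>Pow {..<k}. (-1) ^ (k - card I) * (\<Prod>i<k. \<Sum>j\<in>I. h i j)) =
      (\<Sum>I\<in>Pow {..<k}. \<Sum>xs\<in>lists_over k {..<k}.
        if set xs \<subseteq> I then (-1) ^ (k - card I) * (\<Prod>i<k. h i (xs ! i)) else 0)"
  proof (rule sum.cong[OF refl])
    fix I assume I: "I \<in> Pow {..<k}"
    have "(-1) ^ (k - card I) * (\<Prod>i<k. \<Sum>j\<in>I. h i j) =
        (\<Sum>xs\<in>lists_over k I. (-1) ^ (k - card I) * (\<Prod>i<k. h i (xs ! i)))"
      unfolding sum_prod_lists_over[symmetric] by (rule sum_distrib_left)
    also have "\<dots> = (\<Sum>xs\<in>lists_over k {..<k}.
        if set xs \<subseteq> I then (-1) ^ (k - card I) * (\<Prod>i<k. h i (xs ! i)) else 0)"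
      using I by (intro sum.mono_neutral_cong_left) auto
    finally show "(-1) ^ (k - card I) * (\<Prod>i<k. \<Sum>j\<in>I. h i j) = \<dots>" .
  qed
  also have "\<dots> = (\<Sum>xs\<in>lists_over k {..<k}. (\<Prod>i<k. h i (xs ! i)) *
      (\<Sum>I\<in>Pow {..<k}. if set xs \<subseteq> I then (-1) ^ (k - card I) else 0))"
    unfolding sum_distrib_left by (subst sum.swap) (intro sum.cong; auto)
  also have "\<dots> = (\<Sum>xs\<in>lists_over k {..<k}. (\<Prod>i<k. h i (xs ! i)) *
      (if set xs = {..<k} then 1 else 0))"
    by (intro sum.cong refl) (subst alternating_sum_supersets; auto)
  also have "\<dots> = (\<Sum>xs\<in>perm_lists k. \<Prod>i<k. h i (xs ! i))"
    by (intro sum.mono_neutral_cong_right) auto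
  finally show ?thesis .
qed

lemma prod_mset_list: "\<Prod>\<^sub># (image_mset f (mset xs)) = (\<Prod>i<length xs. f (xs ! i))"
  by (induction xs) (simp_all add: prod.lessThan_Suc_shift del: prod.lessThan_Suc)

lemma mset_list_sum: "mset xs = (\<Sum>i<length xs. {#xs ! i#})"
  by (induction xs) (simp_all add: sum.lessThan_Suc_shift del: sum.lessThan_Suc)

section \<open>Jets that are sums of decomposable tensors\<close>

text \<open>The vectors \<open>u j\<close> and \<open>w j\<close> are independent of each other: for
  formal variables no reality condition relates \<open>g(A;B)\<close> to
  \<open>g(B;A)\<close>.\<close>

definition jet_sum ::
  "nat \<Rightarrow> (nat \<Rightarrow> complex) \<Rightarrow> (nat \<Rightarrow> nat \<Rightarrow> complex) \<Rightarrow> (nat \<Rightarrow> nat \<Rightarrow> complex) \<Rightarrow> jet_var \<Rightarrow> complex"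
  where
  "jet_sum n t u w = (\<lambda>(A, B). \<Sum>j<n. t j * \<Prod>\<^sub># (image_mset (u j) A) * \<Prod>\<^sub># (image_mset (w j) B))"

text \<open>
  The coefficient of \<open>\<mu>\<close> is read off from the monomial that contains each \<open>t j\<close> exactly once: the
  terms of \<open>q\<close> contributing to it can be recovered from that monomial.
\<close>

lemma no_monomials_of_degree:
  fixes q :: jet_poly
  assumes zero: "\<And>t u w. ev (jet_sum n t u w) q = 0" and \<mu>0: "\<mu>0 \<in> Poly_Mapping.keys q"
  shows "size (mono_mset \<mu>0) \<noteq> n"
proof
  assume size_\<mu>0: "size (mono_mset \<mu>0) = n"
  define vs where "vs = (\<lambda>\<mu>::jet_var \<Rightarrow>\<^sub>0 nat. SOME xs. mset xs = mono_mset \<mu>)"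
  have mset_vs: "mset (vs \<mu>) = mono_mset \<mu>" for \<mu>
    unfolding vs_def by (rule someI_ex[OF ex_mset])
  \<comment> \<open>The tags 0, 1, 2 mark variables for \<open>t\<close>, \<open>u\<close>,
    \<open>w\<close>, and \<open>l\<close> tells to which summand of the jet they belong;
    \<open>term_mset v l\<close> is the monomial that summand \<open>l\<close> contributes to the
    value of \<open>v\<close>.\<close>
  define term_mset :: "jet_var \<Rightarrow> nat \<Rightarrow> (nat \<times> nat \<times> nat) multiset" where
    "term_mset = (\<lambda>v l. {#(0, l, 0)#} + image_mset (\<lambda>a. (1, l, a)) (fst v)
      + image_mset (\<lambda>b. (2, l, b)) (snd v))"
  define N where "N = (\<lambda>vs fs. \<Sum>i<length vs. term_mset (vs ! i) (fs ! i))"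
  \<comment> \<open>\<open>H\<close> reads off which summands were used, and \<open>R\<close> which
    jet variable used a given summand; the latter is reliable when no summand is used twice.\<close>
  define H :: "(nat \<times> nat \<times> nat) multiset \<Rightarrow> nat multiset" where
    "H = (\<lambda>N. image_mset (\<lambda>(c, l, a). l) (filter_mset (\<lambda>(c, l, a). c = 0) N))"
  define R :: "(nat \<times> nat \<times> nat) multiset \<Rightarrow> nat \<Rightarrow> jet_var" where
    "R = (\<lambda>N j. (image_mset (\<lambda>(c, l, a). a) (filter_mset (\<lambda>(c, l, a). c = 1 \<and> l = j) N),
                image_mset (\<lambda>(c, l, a). a) (filter_mset (\<lambda>(c, l, a). c = 2 \<and> l = j) N)))"
  have filter_sum: "filter_mset P (\<Sum>i\<in>I. f i) = (\<Sum>i\<in>I. filter_mset P (f i))"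
    if "finite I" for P I and f :: "nat \<Rightarrow> (nat \<times> nat \<times> nat) multiset"
    using that by (induction rule: finite_induct) auto
  have image_sum: "image_mset g (\<Sum>i\<in>I. f i) = (\<Sum>i\<in>I. image_mset g (f i))"
    if "finite I" for I and f :: "nat \<Rightarrow> (nat \<times> nat \<times> nat) multiset" and g :: "_ \<Rightarrow> nat"
    using that by (induction rule: finite_induct) auto
  have H_term: "image_mset (\<lambda>(c, l, a). l) (filter_mset (\<lambda>(c, l, a). c = 0) (term_mset v l)) = {#l#}" for v l
    by (simp add: term_mset_def filter_mset_image_mset o_def case_prod_beta)
  have H_N: "H (N vs fs) = mset fs" if "length fs = length vs" for vs fs
    unfolding H_def N_def filter_sum[OF finite_lessThan] image_sum[OF finite_lessThan] H_term
    by (simp add: mset_list_sum[of fs] that)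
  have R_term: "image_mset (\<lambda>(c, l, a). a) (filter_mset (\<lambda>(c, l, a). c = 1 \<and> l = j) (term_mset v l)) =
      (if l = j then fst v else {#})"
    "image_mset (\<lambda>(c, l, a). a) (filter_mset (\<lambda>(c, l, a). c = 2 \<and> l = j) (term_mset v l)) =
      (if l = j then snd v else {#})" for v l j
    by (auto simp: term_mset_def filter_mset_image_mset o_def case_prod_beta image_mset.compositionality)
  have R_N: "R (N vs fs) (fs ! i) = vs ! i"
    if "length fs = length vs" "distinct fs" "i < length vs" for vs fs i
  proof -
    have eq: "fs ! i' = fs ! i \<longleftrightarrow> i' = i" if "i' < length vs" for i'
      using that \<open>i < length vs\<close> \<open>distinct fs\<close> \<open>length fs = length vs\<close> by (simp add: nth_eq_iff_index_eq)
    have single: "(\<Sum>i'<length vs. if fs ! i' = fs ! i then f i' else {#}) = f i"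
      for f :: "nat \<Rightarrow> nat multiset"
    proof -
      have "(\<Sum>i'<length vs. if fs ! i' = fs ! i then f i' else {#}) =
          (\<Sum>i'<length vs. if i' = i then f i' else {#})"
        by (intro sum.cong) (auto simp: eq)
      with that show ?thesis
        by simp
    qed
    show ?thesis
      unfolding R_def N_def filter_sum[OF finite_lessThan] image_sum[OF finite_lessThan] R_term single
      by simp
  qed
  have recover: "\<mu> = \<mu>0"
    if "length fs = length (vs \<mu>)" "N (vs \<mu>) fs = N (vs \<mu>0) [0..<n]" for \<mu> fs
  proof -
    have len0: "length [0..<n] = length (vs \<mu>0)"
      using size_\<mu>0 by (metis mset_vs size_mset length_upt diff_zero)
    have fs: "mset fs = mset [0..<n]"
      using that H_N[of fs "vs \<mu>"] H_N[OF len0] by simp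
    then have "distinct fs"
      by (metis distinct_upt mset_eq_imp_distinct_iff)
    have "vs \<mu> = map (R (N (vs \<mu>) fs)) fs"
      using R_N[OF that(1) \<open>distinct fs\<close>] that(1) by (simp add: list_eq_iff_nth_eq)
    moreover have "vs \<mu>0 = map (R (N (vs \<mu>0) [0..<n])) [0..<n]"
    proof (rule nth_equalityI)
      fix i assume "i < length (vs \<mu>0)"
      with len0 have "map (R (N (vs \<mu>0) [0..<n])) [0..<n] ! i = R (N (vs \<mu>0) [0..<n]) ([0..<n] ! i)"
        by (metis nth_map)
      with R_N[OF len0 distinct_upt \<open>i < length (vs \<mu>0)\<close>]
      show "vs \<mu>0 ! i = map (R (N (vs \<mu>0) [0..<n])) [0..<n] ! i"
        by (simp only:)
    qed (use len0 in simp)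
    ultimately have "mset (vs \<mu>) = mset (vs \<mu>0)"
      using fs that(2) by (metis mset_map)
    then show ?thesis
      by (simp add: mset_vs mono_mset_inject)
  qed
  let ?K = "Poly_Mapping.keys q"
  let ?S = "Sigma ?K (\<lambda>\<mu>. lists_over (length (vs \<mu>)) {..<n})"
  let ?g = "\<lambda>(\<mu>, fs). N (vs \<mu>) fs"
  have fin: "finite ?S"
    by (intro finite_SigmaI) auto
  \<comment> \<open>Different pairs may yield the same monomial \<open>M\<close>; \<open>c\<close>
    collects their coefficients.\<close>
  define c where "c = (\<lambda>M. \<Sum>p\<in>{p \<in> ?S. ?g p = M}. Poly_Mapping.lookup q (fst p))"
  have "c (N (vs \<mu>0) [0..<n]) = 0"
  proof (rule monomials_independent[where S = "?g ` ?S" and c = c])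
    show "finite (?g ` ?S)"
      using fin by simp
    have "(\<mu>0, [0..<n]) \<in> ?S"
      using \<mu>0 size_\<mu>0 by (auto simp: mset_vs simp flip: size_mset)
    then show "N (vs \<mu>0) [0..<n] \<in> ?g ` ?S"
      by (rule rev_image_eqI) simp
    fix X :: "nat \<times> nat \<times> nat \<Rightarrow> complex"
    let ?x = "jet_sum n (\<lambda>j. X (0, j, 0)) (\<lambda>j a. X (1, j, a)) (\<lambda>j b. X (2, j, b))"
    have x: "?x v = (\<Sum>j<n. \<Prod>\<^sub># (image_mset X (term_mset v j)))" for v
      by (simp add: jet_sum_def term_mset_def case_prod_beta image_mset.compositionality o_def mult.assoc)
    have mono: "\<Prod>\<^sub># (image_mset ?x (mono_mset \<mu>)) =
        (\<Sum>fs\<in>lists_over (length (vs \<mu>)) {..<n}. \<Prod>\<^sub># (image_mset X (N (vs \<mu>) fs)))" for \<mu>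
      unfolding mset_vs[symmetric] prod_mset_list x N_def prod_mset_image_sum[OF finite_lessThan]
      by (subst sum_prod_lists_over) (rule refl)
    have "0 = ev ?x q"
      using zero by simp
    also have "\<dots> = (\<Sum>\<mu>\<in>?K. \<Sum>fs\<in>lists_over (length (vs \<mu>)) {..<n}.
        Poly_Mapping.lookup q \<mu> * \<Prod>\<^sub># (image_mset X (N (vs \<mu>) fs)))"
      unfolding peval_mset mono sum_distrib_left ..
    also have "\<dots> = (\<Sum>p\<in>?S. Poly_Mapping.lookup q (fst p) * \<Prod>\<^sub># (image_mset X (?g p)))"
      by (subst sum.Sigma) (auto simp: case_prod_beta)
    also have "\<dots> = (\<Sum>M\<in>?g ` ?S. \<Sum>p\<in>{p \<in> ?S. ?g p = M}.
        Poly_Mapping.lookup q (fst p) * \<Prod>\<^sub># (image_mset X (?g p)))"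
      by (rule sum.image_gen[OF fin])
    also have "\<dots> = (\<Sum>M\<in>?g ` ?S. c M * \<Prod>\<^sub># (image_mset X M))"
      unfolding c_def sum_distrib_right by (intro sum.cong) auto
    finally show "(\<Sum>M\<in>?g ` ?S. c M * \<Prod>\<^sub># (image_mset X M)) = 0"
      by simp
  qed
  \<comment> \<open>By \<open>recover\<close>, all pairs yielding this monomial come from
    \<open>\<mu>0\<close>, so their coefficients are equal and cannot cancel.\<close>
  moreover have "c (N (vs \<mu>0) [0..<n]) =
      of_nat (card {p \<in> ?S. ?g p = N (vs \<mu>0) [0..<n]}) * Poly_Mapping.lookup q \<mu>0"
  proof -
    have "c (N (vs \<mu>0) [0..<n]) =
        (\<Sum>p\<in>{p \<in> ?S. ?g p = N (vs \<mu>0) [0..<n]}. Poly_Mapping.lookup q \<mu>0)"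
      unfolding c_def
    proof (intro sum.cong refl)
      fix p assume "p \<in> {p \<in> ?S. ?g p = N (vs \<mu>0) [0..<n]}"
      then have "fst p = \<mu>0"
        by (intro recover[of "snd p" "fst p"]) auto
      then show "Poly_Mapping.lookup q (fst p) = Poly_Mapping.lookup q \<mu>0"
        by simp
    qed
    then show ?thesis
      by simp
  qed
  moreover have "(\<mu>0, [0..<n]) \<in> {p \<in> ?S. ?g p = N (vs \<mu>0) [0..<n]}"
    using \<mu>0 size_\<mu>0 by (auto simp: mset_vs simp flip: size_mset)
  then have "card {p \<in> ?S. ?g p = N (vs \<mu>0) [0..<n]} \<noteq> 0"
    using fin by (metis (no_types, lifting) card_eq_0_iff empty_iff finite_subset mem_Collect_eq subsetI)
  ultimately show False
    using \<mu>0 by (simp add: in_keys_iff)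
qed

section \<open>The exterior algebra\<close>

lemma wedge_infinite: "infinite K \<Longrightarrow> (\<omega> \<and>\<^sub>w \<eta>) K = 0"
  by (simp add: wedge_def)

text \<open>On infinite index sets every product is 0, since the defining sum runs over an infinite
  set. The unit laws hold on finite sets only, and this lemma makes them usable inside further
  products.\<close>

lemma wedge_cong:
  assumes "\<And>K. finite K \<Longrightarrow> \<omega> K = \<omega>' K" "\<And>K. finite K \<Longrightarrow> \<eta> K = \<eta>' K"
  shows "\<omega> \<and>\<^sub>w \<eta> = \<omega>' \<and>\<^sub>w \<eta>'"
proof
  fix K
  show "(\<omega> \<and>\<^sub>w \<eta>) K = (\<omega>' \<and>\<^sub>w \<eta>') K"
  proof (cases "finite K")
    case True
    then show ?thesis
      unfolding wedge_def by (intro sum.cong refl) (auto simp: assms finite_subset)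
  qed (simp add: wedge_infinite)
qed

lemma wedge_scale_left: "(\<lambda>K. c * \<omega> K) \<and>\<^sub>w \<eta> = (\<lambda>K. c * (\<omega> \<and>\<^sub>w \<eta>) K)"
  by (auto simp: wedge_def sum_distrib_left mult_ac)

lemma wedge_scale_right: "\<omega> \<and>\<^sub>w (\<lambda>K. c * \<eta> K) = (\<lambda>K. c * (\<omega> \<and>\<^sub>w \<eta>) K)"
  by (auto simp: wedge_def sum_distrib_left mult_ac)

lemma wedge_sum_left: "(\<lambda>K. \<Sum>i\<in>A. f i K) \<and>\<^sub>w \<eta> = (\<lambda>K. \<Sum>i\<in>A. (f i \<and>\<^sub>w \<eta>) K)"
  unfolding wedge_def sum_distrib_left sum_distrib_right by (intro ext sum.swap)

lemma wedge_sum_right: "\<omega> \<and>\<^sub>w (\<lambda>K. \<Sum>i\<in>A. f i K) = (\<lambda>K. \<Sum>i\<in>A. (\<omega> \<and>\<^sub>w f i) K)"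
  unfolding wedge_def sum_distrib_left sum_distrib_right by (intro ext sum.swap)

lemma shuffle_sign_union_left:
  assumes "finite I" "finite J" "finite L" "I \<inter> J = {}"
  shows "shuffle_sign (I \<union> J) L = shuffle_sign I L * (shuffle_sign J L :: 'a::comm_ring_1)"
proof -
  have split: "{(i, j). i \<in> I \<union> J \<and> j \<in> L \<and> j < i} =
      {(i, j). i \<in> I \<and> j \<in> L \<and> j < i} \<union> {(i, j). i \<in> J \<and> j \<in> L \<and> j < i}"
    by auto
  moreover have "finite {(i, j). i \<in> I \<and> j \<in> L \<and> j < i}" "finite {(i, j). i \<in> J \<and> j \<in> L \<and> j < i}"
    using assms by (auto intro: finite_subset[of _ "I \<times> L"] finite_subset[of _ "J \<times> L"])
  ultimately show ?thesis
    using assms unfolding shuffle_sign_def split by (subst card_Un_disjoint) (auto simp: power_add)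
qed

lemma shuffle_sign_union_right:
  assumes "finite I" "finite J" "finite L" "J \<inter> L = {}"
  shows "shuffle_sign I (J \<union> L) = shuffle_sign I J * (shuffle_sign I L :: 'a::comm_ring_1)"
proof -
  have split: "{(i, j). i \<in> I \<and> j \<in> J \<union> L \<and> j < i} =
      {(i, j). i \<in> I \<and> j \<in> J \<and> j < i} \<union> {(i, j). i \<in> I \<and> j \<in> L \<and> j < i}"
    by auto
  moreover have "finite {(i, j). i \<in> I \<and> j \<in> J \<and> j < i}" "finite {(i, j). i \<in> I \<and> j \<in> L \<and> j < i}"
    using assms by (auto intro: finite_subset[of _ "I \<times> J"] finite_subset[of _ "I \<times> L"])
  ultimately show ?thesis
    using assms unfolding shuffle_sign_def split by (subst card_Un_disjoint) (auto simp: power_add)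
qed

text \<open>Both sides are sums over ordered partitions of \<open>K\<close> into three parts, with
  the product of the three pairwise shuffle signs.\<close>

lemma wedge_assoc: "(\<omega> \<and>\<^sub>w \<eta>) \<and>\<^sub>w \<theta> = \<omega> \<and>\<^sub>w (\<eta> \<and>\<^sub>w \<theta>)"
proof
  fix K :: "nat set"
  show "((\<omega> \<and>\<^sub>w \<eta>) \<and>\<^sub>w \<theta>) K = (\<omega> \<and>\<^sub>w (\<eta> \<and>\<^sub>w \<theta>)) K"
  proof (cases "finite K")
    case True
    let ?f = "\<lambda>A B L. shuffle_sign A B * shuffle_sign A L * shuffle_sign B L * \<omega> A * \<eta> B * \<theta> L"
    have fin: "finite I" if "I \<subseteq> K" for I
      using True that by (rule finite_subset[rotated])
    have "((\<omega> \<and>\<^sub>w \<eta>) \<and>\<^sub>w \<theta>) K = (\<Sum>I\<in>Pow K. \<Sum>A\<in>Pow I. ?f A (I - A) (K - I))"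
      unfolding wedge_def sum_distrib_left sum_distrib_right
    proof (intro sum.cong refl)
      fix I A assume "I \<in> Pow K" "A \<in> Pow I"
      then have "A \<subseteq> K" "K - I \<subseteq> K" "I - A \<subseteq> K" "A \<union> (I - A) = I"
        by auto
      with fin have "shuffle_sign I (K - I) =
          shuffle_sign A (K - I) * (shuffle_sign (I - A) (K - I) :: 'a)"
        using shuffle_sign_union_left[of A "I - A" "K - I"] by auto
      then show "shuffle_sign I (K - I) * (shuffle_sign A (I - A) * \<omega> A * \<eta> (I - A)) * \<theta> (K - I) =
          ?f A (I - A) (K - I)"
        by (simp add: mult_ac)
    qed
    also have "\<dots> = (\<Sum>(I, A)\<in>Sigma (Pow K) Pow. ?f A (I - A) (K - I))"
      using True fin by (subst sum.Sigma) auto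
    also have "\<dots> = (\<Sum>(A, B)\<in>Sigma (Pow K) (\<lambda>A. Pow (K - A)). ?f A B (K - A - B))"
    proof (rule sum.reindex_bij_witness[where i = "\<lambda>(A, B). (A \<union> B, A)" and j = "\<lambda>(I, A). (A, I - A)"])
      fix p assume "p \<in> Sigma (Pow K) Pow"
      then obtain I A where p: "p = (I, A)" "A \<subseteq> I" "I \<subseteq> K"
        by auto
      then have "K - A - (I - A) = K - I"
        by auto
      with p show "(case case p of (I, A) \<Rightarrow> (A, I - A) of (A, B) \<Rightarrow> ?f A B (K - A - B)) =
          (case p of (I, A) \<Rightarrow> ?f A (I - A) (K - I))"
        by simp
    qed auto
    also have "\<dots> = (\<Sum>A\<in>Pow K. \<Sum>B\<in>Pow (K - A). ?f A B (K - A - B))"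
      using True by (subst sum.Sigma) auto
    also have "\<dots> = (\<omega> \<and>\<^sub>w (\<eta> \<and>\<^sub>w \<theta>)) K"
      unfolding wedge_def sum_distrib_left sum_distrib_right
    proof (intro sum.cong refl)
      fix A B assume "A \<in> Pow K" "B \<in> Pow (K - A)"
      then have "A \<subseteq> K" "B \<subseteq> K" "K - A - B \<subseteq> K" "B \<union> (K - A - B) = K - A"
        by auto
      with fin have "shuffle_sign A (K - A) =
          shuffle_sign A B * (shuffle_sign A (K - A - B) :: 'a)"
        using shuffle_sign_union_right[of A B "K - A - B"] by auto
      then show "?f A B (K - A - B) = shuffle_sign A (K - A) * \<omega> A *
          (shuffle_sign B (K - A - B) * \<eta> B * \<theta> (K - A - B))"
        by (simp add: mult_ac)
    qed
    finally show ?thesis .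
  qed (simp add: wedge_infinite)
qed

lemma wedge_unit_left: "finite K \<Longrightarrow> (unit_form \<and>\<^sub>w \<eta>) K = \<eta> K"
proof -
  assume "finite K"
  then have "(unit_form \<and>\<^sub>w \<eta>) K = (\<Sum>I\<in>{{}}. shuffle_sign I (K - I) * unit_form I * \<eta> (K - I))"
    unfolding wedge_def by (intro sum.mono_neutral_right) (auto simp: unit_form_def)
  then show ?thesis
    by (simp add: shuffle_sign_def unit_form_def)
qed

lemma wedge_unit_right: "finite K \<Longrightarrow> (\<eta> \<and>\<^sub>w unit_form) K = \<eta> K"
proof -
  assume "finite K"
  then have "(\<eta> \<and>\<^sub>w unit_form) K = (\<Sum>I\<in>{K}. shuffle_sign I (K - I) * \<eta> I * unit_form (K - I))"
    unfolding wedge_def by (intro sum.mono_neutral_right) (auto simp: unit_form_def)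
  then show ?thesis
    by (simp add: shuffle_sign_def unit_form_def)
qed

section \<open>Products of lists of forms\<close>

lemma wedge_list_Nil [simp]: "wedge_list [] = unit_form"
  and wedge_list_Cons [simp]: "wedge_list (\<omega> # \<omega>s) = \<omega> \<and>\<^sub>w wedge_list \<omega>s"
  by (simp_all add: wedge_list_def)

lemma wedge_list_infinite: "infinite K \<Longrightarrow> wedge_list \<omega>s K = 0"
  by (cases \<omega>s) (auto simp: unit_form_def wedge_infinite)

lemma wedge_list_append: "wedge_list (\<omega>s @ \<eta>s) = wedge_list \<omega>s \<and>\<^sub>w wedge_list \<eta>s"
proof (induction \<omega>s)
  case Nil
  show ?case
  proof
    fix K :: "nat set"
    show "wedge_list ([] @ \<eta>s) K = (wedge_list [] \<and>\<^sub>w wedge_list \<eta>s) K"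
      by (cases "finite K") (simp_all add: wedge_unit_left wedge_list_infinite wedge_infinite)
  qed
qed (simp add: wedge_assoc)

lemma wedge_list_concat: "wedge_list (concat \<omega>ss) = wedge_list (map wedge_list \<omega>ss)"
  by (induction \<omega>ss) (simp_all add: wedge_list_append)

text \<open>Multilinear expansion, meant for curvature matrices whose entries are all combinations
  of the same few 2-forms \<open>\<omega> j\<close>.\<close>

lemma wedge_list_map_sum:
  fixes b :: "'i \<Rightarrow> 'v \<Rightarrow> 'a::comm_ring_1"
  shows "wedge_list (map (\<lambda>v K. \<Sum>j\<in>A. b j v * \<omega> j K) vs) =
    (\<lambda>K. \<Sum>js\<in>lists_over (length vs) A. (\<Prod>i<length vs. b (js ! i) (vs ! i)) * wedge_list (map \<omega> js) K)"
proof (induction vs)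
  case Nil
  have "lists_over 0 A = {[]}"
    by auto
  then show ?case
    by simp
next
  case (Cons v vs)
  let ?n = "length vs"
  have "wedge_list (map (\<lambda>v K. \<Sum>j\<in>A. b j v * \<omega> j K) (v # vs)) =
      (\<lambda>K. \<Sum>j\<in>A. \<Sum>js\<in>lists_over ?n A.
        b j v * ((\<Prod>i<?n. b (js ! i) (vs ! i)) * (\<omega> j \<and>\<^sub>w wedge_list (map \<omega> js)) K))"
    by (simp add: Cons.IH wedge_sum_left wedge_sum_right wedge_scale_left wedge_scale_right sum_distrib_left)
  also have "\<dots> = (\<lambda>K. \<Sum>j\<in>A. \<Sum>js\<in>lists_over ?n A.
        (\<Prod>i<Suc ?n. b ((j # js) ! i) ((v # vs) ! i)) * wedge_list (map \<omega> (j # js)) K)"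
    by (simp add: prod.lessThan_Suc_shift mult.assoc del: prod.lessThan_Suc)
  finally show ?case
    by (simp only: sum_lists_over_Suc list.size(4) One_nat_def add_Suc_right add_0_right)
qed

text \<open>Lists the matrix entries of a monomial in the row by row order in which
  \<open>mat_poly_form\<close> multiplies the 2-forms.\<close>

definition var_list :: "nat \<Rightarrow> (nat \<times> nat \<Rightarrow>\<^sub>0 nat) \<Rightarrow> (nat \<times> nat) list" where
  "var_list m \<mu> = concat (concat (map (\<lambda>i. map (\<lambda>j. replicate (Poly_Mapping.lookup \<mu> (i, j)) (i, j))
     [0..<m]) [0..<m]))"

lemma wedge_power_list:
  "wedge_list [wedge_power (X i j) (Poly_Mapping.lookup \<mu> (i, j)). i \<leftarrow> [0..<m], j \<leftarrow> [0..<m]] =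
    wedge_list (map (\<lambda>(i, j). X i j) (var_list m \<mu>))"
  unfolding var_list_def map_concat map_map wedge_list_concat
  by (simp add: wedge_power_def o_def map_concat)

lemma mat_poly_form_var_list:
  "mat_poly_form emb m S X = (\<lambda>K. \<Sum>\<mu>\<in>Poly_Mapping.keys S. emb (Poly_Mapping.lookup S \<mu>) *
    wedge_list (map (\<lambda>(i, j). X i j) (var_list m \<mu>)) K)"
  unfolding mat_poly_form_def wedge_power_list ..

lemma mset_var_list:
  assumes "Poly_Mapping.keys \<mu> \<subseteq> {..<m} \<times> {..<m}"
  shows "mset (var_list m \<mu>) = mono_mset \<mu>"
proof -
  have mset_concat': "mset (concat xss) = (\<Sum>xs\<leftarrow>xss. mset xs)" for xss :: "'b list list"
    by (induction xss) auto
  have sum_concat: "sum_list (concat xss) = (\<Sum>xs\<leftarrow>xss. sum_list xs)" for xss :: "'b multiset list list"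
    by (induction xss) auto
  have "mset (var_list m \<mu>) =
      (\<Sum>i<m. \<Sum>j<m. replicate_mset (Poly_Mapping.lookup \<mu> (i, j)) (i, j))"
    unfolding var_list_def mset_concat' map_concat map_map
    by (simp add: o_def sum_concat interv_sum_list_conv_sum_set_nat atLeast0LessThan)
  also have "\<dots> = (\<Sum>v\<in>{..<m} \<times> {..<m}. replicate_mset (Poly_Mapping.lookup \<mu> v) v)"
    by (simp add: sum.cartesian_product case_prod_beta)
  also have "\<dots> = mono_mset \<mu>"
    unfolding mono_mset_def using assms
    by (intro sum.mono_neutral_right) (auto simp: in_keys_iff)
  finally show ?thesis .
qed

section \<open>One-forms\<close>

definition one_form :: "(nat \<Rightarrow> 'a::comm_ring_1) \<Rightarrow> 'a form" where
  "one_form v = (\<lambda>K. if is_singleton K then v (the_elem K) else 0)"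

lemma one_form_singleton [simp]: "one_form v {a} = v a"
  by (simp add: one_form_def)

lemma covec_one_form: "covec a = one_form (\<lambda>b. if b = a then 1 else 0)"
  by (rule ext) (auto simp: covec_def one_form_def is_singleton_def)

lemma one_form_sum: "one_form (\<lambda>a. \<Sum>i\<in>A. f i a) = (\<lambda>K. \<Sum>i\<in>A. one_form (f i) K)"
  by (auto simp: one_form_def)

lemma one_form_scale: "one_form (\<lambda>a. c * f a) = (\<lambda>K. c * one_form f K)"
  by (auto simp: one_form_def)

lemma wedge_one_form:
  assumes "finite K"
  shows "(one_form v \<and>\<^sub>w \<eta>) K = (\<Sum>a\<in>K. (-1) ^ card {j \<in> K. j < a} * v a * \<eta> (K - {a}))"
proof -
  have "(one_form v \<and>\<^sub>w \<eta>) K = (\<Sum>I\<in>(\<lambda>a. {a}) ` K. shuffle_sign I (K - I) * one_form v I * \<eta> (K - I))"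
    unfolding wedge_def using assms
    by (intro sum.mono_neutral_right) (auto simp: one_form_def is_singleton_def)
  also have "\<dots> = (\<Sum>a\<in>K. shuffle_sign {a} (K - {a}) * v a * \<eta> (K - {a}))"
    by (subst sum.reindex) auto
  also have "\<dots> = (\<Sum>a\<in>K. (-1) ^ card {j \<in> K. j < a} * v a * \<eta> (K - {a}))"
  proof (intro sum.cong refl arg_cong2[where f = "(*)"])
    fix a assume "a \<in> K"
    have "{(i, j). i \<in> {a} \<and> j \<in> K - {a} \<and> j < i} = Pair a ` {j \<in> K. j < a}"
      by auto
    then show "shuffle_sign {a} (K - {a}) = (-1) ^ card {j \<in> K. j < a}"
      by (simp add: shuffle_sign_def card_image inj_on_def)
  qed
  finally show ?thesis .
qed

lemma wedge_one_forms_pair: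
  fixes v w :: "nat \<Rightarrow> 'a::comm_ring_1"
  assumes "a < b"
  shows "(one_form v \<and>\<^sub>w one_form w) {a, b} = v a * w b - v b * w a"
proof -
  have empty: "{j. (j = a \<or> j = b) \<and> j < a} = {}"
    using assms by auto
  have "(-1 :: 'a) ^ card {j. (j = a \<or> j = b) \<and> j < a} = 1"
    unfolding empty by simp
  moreover have "{j. (j = a \<or> j = b) \<and> j < b} = {a}"
    "{a, b} - {a} = {b}" "{a, b} - {b} = {a}"
    using assms by auto
  ultimately show ?thesis
    using assms by (simp add: wedge_one_form)
qed

lemma wedge_one_forms_card: "card K \<noteq> 2 \<Longrightarrow> (one_form v \<and>\<^sub>w one_form w) K = 0"
proof (cases "finite K")
  case True
  assume "card K \<noteq> 2"
  then have "\<not> is_singleton (K - {a})" if "a \<in> K" for a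
    using that True by (auto simp: is_singleton_altdef card_Diff_singleton)
  then have "one_form w (K - {a}) = 0" if "a \<in> K" for a
    using that by (simp add: one_form_def)
  then show ?thesis
    using True by (simp add: wedge_one_form)
qed (simp add: wedge_infinite)

lemma card_2_obtain:
  fixes K :: "nat set"
  assumes "card K = 2"
  obtains a b where "K = {a, b}" "a < b"
proof -
  obtain x y where "K = {x, y}" "x \<noteq> y"
    using assms by (meson card_2_iff)
  then show thesis
    using that[of x y] that[of y x] by (cases "x < y") (auto simp: insert_commute)
qed

lemma one_form_anticommute: "one_form v \<and>\<^sub>w one_form w = (\<lambda>K. - (one_form w \<and>\<^sub>w one_form v) K)"
proof
  fix K :: "nat set"
  show "(one_form v \<and>\<^sub>w one_form w) K = - (one_form w \<and>\<^sub>w one_form v) K"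
  proof (cases "card K = 2")
    case True
    then obtain a b where "K = {a, b}" "a < b"
      by (rule card_2_obtain)
    then show ?thesis
      by (simp add: wedge_one_forms_pair mult.commute)
  qed (simp add: wedge_one_forms_card)
qed

lemma wedge_one_form_list:
  "one_form w \<and>\<^sub>w wedge_list (map one_form us) =
    (\<lambda>K. (-1) ^ length us * (wedge_list (map one_form us) \<and>\<^sub>w one_form w) K)"
proof (induction us)
  case Nil
  have "(one_form w \<and>\<^sub>w unit_form) K = (unit_form \<and>\<^sub>w one_form w) K" for K
    by (cases "finite K") (simp_all add: wedge_unit_left wedge_unit_right wedge_infinite)
  then show ?case
    by auto
next
  case (Cons u us)
  have "one_form w \<and>\<^sub>w wedge_list (map one_form (u # us)) =
      (one_form w \<and>\<^sub>w one_form u) \<and>\<^sub>w wedge_list (map one_form us)"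
    by (simp add: wedge_assoc)
  also have "\<dots> = (\<lambda>K. (-1) * ((one_form u \<and>\<^sub>w one_form w) \<and>\<^sub>w wedge_list (map one_form us)) K)"
    using wedge_scale_left[of "-1" "one_form u \<and>\<^sub>w one_form w"]
    by (simp add: one_form_anticommute[of w u])
  also have "\<dots> = (\<lambda>K. (-1) * (one_form u \<and>\<^sub>w (one_form w \<and>\<^sub>w wedge_list (map one_form us))) K)"
    by (simp add: wedge_assoc)
  also have "\<dots> = (\<lambda>K. (-1) ^ length (u # us) * (wedge_list (map one_form (u # us)) \<and>\<^sub>w one_form w) K)"
    unfolding Cons.IH wedge_scale_right by (simp add: wedge_assoc mult.assoc)
  finally show ?case .
qed

text \<open>Equals -1 to the power n(n-1)/2, the sign of moving the first members of
  \<open>n\<close> pairs of 1-forms in front of all the second members.\<close>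

primrec reorder_sign :: "nat \<Rightarrow> 'a::comm_ring_1" where
  "reorder_sign 0 = 1"
| "reorder_sign (Suc n) = (-1) ^ n * reorder_sign n"

lemma reorder_sign_square [simp]: "reorder_sign n * reorder_sign n = (1::'a::comm_ring_1)"
proof (induction n)
  case (Suc n)
  have "reorder_sign (Suc n) * reorder_sign (Suc n) =
      ((-1) ^ n * (-1) ^ n) * (reorder_sign n * reorder_sign n :: 'a)"
    by (simp add: mult_ac)
  with Suc show ?case
    by (simp flip: power_add)
qed simp

text \<open>The new second member has to pass the \<open>length ls\<close> first members already
  collected; this is the sign in the recursion for \<open>reorder_sign\<close>.\<close>

lemma wedge_list_separate:
  "wedge_list (map (\<lambda>l. one_form (U l) \<and>\<^sub>w one_form (W l)) ls) =
    (\<lambda>K. reorder_sign (length ls) *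
      (wedge_list (map (\<lambda>l. one_form (U l)) ls) \<and>\<^sub>w wedge_list (map (\<lambda>l. one_form (W l)) ls)) K)"
proof (induction ls)
  case Nil
  have "unit_form K = (unit_form \<and>\<^sub>w unit_form) K" for K :: "nat set"
    by (cases "finite K") (simp add: wedge_unit_left, simp add: wedge_infinite, auto simp: unit_form_def)
  then show ?case
    by auto
next
  case (Cons l ls)
  let ?u = "one_form (U l)" and ?w = "one_form (W l)"
  let ?A = "wedge_list (map (\<lambda>l. one_form (U l)) ls)" and ?B = "wedge_list (map (\<lambda>l. one_form (W l)) ls)"
  have "?w \<and>\<^sub>w ?A = (\<lambda>K. (-1) ^ length ls * (?A \<and>\<^sub>w ?w) K)"
    using wedge_one_form_list[of "W l" "map U ls"] by (simp add: o_def)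
  then have "?u \<and>\<^sub>w ?w \<and>\<^sub>w (?A \<and>\<^sub>w ?B) = (\<lambda>K. (-1) ^ length ls * ((?u \<and>\<^sub>w ?A) \<and>\<^sub>w (?w \<and>\<^sub>w ?B)) K)"
    by (simp add: wedge_assoc wedge_scale_left wedge_scale_right flip: wedge_assoc[of ?w])
  then show ?case
    by (simp add: Cons.IH wedge_scale_right mult_ac)
qed

text \<open>The sign of the permutation sorting a list of distinct numbers.\<close>

primrec list_sign :: "nat list \<Rightarrow> 'a::comm_ring_1" where
  "list_sign [] = 1"
| "list_sign (a # as) = (-1) ^ card {j \<in> set as. j < a} * list_sign as"

abbreviation enumerations :: "nat \<Rightarrow> nat set \<Rightarrow> nat list set" where
  "enumerations n K \<equiv> {as. length as = n \<and> distinct as \<and> set as = K}"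

lemma finite_enumerations: "finite K \<Longrightarrow> finite (enumerations n K)"
  by (rule finite_subset[OF _ finite_lists_over[of K n]]) auto

text \<open>Expanding along the leading 1-form removes one index at a time. The order of removal is
  the enumeration \<open>as\<close>, and the signs accumulate to \<open>list_sign\<close>.\<close>

lemma wedge_list_one_forms:
  assumes "finite K"
  shows "wedge_list (map (\<lambda>l. one_form (U l)) ls) K =
    (\<Sum>as\<in>enumerations (length ls) K. list_sign as * (\<Prod>i<length ls. U (ls ! i) (as ! i)))"
  using assms
proof (induction ls arbitrary: K)
  case Nil
  have "enumerations 0 K = (if K = {} then {[]} else {})"
    by auto
  then show ?case
    by (simp add: unit_form_def)
next
  case (Cons l ls)
  let ?n = "length ls"
  let ?f = "\<lambda>as. list_sign as * (\<Prod>i<Suc ?n. U ((l # ls) ! i) (as ! i))"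
  have "wedge_list (map (\<lambda>l. one_form (U l)) (l # ls)) K =
      (\<Sum>a\<in>K. \<Sum>as\<in>enumerations ?n (K - {a}). (-1) ^ card {j \<in> K. j < a} * U l a *
        (list_sign as * (\<Prod>i<?n. U (ls ! i) (as ! i))))"
    using Cons by (simp add: wedge_one_form sum_distrib_left)
  also have "\<dots> = (\<Sum>a\<in>K. \<Sum>as\<in>enumerations ?n (K - {a}). ?f (a # as))"
  proof (intro sum.cong refl)
    fix a as assume "a \<in> K" "as \<in> enumerations ?n (K - {a})"
    then have "{j \<in> K. j < a} = {j \<in> set as. j < a}"
      by auto
    then show "(-1) ^ card {j \<in> K. j < a} * U l a * (list_sign as * (\<Prod>i<?n. U (ls ! i) (as ! i))) =
        ?f (a # as)"
      by (simp add: prod.lessThan_Suc_shift mult_ac del: prod.lessThan_Suc)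
  qed
  also have "\<dots> = (\<Sum>(a, as)\<in>Sigma K (\<lambda>a. enumerations ?n (K - {a})). ?f (a # as))"
    using Cons.prems by (subst sum.Sigma) (auto simp: finite_enumerations)
  also have "\<dots> = (\<Sum>as\<in>enumerations (Suc ?n) K. ?f as)"
  proof -
    have img: "enumerations (Suc ?n) K = (\<lambda>(a, as). a # as) ` Sigma K (\<lambda>a. enumerations ?n (K - {a}))"
    proof (intro equalityI subsetI)
      fix as assume "as \<in> enumerations (Suc ?n) K"
      then show "as \<in> (\<lambda>(a, as). a # as) ` Sigma K (\<lambda>a. enumerations ?n (K - {a}))"
        by (cases as) (auto simp: image_iff)
    next
      fix as assume "as \<in> (\<lambda>(a, as). a # as) ` Sigma K (\<lambda>a. enumerations ?n (K - {a}))"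
      then obtain p where p: "as = (\<lambda>(a, as). a # as) p" "p \<in> Sigma K (\<lambda>a. enumerations ?n (K - {a}))"
        by (rule imageE)
      obtain a bs where "p = (a, bs)"
        by (cases p)
      with p have "as = a # bs" "a \<in> K" "bs \<in> enumerations ?n (K - {a})"
        by simp_all
      then show "as \<in> enumerations (Suc ?n) K"
        by auto
    qed
    have inj: "inj_on (\<lambda>(a, as). a # as) (Sigma K (\<lambda>a. enumerations ?n (K - {a})))"
      by (auto simp: inj_on_def)
    show ?thesis
      unfolding img sum.reindex[OF inj] by (intro sum.cong refl) (simp only: case_prod_unfold o_def)
  qed
  finally show ?case
    by simp
qed

text \<open>Moving the entry at position \<open>j\<close> to the front costs
  \<open>(-1) ^ j\<close>, and as head of the list it contributes the number of smaller entries.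
  This matches the signs of Laplace expansion with those of \<open>wedge_one_form\<close>.\<close>

lemma list_sign_remove:
  assumes "distinct as" "j < length as"
  shows "list_sign as * (-1) ^ card {x \<in> set as. x < as ! j} =
    (-1) ^ j * (list_sign (take j as @ drop (Suc j) as) :: 'a::comm_ring_1)"
  using assms
proof (induction as arbitrary: j)
  case (Cons a as)
  have sq: "(-1) ^ n * ((-1) ^ n * x) = (x::'a)" for n x
    by (simp add: mult.assoc[symmetric] flip: power_add)
  show ?case
  proof (cases j)
    case 0
    have "{x \<in> set (a # as). x < a} = {x \<in> set as. x < a}"
      by auto
    then show ?thesis
      using 0 by (simp add: mult_ac sq)
  next
    case (Suc i)
    let ?b = "as ! i" and ?as = "take i as @ drop (Suc i) as"
    have i: "i < length as" and "?b \<in> set as" "a \<notin> set as" and d: "distinct as"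
      using Cons.prems Suc by auto
    have as_eq: "as = take i as @ ?b # drop (Suc i) as"
      using i by (rule id_take_nth_drop)
    have d': "distinct (take i as @ ?b # drop (Suc i) as)"
      using d as_eq by simp
    then have b: "?b \<notin> set ?as"
      by auto
    have "set as = set (take i as @ ?b # drop (Suc i) as)"
      by (rule arg_cong[OF as_eq])
    then have set_as: "set as = insert ?b (set ?as)"
      by simp
    have 1: "card {x \<in> set (a # as). x < ?b} = card {x \<in> set as. x < ?b} + (if a < ?b then 1 else 0)"
    proof -
      have "{x \<in> set (a # as). x < ?b} = {x \<in> set as. x < ?b} \<union> (if a < ?b then {a} else {})"
        by auto
      then show ?thesis
        using \<open>a \<notin> set as\<close> by auto
    qed
    have 2: "card {x \<in> set as. x < a} = card {x \<in> set ?as. x < a} + (if ?b < a then 1 else 0)"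
    proof -
      have "{x \<in> set as. x < a} = {x \<in> set ?as. x < a} \<union> (if ?b < a then {?b} else {})"
        unfolding set_as by auto
      then show ?thesis
        using b by auto
    qed
    have "a \<noteq> ?b"
      using \<open>a \<notin> set as\<close> \<open>?b \<in> set as\<close> by auto
    then have sgn: "(-1) ^ (if a < ?b then 1 else 0) * (-1) ^ (if ?b < a then 1 else 0) = (-1 :: 'a)"
      by auto
    have "list_sign (a # as) * (-1) ^ card {x \<in> set (a # as). x < (a # as) ! j} =
        ((-1) ^ (if a < ?b then 1 else 0) * (-1) ^ (if ?b < a then 1 else 0)) *
        ((-1) ^ card {x \<in> set ?as. x < a} * (list_sign as * (-1) ^ card {x \<in> set as. x < ?b} :: 'a))"
      using Suc 1 2 by (simp add: power_add mult_ac)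
    also have "\<dots> = (-1) * ((-1) ^ card {x \<in> set ?as. x < a} * ((-1) ^ i * list_sign ?as))"
      unfolding sgn Cons.IH[OF d i] ..
    also have "\<dots> = (-1) ^ j * list_sign (take j (a # as) @ drop (Suc j) (a # as))"
      using Suc by (simp add: mult_ac)
    finally show ?thesis .
  qed
qed simp

text \<open>Laplace expansion along the first row is the expansion of a product along its first
  1-form; \<open>list_sign\<close> accounts for columns that are not in increasing order.\<close>

lemma det_one_forms:
  fixes W :: "'i \<Rightarrow> nat \<Rightarrow> 'a::comm_ring_1"
  assumes "distinct as" "length as = length ls"
  shows "Determinant.det (mat (length ls) (length ls) (\<lambda>(i, j). W (ls ! i) (as ! j))) =
    list_sign as * wedge_list (map (\<lambda>l. one_form (W l)) ls) (set as)"
  using assms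
proof (induction ls arbitrary: as)
  case Nil
  then show ?case
    by (simp add: unit_form_def det_def)
next
  case (Cons l ls)
  let ?n = "length ls" and ?W = "wedge_list (map (\<lambda>l. one_form (W l)) ls)"
  let ?A = "mat (Suc ?n) (Suc ?n) (\<lambda>(i, j). W ((l # ls) ! i) (as ! j))"
  let ?rm = "\<lambda>j. take j as @ drop (Suc j) as"
  have len: "length as = Suc ?n"
    using Cons.prems by simp
  have rm: "distinct (?rm j)" "length (?rm j) = ?n" "set (?rm j) = set as - {as ! j}" if "j < Suc ?n" for j
  proof -
    have "as = take j as @ as ! j # drop (Suc j) as"
      using that len by (intro id_take_nth_drop) simp
    then have d: "distinct (take j as @ as ! j # drop (Suc j) as)" and
      s: "set as = set (take j as @ as ! j # drop (Suc j) as)"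
      using Cons.prems(1) by simp_all
    from d show "distinct (?rm j)"
      by simp
    from d s show "set (?rm j) = set as - {as ! j}"
      by auto
    show "length (?rm j) = ?n"
      using that len by simp
  qed
  have del: "mat_delete ?A 0 j = mat ?n ?n (\<lambda>(i, j'). W (ls ! i) (?rm j ! j'))" if "j < Suc ?n" for j
    unfolding mat_delete_def using that len
    by (intro eq_matI) (auto simp: nth_append min_def)
  have "Determinant.det ?A = (\<Sum>j<Suc ?n. ?A $$ (0, j) * cofactor ?A 0 j)"
    by (rule laplace_expansion_row[of _ "Suc ?n"]) auto
  also have "\<dots> = (\<Sum>j<Suc ?n. list_sign as * ((-1) ^ card {x \<in> set as. x < as ! j} * W l (as ! j) * ?W (set as - {as ! j})))"
  proof (intro sum.cong refl)
    fix j assume "j \<in> {..<Suc ?n}"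
    then have j: "j < Suc ?n"
      by simp
    have "cofactor ?A 0 j = (-1) ^ j * (list_sign (?rm j) * ?W (set as - {as ! j}))"
      unfolding cofactor_def del[OF j] Cons.IH[OF rm(1,2)[OF j]] rm(3)[OF j] by simp
    also have "\<dots> = list_sign as * (-1) ^ card {x \<in> set as. x < as ! j} * ?W (set as - {as ! j})"
      using list_sign_remove[of as j, where 'a = 'a] j len Cons.prems by (simp add: mult.assoc)
    finally show "?A $$ (0, j) * cofactor ?A 0 j =
        list_sign as * ((-1) ^ card {x \<in> set as. x < as ! j} * W l (as ! j) * ?W (set as - {as ! j}))"
      using j by (simp add: mult_ac)
  qed
  also have "\<dots> = list_sign as * (\<Sum>a\<in>set as. (-1) ^ card {x \<in> set as. x < a} * W l a * ?W (set as - {a}))"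
  proof -
    have "bij_betw (\<lambda>j. as ! j) {..<Suc ?n} (set as)"
      using Cons.prems len by (intro bij_betw_nth) auto
    then show ?thesis
      unfolding sum_distrib_left[symmetric] by (subst sum.reindex_bij_betw[symmetric]) auto
  qed
  finally show ?case
    by (simp add: wedge_one_form)
qed

section \<open>The total contraction of even forms\<close>

abbreviation index_pairs :: "nat set \<Rightarrow> nat set" where
  "index_pairs I \<equiv> (\<lambda>i. 2 * i) ` I \<union> (\<lambda>i. 2 * i + 1) ` I"

text \<open>Up to a factor depending only on \<open>n\<close>, this is the pairing with the
  \<open>n\<close>-th power of the Kaehler form.\<close>

definition pair_trace :: "nat \<Rightarrow> nat \<Rightarrow> 'a::comm_ring_1 form \<Rightarrow> 'a" where
  "pair_trace m n \<omega> = (\<Sum>I\<in>{I \<in> Pow {..<m}. card I = n}. \<omega> (index_pairs I))"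

definition hol_form :: "nat \<Rightarrow> (nat \<Rightarrow> 'a::comm_ring_1) \<Rightarrow> nat \<Rightarrow> 'a" where
  "hol_form m u = (\<lambda>a. if even a \<and> a < 2 * m then u (a div 2) else 0)"

definition antihol_form :: "nat \<Rightarrow> (nat \<Rightarrow> 'a::comm_ring_1) \<Rightarrow> nat \<Rightarrow> 'a" where
  "antihol_form m w = (\<lambda>a. if odd a \<and> a < 2 * m then w (a div 2) else 0)"

text \<open>Since \<open>2 * j + 1 < 2 * i\<close> means \<open>j < i\<close>, the inversions are
  the pairs of distinct elements of \<open>I\<close>. The induction adds the largest element last,
  which forms a pair with each of the others.\<close>

lemma shuffle_sign_even_odd:
  assumes "finite I"
  shows "shuffle_sign ((\<lambda>i. 2 * i) ` I) ((\<lambda>i. 2 * i + 1) ` I) = (reorder_sign (card I) :: 'a::comm_ring_1)"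
proof -
  have "(-1) ^ card {(i, j). i \<in> I \<and> j \<in> I \<and> j < i} = (reorder_sign (card I) :: 'a)"
    using assms
  proof (induction I rule: finite_linorder_max_induct)
    case (insert b I)
    have 1: "{(i, j). i \<in> insert b I \<and> j \<in> insert b I \<and> j < i} =
        {(i, j). i \<in> I \<and> j \<in> I \<and> j < i} \<union> Pair b ` I"
      using insert by (auto dest: less_asym)
    have 2: "card ({(i, j). i \<in> I \<and> j \<in> I \<and> j < i} \<union> Pair b ` I) =
        card {(i, j). i \<in> I \<and> j \<in> I \<and> j < i} + card I"
    proof -
      have "finite {(i, j). i \<in> I \<and> j \<in> I \<and> j < i}"
        using insert.hyps by (auto intro: finite_subset[of _ "I \<times> I"])
      then show ?thesis
        using insert.hyps by (subst card_Un_disjoint) (auto simp: card_image inj_on_def)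
    qed
    have 3: "card (insert b I) = Suc (card I)"
      using insert.hyps by (metis card_insert_disjoint less_irrefl)
    show ?case
      unfolding 1 2 3 power_add insert.IH by (simp add: mult.commute)
  qed simp
  moreover have "{(i, j). i \<in> (\<lambda>i. 2 * i) ` I \<and> j \<in> (\<lambda>i. 2 * i + 1) ` I \<and> j < i} =
      (\<lambda>(i, j). (2 * i, 2 * j + 1)) ` {(i, j). i \<in> I \<and> j \<in> I \<and> j < i}"
    by (auto simp: image_iff)
  moreover have "inj_on (\<lambda>(i, j). (2 * i, 2 * j + 1 :: nat)) {(i, j). i \<in> I \<and> j \<in> I \<and> j < i}"
    by (auto simp: inj_on_def)
  ultimately show ?thesis
    unfolding shuffle_sign_def by (simp add: card_image)
qed

lemma list_sign_map_even: "list_sign (map (\<lambda>i. 2 * i) as) = list_sign as"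
proof (induction as)
  case (Cons a as)
  have "{j \<in> (\<lambda>i. 2 * i) ` set as. j < 2 * a} = (\<lambda>i. 2 * i) ` {j \<in> set as. j < a}"
    by auto
  then show ?case
    using Cons by (simp add: card_image inj_on_def)
qed simp

lemma list_sign_map_odd: "list_sign (map (\<lambda>i. 2 * i + 1) as) = list_sign as"
proof (induction as)
  case (Cons a as)
  have "{j \<in> (\<lambda>i. 2 * i + 1) ` set as. j < 2 * a + 1} = (\<lambda>i. 2 * i + 1) ` {j \<in> set as. j < a}"
    by auto
  then show ?case
    using Cons by (simp add: card_image inj_on_def)
qed simp

text \<open>Every enumeration of \<open>K\<close> assigns the index \<open>a0\<close> to some
  factor, and that factor vanishes there. Applied to an odd index for forms of type (1,0) and to an
  even one for type (0,1).\<close>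

lemma wedge_list_hol_eq_0:
  assumes "finite K" "\<And>l a. a \<in> K \<Longrightarrow> a = a0 \<Longrightarrow> U l a = 0" "a0 \<in> K"
  shows "wedge_list (map (\<lambda>l. one_form (U l)) ls) K = 0"
  unfolding wedge_list_one_forms[OF assms(1)]
proof (rule sum.neutral, rule ballI)
  fix as assume as: "as \<in> enumerations (length ls) K"
  then obtain i where "i < length ls" "as ! i = a0"
    using assms(3) by (auto simp: in_set_conv_nth)
  then have "(\<Prod>i<length ls. U (ls ! i) (as ! i)) = 0"
    using assms(2)[of a0] assms(3) by (auto intro!: prod_zero)
  then show "list_sign as * (\<Prod>i<length ls. U (ls ! i) (as ! i)) = 0"
    by simp
qed

lemma enumerations_image:
  assumes "inj f"
  shows "enumerations n (f ` I) = map f ` enumerations n I"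
proof (intro equalityI subsetI)
  fix as assume as: "as \<in> enumerations n (f ` I)"
  then have "as = map f (map (the_inv f) as)"
    using assms by (auto simp: list_eq_iff_nth_eq f_the_inv_into_f subset_iff dest!: nth_mem)
  moreover have "map (the_inv f) as \<in> enumerations n I"
  proof -
    have "the_inv f ` f ` I = I"
      using assms by (auto simp: image_image the_inv_f_f)
    moreover have "inj_on (the_inv f) (set as)"
      using assms as by (auto simp: inj_on_def the_inv_f_f)
    ultimately show ?thesis
      using as by (auto simp: distinct_map)
  qed
  ultimately show "as \<in> map f ` enumerations n I"
    by (rule image_eqI)
qed (use inj_on_subset[OF assms subset_UNIV] in \<open>auto simp: distinct_map\<close>)

text \<open>Of all splittings of \<open>index_pairs I\<close>, only the one into even and odd
  indices contributes. The (1,0) factors are expanded over enumerations of \<open>I\<close>; the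
  sign of each enumeration is absorbed when the (0,1) factors become a determinant with its columns
  in that order.\<close>

lemma wedge_hol_antihol_index_pairs:
  fixes u w :: "'l \<Rightarrow> nat \<Rightarrow> 'a::comm_ring_1"
  assumes "I \<subseteq> {..<m}"
  shows "(wedge_list (map (\<lambda>l. one_form (hol_form m (u l))) ls) \<and>\<^sub>w
      wedge_list (map (\<lambda>l. one_form (antihol_form m (w l))) ls)) (index_pairs I) =
    reorder_sign (card I) *
    (\<Sum>as\<in>enumerations (length ls) I. (\<Prod>i<length ls. u (ls ! i) (as ! i)) *
       Determinant.det (mat (length ls) (length ls) (\<lambda>(i, j). w (ls ! i) (as ! j))))"
proof -
  let ?n = "length ls"
  let ?U = "wedge_list (map (\<lambda>l. one_form (hol_form m (u l))) ls)"
  let ?W = "wedge_list (map (\<lambda>l. one_form (antihol_form m (w l))) ls)"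
  let ?E = "(\<lambda>i. 2 * i) ` I" and ?O = "(\<lambda>i. 2 * i + 1) ` I"
  have fin: "finite I"
    using assms finite_subset by blast
  have diff: "index_pairs I - ?E = ?O"
    by (auto simp: image_iff) presburger
  have "(?U \<and>\<^sub>w ?W) (index_pairs I) =
      (\<Sum>J\<in>{?E}. shuffle_sign J (index_pairs I - J) * ?U J * ?W (index_pairs I - J))"
    unfolding wedge_def
  proof (intro sum.mono_neutral_right ballI)
    fix J assume J: "J \<in> Pow (index_pairs I) - {?E}"
    have finJ: "finite J" "finite (index_pairs I - J)"
      using J fin by (auto intro: finite_subset)
    show "shuffle_sign J (index_pairs I - J) * ?U J * ?W (index_pairs I - J) = 0"
    proof (cases "\<exists>a\<in>J. odd a")
      case True
      then obtain a where "a \<in> J" "odd a"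
        by auto
      then have "?U J = 0"
        by (intro wedge_list_hol_eq_0[OF finJ(1), of a]) (auto simp: hol_form_def)
      then show ?thesis
        by simp
    next
      case False
      have "J \<subseteq> ?E"
      proof
        fix x assume "x \<in> J"
        then have "even x" "x \<in> index_pairs I"
          using False J by auto
        then show "x \<in> ?E"
          by auto
      qed
      then have "J \<subset> ?E"
        using J by auto
      then obtain a where "a \<in> ?E" "a \<notin> J"
        by auto
      then have "?W (index_pairs I - J) = 0"
        by (intro wedge_list_hol_eq_0[OF finJ(2), of a]) (auto simp: antihol_form_def)
      then show ?thesis
        by simp
    qed
  qed (use fin in auto)
  also have "\<dots> = reorder_sign (card I) * (?U ?E * ?W ?O)"
    by (simp add: diff shuffle_sign_even_odd[OF fin] mult.assoc del: One_nat_def)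
  also have "?U ?E * ?W ?O = (\<Sum>as\<in>enumerations ?n I. (\<Prod>i<?n. u (ls ! i) (as ! i)) * (list_sign as * ?W ?O))"
  proof -
    have inj: "inj_on (map (\<lambda>i. 2 * i)) (enumerations ?n I)"
      by (rule inj_on_subset[OF inj_mapI]) (auto simp: inj_on_def)
    have lt: "as ! i < m" if "as \<in> enumerations ?n I" "i < ?n" for as i
      using that assms nth_mem[of i as] by auto
    have "?U ?E = (\<Sum>as\<in>enumerations ?n I. list_sign as * (\<Prod>i<?n. u (ls ! i) (as ! i)))"
    proof -
      have "?U ?E = (\<Sum>as\<in>enumerations ?n I. list_sign as *
          (\<Prod>i<?n. hol_form m (u (ls ! i)) (map (\<lambda>i. 2 * i) as ! i)))"
        using fin by (simp add: wedge_list_one_forms enumerations_image inj_on_def sum.reindex[OF inj] list_sign_map_even)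
      also have "\<dots> = (\<Sum>as\<in>enumerations ?n I. list_sign as * (\<Prod>i<?n. u (ls ! i) (as ! i)))"
        using lt by (intro sum.cong refl arg_cong2[where f = "(*)"] prod.cong) (simp add: hol_form_def)
      finally show ?thesis .
    qed
    then show ?thesis
      by (simp add: sum_distrib_left sum_distrib_right mult_ac)
  qed
  also have "\<dots> = (\<Sum>as\<in>enumerations ?n I. (\<Prod>i<?n. u (ls ! i) (as ! i)) *
       Determinant.det (mat ?n ?n (\<lambda>(i, j). w (ls ! i) (as ! j))))"
  proof (intro sum.cong refl arg_cong2[where f = "(*)"])
    fix as assume as: "as \<in> enumerations ?n I"
    let ?as = "map (\<lambda>i. 2 * i + 1) as"
    have dist: "distinct ?as" and len: "length ?as = length ls" and set_as: "set ?as = ?O"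
      using as by (auto simp: distinct_map inj_on_def)
    have "list_sign as * ?W ?O =
        Determinant.det (mat ?n ?n (\<lambda>(i, j). antihol_form m (w (ls ! i)) (?as ! j)))"
      using det_one_forms[OF dist len, of "\<lambda>l. antihol_form m (w l)"]
      unfolding set_as list_sign_map_odd by simp
    also have "mat ?n ?n (\<lambda>(i, j). antihol_form m (w (ls ! i)) (?as ! j)) = mat ?n ?n (\<lambda>(i, j). w (ls ! i) (as ! j))"
    proof (rule eq_matI)
      fix i j assume "i < dim_row (mat ?n ?n (\<lambda>(i, j). w (ls ! i) (as ! j)))"
        "j < dim_col (mat ?n ?n (\<lambda>(i, j). w (ls ! i) (as ! j)))"
      then have ij: "i < ?n" "j < ?n"
        by auto
      then have "as ! j < m"
        using as assms nth_mem[of j as] by auto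
      with ij as show "mat ?n ?n (\<lambda>(i, j). antihol_form m (w (ls ! i)) (?as ! j)) $$ (i, j) =
          mat ?n ?n (\<lambda>(i, j). w (ls ! i) (as ! j)) $$ (i, j)"
        by (simp add: antihol_form_def)
    qed auto
    finally show "list_sign as * ?W ?O = Determinant.det (mat ?n ?n (\<lambda>(i, j). w (ls ! i) (as ! j)))" .
  qed
  finally show ?thesis .
qed

text \<open>
  Summing over the lists \<open>as\<close> first instead of over their underlying sets makes the Cauchy-Binet formula
  unnecessary.
\<close>

lemma pair_trace_wedge_list:
  fixes u w :: "'l \<Rightarrow> nat \<Rightarrow> 'a::comm_ring_1"
  shows "pair_trace m (length ls)
      (wedge_list (map (\<lambda>l. one_form (hol_form m (u l)) \<and>\<^sub>w one_form (antihol_form m (w l))) ls)) =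
    Determinant.det (mat (length ls) (length ls) (\<lambda>(i, j). \<Sum>a<m. u (ls ! i) a * w (ls ! j) a))"
proof -
  let ?n = "length ls"
  let ?D = "\<lambda>as. Determinant.det (mat ?n ?n (\<lambda>(i, j). w (ls ! i) (as ! j)))"
  let ?f = "\<lambda>as. (\<Prod>i<?n. u (ls ! i) (as ! i)) * ?D as"
  let ?Is = "{I \<in> Pow {..<m}. card I = ?n}"
  have perm: "p i < ?n" if "p permutes {0..<?n}" "i < ?n" for p i
    using permutes_in_image[OF that(1), of i] that(2) by simp
  have fin: "finite ?Is" "\<And>I. I \<in> ?Is \<Longrightarrow> finite I"
    using finite_subset by auto
  have "pair_trace m ?n (wedge_list (map (\<lambda>l. one_form (hol_form m (u l)) \<and>\<^sub>w one_form (antihol_form m (w l))) ls)) =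
      (\<Sum>I\<in>?Is. \<Sum>as\<in>enumerations ?n I. ?f as)"
    unfolding pair_trace_def wedge_list_separate
  proof (intro sum.cong refl)
    fix I assume "I \<in> ?Is"
    then have "I \<subseteq> {..<m}" and n: "?n = card I"
      by auto
    show "reorder_sign ?n * (wedge_list (map (\<lambda>l. one_form (hol_form m (u l))) ls) \<and>\<^sub>w
        wedge_list (map (\<lambda>l. one_form (antihol_form m (w l))) ls)) (index_pairs I) =
      (\<Sum>as\<in>enumerations ?n I. ?f as)"
      unfolding wedge_hol_antihol_index_pairs[OF \<open>I \<subseteq> {..<m}\<close>] mult.assoc[symmetric]
      unfolding n reorder_sign_square by (simp only: mult_1_left)
  qed
  also have "\<dots> = (\<Sum>(I, as)\<in>Sigma ?Is (enumerations ?n). ?f as)"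
    by (rule sum.Sigma) (use fin in \<open>blast intro: finite_enumerations\<close>)+
  also have "\<dots> = (\<Sum>as\<in>{as. length as = ?n \<and> distinct as \<and> set as \<subseteq> {..<m}}. ?f as)"
    by (rule sum.reindex_bij_witness[where j = snd and i = "\<lambda>as. (set as, as)"])
      (auto simp: distinct_card)
  \<comment> \<open>Lists with repetitions may be added, because equal columns make
    \<open>?D\<close> vanish.\<close>
  also have "\<dots> = (\<Sum>as\<in>lists_over ?n {..<m}. ?f as)"
  proof (rule sum.mono_neutral_left)
    show "\<forall>as\<in>lists_over ?n {..<m} - {as. length as = ?n \<and> distinct as \<and> set as \<subseteq> {..<m}}. ?f as = 0"
    proof
      fix as assume as: "as \<in> lists_over ?n {..<m} - {as. length as = ?n \<and> distinct as \<and> set as \<subseteq> {..<m}}"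
      then obtain i j where ij: "i < ?n" "j < ?n" "i \<noteq> j" "as ! i = as ! j"
        by (auto simp: distinct_conv_nth)
      then have "?D as = 0"
        by (intro det_identical_columns[of _ ?n i j]) auto
      then show "?f as = 0"
        by simp
    qed
  qed auto
  also have "\<dots> = (\<Sum>as\<in>lists_over ?n {..<m}. \<Sum>p\<in>{p. p permutes {0..<?n}}.
      signof p * (\<Prod>i<?n. u (ls ! i) (as ! i) * w (ls ! p i) (as ! i)))"
  proof (intro sum.cong refl)
    fix as
    have "?D as = Determinant.det (mat ?n ?n (\<lambda>(i, j). w (ls ! j) (as ! i)))"
      by (subst det_transpose[symmetric, of _ ?n]) (auto intro!: arg_cong[where f = Determinant.det] eq_matI)
    also have "\<dots> = (\<Sum>p\<in>{p. p permutes {0..<?n}}. signof p * (\<Prod>i<?n. w (ls ! p i) (as ! i)))"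
      by (subst det_def'[of _ ?n]) (auto simp: perm lessThan_atLeast0 intro!: sum.cong prod.cong)
    finally show "?f as = (\<Sum>p\<in>{p. p permutes {0..<?n}}. signof p *
        (\<Prod>i<?n. u (ls ! i) (as ! i) * w (ls ! p i) (as ! i)))"
      by (simp add: sum_distrib_left prod.distrib mult_ac)
  qed
  \<comment> \<open>For a fixed permutation the sum over all lists decouples into sums over single
    entries, which are the Gram entries.\<close>
  also have "\<dots> = (\<Sum>p\<in>{p. p permutes {0..<?n}}. signof p *
      (\<Prod>i<?n. \<Sum>a<m. u (ls ! i) a * w (ls ! p i) a))"
  proof -
    have "(\<Sum>as\<in>lists_over ?n {..<m}. \<Prod>i<?n. u (ls ! i) (as ! i) * w (ls ! p i) (as ! i)) =
        (\<Prod>i<?n. \<Sum>a<m. u (ls ! i) a * w (ls ! p i) a)" for p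
      using sum_prod_lists_over[where n = ?n and A = "{..<m}" and h = "\<lambda>i a. u (ls ! i) a * w (ls ! p i) a"] .
    then show ?thesis
      by (subst sum.swap) (simp only: sum_distrib_left[symmetric])
  qed
  also have "\<dots> = Determinant.det (mat ?n ?n (\<lambda>(i, j). \<Sum>a<m. u (ls ! i) a * w (ls ! j) a))"
    by (subst det_def'[of _ ?n]) (auto simp: perm lessThan_atLeast0 intro!: sum.cong prod.cong)
  finally show ?thesis .
qed

section \<open>Pairing with powers of the Kaehler form\<close>

lemma two_form_apply:
  "two_form m w K = (if card K = 2 \<and> K \<subseteq> {..<2 * m} then w (Min K) (Max K) else 0)"
proof (cases "card K = 2")
  case True
  then obtain a b where K: "K = {a, b}" "a < b"
    by (rule card_2_obtain)
  have cc: "(covec a' \<and>\<^sub>w covec b') K = (if a' = a \<and> b' = b then 1 else (0::'a))" if "a' < b'" for a' b'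
    using that K by (auto simp: covec_one_form wedge_one_forms_pair)
  have "two_form m w K = (\<Sum>b'<2 * m. \<Sum>a'<b'. if a' = a \<and> b' = b then w a b else 0)"
    unfolding two_form_def by (intro sum.cong refl) (auto simp: cc)
  also have "\<dots> = (\<Sum>b'<2 * m. if b' = b then w a b else 0)"
  proof (intro sum.cong refl)
    fix b'
    have "(\<Sum>a'<b'. if a' = a \<and> b' = b then w a b else 0) = (\<Sum>a'<b'. if a' = a then if b' = b then w a b else 0 else 0)"
      by (intro sum.cong) auto
    then show "(\<Sum>a'<b'. if a' = a \<and> b' = b then w a b else 0) = (if b' = b then w a b else 0)"
      using K by simp
  qed
  also have "\<dots> = (if K \<subseteq> {..<2 * m} then w (Min K) (Max K) else 0)"
    using K by auto
  finally show ?thesis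
    using True by simp
qed (auto simp: two_form_def covec_one_form wedge_one_forms_card)

text \<open>In a conjugate pair taken in increasing order the second vector has type (0,1), where
  \<open>J\<close> acts as \<open>- \<i>\<close>.\<close>

lemma kaehler_2form_apply:
  "kaehler_2form m K = (if \<exists>i<m. K = index_pairs {i} then - \<i> else 0)"
proof (cases "card K = 2")
  case True
  then obtain a b where K: "K = {a, b}" "a < b"
    by (rule card_2_obtain)
  show ?thesis
  proof (cases "\<exists>i<m. K = index_pairs {i}")
    case True
    then show ?thesis
      by (auto simp: kaehler_2form_def two_form_apply unitary_metric_def J_eigen_def)
  next
    case False
    have "\<not> (a div 2 = b div 2 \<and> b < 2 * m)"
    proof
      assume ab: "a div 2 = b div 2 \<and> b < 2 * m"
      obtain q where q: "q = a div 2"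
        by simp
      have "a = 2 * q + a mod 2"
        unfolding q by simp
      moreover have "b = 2 * q + b mod 2"
        unfolding q conjunct1[OF ab] by simp
      moreover have "a mod 2 < 2" "b mod 2 < 2"
        by simp_all
      ultimately have "a = 2 * q" "b = 2 * q + 1" "q < m"
        using K(2) ab by linarith+
      with K(1) False show False
        by auto
    qed
    then show ?thesis
      using False K by (auto simp: kaehler_2form_def two_form_apply unitary_metric_def)
  qed
next
  case False
  then have "K \<noteq> index_pairs {i}" for i
    by auto
  with False show ?thesis
    by (auto simp: kaehler_2form_def two_form_apply)
qed

lemma index_pairs_inject: "index_pairs I = index_pairs J \<longleftrightarrow> I = J"
proof
  assume eq: "index_pairs I = index_pairs J"
  have "i \<in> I \<longleftrightarrow> 2 * i \<in> index_pairs I" for I i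
    by (auto simp: double_not_eq_Suc_double)
  with eq show "I = J"
    by blast
qed simp

lemma card_index_pairs:
  assumes "finite I"
  shows "card (index_pairs I) = 2 * card I"
proof -
  have "card (index_pairs I) = card ((\<lambda>i. 2 * i) ` I) + card ((\<lambda>i. 2 * i + 1) ` I)"
    using assms by (intro card_Un_disjoint) (auto, presburger)
  then show ?thesis
    by (simp add: card_image inj_on_def)
qed

text \<open>As \<open>2 * i\<close> is not in \<open>index_pairs I\<close>, the same elements lie
  below \<open>2 * i\<close> as below \<open>2 * i + 1\<close>, and the inversions come in
  twos.\<close>

lemma shuffle_sign_index_pairs:
  assumes "finite I" "i \<notin> I"
  shows "shuffle_sign (index_pairs {i}) (index_pairs I) = (1::'a::comm_ring_1)"
proof -
  let ?L = "{y \<in> index_pairs I. y < 2 * i}"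
  have "y \<noteq> 2 * i" if "y \<in> index_pairs I" for y
    using that assms(2) by (auto simp: Suc_double_not_eq_double double_not_eq_Suc_double)
  then have *: "y < 2 * i + 1 \<longleftrightarrow> y < 2 * i" if "y \<in> index_pairs I" for y
    using that by (metis less_Suc_eq Suc_eq_plus1)
  have "{(x, y). x \<in> index_pairs {i} \<and> y \<in> index_pairs I \<and> y < x} = Pair (2 * i) ` ?L \<union> Pair (2 * i + 1) ` ?L"
    using * by auto
  moreover have "card (Pair (2 * i) ` ?L \<union> Pair (2 * i + 1) ` ?L) = 2 * card ?L"
    using assms by (subst card_Un_disjoint) (auto simp: card_image inj_on_def)
  ultimately show ?thesis
    unfolding shuffle_sign_def by simp
qed

text \<open>Conjugate pairs can be split off without a sign, and in the induction step each of the
  \<open>n + 1\<close> elements of \<open>I\<close> can be the one split off; this produces the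
  factorial.\<close>

lemma kaehler_power_apply:
  "wedge_power (kaehler_2form m) n K =
    (if \<exists>I\<subseteq>{..<m}. card I = n \<and> K = index_pairs I then fact n * (- \<i>) ^ n else 0)"
proof (induction n arbitrary: K)
  case 0
  have "(\<exists>I\<subseteq>{..<m}. card I = 0 \<and> K = index_pairs I) \<longleftrightarrow> K = {}"
    using finite_subset[of _ "{..<m}"] by (auto intro!: exI[of _ "{}"])
  then show ?case
    by (simp add: wedge_power_def unit_form_def)
next
  case (Suc n)
  let ?\<Omega> = "kaehler_2form m" and ?P = "wedge_power (kaehler_2form m) n"
  let ?t = "\<lambda>J. shuffle_sign J (K - J) * ?\<Omega> J * ?P (K - J)"
  have step: "wedge_power ?\<Omega> (Suc n) K = (\<Sum>J\<in>Pow K. ?t J)"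
    by (simp add: wedge_power_def wedge_def)
  have nz: "\<exists>i I. i < m \<and> I \<subseteq> {..<m} \<and> i \<notin> I \<and> card I = n \<and> J = index_pairs {i} \<and> K = index_pairs (insert i I)"
    if "J \<subseteq> K" "?t J \<noteq> 0" for J
  proof -
    from that obtain i I where i: "i < m" "J = index_pairs {i}" and I: "I \<subseteq> {..<m}" "card I = n" "K - J = index_pairs I"
      by (auto simp: kaehler_2form_apply Suc.IH split: if_splits)
    have "K = index_pairs (insert i I)"
      using i I that by auto
    moreover have "2 * i \<notin> index_pairs I"
      using i(2) I(3) by auto
    then have "i \<notin> I"
      by auto
    ultimately show ?thesis
      using i I by blast
  qed
  show ?case
  proof (cases "\<exists>I\<subseteq>{..<m}. card I = Suc n \<and> K = index_pairs I")
    case True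
    then obtain I where I: "I \<subseteq> {..<m}" "card I = Suc n" "K = index_pairs I"
      by auto
    then have fin: "finite I"
      using finite_subset by blast
    have "(\<Sum>J\<in>Pow K. ?t J) = (\<Sum>J\<in>(\<lambda>i. index_pairs {i}) ` I. ?t J)"
    proof (rule sum.mono_neutral_right)
      show "\<forall>J\<in>Pow K - (\<lambda>i. index_pairs {i}) ` I. ?t J = 0"
      proof (rule ballI, rule ccontr)
        fix J assume J: "J \<in> Pow K - (\<lambda>i. index_pairs {i}) ` I" "?t J \<noteq> 0"
        then obtain i I' where J_eq: "J = index_pairs {i}" and "K = index_pairs (insert i I')"
          using nz[of J] by blast
        then have "index_pairs (insert i I') = index_pairs I"
          using I(3) by (rule_tac trans[OF sym])
        then have "i \<in> I"
          unfolding index_pairs_inject by (rule subst) simp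
        then have "J \<in> (\<lambda>i. index_pairs {i}) ` I"
          unfolding J_eq by (rule imageI)
        with J(1) show False
          by simp
      qed
    qed (use fin I in auto)
    also have "\<dots> = (\<Sum>i\<in>I. ?t (index_pairs {i}))"
      by (subst sum.reindex) (auto simp: inj_on_def doubleton_eq_iff)
    also have "\<dots> = (\<Sum>i\<in>I. fact n * (- \<i>) ^ Suc n)"
    proof (intro sum.cong refl)
      fix i assume i: "i \<in> I"
      have diff: "K - index_pairs {i} = index_pairs (I - {i})"
        using I(3) by (auto simp: double_not_eq_Suc_double Suc_double_not_eq_double)
      have "?\<Omega> (index_pairs {i}) = - \<i>"
        using i I(1) unfolding kaehler_2form_apply by auto
      moreover have "?P (index_pairs (I - {i})) = fact n * (- \<i>) ^ n"
        unfolding Suc.IH using i I fin by (auto intro!: exI[of _ "I - {i}"])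
      moreover have "shuffle_sign (index_pairs {i}) (index_pairs (I - {i})) = (1::complex)"
        using fin by (intro shuffle_sign_index_pairs) auto
      ultimately show "?t (index_pairs {i}) = fact n * (- \<i>) ^ Suc n"
        unfolding diff by (simp only: power_Suc) (simp only: mult_1_left mult_ac)
    qed
    finally show ?thesis
      using True I(2) unfolding step by (simp add: algebra_simps)
  next
    case False
    have "?t J = 0" if "J \<in> Pow K" for J
    proof (rule ccontr)
      assume "?t J \<noteq> 0"
      with nz[of J] that obtain i I where "i < m" "I \<subseteq> {..<m}" "i \<notin> I" "card I = n" "K = index_pairs (insert i I)"
        by auto
      then have "insert i I \<subseteq> {..<m}" "card (insert i I) = Suc n"
        using finite_subset[of I "{..<m}"] by auto
      with False \<open>K = index_pairs (insert i I)\<close> show False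
        by blast
    qed
    then have "(\<Sum>J\<in>Pow K. ?t J) = 0"
      by (intro sum.neutral) auto
    with False show ?thesis
      unfolding step by (simp only: if_False)
  qed
qed

lemma sorted_list_of_index_pairs:
  assumes "finite I" "j < 2 * card I"
  shows "sorted_list_of_set (index_pairs I) ! j = 2 * sorted_list_of_set I ! (j div 2) + j mod 2"
proof -
  let ?s = "sorted_list_of_set I"
  have nth: "concat (map (\<lambda>i. [2 * i, 2 * i + 1]) xs) ! j = 2 * xs ! (j div 2) + j mod 2"
    if "j < 2 * length xs" for xs :: "nat list" and j
    using that
  proof (induction xs arbitrary: j)
    case (Cons x xs)
    show ?case
    proof (cases "j < 2")
      case True
      then show ?thesis
        by (cases j) (auto simp: less_Suc_eq)
    next
      case False
      then obtain j' where "j = Suc (Suc j')"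
        by (metis less_2_cases_iff not0_implies_Suc One_nat_def)
      with Cons show ?thesis
        by simp
    qed
  qed simp
  have sorted: "sorted (concat (map (\<lambda>i. [2 * i, 2 * i + 1]) xs))" if "sorted xs" "distinct xs" for xs :: "nat list"
    using that
  proof (induction xs)
    case (Cons a xs)
    have "a < y" if "y \<in> set xs" for y
      using Cons.prems that by (auto simp: le_less)
    with Cons show ?case
      by (auto simp: Suc_le_eq dest!: less_imp_le)
  qed simp
  have dist: "distinct (concat (map (\<lambda>i. [2 * i, 2 * i + 1]) xs))" if "distinct xs" for xs :: "nat list"
    using that by (induction xs) (auto simp: double_not_eq_Suc_double Suc_double_not_eq_double)
  have "sorted_list_of_set (index_pairs I) = concat (map (\<lambda>i. [2 * i, 2 * i + 1]) ?s)"
  proof (rule sorted_distinct_set_unique)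
    show "set (sorted_list_of_set (index_pairs I)) = set (concat (map (\<lambda>i. [2 * i, 2 * i + 1]) ?s))"
      using assms(1) by auto
  qed (use sorted dist in auto)
  then show ?thesis
    using nth[of j ?s] assms by simp
qed

definition metric_det :: "nat \<Rightarrow> complex" where
  "metric_det n = Determinant.det (mat (2 * n) (2 * n) (\<lambda>(i, j). unitary_metric i j))"

text \<open>The matrix exchanges every index with its conjugate, so it is its own inverse.\<close>

lemma metric_det_nonzero: "metric_det n \<noteq> 0"
proof -
  let ?M = "mat (2 * n) (2 * n) (\<lambda>(i, j). unitary_metric i j)"
  let ?c = "\<lambda>i. if even i then i + 1 else i - 1 :: nat"
  have um: "unitary_metric i j = (if j = ?c i then 1 else 0)" for i j
  proof -
    have "i div 2 = j div 2 \<and> i \<noteq> j \<longleftrightarrow> j = ?c i"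
    proof (cases "even i")
      case True
      then obtain q where "i = 2 * q"
        by (elim evenE)
      then show ?thesis
        using True by (simp, presburger)
    next
      case False
      then obtain q where "i = 2 * q + 1"
        by (elim oddE)
      then show ?thesis
        using False by (simp, presburger)
    qed
    then show ?thesis
      unfolding unitary_metric_def by simp
  qed
  have "?M * ?M = 1\<^sub>m (2 * n)"
  proof (rule eq_matI)
    fix i j assume "i < dim_row (1\<^sub>m (2 * n))" "j < dim_col (1\<^sub>m (2 * n))"
    then have ij: "i < 2 * n" "j < 2 * n"
      by auto
    have ci: "?c i < 2 * n" "?c (?c i) = i"
      using ij by (auto elim!: evenE oddE)
    have "(?M * ?M) $$ (i, j) = (\<Sum>l<2 * n. unitary_metric i l * unitary_metric l j)"
      using ij by (simp add: scalar_prod_def lessThan_atLeast0)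
    also have "\<dots> = (\<Sum>l<2 * n. if l = ?c i then unitary_metric (?c i) j else 0)"
      by (intro sum.cong refl) (simp add: um)
    also have "\<dots> = unitary_metric (?c i) j"
      using ci by simp
    also have "\<dots> = (1\<^sub>m (2 * n)) $$ (i, j)"
      unfolding um ci(2) using ij by auto
    finally show "(?M * ?M) $$ (i, j) = (1\<^sub>m (2 * n)) $$ (i, j)" .
  qed auto
  then have "metric_det n * metric_det n = 1"
    unfolding metric_det_def by (subst det_mult[of _ "2 * n", symmetric]) auto
  then show ?thesis
    by auto
qed

text \<open>The metric pairs an index only with its conjugate. If \<open>I\<close> has an index
  outside the conjugation-stable set \<open>index_pairs J\<close>, its row of pairings is zero, so
  only diagonal terms remain. There all determinants equal \<open>metric_det n\<close>, because
  sorting keeps conjugate indices adjacent.\<close>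

lemma form_pairing_kaehler_power:
  "form_pairing (\<lambda>c. c) m \<omega> (wedge_power (kaehler_2form m) n) =
    fact n * (- \<i>) ^ n * metric_det n * pair_trace m n \<omega>"
proof -
  let ?D = "\<lambda>I J. Determinant.det (mat (card I) (card I)
          (\<lambda>(i, j). unitary_metric (sorted_list_of_set I ! i) (sorted_list_of_set J ! j)))"
  let ?P = "wedge_power (kaehler_2form m) n" and ?c = "fact n * (- \<i>) ^ n :: complex"
  let ?Is = "{I \<in> Pow {..<m}. card I = n}"
  have D_eq: "?D (index_pairs I) (index_pairs I) = metric_det n" if "I \<in> ?Is" for I
  proof -
    have fin: "finite I" "card I = n"
      using that finite_subset by auto
    have "mat (2 * n) (2 * n) (\<lambda>(i, j). unitary_metric (sorted_list_of_set (index_pairs I) ! i) (sorted_list_of_set (index_pairs I) ! j)) =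
        mat (2 * n) (2 * n) (\<lambda>(i, j). unitary_metric i j)"
    proof (rule eq_matI)
      fix i j assume "i < dim_row (mat (2 * n) (2 * n) (\<lambda>(i, j). unitary_metric i j))"
        "j < dim_col (mat (2 * n) (2 * n) (\<lambda>(i, j). unitary_metric i j))"
      then have ij: "i < 2 * n" "j < 2 * n"
        by auto
      let ?s = "sorted_list_of_set I"
      have "?s ! (i div 2) = ?s ! (j div 2) \<longleftrightarrow> i div 2 = j div 2"
        using ij fin by (intro nth_eq_iff_index_eq) auto
      then have "unitary_metric (2 * ?s ! (i div 2) + i mod 2) (2 * ?s ! (j div 2) + j mod 2) = unitary_metric i j"
      proof (cases "i div 2 = j div 2")
        case True
        then have "i \<noteq> j \<longleftrightarrow> i mod 2 \<noteq> j mod 2"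
          by (metis div_mult_mod_eq)
        with True show ?thesis
          by (simp add: unitary_metric_def)
      qed (simp add: unitary_metric_def)
      then show "mat (2 * n) (2 * n) (\<lambda>(i, j). unitary_metric (sorted_list_of_set (index_pairs I) ! i)
          (sorted_list_of_set (index_pairs I) ! j)) $$ (i, j) =
          mat (2 * n) (2 * n) (\<lambda>(i, j). unitary_metric i j) $$ (i, j)"
        using ij fin by (simp add: sorted_list_of_index_pairs[OF fin(1), unfolded fin(2)] del: One_nat_def)
    qed auto
    then show ?thesis
      unfolding metric_det_def card_index_pairs[OF fin(1)] fin(2) by simp
  qed
  have D_0: "?D I (index_pairs J) = 0"
    if I: "I \<subseteq> {..<2 * m}" and J: "J \<in> ?Is" and card: "card (index_pairs J) = card I" and ne: "I \<noteq> index_pairs J" for I J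
  proof -
    let ?J = "index_pairs J"
    have finI: "finite I" and finJ: "finite ?J"
      using I J finite_subset by auto
    have "\<not> I \<subseteq> ?J"
      using card_subset_eq[OF finJ] card ne by metis
    then obtain x where x: "x \<in> I" "x \<notin> ?J"
      by auto
    then obtain i where i: "i < card I" "sorted_list_of_set I ! i = x"
      using finI by (metis in_set_conv_nth set_sorted_list_of_set sorted_list_of_set.length_sorted_key_list_of_set)
    have conj: "unitary_metric x y = 0" if "y \<in> ?J" for y
    proof (rule ccontr)
      assume "unitary_metric x y \<noteq> 0"
      then have "x div 2 = y div 2"
        by (simp add: unitary_metric_def split: if_splits)
      moreover have "y div 2 \<in> J"
        using that by auto
      moreover have "x = 2 * (x div 2) \<or> x = 2 * (x div 2) + 1"
        by presburger
      ultimately show False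
        using x(2) by (metis UnCI imageI)
    qed
    let ?A = "mat (card I) (card I) (\<lambda>(i, j). unitary_metric (sorted_list_of_set I ! i) (sorted_list_of_set ?J ! j))"
    have "?A $$ (i, j) = 0" if "j < card I" for j
    proof -
      have "sorted_list_of_set ?J ! j \<in> ?J"
        using that card finJ by (metis nth_mem set_sorted_list_of_set sorted_list_of_set.length_sorted_key_list_of_set)
      with conj i that show ?thesis
        by simp
    qed
    then show ?thesis
      using laplace_expansion_row[of ?A "card I" i] i by simp
  qed
  have "form_pairing (\<lambda>c. c) m \<omega> ?P =
      (\<Sum>I\<in>Pow {..<2 * m}. if I \<in> index_pairs ` ?Is then \<omega> I * (?c * metric_det n) else 0)"
    unfolding form_pairing_def
  proof (intro sum.cong refl)
    fix I assume I: "I \<in> Pow {..<2 * m}"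
    let ?Js = "{J \<in> Pow {..<2 * m}. card J = card I}"
    have fin: "finite ?Js"
      by auto
    have zero: "\<omega> I * (?P J * ?D I J) = 0" if "J \<in> ?Js" "J \<noteq> I \<or> I \<notin> index_pairs ` ?Is" for J
    proof (cases "?P J = 0")
      case False
      then obtain J' where "J' \<in> ?Is" "J = index_pairs J'"
        by (auto simp: kaehler_power_apply split: if_splits)
      with that I show ?thesis
        using D_0[of I J'] by auto
    qed simp
    show "(\<Sum>J\<in>?Js. \<omega> I * (?P J * ?D I J)) = (if I \<in> index_pairs ` ?Is then \<omega> I * (?c * metric_det n) else 0)"
    proof (cases "I \<in> index_pairs ` ?Is")
      case True
      then obtain I' where I': "I' \<in> ?Is" "I = index_pairs I'"
        by auto
      have "(\<Sum>J\<in>?Js. \<omega> I * (?P J * ?D I J)) = (\<Sum>J\<in>{I}. \<omega> I * (?P J * ?D I J))"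
        using I fin zero by (intro sum.mono_neutral_right) auto
      also have "\<dots> = \<omega> I * (?c * metric_det n)"
        using I' D_eq[OF I'(1)] by (auto simp: kaehler_power_apply)
      finally show ?thesis
        using True by simp
    next
      case False
      then show ?thesis
        using zero by (simp add: sum.neutral)
    qed
  qed
  also have "\<dots> = (\<Sum>I\<in>index_pairs ` ?Is. \<omega> I * (?c * metric_det n))"
  proof -
    have "index_pairs ` ?Is \<subseteq> Pow {..<2 * m}"
      by auto
    then have "Pow {..<2 * m} \<inter> {I. I \<in> index_pairs ` ?Is} = index_pairs ` ?Is"
      by auto
    then show ?thesis
      by (subst sum.If_cases) (simp_all del: image_eqI)
  qed
  also have "\<dots> = (\<Sum>I\<in>?Is. \<omega> (index_pairs I) * (?c * metric_det n))"
    by (subst sum.reindex) (simp_all only: inj_on_def index_pairs_inject o_def, blast)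
  finally show ?thesis
    unfolding pair_trace_def sum_distrib_left by (simp add: mult_ac)
qed

section \<open>The map \<open>\<Xi>\<close> on values of jets\<close>

context comm_ring_hom
begin

lemma hom_shuffle_sign: "hom (shuffle_sign I J) = shuffle_sign I J"
  by (simp add: shuffle_sign_def hom_power hom_uminus)

lemma hom_wedge: "hom ((\<omega> \<and>\<^sub>w \<eta>) K) = ((\<lambda>K. hom (\<omega> K)) \<and>\<^sub>w (\<lambda>K. hom (\<eta> K))) K"
  by (simp add: wedge_def hom_sum hom_mult hom_shuffle_sign)

lemma hom_covec: "hom (covec a K) = covec a K"
  by (simp add: covec_def)

lemma hom_two_form: "hom (two_form m w K) = two_form m (\<lambda>a b. hom (w a b)) K"
  by (simp add: two_form_apply)

lemma hom_wedge_list: "hom (wedge_list \<omega>s K) = wedge_list (map (\<lambda>\<omega> K. hom (\<omega> K)) \<omega>s) K"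
proof (induction \<omega>s arbitrary: K)
  case (Cons \<omega> \<omega>s)
  then have "(\<lambda>K. hom (wedge_list \<omega>s K)) = wedge_list (map (\<lambda>\<omega> K. hom (\<omega> K)) \<omega>s)"
    by auto
  then show ?case
    by (simp add: hom_wedge)
qed (simp add: unit_form_def)

lemma hom_mat_poly_form:
  "hom (mat_poly_form emb m S X K) = mat_poly_form (\<lambda>c. hom (emb c)) m S (\<lambda>i j K. hom (X i j K)) K"
  by (simp add: mat_poly_form_var_list hom_sum hom_mult hom_wedge_list o_def case_prod_unfold)

lemma hom_form_pairing:
  "hom (form_pairing emb m \<omega> \<eta>) = form_pairing (\<lambda>c. hom (emb c)) m (\<lambda>K. hom (\<omega> K)) \<eta>"
  by (simp add: form_pairing_def hom_sum hom_mult)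

lemma hom_Xi_of_curvature:
  "hom (Xi_of_curvature emb m k X S \<alpha> \<beta>) =
    Xi_of_curvature (\<lambda>c. hom (emb c)) m k (\<lambda>i j K. hom (X i j K)) S \<alpha> \<beta>"
  by (simp add: Xi_of_curvature_def hom_mult hom_form_pairing hom_wedge hom_covec hom_mat_poly_form[abs_def])

end

definition curvature_values :: "nat \<Rightarrow> (jet_var \<Rightarrow> complex) \<Rightarrow> nat \<Rightarrow> nat \<Rightarrow> complex form" where
  "curvature_values m x \<delta> \<gamma> = two_form m (\<lambda>a b.
     if even a \<and> odd b then - x ({#a div 2, \<gamma>#}, {#b div 2, \<delta>#})
     else if odd a \<and> even b then x ({#b div 2, \<gamma>#}, {#a div 2, \<delta>#})
     else 0)"

text \<open>Evaluation at a jet is a ring homomorphism and hence commutes with all ingredients of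
  \<open>Xi\<close>; from here on \<open>Xi\<close> is computed with complex numbers.\<close>

lemma ev_Xi: "ev x (Xi m k S \<alpha> \<beta>) = Xi_of_curvature (\<lambda>c. c) m k (curvature_values m x) S \<alpha> \<beta>"
proof -
  have "(\<lambda>K. ev x (jet_curvature m \<delta> \<gamma> K)) = curvature_values m x \<delta> \<gamma>" for \<delta> \<gamma>
    unfolding jet_curvature_def curvature_values_def ev_hom.hom_two_form
    by (intro ext arg_cong2[where f = "two_form m"] arg_cong[where f = "\<lambda>w. two_form m w _"])
      (simp add: ev_hom.hom_uminus)
  then show ?thesis
    unfolding Xi_def ev_hom.hom_Xi_of_curvature by simp
qed

lemma set_var_list: "set (var_list m \<mu>) \<subseteq> {..<m} \<times> {..<m}"
  by (auto simp: var_list_def)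

lemma mat_poly_form_cong:
  assumes "\<And>i j. i < m \<Longrightarrow> j < m \<Longrightarrow> X i j = X' i j"
  shows "mat_poly_form emb m S X = mat_poly_form emb m S X'"
proof -
  have "map (\<lambda>(i, j). X i j) (var_list m \<mu>) = map (\<lambda>(i, j). X' i j) (var_list m \<mu>)" for \<mu>
    using set_var_list[of m \<mu>] assms by (intro map_cong refl) auto
  then show ?thesis
    by (simp only: mat_poly_form_var_list)
qed

lemma Xi_of_curvature_cong:
  assumes "\<And>i j. i < m \<Longrightarrow> j < m \<Longrightarrow> X i j = X' i j"
  shows "Xi_of_curvature emb m k X S = Xi_of_curvature emb m k X' S"
proof -
  have eq: "mat_poly_form emb m S X = mat_poly_form emb m S X'"
    by (rule mat_poly_form_cong) (fact assms)
  show ?thesis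
    unfolding Xi_of_curvature_def eq ..
qed

text \<open>The factor \<open>fact (k + 1)\<close> from the power of the Kaehler form has already
  been cancelled against the normalization of \<open>Xi\<close>.\<close>

definition Xi_constant :: "nat \<Rightarrow> complex" where
  "Xi_constant k = (- \<i>) ^ (k + 1) * metric_det (k + 1)"

lemma Xi_constant_nonzero: "Xi_constant k \<noteq> 0"
  by (simp add: Xi_constant_def metric_det_nonzero)

lemma Xi_of_curvature_trace:
  "Xi_of_curvature (\<lambda>c. c) m k X S \<alpha> \<beta> = (if \<alpha> < m \<and> \<beta> < m then Xi_constant k *
    pair_trace m (k + 1) (mat_poly_form (\<lambda>c. c) m S X \<and>\<^sub>w covec (2 * \<alpha>) \<and>\<^sub>w covec (2 * \<beta> + 1)) else 0)"
  unfolding Xi_of_curvature_def form_pairing_kaehler_power Xi_constant_def by (simp del: fact_Suc)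

lemma pair_trace_sum: "pair_trace m n (\<lambda>K. \<Sum>i\<in>A. f i K) = (\<Sum>i\<in>A. pair_trace m n (f i))"
  unfolding pair_trace_def by (rule sum.swap)

lemma pair_trace_scale: "pair_trace m n (\<lambda>K. c * f K) = c * pair_trace m n f"
  by (simp add: pair_trace_def sum_distrib_left)

text \<open>Index \<open>k\<close> is reserved for the tensor slot: \<open>jet_sum k\<close> sees
  only vectors with smaller index.\<close>

definition contraction :: "nat \<Rightarrow> nat \<Rightarrow> jet_tensor \<Rightarrow> (nat \<Rightarrow> complex) \<Rightarrow> (nat \<Rightarrow> nat \<Rightarrow> complex)
    \<Rightarrow> (nat \<Rightarrow> nat \<Rightarrow> complex) \<Rightarrow> complex" where
  "contraction m k Q t u w = (\<Sum>\<alpha><m. \<Sum>\<beta><m. u k \<alpha> * w k \<beta> * ev (jet_sum k t u w) (Q \<alpha> \<beta>))"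

definition gram :: "nat \<Rightarrow> (nat \<Rightarrow> nat \<Rightarrow> complex) \<Rightarrow> (nat \<Rightarrow> nat \<Rightarrow> complex) \<Rightarrow> nat \<Rightarrow> nat \<Rightarrow> complex" where
  "gram m u w = (\<lambda>i j. \<Sum>a<m. u i a * w j a)"

abbreviation det_fun :: "nat \<Rightarrow> (nat \<Rightarrow> nat \<Rightarrow> complex) \<Rightarrow> complex" where
  "det_fun n G \<equiv> Determinant.det (mat n n (\<lambda>(i, j). G i j))"

text \<open>The full polarization of \<open>S\<close> at the rank one matrices with entries
  \<open>w j \<delta> * u j \<gamma>\<close>. For \<open>S\<close> homogeneous of degree
  \<open>k\<close> it is \<open>fact k\<close> times the associated symmetric multilinear
  form.\<close>

definition polarized :: "nat \<Rightarrow> nat \<Rightarrow> (nat \<times> nat) poly_over \<Rightarrow> (nat \<Rightarrow> nat \<Rightarrow> complex)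
    \<Rightarrow> (nat \<Rightarrow> nat \<Rightarrow> complex) \<Rightarrow> complex" where
  "polarized m k S u w = (\<Sum>I\<in>Pow {..<k}. (-1) ^ (k - card I) *
     mat_poly S (mat m m (\<lambda>(\<delta>, \<gamma>). \<Sum>j\<in>I. w j \<delta> * u j \<gamma>)))"

text \<open>On a decomposable jet the value of a curvature variable is a product over its four
  indices, so each summand is a rank one matrix times a decomposable 2-form. The minus sign is the
  one in \<open>jet_curvature\<close>.\<close>

lemma curvature_values_jet_sum:
  "curvature_values m (jet_sum k t u w) \<delta> \<gamma> = (\<lambda>K. \<Sum>j<k. (- t j * w j \<delta> * u j \<gamma>) *
     (one_form (hol_form m (u j)) \<and>\<^sub>w one_form (antihol_form m (w j))) K)"
proof
  fix K :: "nat set"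
  show "curvature_values m (jet_sum k t u w) \<delta> \<gamma> K = (\<Sum>j<k. (- t j * w j \<delta> * u j \<gamma>) *
     (one_form (hol_form m (u j)) \<and>\<^sub>w one_form (antihol_form m (w j))) K)"
  proof (cases "card K = 2")
    case True
    then obtain a b where K: "K = {a, b}" "a < b"
      by (rule card_2_obtain)
    show ?thesis
    proof (cases "b < 2 * m")
      case True
      then show ?thesis
        using K by (cases "even a"; cases "even b")
          (auto simp: curvature_values_def two_form_apply wedge_one_forms_pair hol_form_def antihol_form_def
             jet_sum_def sum_negf[symmetric] intro!: sum.cong)
    next
      case False
      then show ?thesis
        using K by (auto simp: curvature_values_def two_form_apply wedge_one_forms_pair hol_form_def antihol_form_def)
    qed
  qed (auto simp: curvature_values_def two_form_apply wedge_one_forms_card)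
qed

text \<open>Rows and columns are permuted simultaneously, so the two signs cancel; a repetition
  produces equal rows.\<close>

lemma det_fun_reindex:
  assumes "length ls = n" "set ls \<subseteq> {..<n}"
  shows "det_fun n (\<lambda>i j. G (ls ! i) (ls ! j)) = (if distinct ls then det_fun n G else 0)"
proof (cases "distinct ls")
  case False
  then obtain i j where "i < n" "j < n" "i \<noteq> j" "ls ! i = ls ! j"
    using assms by (auto simp: distinct_conv_nth)
  then have "det_fun n (\<lambda>i j. G (ls ! i) (ls ! j)) = 0"
    by (intro det_identical_rows[of _ n i j]) auto
  with False show ?thesis
    by simp
next
  case True
  define p where "p = (\<lambda>i. if i < n then ls ! i else i)"
  have lt: "ls ! i < n" if "i < n" for i
    using assms that nth_mem[of i ls] by blast
  have inj: "inj_on p {0..<n}"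
    using True assms by (auto simp: inj_on_def p_def nth_eq_iff_index_eq)
  have "p ` {0..<n} \<subseteq> {0..<n}"
    using lt by (auto simp: p_def)
  with inj have "bij_betw p {0..<n} {0..<n}"
    by (simp add: bij_betw_def endo_inj_surj)
  then have p: "p permutes {0..<n}"
    by (rule bij_imp_permutes) (simp add: p_def)
  have p_lt: "p i < n" if "i < n" for i
    using that lt by (simp add: p_def)
  let ?A = "mat n n (\<lambda>(i, j). G i j)"
  let ?B = "mat n n (\<lambda>(i, j). ?A $$ (p i, j))"
  have "det_fun n (\<lambda>i j. G (ls ! i) (ls ! j)) = Determinant.det (mat n n (\<lambda>(i, j). ?B\<^sup>T $$ (p i, j)))\<^sup>T"
    using p_lt by (intro arg_cong[where f = Determinant.det] eq_matI) (auto simp: p_def)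
  also have "\<dots> = signof p * (signof p * Determinant.det ?A)"
    by (subst det_transpose[of _ n]) (simp_all add: det_permute_rows[OF _ p] det_transpose[of _ n])
  finally show ?thesis
    using True by (simp add: sign_def)
qed

lemma mat_poly_polarized:
  assumes "\<And>\<mu>. \<mu> \<in> Poly_Mapping.keys S \<Longrightarrow> Poly_Mapping.keys \<mu> \<subseteq> {..<m} \<times> {..<m} \<and> size (mono_mset \<mu>) = k"
  shows "polarized m k S u w = (\<Sum>\<mu>\<in>Poly_Mapping.keys S. Poly_Mapping.lookup S \<mu> *
    (\<Sum>js\<in>perm_lists k. \<Prod>i<k. w (js ! i) (fst (var_list m \<mu> ! i)) * u (js ! i) (snd (var_list m \<mu> ! i))))"
proof -
  let ?B = "\<lambda>I. mat m m (\<lambda>(\<delta>, \<gamma>). \<Sum>j\<in>I. w j \<delta> * u j \<gamma>)"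
  have eval: "mat_poly S (?B I) = (\<Sum>\<mu>\<in>Poly_Mapping.keys S. Poly_Mapping.lookup S \<mu> *
      (\<Prod>i<k. \<Sum>j\<in>I. w j (fst (var_list m \<mu> ! i)) * u j (snd (var_list m \<mu> ! i))))" for I
    unfolding mat_poly_def peval_mset
  proof (intro sum.cong refl arg_cong2[where f = "(*)"])
    fix \<mu> assume "\<mu> \<in> Poly_Mapping.keys S"
    then have mset: "mset (var_list m \<mu>) = mono_mset \<mu>" and "size (mono_mset \<mu>) = k"
      using assms by (auto intro: mset_var_list)
    then have len: "length (var_list m \<mu>) = k"
      by (metis size_mset)
    have "\<Prod>\<^sub># (image_mset (\<lambda>(i, j). ?B I $$ (i, j)) (mono_mset \<mu>)) =
        (\<Prod>i<k. (\<lambda>(i, j). ?B I $$ (i, j)) (var_list m \<mu> ! i))"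
      unfolding mset[symmetric] prod_mset_list len ..
    also have "\<dots> = (\<Prod>i<k. \<Sum>j\<in>I. w j (fst (var_list m \<mu> ! i)) * u j (snd (var_list m \<mu> ! i)))"
    proof (intro prod.cong refl)
      fix i assume "i \<in> {..<k}"
      then have "var_list m \<mu> ! i \<in> {..<m} \<times> {..<m}"
        using set_var_list[of m \<mu>] len nth_mem by blast
      then show "(\<lambda>(i, j). ?B I $$ (i, j)) (var_list m \<mu> ! i) =
          (\<Sum>j\<in>I. w j (fst (var_list m \<mu> ! i)) * u j (snd (var_list m \<mu> ! i)))"
        by auto
    qed
    finally show "\<Prod>\<^sub># (image_mset (\<lambda>(i, j). ?B I $$ (i, j)) (mono_mset \<mu>)) = \<dots>" .
  qed
  have "polarized m k S u w = (\<Sum>\<mu>\<in>Poly_Mapping.keys S. \<Sum>I\<in>Pow {..<k}. (-1) ^ (k - card I) *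
      (Poly_Mapping.lookup S \<mu> * (\<Prod>i<k. \<Sum>j\<in>I. w j (fst (var_list m \<mu> ! i)) * u j (snd (var_list m \<mu> ! i)))))"
    unfolding polarized_def eval sum_distrib_left by (rule sum.swap)
  also have "\<dots> = (\<Sum>\<mu>\<in>Poly_Mapping.keys S. Poly_Mapping.lookup S \<mu> * (\<Sum>I\<in>Pow {..<k}. (-1) ^ (k - card I) *
      (\<Prod>i<k. \<Sum>j\<in>I. w j (fst (var_list m \<mu> ! i)) * u j (snd (var_list m \<mu> ! i)))))"
    unfolding sum_distrib_left by (intro sum.cong refl mult.left_commute)
  finally show ?thesis
    unfolding inclusion_exclusion_perm_lists .
qed

lemma hol_form_sum: "hol_form m u = (\<lambda>a. \<Sum>\<alpha><m. u \<alpha> * (if a = 2 * \<alpha> then 1 else 0))"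
proof
  fix a
  show "hol_form m u a = (\<Sum>\<alpha><m. u \<alpha> * (if a = 2 * \<alpha> then 1 else 0))"
  proof (cases "even a")
    case True
    then obtain q where q: "a = 2 * q"
      by (elim evenE)
    have "(\<Sum>\<alpha><m. u \<alpha> * (if a = 2 * \<alpha> then 1 else 0)) = (\<Sum>\<alpha><m. if \<alpha> = q then u q else 0)"
      by (intro sum.cong) (auto simp: q)
    then show ?thesis
      by (auto simp: hol_form_def q)
  next
    case False
    then have "a \<noteq> 2 * \<alpha>" for \<alpha>
      by auto
    with False show ?thesis
      by (simp add: hol_form_def)
  qed
qed

lemma antihol_form_sum: "antihol_form m w = (\<lambda>a. \<Sum>\<beta><m. w \<beta> * (if a = 2 * \<beta> + 1 then 1 else 0))"
proof
  fix a
  show "antihol_form m w a = (\<Sum>\<beta><m. w \<beta> * (if a = 2 * \<beta> + 1 then 1 else 0))"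
  proof (cases "odd a")
    case True
    then obtain q where q: "a = 2 * q + 1"
      by (elim oddE)
    have "(\<Sum>\<beta><m. w \<beta> * (if a = 2 * \<beta> + 1 then 1 else 0)) = (\<Sum>\<beta><m. if \<beta> = q then w q else 0)"
      by (intro sum.cong) (auto simp: q)
    then show ?thesis
      by (auto simp: antihol_form_def q)
  next
    case False
    then have "a \<noteq> 2 * \<beta> + 1" for \<beta>
      by auto
    with False show ?thesis
      by (simp add: antihol_form_def)
  qed
qed

text \<open>Contracting the tensor slot with \<open>u\<close> and \<open>w\<close> adds one more
  decomposable 2-form, so slot \<open>k\<close> enters the determinant on the same footing as the
  summands of the jet.\<close>

lemma contract_covectors:
  "(\<Sum>\<alpha><m. \<Sum>\<beta><m. u \<alpha> * w \<beta> * pair_trace m n (\<omega> \<and>\<^sub>w covec (2 * \<alpha>) \<and>\<^sub>w covec (2 * \<beta> + 1))) =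
    pair_trace m n (\<omega> \<and>\<^sub>w (one_form (hol_form m u) \<and>\<^sub>w one_form (antihol_form m w)))"
  unfolding hol_form_sum antihol_form_sum one_form_sum one_form_scale covec_one_form[symmetric]
    wedge_sum_left wedge_sum_right wedge_scale_left wedge_scale_right pair_trace_sum pair_trace_scale
    sum_distrib_left wedge_assoc
  by (simp add: mult_ac)

text \<open>In the expansion over choice lists each term is the total contraction of a product of
  decomposable 2-forms, that is, a Gram determinant. Repeated choices give zero and permutations do
  not change it, so it factors out; the remaining coefficients form the polarization of
  \<open>S\<close>.\<close>

lemma contraction_Xi:
  assumes S: "\<And>\<mu>. \<mu> \<in> Poly_Mapping.keys S \<Longrightarrow> Poly_Mapping.keys \<mu> \<subseteq> {..<m} \<times> {..<m} \<and> size (mono_mset \<mu>) = k"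
  shows "contraction m k (Xi m k S) t u w =
    Xi_constant k * (-1) ^ k * (\<Prod>j<k. t j) * det_fun (Suc k) (gram m u w) * polarized m k S u w"
proof -
  let ?X = "curvature_values m (jet_sum k t u w)"
  let ?\<omega> = "\<lambda>j. one_form (hol_form m (u j)) \<and>\<^sub>w one_form (antihol_form m (w j))"
  let ?b = "\<lambda>j v. - t j * w j (fst v) * u j (snd v)"
  have X: "(\<lambda>(i, j). ?X i j) = (\<lambda>v K. \<Sum>j<k. ?b j v * ?\<omega> j K)"
    by (auto simp: curvature_values_jet_sum)
  have len: "length (var_list m \<mu>) = k" if "\<mu> \<in> Poly_Mapping.keys S" for \<mu>
    using S[OF that] mset_var_list[of \<mu> m] by (metis size_mset)
  have trace: "pair_trace m (Suc k) (wedge_list (map ?\<omega> js) \<and>\<^sub>w ?\<omega> k) =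
      (if js \<in> perm_lists k then det_fun (Suc k) (gram m u w) else 0)" if js: "js \<in> lists_over k {..<k}" for js
  proof -
    have "wedge_list (map ?\<omega> js) \<and>\<^sub>w ?\<omega> k = wedge_list (map ?\<omega> js) \<and>\<^sub>w wedge_list [?\<omega> k]"
    proof (rule wedge_cong)
      fix K :: "nat set" assume "finite K"
      then show "?\<omega> k K = wedge_list [?\<omega> k] K"
        by (simp add: wedge_unit_right)
    qed simp
    also have "\<dots> = wedge_list (map ?\<omega> (js @ [k]))"
      by (simp add: wedge_list_append)
    finally have "pair_trace m (Suc k) (wedge_list (map ?\<omega> js) \<and>\<^sub>w ?\<omega> k) =
        det_fun (Suc k) (\<lambda>i j. gram m u w ((js @ [k]) ! i) ((js @ [k]) ! j))"
      using pair_trace_wedge_list[of m "js @ [k]" u w] js by (simp add: gram_def)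
    also have "\<dots> = (if distinct (js @ [k]) then det_fun (Suc k) (gram m u w) else 0)"
      using js by (intro det_fun_reindex) auto
    also have "distinct (js @ [k]) \<longleftrightarrow> js \<in> perm_lists k"
    proof
      assume "distinct (js @ [k])"
      then have "card (set js) = card {..<k}"
        using js by (simp add: distinct_card)
      then show "js \<in> perm_lists k"
        using js card_subset_eq[of "{..<k}" "set js"] by auto
    next
      assume "js \<in> perm_lists k"
      then show "distinct (js @ [k])"
        using distinct_perm_list[of js k] by auto
    qed
    finally show ?thesis .
  qed
  have pol: "polarized m k S u w = (\<Sum>\<mu>\<in>Poly_Mapping.keys S. Poly_Mapping.lookup S \<mu> *
      (\<Sum>js\<in>perm_lists k. \<Prod>i<k. w (js ! i) (fst (var_list m \<mu> ! i)) * u (js ! i) (snd (var_list m \<mu> ! i))))"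
    by (rule mat_poly_polarized) (fact S)
  have "contraction m k (Xi m k S) t u w = Xi_constant k *
      (\<Sum>\<alpha><m. \<Sum>\<beta><m. u k \<alpha> * w k \<beta> *
        pair_trace m (Suc k) (mat_poly_form (\<lambda>c. c) m S ?X \<and>\<^sub>w covec (2 * \<alpha>) \<and>\<^sub>w covec (2 * \<beta> + 1)))"
    by (simp add: contraction_def ev_Xi Xi_of_curvature_trace sum_distrib_left mult_ac)
  also have "\<dots> = Xi_constant k * pair_trace m (Suc k) (mat_poly_form (\<lambda>c. c) m S ?X \<and>\<^sub>w ?\<omega> k)"
    unfolding contract_covectors ..
  also have "mat_poly_form (\<lambda>c. c) m S ?X = (\<lambda>K. \<Sum>\<mu>\<in>Poly_Mapping.keys S. \<Sum>js\<in>lists_over k {..<k}.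
      (Poly_Mapping.lookup S \<mu> * (\<Prod>i<k. ?b (js ! i) (var_list m \<mu> ! i))) * wedge_list (map ?\<omega> js) K)"
    unfolding mat_poly_form_var_list X wedge_list_map_sum
    by (intro ext sum.cong refl) (simp only: len sum_distrib_left mult.assoc)
  also have "pair_trace m (Suc k) (\<dots> \<and>\<^sub>w ?\<omega> k) = (\<Sum>\<mu>\<in>Poly_Mapping.keys S. \<Sum>js\<in>lists_over k {..<k}.
      (Poly_Mapping.lookup S \<mu> * (\<Prod>i<k. ?b (js ! i) (var_list m \<mu> ! i))) *
      (if js \<in> perm_lists k then det_fun (Suc k) (gram m u w) else 0))"
    unfolding wedge_sum_left wedge_scale_left pair_trace_sum pair_trace_scale
    by (intro sum.cong refl arg_cong2[where f = "(*)"] trace)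
  also have "\<dots> = (\<Sum>\<mu>\<in>Poly_Mapping.keys S. \<Sum>js\<in>perm_lists k.
      (Poly_Mapping.lookup S \<mu> * (\<Prod>i<k. ?b (js ! i) (var_list m \<mu> ! i))) * det_fun (Suc k) (gram m u w))"
    by (intro sum.cong refl sum.mono_neutral_cong_right) auto
  also have "\<dots> = (-1) ^ k * (\<Prod>j<k. t j) * det_fun (Suc k) (gram m u w) * polarized m k S u w"
    unfolding pol sum_distrib_left
  proof (intro sum.cong refl)
    fix \<mu> js assume js: "js \<in> perm_lists k"
    have "bij_betw (\<lambda>i. js ! i) {..<k} {..<k}"
      using js distinct_perm_list[OF js] by (intro bij_betw_nth) auto
    then have "(\<Prod>i<k. t (js ! i)) = (\<Prod>j<k. t j)"
      by (rule prod.reindex_bij_betw)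
    moreover have "(\<Prod>i<k. ?b (js ! i) (var_list m \<mu> ! i)) = (\<Prod>i<k. (-1) * t (js ! i) *
        (w (js ! i) (fst (var_list m \<mu> ! i)) * u (js ! i) (snd (var_list m \<mu> ! i))))"
      by (intro prod.cong) auto
    ultimately have "(\<Prod>i<k. ?b (js ! i) (var_list m \<mu> ! i)) = (-1) ^ k * (\<Prod>j<k. t j) *
        (\<Prod>i<k. w (js ! i) (fst (var_list m \<mu> ! i)) * u (js ! i) (snd (var_list m \<mu> ! i)))"
      by (simp only: prod.distrib prod_constant card_lessThan)
    then show "Poly_Mapping.lookup S \<mu> * (\<Prod>i<k. ?b (js ! i) (var_list m \<mu> ! i)) * det_fun (Suc k) (gram m u w) =
        (-1) ^ k * (\<Prod>j<k. t j) * det_fun (Suc k) (gram m u w) * (Poly_Mapping.lookup S \<mu> *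
        (\<Prod>i<k. w (js ! i) (fst (var_list m \<mu> ! i)) * u (js ! i) (snd (var_list m \<mu> ! i))))"
      by (simp only: mult_ac)
  qed
  finally show ?thesis
    by (simp only: mult_ac)
qed

section \<open>Polynomial curves\<close>

text \<open>Polynomial dependence on many variables is only ever tested along curves, which suffices
  for the identity theorems below.\<close>

definition polynomial_fun :: "(complex \<Rightarrow> complex) \<Rightarrow> bool" where
  "polynomial_fun f \<longleftrightarrow> (\<exists>p. f = poly p)"

named_theorems polynomial_intros

lemma polynomial_const [polynomial_intros]: "polynomial_fun (\<lambda>z. c)"
  unfolding polynomial_fun_def by (rule exI[of _ "[:c:]"]) auto

lemma polynomial_id [polynomial_intros]: "polynomial_fun (\<lambda>z. z)"
  unfolding polynomial_fun_def by (rule exI[of _ "[:0, 1:]"]) auto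

lemma polynomial_add [polynomial_intros]:
  assumes "polynomial_fun f" "polynomial_fun g"
  shows "polynomial_fun (\<lambda>z. f z + g z)"
proof -
  obtain p q where "f = poly p" "g = poly q"
    using assms by (auto simp: polynomial_fun_def)
  then have "(\<lambda>z. f z + g z) = poly (p + q)"
    by auto
  then show ?thesis
    unfolding polynomial_fun_def by blast
qed

lemma polynomial_mult [polynomial_intros]:
  assumes "polynomial_fun f" "polynomial_fun g"
  shows "polynomial_fun (\<lambda>z. f z * g z)"
proof -
  obtain p q where "f = poly p" "g = poly q"
    using assms by (auto simp: polynomial_fun_def)
  then have "(\<lambda>z. f z * g z) = poly (p * q)"
    by auto
  then show ?thesis
    unfolding polynomial_fun_def by blast
qed

lemma polynomial_uminus [polynomial_intros]:
  "polynomial_fun f \<Longrightarrow> polynomial_fun (\<lambda>z. - f z)"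
  using polynomial_mult[OF polynomial_const[of "-1"]] by simp

lemma polynomial_diff [polynomial_intros]:
  "polynomial_fun f \<Longrightarrow> polynomial_fun g \<Longrightarrow> polynomial_fun (\<lambda>z. f z - g z)"
  using polynomial_add[OF _ polynomial_uminus] by simp

lemma polynomial_sum [polynomial_intros]:
  "(\<And>i. i \<in> A \<Longrightarrow> polynomial_fun (f i)) \<Longrightarrow> polynomial_fun (\<lambda>z. \<Sum>i\<in>A. f i z)"
  by (induction A rule: infinite_finite_induct) (auto intro: polynomial_intros)

lemma polynomial_prod [polynomial_intros]:
  "(\<And>i. i \<in> A \<Longrightarrow> polynomial_fun (f i)) \<Longrightarrow> polynomial_fun (\<lambda>z. \<Prod>i\<in>A. f i z)"
  by (induction A rule: infinite_finite_induct) (auto intro: polynomial_intros)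

lemma polynomial_power [polynomial_intros]:
  "polynomial_fun f \<Longrightarrow> polynomial_fun (\<lambda>z. f z ^ n)"
  by (induction n) (auto intro: polynomial_intros)

lemma polynomial_prod_mset [polynomial_intros]:
  "(\<And>v. v \<in># M \<Longrightarrow> polynomial_fun (\<lambda>z. f z v)) \<Longrightarrow> polynomial_fun (\<lambda>z. \<Prod>\<^sub># (image_mset (f z) M))"
  by (induction M) (auto intro: polynomial_intros)

lemma polynomial_if [polynomial_intros]:
  "(P \<Longrightarrow> polynomial_fun f) \<Longrightarrow> (\<not> P \<Longrightarrow> polynomial_fun g) \<Longrightarrow>
    polynomial_fun (\<lambda>z. if P then f z else g z)"
  by (cases P) auto

lemma polynomial_ev [polynomial_intros]:
  "(\<And>v. polynomial_fun (\<lambda>z. x z v)) \<Longrightarrow> polynomial_fun (\<lambda>z. ev (x z) p)"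
  unfolding peval_mset by (intro polynomial_intros)

lemma polynomial_det [polynomial_intros]:
  assumes "\<And>i j. i < n \<Longrightarrow> j < n \<Longrightarrow> polynomial_fun (\<lambda>z. G z i j)"
  shows "polynomial_fun (\<lambda>z. det_fun n (G z))"
proof -
  have "det_fun n (G z) = (\<Sum>p\<in>{p. p permutes {0..<n}}. signof p * (\<Prod>i<n. G z i (p i)))" for z
  proof -
    have "p i < n" if "p permutes {0..<n}" "i < n" for p i
      using permutes_in_image[OF that(1), of i] that(2) by simp
    then show ?thesis
      by (subst det_def'[of _ n]) (auto intro!: sum.cong prod.cong simp: lessThan_atLeast0)
  qed
  moreover have "p i < n" if "p permutes {0..<n}" "i < n" for p i
    using permutes_in_image[OF that(1), of i] that(2) by simp
  ultimately show ?thesis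
    using assms by (auto intro!: polynomial_intros)
qed

text \<open>A product of univariate polynomials that vanishes everywhere has a zero factor; this
  takes the place of density of the set where \<open>g\<close> is nonzero.\<close>

lemma polynomial_fun_zero:
  assumes "polynomial_fun f" "polynomial_fun g" "\<And>z. g z \<noteq> 0 \<Longrightarrow> f z = 0" "g z0 \<noteq> 0"
  shows "f z = 0"
proof -
  obtain p q where pq: "f = poly p" "g = poly q"
    using assms by (auto simp: polynomial_fun_def)
  have "poly (p * q) z = 0" for z
    using assms(3)[of z] pq by (cases "g z = 0") auto
  then have "p * q = 0"
    using poly_all_0_iff_0 by blast
  moreover have "q \<noteq> 0"
    using assms(4) pq by auto
  ultimately show ?thesis
    using pq by simp
qed

lemma polynomial_fun_zero_infinite:
  assumes "polynomial_fun f" "infinite Z" "\<And>z. z \<in> Z \<Longrightarrow> f z = 0"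
  shows "f z = 0"
proof -
  obtain p where p: "f = poly p"
    using assms by (auto simp: polynomial_fun_def)
  have "Z \<subseteq> {z. poly p z = 0}"
    using assms(3) p by auto
  then have "p = 0"
    using assms(2) poly_roots_finite finite_subset by blast
  then show ?thesis
    using p by simp
qed

lemma polynomial_jet_sum [polynomial_intros]:
  assumes "\<And>j. j < k \<Longrightarrow> polynomial_fun (\<lambda>z. t z j)"
    "\<And>j a. j < k \<Longrightarrow> polynomial_fun (\<lambda>z. u z j a)" "\<And>j a. j < k \<Longrightarrow> polynomial_fun (\<lambda>z. w z j a)"
  shows "polynomial_fun (\<lambda>z. jet_sum k (t z) (u z) (w z) v)"
  using assms unfolding jet_sum_def case_prod_beta by (intro polynomial_intros) auto

lemma polynomial_contraction [polynomial_intros]: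
  assumes "\<And>j. j < k \<Longrightarrow> polynomial_fun (\<lambda>z. t z j)"
    "\<And>j a. j \<le> k \<Longrightarrow> polynomial_fun (\<lambda>z. u z j a)" "\<And>j a. j \<le> k \<Longrightarrow> polynomial_fun (\<lambda>z. w z j a)"
  shows "polynomial_fun (\<lambda>z. contraction m k Q (t z) (u z) (w z))"
  using assms unfolding contraction_def by (intro polynomial_intros) auto

text \<open>The condition \<open>keys\<close> enters because entries of \<open>mat m m\<close>
  outside the index range are unspecified.\<close>

lemma polynomial_polarized [polynomial_intros]:
  assumes "\<And>j a. j < k \<Longrightarrow> polynomial_fun (\<lambda>z. u z j a)" "\<And>j a. j < k \<Longrightarrow> polynomial_fun (\<lambda>z. w z j a)"
    and keys: "\<And>\<mu>. \<mu> \<in> Poly_Mapping.keys S \<Longrightarrow> Poly_Mapping.keys \<mu> \<subseteq> {..<m} \<times> {..<m}"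
  shows "polynomial_fun (\<lambda>z. polarized m k S (u z) (w z))"
proof -
  have eq: "mat_poly S (mat m m (\<lambda>(\<delta>, \<gamma>). B \<delta> \<gamma>)) = ev (\<lambda>(\<delta>, \<gamma>). B \<delta> \<gamma>) S" for B
    unfolding mat_poly_def
  proof (rule peval_cong)
    fix \<mu> v assume "\<mu> \<in> Poly_Mapping.keys S" "v \<in> Poly_Mapping.keys \<mu>"
    with keys have "v \<in> {..<m} \<times> {..<m}"
      by blast
    then show "(\<lambda>(i, j). mat m m (\<lambda>(\<delta>, \<gamma>). B \<delta> \<gamma>) $$ (i, j)) v = (\<lambda>(\<delta>, \<gamma>). B \<delta> \<gamma>) v"
      by auto
  qed
  show ?thesis
    unfolding polarized_def eq case_prod_beta using assms by (intro polynomial_intros) auto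
qed

lemma polynomial_gram [polynomial_intros]:
  assumes "\<And>a. polynomial_fun (\<lambda>z. u z i a)" "\<And>a. polynomial_fun (\<lambda>z. w z j a)"
  shows "polynomial_fun (\<lambda>z. gram m (u z) (w z) i j)"
  unfolding gram_def by (intro polynomial_intros assms)

section \<open>Linearity and injectivity of \<open>\<Xi>\<close>\<close>

lemma inv_polysD:
  assumes "S \<in> inv_polys m k" "\<mu> \<in> Poly_Mapping.keys S"
  shows "Poly_Mapping.keys \<mu> \<subseteq> {..<m} \<times> {..<m} \<and> size (mono_mset \<mu>) = k"
  using assms by (auto simp: inv_polys_def size_mono_mset)

lemma wedge_add_left: "(\<lambda>K. f K + g K) \<and>\<^sub>w \<eta> = (\<lambda>K. (f \<and>\<^sub>w \<eta>) K + (g \<and>\<^sub>w \<eta>) K)"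
  by (auto simp: wedge_def algebra_simps sum.distrib)

lemma pair_trace_add: "pair_trace m n (\<lambda>K. f K + g K) = pair_trace m n f + pair_trace m n g"
  by (simp add: pair_trace_def sum.distrib)

lemma mat_poly_form_superset:
  assumes "finite Z" "Poly_Mapping.keys S \<subseteq> Z"
  shows "mat_poly_form (\<lambda>c. c) m S X = (\<lambda>K. \<Sum>\<mu>\<in>Z. Poly_Mapping.lookup S \<mu> *
    wedge_list (map (\<lambda>(i, j). X i j) (var_list m \<mu>)) K)"
  unfolding mat_poly_form_var_list using assms
  by (intro ext sum.mono_neutral_left) (auto simp: in_keys_iff)

lemma mat_poly_form_add:
  "mat_poly_form (\<lambda>c. c) m (S + S') X =
    (\<lambda>K. mat_poly_form (\<lambda>c. c) m S X K + mat_poly_form (\<lambda>c. c) m S' X K)"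
proof -
  let ?Z = "Poly_Mapping.keys S \<union> Poly_Mapping.keys S'"
  have "mat_poly_form (\<lambda>c. c) m T X = (\<lambda>K. \<Sum>\<mu>\<in>?Z. Poly_Mapping.lookup T \<mu> *
      wedge_list (map (\<lambda>(i, j). X i j) (var_list m \<mu>)) K)" if "Poly_Mapping.keys T \<subseteq> ?Z" for T
    using that by (intro mat_poly_form_superset) auto
  from this[of S] this[of S'] this[OF Poly_Mapping.keys_add] show ?thesis
    by (simp add: lookup_add algebra_simps sum.distrib)
qed

lemma lookup_pconst_mult: "Poly_Mapping.lookup (pconst c * S) \<mu> = c * Poly_Mapping.lookup S \<mu>"
proof (induction S rule: poly_mapping_add_induct)
  case (2 \<nu> d)
  show ?case
    by (simp add: pconst_def mult_single lookup_single when_def)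
qed (simp_all add: lookup_add algebra_simps)

lemma mat_poly_form_pconst:
  "mat_poly_form (\<lambda>c. c) m (pconst c * S) X = (\<lambda>K. c * mat_poly_form (\<lambda>c. c) m S X K)"
proof -
  have "Poly_Mapping.keys (pconst c * S) \<subseteq> Poly_Mapping.keys S"
    by (auto simp: in_keys_iff lookup_pconst_mult)
  then have "mat_poly_form (\<lambda>c. c) m (pconst c * S) X = (\<lambda>K. \<Sum>\<mu>\<in>Poly_Mapping.keys S.
      Poly_Mapping.lookup (pconst c * S) \<mu> * wedge_list (map (\<lambda>(i, j). X i j) (var_list m \<mu>)) K)"
    by (intro mat_poly_form_superset) auto
  then show ?thesis
    unfolding mat_poly_form_var_list by (simp add: lookup_pconst_mult sum_distrib_left mult.assoc)
qed

lemma Xi_add: "Xi m k (S + S') = (\<lambda>\<alpha> \<beta>. Xi m k S \<alpha> \<beta> + Xi m k S' \<alpha> \<beta>)"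
  by (intro ext ev_eq_imp)
    (simp add: ev_Xi ev_hom.hom_add Xi_of_curvature_trace mat_poly_form_add wedge_add_left pair_trace_add algebra_simps)

lemma Xi_scale: "Xi m k (pconst c * S) = (\<lambda>\<alpha> \<beta>. pconst c * Xi m k S \<alpha> \<beta>)"
  by (intro ext ev_eq_imp)
    (simp add: ev_Xi ev_hom.hom_mult Xi_of_curvature_trace mat_poly_form_pconst wedge_scale_left pair_trace_scale)

lemma gram_basis:
  assumes "i \<le> k" "j \<le> k" "k < m"
  shows "gram m (\<lambda>l a. if a = l then 1 else 0) (\<lambda>l a. if a = l then 1 else 0) i j = (if i = j then 1 else 0)"
proof -
  have "gram m (\<lambda>l a. if a = l then 1 else 0) (\<lambda>l a. if a = l then 1 else 0) i j =
      (\<Sum>a<m. if a = i then if i = j then 1 else 0 else 0)"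
    unfolding gram_def by (intro sum.cong) auto
  with assms show ?thesis
    by simp
qed

lemma det_fun_one: "det_fun n (\<lambda>i j. if i = j then 1 else 0) = 1"
proof -
  have "mat n n (\<lambda>(i, j). if i = j then 1 else 0) = (1\<^sub>m n :: complex mat)"
    by (intro eq_matI) auto
  then show ?thesis
    by simp
qed

lemma det_fun_cong:
  assumes "\<And>i j. i < n \<Longrightarrow> j < n \<Longrightarrow> G i j = H i j"
  shows "det_fun n G = det_fun n H"
  using assms by (intro arg_cong[where f = Determinant.det] eq_matI) auto

text \<open>The Gram determinant is not the zero polynomial because \<open>k + 1 \<le> m\<close>.\<close>

lemma cancel_gram_det:
  assumes km: "k < m"
    and P: "\<And>u w. (\<And>j a. polynomial_fun (\<lambda>z. u z j a)) \<Longrightarrow> (\<And>j a. polynomial_fun (\<lambda>z. w z j a)) \<Longrightarrow>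
      polynomial_fun (\<lambda>z. P (u z) (w z))"
    and zero: "\<And>u w. det_fun (Suc k) (gram m u w) * P u w = 0"
  shows "P u w = 0"
proof -
  let ?e = "\<lambda>l a. if a = l then 1 else 0 :: complex"
  \<comment> \<open>Segments from the given vectors at 0 to the standard basis at 1, where the Gram
    determinant is 1.\<close>
  let ?u = "\<lambda>z l a. (1 - z) * u l a + z * ?e l a" and ?w = "\<lambda>z l a. (1 - z) * w l a + z * ?e l a"
  have poly: "polynomial_fun (\<lambda>z. ?u z j a)" "polynomial_fun (\<lambda>z. ?w z j a)" for j a
    by (intro polynomial_intros)+
  have "P (?u 0) (?w 0) = 0"
  proof (rule polynomial_fun_zero[where f = "\<lambda>z. P (?u z) (?w z)" and z = 0])
    show "polynomial_fun (\<lambda>z. P (?u z) (?w z))"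
      by (rule P) (intro poly)+
    show "polynomial_fun (\<lambda>z. det_fun (Suc k) (gram m (?u z) (?w z)))"
      by (intro polynomial_det polynomial_gram poly)
    show "P (?u z) (?w z) = 0" if "det_fun (Suc k) (gram m (?u z) (?w z)) \<noteq> 0" for z
      using zero[of "?u z" "?w z"] that by simp
    have "det_fun (Suc k) (gram m (?u 1) (?w 1)) = det_fun (Suc k) (\<lambda>i j. if i = j then 1 else 0)"
      using km by (intro det_fun_cong) (simp add: gram_basis[where k = k])
    then show "det_fun (Suc k) (gram m (?u 1) (?w 1)) \<noteq> 0"
      by (simp add: det_fun_one)
  qed
  then show ?thesis
    by simp
qed

text \<open>The chosen vectors make the \<open>j\<close>-th rank one matrix the matrix unit at entry
  \<open>j\<close> of \<open>var_list m \<mu>0\<close>. A monomial contributes only if some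
  permutation carries one entry list to the other, so only \<open>\<mu>0\<close> does;
  \<open>N\<close> counts these permutations, among them the identity.\<close>

lemma polarized_basis:
  assumes S: "\<And>\<mu>. \<mu> \<in> Poly_Mapping.keys S \<Longrightarrow> Poly_Mapping.keys \<mu> \<subseteq> {..<m} \<times> {..<m} \<and> size (mono_mset \<mu>) = k"
    and \<mu>0: "Poly_Mapping.keys \<mu>0 \<subseteq> {..<m} \<times> {..<m}" "size (mono_mset \<mu>0) = k"
  defines "N \<equiv> card {js \<in> perm_lists k. \<forall>i<k. var_list m \<mu>0 ! i = var_list m \<mu>0 ! (js ! i)}"
  shows "polarized m k S (\<lambda>j a. if a = snd (var_list m \<mu>0 ! j) then 1 else 0)
      (\<lambda>j a. if a = fst (var_list m \<mu>0 ! j) then 1 else 0) = of_nat N * Poly_Mapping.lookup S \<mu>0"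
    and "N \<noteq> 0"
proof -
  let ?v = "var_list m \<mu>0"
  have len: "length ?v = k"
    using \<mu>0 mset_var_list[of \<mu>0 m] by (metis size_mset)
  have pol: "polarized m k S u w = (\<Sum>\<mu>\<in>Poly_Mapping.keys S. Poly_Mapping.lookup S \<mu> *
    (\<Sum>js\<in>perm_lists k. \<Prod>i<k. w (js ! i) (fst (var_list m \<mu> ! i)) * u (js ! i) (snd (var_list m \<mu> ! i))))" for u w
    by (rule mat_poly_polarized) (fact S)
  have eq: "(\<Prod>i<k. (if fst (var_list m \<mu> ! i) = fst (?v ! (js ! i)) then 1 else 0) *
        (if snd (var_list m \<mu> ! i) = snd (?v ! (js ! i)) then 1 else 0)) =
      (if \<forall>i<k. var_list m \<mu> ! i = ?v ! (js ! i) then 1 else 0 :: complex)" for \<mu> js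
    by (auto simp: prod_eq_iff intro!: prod_zero prod.neutral)
  have "polarized m k S (\<lambda>j a. if a = snd (?v ! j) then 1 else 0) (\<lambda>j a. if a = fst (?v ! j) then 1 else 0) =
      (\<Sum>\<mu>\<in>Poly_Mapping.keys S. Poly_Mapping.lookup S \<mu> *
        (\<Sum>js\<in>perm_lists k. if \<forall>i<k. var_list m \<mu> ! i = ?v ! (js ! i) then 1 else 0))"
    unfolding pol eq ..
  also have "\<dots> = (\<Sum>\<mu>\<in>Poly_Mapping.keys S. if \<mu> = \<mu>0 then Poly_Mapping.lookup S \<mu>0 * of_nat N else 0)"
  proof (intro sum.cong refl)
    fix \<mu> assume \<mu>: "\<mu> \<in> Poly_Mapping.keys S"
    have len\<mu>: "length (var_list m \<mu>) = k"
      using S[OF \<mu>] mset_var_list[of \<mu> m] by (metis size_mset)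
    show "Poly_Mapping.lookup S \<mu> * (\<Sum>js\<in>perm_lists k. if \<forall>i<k. var_list m \<mu> ! i = ?v ! (js ! i) then 1 else 0) =
      (if \<mu> = \<mu>0 then Poly_Mapping.lookup S \<mu>0 * of_nat N else 0)"
    proof (cases "\<mu> = \<mu>0")
      case True
      then show ?thesis
        by (simp add: N_def sum.If_cases Int_def)
    next
      case False
      have neg: "\<not> (\<forall>i<k. var_list m \<mu> ! i = ?v ! (js ! i))" if "js \<in> perm_lists k" for js
      proof
        assume "\<forall>i<k. var_list m \<mu> ! i = ?v ! (js ! i)"
        then have "var_list m \<mu> = map ((!) ?v) js"
        proof (intro nth_equalityI)
          show "length (var_list m \<mu>) = length (map ((!) ?v) js)"
            using len\<mu> that by simp
        next
          fix i assume "i < length (var_list m \<mu>)"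
          with len\<mu> that \<open>\<forall>i<k. var_list m \<mu> ! i = ?v ! (js ! i)\<close>
          show "var_list m \<mu> ! i = map ((!) ?v) js ! i"
            by simp
        qed
        moreover have "mset js = mset [0..<k]"
          using that set_eq_iff_mset_eq_distinct[OF distinct_perm_list[OF that] distinct_upt[of 0 k]]
          by (simp only: set_upt mem_Collect_eq lessThan_atLeast0) simp
        ultimately have "mset (var_list m \<mu>) = mset (map ((!) ?v) [0..<k])"
          by (metis mset_map)
        also have "map ((!) ?v) [0..<k] = ?v"
          using len map_nth by blast
        finally have "mono_mset \<mu> = mono_mset \<mu>0"
          using S[OF \<mu>] \<mu>0 by (simp add: mset_var_list)
        with False show False
          by (simp add: mono_mset_inject)
      qed
      have "(\<Sum>js\<in>perm_lists k. if \<forall>i<k. var_list m \<mu> ! i = ?v ! (js ! i) then 1 else 0) =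
          (\<Sum>js\<in>perm_lists k. 0 :: complex)"
        by (rule sum.cong[OF refl], rule if_not_P, rule neg)
      with False show ?thesis
        by simp
    qed
  qed
  also have "\<dots> = of_nat N * Poly_Mapping.lookup S \<mu>0"
    by (simp add: in_keys_iff)
  finally show "polarized m k S (\<lambda>j a. if a = snd (?v ! j) then 1 else 0)
      (\<lambda>j a. if a = fst (?v ! j) then 1 else 0) = of_nat N * Poly_Mapping.lookup S \<mu>0" .
  have "[0..<k] \<in> {js \<in> perm_lists k. \<forall>i<k. ?v ! i = ?v ! (js ! i)}"
    by auto
  then have ne: "{js \<in> perm_lists k. \<forall>i<k. ?v ! i = ?v ! (js ! i)} \<noteq> {}"
    by blast
  have fin: "finite {js \<in> perm_lists k. \<forall>i<k. ?v ! i = ?v ! (js ! i)}"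
    by (rule finite_subset[OF _ finite_perm_lists[of k]]) auto
  show "N \<noteq> 0"
    unfolding N_def card_0_eq[OF fin] by (rule ne)
qed

text \<open>Contractions with all \<open>t j\<close> equal to 1 determine the product of the Gram
  determinant and the polarization. The determinant can be cancelled, and matrix units then read off
  each coefficient.\<close>

lemma inj_on_Xi:
  assumes "k < m"
  shows "inj_on (Xi m k) (inv_polys m k)"
proof (rule inj_onI, rule poly_mapping_eqI)
  fix S S' \<mu> assume S: "S \<in> inv_polys m k" and S': "S' \<in> inv_polys m k" and eq: "Xi m k S = Xi m k S'"
  note keys = inv_polysD[OF S] inv_polysD[OF S']
  have pol: "polarized m k S u w - polarized m k S' u w = 0" for u w
  proof (rule cancel_gram_det[OF assms, where P = "\<lambda>u w. polarized m k S u w - polarized m k S' u w"])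
    fix u w :: "complex \<Rightarrow> nat \<Rightarrow> nat \<Rightarrow> complex"
    assume "\<And>j a. polynomial_fun (\<lambda>z. u z j a)" "\<And>j a. polynomial_fun (\<lambda>z. w z j a)"
    then show "polynomial_fun (\<lambda>z. polarized m k S (u z) (w z) - polarized m k S' (u z) (w z))"
      using keys by (intro polynomial_diff polynomial_polarized) auto
  next
    fix u w
    have "Xi_constant k * (-1) ^ k * det_fun (Suc k) (gram m u w) * polarized m k S u w =
        Xi_constant k * (-1) ^ k * det_fun (Suc k) (gram m u w) * polarized m k S' u w"
      using contraction_Xi[of S m k "\<lambda>_. 1" u w, OF keys(1)] contraction_Xi[of S' m k "\<lambda>_. 1" u w, OF keys(2)]
      unfolding eq prod.neutral_const mult_1_right by (rule trans[OF sym])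
    then have "det_fun (Suc k) (gram m u w) * polarized m k S u w = det_fun (Suc k) (gram m u w) * polarized m k S' u w"
      unfolding mult.assoc using Xi_constant_nonzero[of k] by simp
    then show "det_fun (Suc k) (gram m u w) * (polarized m k S u w - polarized m k S' u w) = 0"
      by (simp add: right_diff_distrib)
  qed
  show "Poly_Mapping.lookup S \<mu> = Poly_Mapping.lookup S' \<mu>"
  proof (cases "\<mu> \<in> Poly_Mapping.keys S \<union> Poly_Mapping.keys S'")
    case True
    then have \<mu>: "Poly_Mapping.keys \<mu> \<subseteq> {..<m} \<times> {..<m}" "size (mono_mset \<mu>) = k"
      using keys(1)[of \<mu>] keys(2)[of \<mu>] by blast+
    show ?thesis
      using pol[of "\<lambda>j a. if a = snd (var_list m \<mu> ! j) then 1 else 0" "\<lambda>j a. if a = fst (var_list m \<mu> ! j) then 1 else 0"]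
        polarized_basis[of S m k \<mu>, OF keys(1) \<mu>] polarized_basis[of S' m k \<mu>, OF keys(2) \<mu>] by simp
  next
    case False
    then show ?thesis
      by (simp add: in_keys_iff)
  qed
qed

section \<open>The image of \<open>\<Xi>\<close> lies in the restriction kernel\<close>

lemma wedge_list_map_scale:
  "wedge_list (map (\<lambda>v K. c * X v K) vs) = (\<lambda>K. c ^ length vs * wedge_list (map X vs) K)"
  by (induction vs) (simp_all add: wedge_scale_left wedge_scale_right mult.assoc)

lemma mat_poly_form_scale:
  assumes "\<And>\<mu>. \<mu> \<in> Poly_Mapping.keys S \<Longrightarrow> Poly_Mapping.keys \<mu> \<subseteq> {..<m} \<times> {..<m} \<and> size (mono_mset \<mu>) = k"
  shows "mat_poly_form (\<lambda>c. c) m S (\<lambda>i j K. c * X i j K) = (\<lambda>K. c ^ k * mat_poly_form (\<lambda>c. c) m S X K)"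
proof -
  have "length (var_list m \<mu>) = k" if "\<mu> \<in> Poly_Mapping.keys S" for \<mu>
    using assms[OF that] mset_var_list[of \<mu> m] by (metis size_mset)
  then show ?thesis
    unfolding mat_poly_form_var_list case_prod_unfold wedge_list_map_scale
    by (simp add: sum_distrib_left mult.left_commute)
qed

section \<open>The monomials that occur in the image\<close>

definition curvature_vars :: "nat \<Rightarrow> jet_var set" where
  "curvature_vars m = {(A, B). set_mset A \<subseteq> {..<m} \<and> set_mset B \<subseteq> {..<m} \<and> size A = 2 \<and> size B = 2}"

lemma Min_Max_mem:
  fixes K :: "nat set"
  assumes "card K = 2" "K \<subseteq> {..<2 * m}"
  shows "Min K div 2 < m" "Max K div 2 < m"
proof -
  obtain a b where "K = {a, b}" "a < b"
    using assms(1) by (rule card_2_obtain)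
  with assms show "Min K div 2 < m" "Max K div 2 < m"
    by auto
qed

lemma curvature_values_cong:
  assumes "\<And>v. v \<in> curvature_vars m \<Longrightarrow> x v = y v" "\<delta> < m" "\<gamma> < m"
  shows "curvature_values m x \<delta> \<gamma> = curvature_values m y \<delta> \<gamma>"
  unfolding curvature_values_def two_form_apply
  using assms Min_Max_mem by (intro ext) (auto simp: curvature_vars_def)

lemma curvature_values_scale:
  "curvature_values m (\<lambda>v. c * x v) \<delta> \<gamma> = (\<lambda>K. c * curvature_values m x \<delta> \<gamma> K)"
  unfolding curvature_values_def two_form_apply by auto

text \<open>Both properties are read off from values: the curvature matrix depends on curvature
  variables only, and scaling it scales a matrix polynomial of degree \<open>k\<close>
  accordingly.\<close>

lemma Xi_keys:
  assumes S: "S \<in> inv_polys m k" and \<mu>: "\<mu> \<in> Poly_Mapping.keys (Xi m k S \<alpha> \<beta>)"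
  shows "Poly_Mapping.keys \<mu> \<subseteq> curvature_vars m" "size (mono_mset \<mu>) = k"
proof -
  show "Poly_Mapping.keys \<mu> \<subseteq> curvature_vars m"
  proof (rule depends_only_imp_keys[OF _ \<mu>])
    fix x y :: "jet_var \<Rightarrow> complex"
    assume "\<And>v. v \<in> curvature_vars m \<Longrightarrow> x v = y v"
    then have "Xi_of_curvature (\<lambda>c. c) m k (curvature_values m x) S = Xi_of_curvature (\<lambda>c. c) m k (curvature_values m y) S"
      by (intro Xi_of_curvature_cong curvature_values_cong)
    then show "ev x (Xi m k S \<alpha> \<beta>) = ev y (Xi m k S \<alpha> \<beta>)"
      unfolding ev_Xi by simp
  qed
  show "size (mono_mset \<mu>) = k"
  proof (rule homogeneous_imp_size[OF _ \<mu>])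
    fix x :: "jet_var \<Rightarrow> complex"
    have "mat_poly_form (\<lambda>c. c) m S (curvature_values m (\<lambda>v. 2 * x v)) =
        (\<lambda>K. 2 ^ k * mat_poly_form (\<lambda>c. c) m S (curvature_values m x) K)"
      using mat_poly_form_scale[of S m k 2 "curvature_values m x"] inv_polysD[OF S]
      by (simp add: curvature_values_scale[abs_def])
    then show "ev (\<lambda>v. 2 * x v) (Xi m k S \<alpha> \<beta>) = 2 ^ k * ev x (Xi m k S \<alpha> \<beta>)"
      by (simp add: ev_Xi Xi_of_curvature_trace wedge_scale_left pair_trace_scale)
  qed
qed

lemma jet_order_curvature_vars:
  assumes "Poly_Mapping.keys \<mu> \<subseteq> curvature_vars m"
  shows "jet_order \<mu> = 2 * size (mono_mset \<mu>)"
proof -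
  have "jet_order \<mu> = (\<Sum>v\<in>Poly_Mapping.keys \<mu>. Poly_Mapping.lookup \<mu> v * 2)"
    unfolding jet_order_def using assms by (intro sum.cong) (auto simp: curvature_vars_def)
  then show ?thesis
    by (simp add: size_mono_mset sum_distrib_left mult.commute)
qed

lemma Xi_outside: "m \<le> \<alpha> \<or> m \<le> \<beta> \<Longrightarrow> Xi m k S \<alpha> \<beta> = 0"
  by (intro ev_eq_0_imp) (auto simp: ev_Xi Xi_of_curvature_trace)

lemma Xi_in_jet_tensors:
  assumes "S \<in> inv_polys m k"
  shows "Xi m k S \<in> jet_tensors m" "homogeneous_of_order (2 * k) (Xi m k S)"
proof -
  show "homogeneous_of_order (2 * k) (Xi m k S)"
    using jet_order_curvature_vars[OF Xi_keys(1)[OF assms]] Xi_keys(2)[OF assms]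
    by (simp add: homogeneous_of_order_def)
  have "jet_monom m \<mu>" if "\<mu> \<in> Poly_Mapping.keys (Xi m k S \<alpha> \<beta>)" for \<alpha> \<beta> \<mu>
    using Xi_keys(1)[OF assms that] by (auto simp: jet_monom_def curvature_vars_def)
  then show "Xi m k S \<in> jet_tensors m"
    by (auto simp: jet_tensors_def Xi_outside)
qed

lemma wedge_supported:
  assumes "\<And>K. \<omega> K \<noteq> 0 \<Longrightarrow> K \<subseteq> V" "\<And>K. \<eta> K \<noteq> 0 \<Longrightarrow> K \<subseteq> V" "(\<omega> \<and>\<^sub>w \<eta>) K \<noteq> 0"
  shows "K \<subseteq> V"
proof (rule ccontr)
  assume "\<not> K \<subseteq> V"
  then have "\<omega> I = 0 \<or> \<eta> (K - I) = 0" for I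
    using assms(1)[of I] assms(2)[of "K - I"] by blast
  then have "shuffle_sign I (K - I) * \<omega> I * \<eta> (K - I) = 0" for I
    by (metis mult_zero_left mult_zero_right)
  then have "(\<omega> \<and>\<^sub>w \<eta>) K = 0"
    unfolding wedge_def by simp
  with assms(3) show False
    by simp
qed

lemma wedge_list_supported:
  assumes "\<And>\<omega> K. \<omega> \<in> set \<omega>s \<Longrightarrow> \<omega> K \<noteq> 0 \<Longrightarrow> K \<subseteq> V" "wedge_list \<omega>s K \<noteq> 0"
  shows "K \<subseteq> V"
  using assms
proof (induction \<omega>s arbitrary: K)
  case Nil
  then show ?case
    by (auto simp: unit_form_def split: if_splits)
next
  case (Cons \<omega> \<omega>s)
  have "\<omega> K \<noteq> 0 \<Longrightarrow> K \<subseteq> V" "wedge_list \<omega>s K \<noteq> 0 \<Longrightarrow> K \<subseteq> V" for K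
    using Cons.prems(1)[of \<omega>] Cons.IH[of K] Cons.prems(1) by auto
  then show ?case
    using Cons.prems(2) wedge_supported[of \<omega> V "wedge_list \<omega>s" K] by auto
qed

definition small_var :: "nat \<Rightarrow> jet_var \<Rightarrow> bool" where
  "small_var \<nu> = (\<lambda>(A, B). set_mset A \<subseteq> {..<\<nu>} \<and> set_mset B \<subseteq> {..<\<nu>})"

text \<open>Restriction amounts to putting every jet variable with an index at least
  \<open>\<nu>\<close> to zero, so it too can be followed through values.\<close>

lemma ev_restrict_poly: "ev x (restrict_poly \<nu> p) = ev (\<lambda>v. if small_var \<nu> v then x v else 0) p"
proof -
  have prod: "\<Prod>\<^sub># (image_mset (\<lambda>v. if small_var \<nu> v then x v else 0) M) =
      (if \<forall>v\<in>#M. small_var \<nu> v then \<Prod>\<^sub># (image_mset x M) else 0)" for M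
    by (induction M) auto
  show ?thesis
    unfolding restrict_poly_def peval_mset[of _ _ p] ev_hom.hom_sum
  proof (intro sum.cong refl)
    fix \<mu> assume "\<mu> \<in> Poly_Mapping.keys p"
    have "(\<forall>(A, B)\<in>Poly_Mapping.keys \<mu>. set_mset A \<subseteq> {..<\<nu>} \<and> set_mset B \<subseteq> {..<\<nu>}) \<longleftrightarrow>
        (\<forall>v\<in>#mono_mset \<mu>. small_var \<nu> v)"
      by (auto simp: small_var_def)
    then show "ev x (if \<forall>(A, B)\<in>Poly_Mapping.keys \<mu>. set_mset A \<subseteq> {..<\<nu>} \<and> set_mset B \<subseteq> {..<\<nu>}
        then Poly_Mapping.single \<mu> (Poly_Mapping.lookup p \<mu>) else 0) =
      Poly_Mapping.lookup p \<mu> * \<Prod>\<^sub># (image_mset (\<lambda>v. if small_var \<nu> v then x v else 0) (mono_mset \<mu>))"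
      by (simp add: prod coeff_hom.peval_single[OF coeff_hom_id])
  qed
qed

text \<open>After restriction all forms live on the first \<open>2 * k\<close> covectors, whereas
  the total contraction asks for \<open>k + 1\<close> conjugate pairs.\<close>

lemma restrict_Xi:
  assumes "k < m"
  shows "restrict_tensor k (Xi m k S) = (\<lambda>\<alpha> \<beta>. 0)"
proof -
  have "restrict_poly k (Xi m k S \<alpha> \<beta>) = 0" if "\<alpha> < k" "\<beta> < k" for \<alpha> \<beta>
  proof (rule ev_eq_0_imp)
    fix x :: "jet_var \<Rightarrow> complex"
    let ?x = "\<lambda>v. if small_var k v then x v else 0"
    let ?\<omega> = "mat_poly_form (\<lambda>c. c) m S (curvature_values m ?x)"
    let ?V = "{..<2 * k}"
    have curv: "K \<subseteq> ?V" if "curvature_values m ?x \<delta> \<gamma> K \<noteq> 0" for \<delta> \<gamma> K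
    proof -
      have "card K = 2"
        using that by (auto simp: curvature_values_def two_form_apply split: if_splits)
      then obtain a b where K: "K = {a, b}" "a < b"
        by (rule card_2_obtain)
      with that have "a div 2 < k \<and> b div 2 < k"
        by (auto simp: curvature_values_def two_form_apply small_var_def split: if_splits)
      with K show ?thesis
        by auto
    qed
    have form: "K \<subseteq> ?V" if nz: "?\<omega> K \<noteq> 0" for K
    proof -
      obtain \<mu> where "wedge_list (map (\<lambda>(i, j). curvature_values m ?x i j) (var_list m \<mu>)) K \<noteq> 0"
        using nz unfolding mat_poly_form_var_list by (metis (no_types, lifting) mult_zero_right sum.neutral)
      then show ?thesis
        by (rule wedge_list_supported[rotated]) (use curv in auto)
    qed
    have covec: "K \<subseteq> ?V" if "covec (2 * \<alpha>) K \<noteq> (0::complex)" for K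
      using that \<open>\<alpha> < k\<close> by (auto simp: covec_def split: if_splits)
    have covec': "K \<subseteq> ?V" if "covec (2 * \<beta> + 1) K \<noteq> (0::complex)" for K
      using that \<open>\<beta> < k\<close> by (auto simp: covec_def split: if_splits)
    let ?\<eta> = "?\<omega> \<and>\<^sub>w covec (2 * \<alpha>) \<and>\<^sub>w covec (2 * \<beta> + 1)"
    have supp: "K \<subseteq> ?V" if "?\<eta> K \<noteq> 0" for K
      by (rule wedge_supported[OF wedge_supported[OF form covec] covec' that])
    have "?\<eta> (index_pairs I) = 0" if "card I = k + 1" for I
    proof (rule ccontr)
      assume "?\<eta> (index_pairs I) \<noteq> 0"
      then have "index_pairs I \<subseteq> ?V"
        by (rule supp)
      then have "I \<subseteq> {..<k}"
        by auto
      then have "card I \<le> k"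
        using card_mono[of "{..<k}" I] by simp
      with that show False
        by simp
    qed
    then have "pair_trace m (k + 1) ?\<eta> = 0"
      unfolding pair_trace_def by (intro sum.neutral) auto
    then show "ev x (restrict_poly k (Xi m k S \<alpha> \<beta>)) = 0"
      unfolding ev_restrict_poly ev_Xi Xi_of_curvature_trace by simp
  qed
  then show ?thesis
    by (auto simp: restrict_tensor_def fun_eq_iff)
qed

section \<open>The action of the unitary group\<close>

abbreviation basis_vec :: "nat \<Rightarrow> nat \<Rightarrow> complex" where
  "basis_vec b \<equiv> \<lambda>a. if a = b then 1 else 0"

text \<open>Basis vectors in slot \<open>k\<close> isolate one component without disturbing the
  jet.\<close>

lemma contraction_basis:
  assumes "\<gamma> < m" "\<delta> < m"
  shows "contraction m k Q t (u(k := basis_vec \<gamma>)) (w(k := basis_vec \<delta>)) = ev (jet_sum k t u w) (Q \<gamma> \<delta>)"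
proof -
  have jet: "jet_sum k t (u(k := basis_vec \<gamma>)) (w(k := basis_vec \<delta>)) = jet_sum k t u w"
    by (auto simp: jet_sum_def)
  have "contraction m k Q t (u(k := basis_vec \<gamma>)) (w(k := basis_vec \<delta>)) =
      (\<Sum>\<alpha><m. \<Sum>\<beta><m. if \<beta> = \<delta> then if \<alpha> = \<gamma> then ev (jet_sum k t u w) (Q \<gamma> \<delta>) else 0 else 0)"
    unfolding contraction_def jet by (intro sum.cong refl) auto
  with assms show ?thesis
    by simp
qed

text \<open>The separation principle for tensors of degree \<open>k\<close>: basis vectors in slot
  \<open>k\<close> isolate a component, and jets with \<open>k\<close> summands detect every
  monomial of degree \<open>k\<close>.\<close>

lemma contraction_eq_imp:
  assumes outside: "\<And>\<alpha> \<beta>. m \<le> \<alpha> \<or> m \<le> \<beta> \<Longrightarrow> Q \<alpha> \<beta> = 0 \<and> Q' \<alpha> \<beta> = 0"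
    and deg: "\<And>\<alpha> \<beta> \<mu>. \<mu> \<in> Poly_Mapping.keys (Q \<alpha> \<beta>) \<union> Poly_Mapping.keys (Q' \<alpha> \<beta>) \<Longrightarrow> size (mono_mset \<mu>) = k"
    and eq: "\<And>t u w. contraction m k Q t u w = contraction m k Q' t u w"
  shows "Q = Q'"
proof (intro ext)
  fix \<alpha> \<beta>
  show "Q \<alpha> \<beta> = Q' \<alpha> \<beta>"
  proof (cases "\<alpha> < m \<and> \<beta> < m")
    case True
    let ?d = "Q \<alpha> \<beta> - Q' \<alpha> \<beta>"
    have zero: "ev (jet_sum k t u w) ?d = 0" for t u w
      using eq contraction_basis[of \<alpha> m \<beta> k Q t u w] contraction_basis[of \<alpha> m \<beta> k Q' t u w] True
      by (simp add: ev_minus)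
    have "Poly_Mapping.keys ?d = {}"
    proof (rule ccontr)
      assume "Poly_Mapping.keys ?d \<noteq> {}"
      then obtain \<mu> where \<mu>: "\<mu> \<in> Poly_Mapping.keys ?d"
        by blast
      have "size (mono_mset \<mu>) \<noteq> k"
        by (rule no_monomials_of_degree[OF _ \<mu>]) (rule zero)
      moreover have "\<mu> \<in> Poly_Mapping.keys (Q \<alpha> \<beta>) \<union> Poly_Mapping.keys (Q' \<alpha> \<beta>)"
        using Poly_Mapping.keys_diff \<mu> by (rule subsetD)
      ultimately show False
        using deg by blast
    qed
    then show ?thesis
      by simp
  next
    case False
    then show ?thesis
      using outside[of \<alpha> \<beta>] by auto
  qed
qed

definition transpose_act :: "nat \<Rightarrow> complex mat \<Rightarrow> (nat \<Rightarrow> nat \<Rightarrow> complex) \<Rightarrow> nat \<Rightarrow> nat \<Rightarrow> complex" where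
  "transpose_act m T u = (\<lambda>l a. \<Sum>c<m. T $$ (c, a) * u l c)"

definition conj_transpose_act :: "nat \<Rightarrow> complex mat \<Rightarrow> (nat \<Rightarrow> nat \<Rightarrow> complex) \<Rightarrow> nat \<Rightarrow> nat \<Rightarrow> complex" where
  "conj_transpose_act m T u = (\<lambda>l a. \<Sum>c<m. cnj (T $$ (c, a)) * u l c)"

definition matrix_act :: "nat \<Rightarrow> complex mat \<Rightarrow> (nat \<Rightarrow> nat \<Rightarrow> complex) \<Rightarrow> nat \<Rightarrow> nat \<Rightarrow> complex" where
  "matrix_act m T u = (\<lambda>l a. \<Sum>c<m. T $$ (a, c) * u l c)"

text \<open>The multilinear expansion of \<open>g(A;B)\<close> sums independently over the new index
  in each position; carrying out these sums replaces the vectors of a decomposable jet by their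
  images.\<close>

lemma ev_act_var:
  "ev (jet_sum k t u w) (act_var m T v) = jet_sum k t (transpose_act m T u) (conj_transpose_act m T w) v"
proof (cases v)
  case (Pair A B)
  define as where "as = sorted_list_of_multiset A"
  define bs where "bs = sorted_list_of_multiset B"
  have AB: "A = mset as" "B = mset bs"
    by (simp_all add: as_def bs_def)
  let ?Cs = "lists_over (length as) {..<m}" and ?Ds = "lists_over (length bs) {..<m}"
  let ?p = "\<lambda>cs. \<Prod>i<length as. T $$ (cs ! i, as ! i)"
  let ?q = "\<lambda>ds. \<Prod>j<length bs. cnj (T $$ (ds ! j, bs ! j))"
  have "ev (jet_sum k t u w) (act_var m T v) =
      (\<Sum>cs\<in>?Cs. \<Sum>ds\<in>?Ds. ?p cs * ?q ds * jet_sum k t u w (mset cs, mset ds))"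
    unfolding Pair act_var_def prod.case Let_def as_def[symmetric] bs_def[symmetric]
    by (simp add: ev_hom.hom_sum ev_hom.hom_mult)
  also have "\<dots> = (\<Sum>cs\<in>?Cs. \<Sum>ds\<in>?Ds. \<Sum>j<k. t j *
      (\<Prod>i<length as. T $$ (cs ! i, as ! i) * u j (cs ! i)) *
      (\<Prod>i<length bs. cnj (T $$ (ds ! i, bs ! i)) * w j (ds ! i)))"
    unfolding jet_sum_def prod.case sum_distrib_left
    by (intro sum.cong refl) (simp add: prod_mset_list prod.distrib mult_ac)
  also have "\<dots> = (\<Sum>j<k. t j *
      (\<Sum>cs\<in>?Cs. \<Prod>i<length as. T $$ (cs ! i, as ! i) * u j (cs ! i)) *
      (\<Sum>ds\<in>?Ds. \<Prod>i<length bs. cnj (T $$ (ds ! i, bs ! i)) * w j (ds ! i)))"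
  proof -
    have swap: "(\<Sum>a\<in>A. \<Sum>b\<in>B. \<Sum>c\<in>C. f a b c) = (\<Sum>c\<in>C. \<Sum>b\<in>B. \<Sum>a\<in>A. f a b c)"
      for f :: "nat list \<Rightarrow> nat list \<Rightarrow> nat \<Rightarrow> complex" and A B C
      by (subst sum.swap, subst (2) sum.swap, rule sum.swap)
    show ?thesis
      unfolding sum_distrib_left sum_distrib_right by (rule swap)
  qed
  also have "\<dots> = (\<Sum>j<k. t j *
      (\<Prod>i<length as. transpose_act m T u j (as ! i)) * (\<Prod>i<length bs. conj_transpose_act m T w j (bs ! i)))"
  proof -
    have "(\<Sum>cs\<in>?Cs. \<Prod>i<length as. T $$ (cs ! i, as ! i) * u j (cs ! i)) =
        (\<Prod>i<length as. transpose_act m T u j (as ! i))" for j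
      unfolding transpose_act_def
      using sum_prod_lists_over[where n = "length as" and A = "{..<m}" and h = "\<lambda>i c. T $$ (c, as ! i) * u j c"] .
    moreover have "(\<Sum>ds\<in>?Ds. \<Prod>i<length bs. cnj (T $$ (ds ! i, bs ! i)) * w j (ds ! i)) =
        (\<Prod>i<length bs. conj_transpose_act m T w j (bs ! i))" for j
      unfolding conj_transpose_act_def
      using sum_prod_lists_over[where n = "length bs" and A = "{..<m}" and h = "\<lambda>i c. cnj (T $$ (c, bs ! i)) * w j c"] .
    ultimately show ?thesis
      by simp
  qed
  finally show ?thesis
    by (simp add: Pair AB jet_sum_def prod_mset_list)
qed

lemma contraction_act:
  "contraction m k (act_tensor m T Q) t u w = contraction m k Q t (transpose_act m T u) (conj_transpose_act m T w)"
proof -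
  let ?e = "\<lambda>\<alpha> \<beta>. ev (jet_sum k t (transpose_act m T u) (conj_transpose_act m T w)) (Q \<alpha> \<beta>)"
  have "contraction m k (act_tensor m T Q) t u w =
      (\<Sum>\<gamma><m. \<Sum>\<delta><m. \<Sum>\<alpha><m. \<Sum>\<beta><m. u k \<gamma> * w k \<delta> * (T $$ (\<gamma>, \<alpha>) * cnj (T $$ (\<delta>, \<beta>)) * ?e \<alpha> \<beta>))"
    unfolding contraction_def
    by (intro sum.cong refl)
      (simp add: act_tensor_def ev_hom.hom_sum ev_hom.hom_mult ev_peval ev_act_var sum_distrib_left)
  also have "\<dots> = (\<Sum>\<gamma><m. \<Sum>\<alpha><m. \<Sum>\<delta><m. \<Sum>\<beta><m. u k \<gamma> * w k \<delta> * (T $$ (\<gamma>, \<alpha>) * cnj (T $$ (\<delta>, \<beta>)) * ?e \<alpha> \<beta>))"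
    by (intro sum.cong refl sum.swap)
  also have "\<dots> = (\<Sum>\<alpha><m. \<Sum>\<gamma><m. \<Sum>\<beta><m. \<Sum>\<delta><m. u k \<gamma> * w k \<delta> * (T $$ (\<gamma>, \<alpha>) * cnj (T $$ (\<delta>, \<beta>)) * ?e \<alpha> \<beta>))"
    by (subst sum.swap) (intro sum.cong refl sum.swap)
  also have "\<dots> = (\<Sum>\<alpha><m. \<Sum>\<beta><m. \<Sum>\<gamma><m. \<Sum>\<delta><m. u k \<gamma> * w k \<delta> * (T $$ (\<gamma>, \<alpha>) * cnj (T $$ (\<delta>, \<beta>)) * ?e \<alpha> \<beta>))"
    by (intro sum.cong refl sum.swap)
  also have "\<dots> = (\<Sum>\<alpha><m. \<Sum>\<beta><m. (\<Sum>\<gamma><m. T $$ (\<gamma>, \<alpha>) * u k \<gamma>) * (\<Sum>\<delta><m. cnj (T $$ (\<delta>, \<beta>)) * w k \<delta>) * ?e \<alpha> \<beta>)"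
    unfolding sum_product unfolding sum_distrib_right by (intro sum.cong refl) (simp only: mult_ac)
  finally show ?thesis
    unfolding contraction_def transpose_act_def conj_transpose_act_def .
qed

lemma mat_adjoint_index:
  fixes T :: "complex mat"
  assumes "T \<in> carrier_mat m m" "i < m" "j < m"
  shows "mat_adjoint T $$ (i, j) = cnj (T $$ (j, i))"
  using assms by (auto simp: mat_adjoint_def mat_of_rows_def)

lemma unitary_groupD:
  assumes "T \<in> unitary_group m"
  shows "T \<in> carrier_mat m m" "mat_adjoint T \<in> carrier_mat m m"
    "\<And>c d. c < m \<Longrightarrow> d < m \<Longrightarrow> (\<Sum>a<m. T $$ (c, a) * cnj (T $$ (d, a))) = (if c = d then 1 else 0)"
proof -
  show T: "T \<in> carrier_mat m m"
    using assms by (simp add: unitary_group_def)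
  then show A: "mat_adjoint T \<in> carrier_mat m m"
    by (auto simp: mat_adjoint_def)
  fix c d assume cd: "c < m" "d < m"
  have "(T * mat_adjoint T) $$ (c, d) = (\<Sum>a<m. T $$ (c, a) * cnj (T $$ (d, a)))"
    using T A cd by (simp add: scalar_prod_def mat_adjoint_index[OF T] lessThan_atLeast0)
  moreover have "T * mat_adjoint T = 1\<^sub>m m"
    using assms by (simp add: unitary_group_def)
  ultimately show "(\<Sum>a<m. T $$ (c, a) * cnj (T $$ (d, a))) = (if c = d then 1 else 0)"
    using cd by simp
qed

lemma gram_unitary:
  assumes T: "T \<in> unitary_group m"
  shows "gram m (transpose_act m T u) (conj_transpose_act m T w) = gram m u w"
proof (intro ext)
  fix i j
  have "gram m (transpose_act m T u) (conj_transpose_act m T w) i j =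
      (\<Sum>a<m. \<Sum>c<m. \<Sum>d<m. u i c * w j d * (T $$ (c, a) * cnj (T $$ (d, a))))"
    unfolding gram_def transpose_act_def conj_transpose_act_def sum_product
    by (intro sum.cong refl) (simp only: mult_ac)
  also have "\<dots> = (\<Sum>c<m. \<Sum>d<m. u i c * w j d * (\<Sum>a<m. T $$ (c, a) * cnj (T $$ (d, a))))"
    unfolding sum_distrib_left by (subst sum.swap) (intro sum.cong refl sum.swap)
  also have "\<dots> = (\<Sum>c<m. \<Sum>d<m. if d = c then u i c * w j c else 0)"
    using unitary_groupD(3)[OF T] by (intro sum.cong refl) auto
  finally show "gram m (transpose_act m T u) (conj_transpose_act m T w) i j = gram m u w i j"
    by (simp add: gram_def)
qed

text \<open>The matrix built from the transformed vectors is the old one conjugated by a unitary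
  matrix, so the invariance of \<open>S\<close> applies.\<close>

lemma polarized_unitary:
  assumes S: "S \<in> inv_polys m k" and T: "T \<in> unitary_group m"
  shows "polarized m k S (transpose_act m T u) (conj_transpose_act m T w) = polarized m k S u w"
proof -
  let ?B = "\<lambda>u w I. mat m m (\<lambda>(\<delta>, \<gamma>). \<Sum>j\<in>I. w j \<delta> * u j \<gamma>) :: complex mat"
  let ?A = "mat_adjoint T"
  note TA = unitary_groupD(1,2)[OF T]
  have "?B (transpose_act m T u) (conj_transpose_act m T w) I = ?A * ?B u w I * T" for I
  proof (rule eq_matI)
    fix \<delta> \<gamma> assume "\<delta> < dim_row (?A * ?B u w I * T)" "\<gamma> < dim_col (?A * ?B u w I * T)"
    then have i: "\<delta> < m" "\<gamma> < m"
      using TA by auto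
    have "(?A * ?B u w I * T) $$ (\<delta>, \<gamma>) = (\<Sum>c<m. (\<Sum>d<m. cnj (T $$ (d, \<delta>)) * (\<Sum>j\<in>I. w j d * u j c)) * T $$ (c, \<gamma>))"
      using TA i by (simp add: scalar_prod_def mat_adjoint_index[OF TA(1)] lessThan_atLeast0)
    also have "\<dots> = (\<Sum>c<m. \<Sum>d<m. \<Sum>j\<in>I. (T $$ (c, \<gamma>) * u j c) * (cnj (T $$ (d, \<delta>)) * w j d))"
      unfolding sum_distrib_left sum_distrib_right by (intro sum.cong refl) (simp only: mult_ac)
    also have "\<dots> = (\<Sum>j\<in>I. \<Sum>c<m. \<Sum>d<m. (T $$ (c, \<gamma>) * u j c) * (cnj (T $$ (d, \<delta>)) * w j d))"
      by (subst sum.swap[of _ I]) (intro sum.cong refl sum.swap)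
    also have "\<dots> = (\<Sum>j\<in>I. conj_transpose_act m T w j \<delta> * transpose_act m T u j \<gamma>)"
      unfolding conj_transpose_act_def transpose_act_def sum_product[symmetric] by (simp only: mult.commute)
    finally show "?B (transpose_act m T u) (conj_transpose_act m T w) I $$ (\<delta>, \<gamma>) = (?A * ?B u w I * T) $$ (\<delta>, \<gamma>)"
      using i by simp
  qed (use TA in auto)
  moreover have "mat_poly S (?A * B * T) = mat_poly S B" if "B \<in> carrier_mat m m" for B
    using S T TA that by (auto simp: inv_polys_def unitary_group_def)
  ultimately show ?thesis
    unfolding polarized_def by simp
qed

lemma act_tensor_size:
  assumes Q: "\<And>\<alpha> \<beta> \<mu>. \<mu> \<in> Poly_Mapping.keys (Q \<alpha> \<beta>) \<Longrightarrow> size (mono_mset \<mu>) = k"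
    and \<mu>: "\<mu> \<in> Poly_Mapping.keys (act_tensor m T Q \<gamma> \<delta>)"
  shows "size (mono_mset \<mu>) = k"
proof (rule homogeneous_imp_size[OF _ \<mu>])
  fix x :: "jet_var \<Rightarrow> complex"
  have scale: "ev (\<lambda>v. 2 * y v) (Q \<alpha> \<beta>) = 2 ^ k * ev y (Q \<alpha> \<beta>)" for y :: "jet_var \<Rightarrow> complex" and \<alpha> \<beta>
  proof -
    have "\<Prod>\<^sub># (image_mset (\<lambda>v. 2 * y v) M) = 2 ^ size M * \<Prod>\<^sub># (image_mset y M)" for M
      by (induction M) auto
    then show ?thesis
      unfolding peval_mset sum_distrib_left using Q by (intro sum.cong) auto
  qed
  have var: "ev (\<lambda>v. 2 * x v) (act_var m T v) = 2 * ev x (act_var m T v)" for v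
    by (cases v) (simp add: act_var_def Let_def ev_hom.hom_sum ev_hom.hom_mult sum_distrib_left mult_ac)
  show "ev (\<lambda>v. 2 * x v) (act_tensor m T Q \<gamma> \<delta>) = 2 ^ k * ev x (act_tensor m T Q \<gamma> \<delta>)"
    by (simp add: act_tensor_def ev_hom.hom_sum ev_hom.hom_mult ev_peval var scale sum_distrib_left
        mult.left_commute[of _ "2 ^ k"])
qed

text \<open>By \<open>contraction_Xi\<close> only the Gram matrix and the polarization matter, and a
  unitary matrix changes neither.\<close>

lemma Xi_invariant:
  assumes S: "S \<in> inv_polys m k" and T: "T \<in> unitary_group m"
  shows "act_tensor m T (Xi m k S) = Xi m k S"
proof (rule contraction_eq_imp[where m = m and k = k])
  fix \<alpha> \<beta> assume "m \<le> \<alpha> \<or> m \<le> \<beta>"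
  then show "act_tensor m T (Xi m k S) \<alpha> \<beta> = 0 \<and> Xi m k S \<alpha> \<beta> = 0"
    by (auto simp: act_tensor_def Xi_outside)
next
  fix \<alpha> \<beta> \<mu>
  assume "\<mu> \<in> Poly_Mapping.keys (act_tensor m T (Xi m k S) \<alpha> \<beta>) \<union> Poly_Mapping.keys (Xi m k S \<alpha> \<beta>)"
  then show "size (mono_mset \<mu>) = k"
    using Xi_keys(2)[OF S] act_tensor_size[of "Xi m k S" k \<mu> m T \<alpha> \<beta>] by blast
next
  fix t u w
  show "contraction m k (act_tensor m T (Xi m k S)) t u w = contraction m k (Xi m k S) t u w"
    unfolding contraction_act
    using contraction_Xi[of S m k, OF inv_polysD[OF S]]
    by (simp add: gram_unitary[OF T] polarized_unitary[OF S T])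
qed

lemma Xi_in_restriction_kernel:
  assumes "S \<in> inv_polys m k" "k < m"
  shows "Xi m k S \<in> restriction_kernel m k"
  using assms by (simp add: restriction_kernel_def invariant_jet_tensors_def Xi_in_jet_tensors Xi_invariant restrict_Xi)

section \<open>Density of the unitary group\<close>

lemma conj_transpose_matrix_act:
  assumes T: "T \<in> unitary_group m" and "a < m"
  shows "conj_transpose_act m T (matrix_act m T w) l a = w l a"
proof -
  have T': "(\<Sum>c<m. cnj (T $$ (c, a)) * T $$ (c, d)) = (if d = a then 1 else 0)" if "d < m" for d
  proof -
    have "(mat_adjoint T * T) $$ (a, d) = (\<Sum>c<m. cnj (T $$ (c, a)) * T $$ (c, d))"
      using unitary_groupD(1,2)[OF T] assms that
      by (simp add: scalar_prod_def mat_adjoint_index[OF unitary_groupD(1)[OF T]] lessThan_atLeast0)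
    moreover have "mat_adjoint T * T = 1\<^sub>m m"
      using T by (simp add: unitary_group_def)
    ultimately show ?thesis
      using assms that by auto
  qed
  have "conj_transpose_act m T (matrix_act m T w) l a = (\<Sum>d<m. (\<Sum>c<m. cnj (T $$ (c, a)) * T $$ (c, d)) * w l d)"
    unfolding conj_transpose_act_def matrix_act_def sum_distrib_left sum_distrib_right
    by (subst sum.swap) (simp only: mult.assoc)
  also have "\<dots> = (\<Sum>d<m. if d = a then w l a else 0)"
    using T' by (intro sum.cong) auto
  finally show ?thesis
    using assms by simp
qed

text \<open>A kernel vector \<open>v\<close> satisfies \<open>X v = - v\<close>. Hence the Hermitian
  product of \<open>v\<close> with \<open>X v\<close> is real, being minus the squared norm, while
  skewness makes it purely imaginary; so the norm is zero.\<close>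

lemma det_one_plus_skew_nonzero:
  fixes X :: "complex mat"
  assumes X: "X \<in> carrier_mat m m" and skew: "\<And>i j. i < m \<Longrightarrow> j < m \<Longrightarrow> cnj (X $$ (j, i)) = - X $$ (i, j)"
  shows "Determinant.det (1\<^sub>m m + X) \<noteq> 0"
proof
  assume "Determinant.det (1\<^sub>m m + X) = 0"
  then obtain v where v: "v \<in> carrier_vec m" "v \<noteq> 0\<^sub>v m" "(1\<^sub>m m + X) *\<^sub>v v = 0\<^sub>v m"
    using X det_0_iff_vec_prod_zero[of "1\<^sub>m m + X" m] by auto
  have Xv: "(\<Sum>j<m. X $$ (i, j) * v $ j) = - v $ i" if "i < m" for i
  proof -
    have "0 = ((1\<^sub>m m + X) *\<^sub>v v) $ i"
      unfolding v(3) using that by simp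
    also have "\<dots> = (\<Sum>j<m. ((if i = j then 1 else 0) + X $$ (i, j)) * v $ j)"
      using X v(1) that by (auto simp: scalar_prod_def lessThan_atLeast0 intro!: sum.cong)
    also have "\<dots> = (\<Sum>j<m. (if j = i then v $ i else 0) + X $$ (i, j) * v $ j)"
      by (intro sum.cong) (auto simp: algebra_simps)
    also have "\<dots> = v $ i + (\<Sum>j<m. X $$ (i, j) * v $ j)"
      using that by (simp add: sum.distrib)
    finally show ?thesis
      by (simp add: eq_neg_iff_add_eq_0 add.commute)
  qed
  let ?s = "\<Sum>i<m. cnj (v $ i) * v $ i"
  let ?t = "\<Sum>i<m. \<Sum>j<m. cnj (v $ i) * X $$ (i, j) * v $ j"
  have s_t: "?s = - ?t"
    by (simp add: Xv mult.assoc sum_negf flip: sum_distrib_left)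
  have t_skew: "cnj ?t = - ?t"
  proof -
    have "cnj ?t = (\<Sum>i<m. \<Sum>j<m. - (cnj (v $ j) * X $$ (j, i) * v $ i))"
      by (simp add: skew mult_ac)
    also have "\<dots> = (\<Sum>j<m. \<Sum>i<m. - (cnj (v $ j) * X $$ (j, i) * v $ i))"
      by (rule sum.swap)
    finally show ?thesis
      by (simp add: sum_negf)
  qed
  have "cnj ?s = ?t"
    unfolding s_t by (simp only: complex_cnj_minus t_skew minus_minus)
  moreover have "cnj ?s = ?s"
    by (simp add: mult.commute)
  ultimately have "?s = - ?s"
    using s_t by simp
  then have "?s = 0"
    by simp
  moreover have "Re ?s = (\<Sum>i<m. (cmod (v $ i))\<^sup>2)"
    by (simp add: cmod_def power2_eq_square)
  ultimately have "(\<Sum>i<m. (cmod (v $ i))\<^sup>2) = 0"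
    by simp
  then have "\<forall>i<m. v $ i = 0"
    by (subst (asm) sum_nonneg_eq_0_iff) auto
  then have "v = 0\<^sub>v m"
    using v(1) by (intro eq_vecI) auto
  with v show False
    by simp
qed

lemma smult_index: "A \<in> carrier_mat m m \<Longrightarrow> i < m \<Longrightarrow> j < m \<Longrightarrow> (c \<cdot>\<^sub>m A) $$ (i, j) = c * A $$ (i, j)"
  by auto

text \<open>Besides the inverse it provides the link with the adjugate, which, unlike the inverse,
  depends polynomially on the matrix.\<close>

lemma mat_inverse_exists:
  fixes Y :: "complex mat"
  assumes Y: "Y \<in> carrier_mat m m" and det: "Determinant.det Y \<noteq> 0"
  obtains Z where "Z \<in> carrier_mat m m" "Y * Z = 1\<^sub>m m" "Z * Y = 1\<^sub>m m"
    "adj_mat Y = Determinant.det Y \<cdot>\<^sub>m Z"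
proof
  let ?D = "Determinant.det Y"
  let ?Z = "inverse ?D \<cdot>\<^sub>m adj_mat Y"
  note adj = adj_mat[OF Y]
  show "?Z \<in> carrier_mat m m"
    using adj by simp
  show "Y * ?Z = 1\<^sub>m m"
    using det by (subst mult_smult_distrib[OF Y adj(1)]) (auto simp: adj intro!: eq_matI)
  show "?Z * Y = 1\<^sub>m m"
    using det by (subst mult_smult_assoc_mat[OF adj(1) Y]) (auto simp: adj intro!: eq_matI)
  show "adj_mat Y = ?D \<cdot>\<^sub>m ?Z"
    using adj(1) det by (intro eq_matI) auto
qed

lemma unitaryI:
  assumes U: "U \<in> carrier_mat m m"
    and UU: "\<And>i j. i < m \<Longrightarrow> j < m \<Longrightarrow> (\<Sum>l<m. cnj (U $$ (l, i)) * U $$ (l, j)) = (if i = j then 1 else 0)"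
  shows "U \<in> unitary_group m"
proof -
  have A: "mat_adjoint U \<in> carrier_mat m m"
    using U by (auto simp: mat_adjoint_def)
  have "mat_adjoint U * U = 1\<^sub>m m"
  proof (rule eq_matI)
    fix i j assume "i < dim_row (1\<^sub>m m)" "j < dim_col (1\<^sub>m m)"
    then have "i < m" "j < m"
      by auto
    then show "(mat_adjoint U * U) $$ (i, j) = 1\<^sub>m m $$ (i, j)"
      using U A UU by (simp add: scalar_prod_def mat_adjoint_index[OF U] lessThan_atLeast0[symmetric])
  qed (use U A in auto)
  moreover from mat_mult_left_right_inverse[OF A U this] have "U * mat_adjoint U = 1\<^sub>m m" .
  ultimately show ?thesis
    using U by (simp add: unitary_group_def)
qed

text \<open>For skew-Hermitian \<open>X\<close> the columns of \<open>1\<^sub>m m - X\<close> and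
  \<open>1\<^sub>m m + X\<close> have the same Hermitian products. This persists after
  multiplication by \<open>Z\<close>, which turns the second matrix into the identity.\<close>

lemma cayley_unitary:
  fixes X :: "complex mat"
  assumes X: "X \<in> carrier_mat m m" and skew: "\<And>i j. i < m \<Longrightarrow> j < m \<Longrightarrow> cnj (X $$ (j, i)) = - X $$ (i, j)"
    and Z: "Z \<in> carrier_mat m m" "(1\<^sub>m m + X) * Z = 1\<^sub>m m"
  shows "(1\<^sub>m m - X) * Z \<in> unitary_group m"
proof (rule unitaryI)
  let ?Y = "1\<^sub>m m + X" and ?N = "1\<^sub>m m - X"
  have Y: "?Y \<in> carrier_mat m m" and N: "?N \<in> carrier_mat m m"
    using X by auto
  have one: "1\<^sub>m m \<in> carrier_mat m m"
    by simp
  let ?d = "\<lambda>i j. if i = j then 1 else 0 :: complex"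
  let ?S = "\<lambda>A i j. \<Sum>l<m. cnj (A $$ (l, i)) * A $$ (l, j)"
  have norms: "?S ?N a b = ?S ?Y a b" if ab: "a < m" "b < m" for a b
  proof -
    have "?S ?N a b - ?S ?Y a b = (\<Sum>l<m. - 2 * (cnj (X $$ (l, a)) * ?d l b) - 2 * (?d l a * X $$ (l, b)))"
      unfolding sum_subtractf[symmetric] using X ab by (intro sum.cong) (auto simp: algebra_simps)
    also have "\<dots> = (\<Sum>l<m. (if l = b then - 2 * cnj (X $$ (l, a)) else 0) + (if l = a then - 2 * X $$ (l, b) else 0))"
      by (intro sum.cong) auto
    also have "\<dots> = - 2 * cnj (X $$ (b, a)) - 2 * X $$ (a, b)"
      using ab by (simp add: sum.distrib)
    also have "\<dots> = 0"
      using skew[OF ab] by simp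
    finally show ?thesis
      by simp
  qed
  have prod: "?S (A * Z) i j = (\<Sum>a<m. \<Sum>b<m. cnj (Z $$ (a, i)) * Z $$ (b, j) * ?S A a b)"
    if A: "A \<in> carrier_mat m m" and ij: "i < m" "j < m" for A i j
  proof -
    have "?S (A * Z) i j = (\<Sum>l<m. (\<Sum>a<m. cnj (A $$ (l, a) * Z $$ (a, i))) * (\<Sum>b<m. A $$ (l, b) * Z $$ (b, j)))"
      using A Z ij by (intro sum.cong) (simp_all add: scalar_prod_def lessThan_atLeast0)
    also have "\<dots> = (\<Sum>l<m. \<Sum>a<m. \<Sum>b<m. cnj (Z $$ (a, i)) * Z $$ (b, j) * (cnj (A $$ (l, a)) * A $$ (l, b)))"
      unfolding sum_product by (intro sum.cong refl) (simp add: mult_ac)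
    also have "\<dots> = (\<Sum>a<m. \<Sum>b<m. \<Sum>l<m. cnj (Z $$ (a, i)) * Z $$ (b, j) * (cnj (A $$ (l, a)) * A $$ (l, b)))"
      by (subst sum.swap) (intro sum.cong refl sum.swap)
    finally show ?thesis
      by (simp only: sum_distrib_left)
  qed
  fix i j assume ij: "i < m" "j < m"
  have "?S (?N * Z) i j = ?S (?Y * Z) i j"
    unfolding prod[OF N ij] prod[OF Y ij] by (intro sum.cong refl arg_cong2[where f = "(*)"] norms) auto
  also have "\<dots> = (\<Sum>l<m. if l = i then ?d i j else 0)"
    unfolding Z using ij by (intro sum.cong) auto
  finally show "?S (?N * Z) i j = ?d i j"
    using ij by simp
qed (use X Z in auto)

lemma polynomial_adj_mat:
  assumes "\<And>z. A z \<in> carrier_mat m m" "\<And>i j. i < m \<Longrightarrow> j < m \<Longrightarrow> polynomial_fun (\<lambda>z. A z $$ (i, j))" "i < m" "j < m"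
  shows "polynomial_fun (\<lambda>z. adj_mat (A z) $$ (i, j))"
proof -
  have dims: "dim_row (A z) = m" "dim_col (A z) = m" for z
    using assms(1)[of z] by auto
  have "adj_mat (A z) $$ (i, j) = (-1) ^ (j + i) * det_fun (m - 1) (\<lambda>i' j'.
      A z $$ (if i' < j then i' else Suc i', if j' < i then j' else Suc j'))" for z
    using assms(3,4) by (simp add: adj_mat_def cofactor_def mat_delete_def dims)
  moreover have "polynomial_fun (\<lambda>z. (-1) ^ (j + i) * det_fun (m - 1) (\<lambda>i' j'.
      A z $$ (if i' < j then i' else Suc i', if j' < i then j' else Suc j')))"
    by (intro polynomial_mult polynomial_const polynomial_det assms(2)) auto
  ultimately show ?thesis
    by simp
qed

lemma polynomial_mat_mult:
  assumes "\<And>z. A z \<in> carrier_mat m m" "\<And>z. B z \<in> carrier_mat m m"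
    "\<And>i j. i < m \<Longrightarrow> j < m \<Longrightarrow> polynomial_fun (\<lambda>z. A z $$ (i, j))"
    "\<And>i j. i < m \<Longrightarrow> j < m \<Longrightarrow> polynomial_fun (\<lambda>z. B z $$ (i, j))" "i < m" "j < m"
  shows "polynomial_fun (\<lambda>z. (A z * B z) $$ (i, j))"
proof -
  have "(A z * B z) $$ (i, j) = (\<Sum>l<m. A z $$ (i, l) * B z $$ (l, j))" for z
    using assms(1,2)[of z] assms(5,6) by (simp add: scalar_prod_def lessThan_atLeast0)
  moreover have "polynomial_fun (\<lambda>z. \<Sum>l<m. A z $$ (i, l) * B z $$ (l, j))"
    using assms by (intro polynomial_intros) auto
  ultimately show ?thesis
    by simp
qed

lemma infinite_unit_circle: "infinite {z. cmod z = 1}"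
proof
  assume fin: "finite {z. cmod z = 1}"
  have "{0..1} \<subseteq> Re ` {z. cmod z = 1}"
  proof
    fix t :: real assume "t \<in> {0..1}"
    then have "t\<^sup>2 \<le> 1"
      by (simp add: power_le_one)
    then have "cmod (Complex t (sqrt (1 - t\<^sup>2))) = 1"
      by (simp add: cmod_def)
    then show "t \<in> Re ` {z. cmod z = 1}"
      by (intro image_eqI[of _ _ "Complex t (sqrt (1 - t\<^sup>2))"]) auto
  qed
  with fin have "finite {0..1::real}"
    using finite_subset by blast
  then show False
    using infinite_Icc[of "0::real" 1] by simp
qed

text \<open>Vanishing spreads by complexification, from unimodular to all scalar multiples of
  unitary matrices, and from skew-Hermitian to all arguments of the Cayley transform. The adjugate
  in place of the inverse keeps the transform polynomial at the price of a scalar. Finally every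
  matrix is a scalar multiple of such a transform.\<close>

theorem unitary_group_dense:
  fixes P :: "complex mat \<Rightarrow> complex"
  assumes poly: "\<And>M. (\<And>z. M z \<in> carrier_mat m m) \<Longrightarrow>
      (\<And>i j. i < m \<Longrightarrow> j < m \<Longrightarrow> polynomial_fun (\<lambda>z. M z $$ (i, j))) \<Longrightarrow> polynomial_fun (\<lambda>z. P (M z))"
    and zero: "\<And>U. U \<in> unitary_group m \<Longrightarrow> P U = 0"
    and T: "T \<in> carrier_mat m m"
  shows "P T = 0"
proof -
  have scaled: "P (s \<cdot>\<^sub>m U) = 0" if U: "U \<in> unitary_group m" for s U
  proof (rule polynomial_fun_zero_infinite[OF _ infinite_unit_circle, where f = "\<lambda>z. P (z \<cdot>\<^sub>m U)"])
    note UD = unitary_groupD[OF U]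
    show "polynomial_fun (\<lambda>z. P (z \<cdot>\<^sub>m U))"
      using UD(1) by (intro poly) (auto simp: smult_index intro: polynomial_intros)
    fix z assume "z \<in> {z. cmod z = 1}"
    then have z: "cnj z * z = 1"
      by (simp add: mult.commute flip: complex_norm_square)
    have "z \<cdot>\<^sub>m U \<in> unitary_group m"
    proof (rule unitaryI)
      fix i j assume ij: "i < m" "j < m"
      have "(\<Sum>l<m. cnj ((z \<cdot>\<^sub>m U) $$ (l, i)) * (z \<cdot>\<^sub>m U) $$ (l, j)) = (cnj z * z) * (\<Sum>l<m. cnj (U $$ (l, i)) * U $$ (l, j))"
        unfolding sum_distrib_left using UD(1) ij by (intro sum.cong) (auto simp: mult_ac)
      also have "(\<Sum>l<m. cnj (U $$ (l, i)) * U $$ (l, j)) = (mat_adjoint U * U) $$ (i, j)"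
        using UD(1,2) ij by (simp add: scalar_prod_def mat_adjoint_index[OF UD(1)] lessThan_atLeast0)
      also have "\<dots> = (if i = j then 1 else 0)"
        using U ij by (simp add: unitary_group_def)
      finally show "(\<Sum>l<m. cnj ((z \<cdot>\<^sub>m U) $$ (l, i)) * (z \<cdot>\<^sub>m U) $$ (l, j)) = (if i = j then 1 else 0)"
        by (simp add: z)
    qed (use UD(1) in simp)
    then show "P (z \<cdot>\<^sub>m U) = 0"
      by (rule zero)
  qed
  have cayley: "P (r \<cdot>\<^sub>m ((1\<^sub>m m - X) * adj_mat (1\<^sub>m m + X))) = 0" if X: "X \<in> carrier_mat m m" for r X
  proof -
    \<comment> \<open>Both \<open>H\<close> and \<open>K\<close> are skew-Hermitian, hence so is
      \<open>H + z K\<close> for real \<open>z\<close>, while \<open>z = \<i>\<close> gives back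
      \<open>X\<close>.\<close>
    define H where "H = mat m m (\<lambda>(i, j). (X $$ (i, j) - cnj (X $$ (j, i))) / 2)"
    define K where "K = mat m m (\<lambda>(i, j). (X $$ (i, j) + cnj (X $$ (j, i))) / (2 * \<i>))"
    let ?X = "\<lambda>z. H + z \<cdot>\<^sub>m K"
    let ?M = "\<lambda>z. (1\<^sub>m m - ?X z) * adj_mat (1\<^sub>m m + ?X z)"
    have car: "H \<in> carrier_mat m m" "K \<in> carrier_mat m m"
      by (simp_all add: H_def K_def)
    then have carX: "?X z \<in> carrier_mat m m" "1\<^sub>m m - ?X z \<in> carrier_mat m m" "1\<^sub>m m + ?X z \<in> carrier_mat m m" for z
      by auto
    have "P (r \<cdot>\<^sub>m ?M \<i>) = 0"
    proof (rule polynomial_fun_zero_infinite[where Z = "range complex_of_real" and f = "\<lambda>z. P (r \<cdot>\<^sub>m ?M z)"])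
      show "infinite (range complex_of_real)"
        using finite_imageD[of complex_of_real UNIV] inj_of_real infinite_UNIV_char_0 by blast
      have M: "polynomial_fun (\<lambda>z. ?M z $$ (i, j))" if "i < m" "j < m" for i j
      proof (rule polynomial_mat_mult[OF carX(2) adj_mat(1)[OF carX(3)] _ _ that])
        show "polynomial_fun (\<lambda>z. (1\<^sub>m m - ?X z) $$ (i, j))" if "i < m" "j < m" for i j
        proof -
          have "(1\<^sub>m m - ?X z) $$ (i, j) = (if i = j then 1 else 0) - (H $$ (i, j) + z * K $$ (i, j))" for z
            using that car by auto
          then show ?thesis
            by (simp only:) (intro polynomial_intros)
        qed
        show "polynomial_fun (\<lambda>z. adj_mat (1\<^sub>m m + ?X z) $$ (i, j))" if "i < m" "j < m" for i j
        proof (rule polynomial_adj_mat[OF carX(3) _ that])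
          show "polynomial_fun (\<lambda>z. (1\<^sub>m m + ?X z) $$ (i, j))" if "i < m" "j < m" for i j
          proof -
            have "(1\<^sub>m m + ?X z) $$ (i, j) = (if i = j then 1 else 0) + (H $$ (i, j) + z * K $$ (i, j))" for z
              using that car by auto
            then show ?thesis
              by (simp only:) (intro polynomial_intros)
          qed
        qed
      qed
      have carM: "?M z \<in> carrier_mat m m" for z
        using carX(2)[of z] adj_mat(1)[OF carX(3)[of z]] by simp
      show "polynomial_fun (\<lambda>z. P (r \<cdot>\<^sub>m ?M z))"
      proof (rule poly)
        show "r \<cdot>\<^sub>m ?M z \<in> carrier_mat m m" for z
          using carM by simp
        show "polynomial_fun (\<lambda>z. (r \<cdot>\<^sub>m ?M z) $$ (i, j))" if "i < m" "j < m" for i j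
          unfolding smult_index[OF carM that] by (intro polynomial_mult polynomial_const M that)
      qed
      fix z assume "z \<in> range complex_of_real"
      then have "cnj z = z"
        by auto
      then have skew: "cnj (?X z $$ (j, i)) = - ?X z $$ (i, j)" if "i < m" "j < m" for i j
        using that by (simp add: H_def K_def field_simps)
      let ?Y = "1\<^sub>m m + ?X z"
      have "Determinant.det ?Y \<noteq> 0"
        using carX(1) skew by (intro det_one_plus_skew_nonzero) auto
      then obtain Z where Z: "Z \<in> carrier_mat m m" "?Y * Z = 1\<^sub>m m" "adj_mat ?Y = Determinant.det ?Y \<cdot>\<^sub>m Z"
        using mat_inverse_exists[OF carX(3)] by blast
      let ?U = "(1\<^sub>m m - ?X z) * Z"
      have U: "?U \<in> unitary_group m"
        using carX(1) skew Z(1,2) by (rule cayley_unitary)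
      have "?M z = Determinant.det ?Y \<cdot>\<^sub>m ?U"
        unfolding Z(3) by (rule mult_smult_distrib[OF carX(2) Z(1)])
      then have "r \<cdot>\<^sub>m ?M z = (r * Determinant.det ?Y) \<cdot>\<^sub>m ?U"
        by (auto intro!: eq_matI simp: mult.assoc)
      then show "P (r \<cdot>\<^sub>m ?M z) = 0"
        using scaled[OF U] by simp
    qed
    moreover have "?X \<i> = X"
      using X by (intro eq_matI) (auto simp: H_def K_def field_simps)
    ultimately show ?thesis
      by simp
  qed
  \<comment> \<open>The determinant is 1 at \<open>s = 0\<close>, so as a polynomial in
    \<open>s\<close> it cannot vanish at all nonzero \<open>s\<close>.\<close>
  have "\<exists>s. s \<noteq> 0 \<and> Determinant.det (1\<^sub>m m + s \<cdot>\<^sub>m T) \<noteq> 0"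
  proof (rule ccontr)
    assume contra: "\<not> ?thesis"
    define g where "g = (\<lambda>s. Determinant.det (1\<^sub>m m + s \<cdot>\<^sub>m T))"
    have g: "g = (\<lambda>s. det_fun m (\<lambda>i j. (if i = j then 1 else 0) + s * T $$ (i, j)))"
      unfolding g_def using T by (intro ext arg_cong[where f = Determinant.det] eq_matI) auto
    have "g 0 = 0"
    proof (rule polynomial_fun_zero[where f = g and g = "\<lambda>s. s" and ?z0.0 = 1])
      show "polynomial_fun g"
        unfolding g by (intro polynomial_intros)
      show "g z = 0" if "z \<noteq> 0" for z
        using that contra unfolding g_def by auto
    qed (auto intro: polynomial_intros)
    then show False
      unfolding g by (simp add: det_fun_one)
  qed
  then obtain s where s: "s \<noteq> 0" "Determinant.det (1\<^sub>m m + s \<cdot>\<^sub>m T) \<noteq> 0"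
    by auto
  let ?Y = "1\<^sub>m m + s \<cdot>\<^sub>m T" and ?N = "1\<^sub>m m - s \<cdot>\<^sub>m T"
  have Y: "?Y \<in> carrier_mat m m" and N: "?N \<in> carrier_mat m m"
    using T by auto
  obtain Z where Z: "Z \<in> carrier_mat m m" "?Y * Z = 1\<^sub>m m" "Z * ?Y = 1\<^sub>m m"
    using mat_inverse_exists[OF Y s(2)] by blast
  \<comment> \<open>The Cayley transform is an involution, so this is the argument whose transform
    is \<open>s\<close> times \<open>T\<close>.\<close>
  let ?X = "?N * Z"
  have X: "?X \<in> carrier_mat m m"
    using N Z(1) by simp
  have plus: "1\<^sub>m m + ?X = 2 \<cdot>\<^sub>m Z"
  proof -
    have "1\<^sub>m m + ?X = ?Y * Z + ?N * Z"
      unfolding Z(2) ..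
    also have "\<dots> = (?Y + ?N) * Z"
      by (rule add_mult_distrib_mat[OF Y N Z(1), symmetric])
    also have "?Y + ?N = 2 \<cdot>\<^sub>m 1\<^sub>m m"
      using T by (intro eq_matI) auto
    also have "(2 \<cdot>\<^sub>m 1\<^sub>m m) * Z = 2 \<cdot>\<^sub>m (1\<^sub>m m * Z)"
      using Z(1) by (intro mult_smult_assoc_mat[of _ m m _ m]) auto
    finally show ?thesis
      using Z(1) by simp
  qed
  have minus: "1\<^sub>m m - ?X = (2 * s) \<cdot>\<^sub>m (T * Z)"
  proof -
    have "1\<^sub>m m - ?X = ?Y * Z - ?N * Z"
      unfolding Z(2) ..
    also have "\<dots> = (?Y - ?N) * Z"
      by (rule minus_mult_distrib_mat[OF Y N Z(1), symmetric])
    also have "?Y - ?N = (2 * s) \<cdot>\<^sub>m T"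
      using T by (intro eq_matI) (auto simp: algebra_simps)
    also have "((2 * s) \<cdot>\<^sub>m T) * Z = (2 * s) \<cdot>\<^sub>m (T * Z)"
      using T Z(1) by (intro mult_smult_assoc_mat[of _ m m _ m]) auto
    finally show ?thesis .
  qed
  let ?D = "Determinant.det (2 \<cdot>\<^sub>m Z)"
  have Z2: "2 \<cdot>\<^sub>m Z \<in> carrier_mat m m"
    using Z(1) by simp
  have inv: "(2 \<cdot>\<^sub>m Z) * ((1 / 2) \<cdot>\<^sub>m ?Y) = 1\<^sub>m m" "((1 / 2) \<cdot>\<^sub>m ?Y) * (2 \<cdot>\<^sub>m Z) = 1\<^sub>m m"
  proof -
    have "(2 \<cdot>\<^sub>m Z) * ((1 / 2) \<cdot>\<^sub>m ?Y) = 2 \<cdot>\<^sub>m (Z * ((1 / 2) \<cdot>\<^sub>m ?Y))"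
      using Y by (intro mult_smult_assoc_mat[OF Z(1), of _ m]) simp
    also have "Z * ((1 / 2) \<cdot>\<^sub>m ?Y) = (1 / 2) \<cdot>\<^sub>m 1\<^sub>m m"
      using mult_smult_distrib[OF Z(1) Y] Z(3) by simp
    finally show 1: "(2 \<cdot>\<^sub>m Z) * ((1 / 2) \<cdot>\<^sub>m ?Y) = 1\<^sub>m m"
      by (auto intro!: eq_matI)
    show "((1 / 2) \<cdot>\<^sub>m ?Y) * (2 \<cdot>\<^sub>m Z) = 1\<^sub>m m"
      using Y by (intro mat_mult_left_right_inverse[OF Z2 _ 1]) auto
  qed
  have D: "?D \<noteq> 0"
  proof
    assume "?D = 0"
    then have "Determinant.det ((2 \<cdot>\<^sub>m Z) * ((1 / 2) \<cdot>\<^sub>m ?Y)) = 0"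
      using Y by (subst det_mult[OF Z2]) auto
    then show False
      unfolding inv by simp
  qed
  obtain Z' where Z': "Z' \<in> carrier_mat m m" "(2 \<cdot>\<^sub>m Z) * Z' = 1\<^sub>m m" "Z' * (2 \<cdot>\<^sub>m Z) = 1\<^sub>m m" "adj_mat (2 \<cdot>\<^sub>m Z) = ?D \<cdot>\<^sub>m Z'"
    using mat_inverse_exists[OF Z2 D] by blast
  have "T * Z * (2 \<cdot>\<^sub>m Z') = T"
  proof -
    have "T * Z * (2 \<cdot>\<^sub>m Z') = T * (Z * (2 \<cdot>\<^sub>m Z'))"
      using T Z(1) Z'(1) by (intro assoc_mult_mat[of _ m m _ m _ m]) auto
    also have "Z * (2 \<cdot>\<^sub>m Z') = (2 \<cdot>\<^sub>m Z) * Z'"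
      using mult_smult_distrib[OF Z(1) Z'(1), of 2] mult_smult_assoc_mat[OF Z(1) Z'(1), of 2] by simp
    finally show ?thesis
      using Z' T by simp
  qed
  have "(1\<^sub>m m - ?X) * adj_mat (1\<^sub>m m + ?X) = (s * ?D) \<cdot>\<^sub>m T"
  proof -
    have TZ: "T * Z \<in> carrier_mat m m"
      using T Z(1) by simp
    have "(1\<^sub>m m - ?X) * adj_mat (1\<^sub>m m + ?X) = ((2 * s) \<cdot>\<^sub>m (T * Z)) * (?D \<cdot>\<^sub>m Z')"
      unfolding plus minus Z' ..
    also have "\<dots> = (2 * s) \<cdot>\<^sub>m (T * Z * (?D \<cdot>\<^sub>m Z'))"
      using TZ Z'(1) by (intro mult_smult_assoc_mat[of _ m m _ m]) auto
    also have "T * Z * (?D \<cdot>\<^sub>m Z') = ?D \<cdot>\<^sub>m (T * Z * Z')"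
      by (rule mult_smult_distrib[OF TZ Z'(1)])
    also have "(2 * s) \<cdot>\<^sub>m (?D \<cdot>\<^sub>m (T * Z * Z')) = (s * ?D) \<cdot>\<^sub>m (2 \<cdot>\<^sub>m (T * Z * Z'))"
      by (intro eq_matI) (auto simp: mult_ac)
    also have "2 \<cdot>\<^sub>m (T * Z * Z') = T * Z * (2 \<cdot>\<^sub>m Z')"
      by (rule mult_smult_distrib[OF TZ Z'(1), symmetric])
    finally show ?thesis
      unfolding \<open>T * Z * (2 \<cdot>\<^sub>m Z') = T\<close> .
  qed
  then have "P ((1 / (s * ?D)) \<cdot>\<^sub>m ((s * ?D) \<cdot>\<^sub>m T)) = 0"
    using cayley[OF X] by simp
  moreover have "(1 / (s * ?D)) \<cdot>\<^sub>m ((s * ?D) \<cdot>\<^sub>m T) = T"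
    using s D T by (intro eq_matI) auto
  ultimately show ?thesis
    by simp
qed

section \<open>Homogeneous polynomials divisible by the determinant\<close>

text \<open>If \<open>z ^ d\<close> times the value at \<open>inverse z\<close> is again polynomial,
  no coefficient lies beyond \<open>d\<close>. For a function homogeneous of degree
  \<open>d\<close>, the parametrizations \<open>r + z * r'\<close> and \<open>z * r + r'\<close> are
  related in this way, which gives its expansion along lines.\<close>

lemma polynomial_reflect:
  assumes f: "polynomial_fun f" and g: "polynomial_fun g" and fg: "\<And>z. z \<noteq> 0 \<Longrightarrow> g z = z ^ d * f (inverse z)"
  shows "\<exists>p. f = poly p \<and> degree p \<le> d \<and> coeff p 0 = f 0 \<and> coeff p d = g 0"
proof -
  obtain p q where p: "f = poly p" and q: "g = poly q"
    using f g by (auto simp: polynomial_fun_def)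
  have refl: "z ^ degree p * poly q z = z ^ d * poly (reflect_poly p) z" if "z \<noteq> 0" for z
    using that fg[of z] poly_reflect_poly_nz[of z p] unfolding p q by simp
  have poly: "polynomial_fun (poly q)" "polynomial_fun (poly (reflect_poly p))"
    by (auto simp: polynomial_fun_def)
  have "z ^ degree p * poly q z - z ^ d * poly (reflect_poly p) z = 0" for z
  proof (rule polynomial_fun_zero[where f = "\<lambda>z. z ^ degree p * poly q z - z ^ d * poly (reflect_poly p) z"
        and g = "\<lambda>z. z" and ?z0.0 = 1])
    show "z ^ degree p * poly q z - z ^ d * poly (reflect_poly p) z = 0" if "z \<noteq> 0" for z
      using refl[OF that] by simp
  qed (auto intro!: polynomial_intros poly)
  then have "poly (monom 1 (degree p) * q) z = poly (monom 1 d * reflect_poly p) z" for z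
    by (simp add: poly_monom)
  then have eq: "monom 1 (degree p) * q = monom 1 d * reflect_poly p"
    by (intro poly_eq_poly_eq_iff[THEN iffD1] ext)
  have deg: "degree p \<le> d"
  proof (rule ccontr)
    assume "\<not> degree p \<le> d"
    then have "d < degree p" "p \<noteq> 0"
      by auto
    then have "coeff (monom 1 (degree p) * q) d = 0"
      by (simp add: coeff_monom_mult)
    moreover have "coeff (monom 1 d * reflect_poly p) d = lead_coeff p"
      by (simp add: coeff_monom_mult coeff_reflect_poly)
    ultimately show False
      using eq \<open>p \<noteq> 0\<close> by simp
  qed
  have "coeff (monom 1 (degree p) * q) (degree p) = coeff q 0"
    by (simp add: coeff_monom_mult)
  moreover have "coeff (monom 1 d * reflect_poly p) (degree p) = coeff p d"
  proof (cases "degree p = d")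
    case True
    then show ?thesis
      by (simp add: coeff_monom_mult coeff_reflect_poly)
  next
    case False
    with deg have "degree p < d"
      by simp
    then show ?thesis
      by (simp add: coeff_monom_mult coeff_eq_0)
  qed
  ultimately have "coeff p d = g 0"
    using eq q by (simp add: poly_0_coeff_0)
  then show ?thesis
    using p deg by (intro exI[of _ p]) (simp add: poly_0_coeff_0)
qed

lemma poly_sum_atMost:
  fixes p :: "complex poly"
  assumes "degree p \<le> d"
  shows "poly p z = (\<Sum>i\<le>d. coeff p i * z ^ i)"
  unfolding poly_altdef using assms by (intro sum.mono_neutral_left) (auto simp: coeff_eq_0)

lemma polynomial_reflect_1:
  assumes "polynomial_fun f" "polynomial_fun g" "\<And>z. z \<noteq> 0 \<Longrightarrow> g z = z * f (inverse z)"
  shows "f z = f 0 + z * g 0"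
proof -
  obtain p where p: "f = poly p" "degree p \<le> 1" "coeff p 0 = f 0" "coeff p 1 = g 0"
    using polynomial_reflect[of f g 1] assms by auto
  have "poly p z = (\<Sum>i\<le>1. coeff p i * z ^ i)"
    by (rule poly_sum_atMost) (fact p(2))
  then show ?thesis
    using p by (simp add: mult.commute)
qed

lemma polynomial_reflect_2:
  assumes "polynomial_fun f" "polynomial_fun g" "\<And>z. z \<noteq> 0 \<Longrightarrow> g z = z ^ 2 * f (inverse z)"
  shows "\<exists>b. \<forall>z. f z = f 0 + z * b + z ^ 2 * g 0"
proof -
  obtain p where p: "f = poly p" "degree p \<le> 2" "coeff p 0 = f 0" "coeff p 2 = g 0"
    using polynomial_reflect[of f g 2] assms by auto
  have "f z = f 0 + z * coeff p 1 + z ^ 2 * g 0" for z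
  proof -
    have "f z = (\<Sum>i\<le>2. coeff p i * z ^ i)"
      unfolding p(1) by (rule poly_sum_atMost) (fact p(2))
    also have "\<dots> = coeff p 0 + z * coeff p 1 + z ^ 2 * coeff p 2"
      by (simp add: numeral_2_eq_2 mult.commute)
    finally show ?thesis
      unfolding p(3,4) .
  qed
  then show ?thesis
    by blast
qed

section \<open>Row expansions and diagonally dominant matrices\<close>

lemma det_fun_row:
  assumes "i < n"
  shows "\<exists>C. \<forall>r. det_fun n (G(i := r)) = (\<Sum>j<n. r j * C j)"
proof (intro exI allI)
  fix r
  let ?M = "\<lambda>r. mat n n (\<lambda>(a, b). (G(i := r)) a b)"
  have "det_fun n (G(i := r)) = (\<Sum>j<n. ?M r $$ (i, j) * cofactor (?M r) i j)"
    using assms by (intro laplace_expansion_row) auto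
  also have "\<dots> = (\<Sum>j<n. r j * cofactor (?M (\<lambda>_. 0)) i j)"
  proof (intro sum.cong refl arg_cong2[where f = "(*)"])
    fix j assume "j \<in> {..<n}"
    then show "?M r $$ (i, j) = r j"
      using assms by simp
    have "mat_delete (?M r) i j = mat_delete (?M (\<lambda>_. 0)) i j"
      by (intro eq_matI) (auto simp: mat_delete_def)
    then show "cofactor (?M r) i j = cofactor (?M (\<lambda>_. 0)) i j"
      by (simp add: cofactor_def)
  qed
  finally show "det_fun n (G(i := r)) = (\<Sum>j<n. r j * cofactor (?M (\<lambda>_. 0)) i j)" .
qed

lemma sum_lists_over_snoc:
  "(\<Sum>xs\<in>lists_over (Suc n) A. f xs) = (\<Sum>xs\<in>lists_over n A. \<Sum>x\<in>A. f (xs @ [x]))"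
proof -
  have inj: "inj_on (\<lambda>(xs, x). xs @ [x]) (lists_over n A \<times> A)"
    by (auto simp: inj_on_def)
  have img: "lists_over (Suc n) A = (\<lambda>(xs, x). xs @ [x]) ` (lists_over n A \<times> A)"
  proof (intro equalityI subsetI)
    fix ys assume ys: "ys \<in> lists_over (Suc n) A"
    then have "ys \<noteq> []"
      by auto
    then obtain xs x where "ys = xs @ [x]"
      by (metis append_butlast_last_id)
    with ys show "ys \<in> (\<lambda>(xs, x). xs @ [x]) ` (lists_over n A \<times> A)"
      by (auto simp: image_iff)
  qed auto
  show ?thesis
    unfolding img sum.reindex[OF inj] sum.cartesian_product
    by (intro sum.cong refl) (simp only: o_def case_prod_unfold)
qed

text \<open>Dominance is a condition on each row separately, so rows can be replaced one at a time
  without leaving the set where the determinant is nonzero.\<close>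

definition dominant_row :: "nat \<Rightarrow> nat \<Rightarrow> (nat \<Rightarrow> complex) \<Rightarrow> bool" where
  "dominant_row k i r \<longleftrightarrow> (\<Sum>j\<in>{..k} - {i}. cmod (r j)) < cmod (r i)"

definition dominant :: "nat \<Rightarrow> (nat \<Rightarrow> nat \<Rightarrow> complex) \<Rightarrow> bool" where
  "dominant k G \<longleftrightarrow> (\<forall>i\<le>k. dominant_row k i (G i))"

lemma dominant_upd: "dominant k G \<Longrightarrow> dominant_row k i r \<Longrightarrow> dominant k (G(i := r))"
  by (simp add: dominant_def)

text \<open>In the row that belongs to a component of largest modulus of a kernel vector, the
  diagonal term would outweigh all the others together.\<close>

lemma dominant_det_nonzero:
  assumes dom: "dominant k G"
  shows "det_fun (Suc k) G \<noteq> 0"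
proof
  assume "det_fun (Suc k) G = 0"
  then obtain v where v: "v \<in> carrier_vec (Suc k)" "v \<noteq> 0\<^sub>v (Suc k)" "mat (Suc k) (Suc k) (\<lambda>(i, j). G i j) *\<^sub>v v = 0\<^sub>v (Suc k)"
    using det_0_iff_vec_prod_zero[of "mat (Suc k) (Suc k) (\<lambda>(i, j). G i j)" "Suc k"] by auto
  have Gv: "(\<Sum>j\<le>k. G i j * v $ j) = 0" if "i \<le> k" for i
  proof -
    have "0 = (mat (Suc k) (Suc k) (\<lambda>(i, j). G i j) *\<^sub>v v) $ i"
      unfolding v(3) using that by simp
    also have "\<dots> = (\<Sum>j\<le>k. G i j * v $ j)"
      using v(1) that by (auto simp: scalar_prod_def atLeast0LessThan lessThan_Suc_atMost intro!: sum.cong)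
    finally show ?thesis
      by simp
  qed
  obtain q where q: "q \<le> k" "v $ q \<noteq> 0"
    using v(1,2) by (metis carrier_vecD eq_vecI index_zero_vec less_Suc_eq_le)
  have "\<exists>p\<le>k. \<forall>i\<le>k. cmod (v $ i) \<le> cmod (v $ p)"
  proof -
    let ?S = "(\<lambda>i. cmod (v $ i)) ` {..k}"
    have "Max ?S \<in> ?S"
      by (intro Max_in) auto
    then obtain p where "Max ?S = cmod (v $ p)" "p \<in> {..k}"
      by (rule imageE)
    moreover have "cmod (v $ i) \<le> Max ?S" if "i \<le> k" for i
      using that by (intro Max_ge) auto
    ultimately have "p \<le> k \<and> (\<forall>i\<le>k. cmod (v $ i) \<le> cmod (v $ p))"
      by simp
    then show ?thesis
      by blast
  qed
  then obtain p where p: "p \<le> k" "\<And>i. i \<le> k \<Longrightarrow> cmod (v $ i) \<le> cmod (v $ p)"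
    by blast
  have vp: "0 < cmod (v $ p)"
    using q p(2)[OF q(1)] by (meson less_le_trans zero_less_norm_iff)
  have "G p p * v $ p = - (\<Sum>j\<in>{..k} - {p}. G p j * v $ j)"
    using Gv[OF p(1)] p(1) by (simp add: sum.remove[of "{..k}" p] eq_neg_iff_add_eq_0)
  then have "cmod (G p p) * cmod (v $ p) = cmod (\<Sum>j\<in>{..k} - {p}. G p j * v $ j)"
    by (metis norm_minus_cancel norm_mult)
  also have "\<dots> \<le> (\<Sum>j\<in>{..k} - {p}. cmod (G p j) * cmod (v $ p))"
    using p(2) by (intro order_trans[OF norm_sum] sum_mono) (simp add: norm_mult mult_left_mono)
  also have "\<dots> = (\<Sum>j\<in>{..k} - {p}. cmod (G p j)) * cmod (v $ p)"
    by (simp add: sum_distrib_right)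
  also have "\<dots> < cmod (G p p) * cmod (v $ p)"
    using dom p(1) vp by (simp add: dominant_def dominant_row_def)
  finally show False
    by simp
qed

text \<open>The weight \<open>1 / 2\<close> on the off-diagonal entry keeps the row dominant; it
  accounts for the factor 2 in \<open>row_coeff\<close>.\<close>

lemma dominant_basis:
  "dominant_row k i (basis_vec i)"
  "i \<noteq> j \<Longrightarrow> dominant_row k i (\<lambda>a. basis_vec i a + basis_vec j a / 2)"
proof -
  show "dominant_row k i (basis_vec i)"
    by (simp add: dominant_row_def)
  assume "i \<noteq> j"
  have "(\<Sum>a\<in>{..k} - {i}. cmod (basis_vec i a + basis_vec j a / 2)) = (\<Sum>a\<in>{..k} - {i}. if a = j then 1 / 2 else 0)"
    by (intro sum.cong) (auto simp: norm_divide)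
  also have "\<dots> \<le> 1 / 2"
    by simp
  also have "\<dots> < cmod (basis_vec i i + basis_vec j i / 2)"
    using \<open>i \<noteq> j\<close> by simp
  finally show "dominant_row k i (\<lambda>a. basis_vec i a + basis_vec j a / 2)"
    unfolding dominant_row_def .
qed

text \<open>
  The coefficient of the \<open>j\<close>-th entry of row \<open>i\<close> in a function \<open>h\<close> that is linear in row \<open>i\<close> as long as
  the matrix stays diagonally dominant.
\<close>

definition row_coeff ::
  "nat \<Rightarrow> nat \<Rightarrow> ((nat \<Rightarrow> nat \<Rightarrow> complex) \<Rightarrow> complex) \<Rightarrow> (nat \<Rightarrow> nat \<Rightarrow> complex) \<Rightarrow> complex" where
  "row_coeff i j h G = (if j = i then h (G(i := basis_vec i))
     else 2 * (h (G(i := (\<lambda>a. basis_vec i a + basis_vec j a / 2))) - h (G(i := basis_vec i))))"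

definition row_linear :: "nat \<Rightarrow> nat \<Rightarrow> ((nat \<Rightarrow> nat \<Rightarrow> complex) \<Rightarrow> complex) \<Rightarrow> bool" where
  "row_linear k i h \<longleftrightarrow> (\<forall>G. dominant k G \<longrightarrow> h G = (\<Sum>j\<le>k. G i j * row_coeff i j h G))"

text \<open>\<open>row_coeff i j h\<close> combines values of \<open>h\<close> at matrices whose row
  \<open>i\<close> has been replaced by fixed dominant rows, which leaves linearity in another row
  intact.\<close>

lemma row_linear_row_coeff:
  assumes lin: "row_linear k i' h" and "i \<noteq> i'"
  shows "row_linear k i' (row_coeff i j h)"
  unfolding row_linear_def
proof (intro allI impI)
  fix G assume G: "dominant k G"
  have *: "h (G(i := r)) = (\<Sum>j'\<le>k. G i' j' * row_coeff i' j' h (G(i := r)))" if "dominant_row k i r" for r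
    using lin dominant_upd[OF G that] \<open>i \<noteq> i'\<close> by (simp add: row_linear_def)
  have twist: "G(i' := r', i := r) = G(i := r, i' := r')" for r r' :: "nat \<Rightarrow> complex"
    using \<open>i \<noteq> i'\<close> by (simp add: fun_upd_twist)
  show "row_coeff i j h G = (\<Sum>j'\<le>k. G i' j' * row_coeff i' j' (row_coeff i j h) G)"
  proof (cases "j = i")
    case True
    have "row_coeff i' j' (row_coeff i j h) G = row_coeff i' j' h (G(i := basis_vec i))" for j'
      using True by (simp add: row_coeff_def twist)
    moreover have "row_coeff i j h G = h (G(i := basis_vec i))"
      using True by (simp add: row_coeff_def)
    ultimately show ?thesis
      using *[OF dominant_basis(1)] by simp
  next
    case False
    let ?b = "\<lambda>a. basis_vec i a + basis_vec j a / 2"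
    have e: "row_coeff i' j' (row_coeff i j h) G =
        2 * (row_coeff i' j' h (G(i := ?b)) - row_coeff i' j' h (G(i := basis_vec i)))" for j'
      using False by (simp add: row_coeff_def twist algebra_simps)
    have "(\<Sum>j'\<le>k. G i' j' * row_coeff i' j' (row_coeff i j h) G) =
        2 * ((\<Sum>j'\<le>k. G i' j' * row_coeff i' j' h (G(i := ?b))) - (\<Sum>j'\<le>k. G i' j' * row_coeff i' j' h (G(i := basis_vec i))))"
      unfolding e sum_subtractf[symmetric] sum_distrib_left by (intro sum.cong refl) (simp add: algebra_simps)
    also have "\<dots> = row_coeff i j h G"
      using False *[OF dominant_basis(1)] *[OF dominant_basis(2)[of i j k]] by (simp add: row_coeff_def[of i j])
    finally show ?thesis
      by simp
  qed
qed

lemma row_coeff_upd_same: "row_coeff i j h (G(i := r)) = row_coeff i j h G"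
  by (simp add: row_coeff_def)

lemma row_coeff_upd_other:
  assumes "\<And>G. h (G(i' := r)) = h G" "i \<noteq> i'"
  shows "row_coeff i j h (G(i' := r)) = row_coeff i j h G"
proof -
  have "h (G(i' := r, i := r')) = h (G(i := r'))" for r'
    using assms(1)[of "G(i := r')"] assms(2) by (simp add: fun_upd_twist)
  then show ?thesis
    by (simp add: row_coeff_def)
qed

lemma row_coeff_cong:
  assumes "\<And>G H. (\<And>a b. a \<le> k \<Longrightarrow> b \<le> k \<Longrightarrow> G a b = H a b) \<Longrightarrow> h G = h H"
    and "\<And>a b. a \<le> k \<Longrightarrow> b \<le> k \<Longrightarrow> G a b = H a b"
  shows "row_coeff i j h G = row_coeff i j h H"
proof -
  have "h (G(i := r)) = h (H(i := r))" for r
    by (rule assms(1)) (simp add: assms(2))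
  then show ?thesis
    by (simp add: row_coeff_def)
qed

text \<open>Rows are expanded one after another. The coefficients left after \<open>k\<close> rows
  ignore those rows and, by \<open>last\<close>, also row \<open>k\<close>; so they are constant on
  dominant matrices.\<close>

lemma multi_row_expansion:
  assumes lin: "\<And>i. i < k \<Longrightarrow> row_linear k i h"
    and last: "\<And>G r. dominant k G \<Longrightarrow> dominant_row k k r \<Longrightarrow> h (G(k := r)) = h G"
    and cong: "\<And>G H. (\<And>a b. a \<le> k \<Longrightarrow> b \<le> k \<Longrightarrow> G a b = H a b) \<Longrightarrow> h G = h H"
  shows "\<exists>d. \<forall>G. dominant k G \<longrightarrow> h G = (\<Sum>fs\<in>lists_over k {..k}. (\<Prod>i<k. G i (fs ! i)) * d fs)"
proof -
  \<comment> \<open>Properties kept for the coefficients \<open>T fs\<close> after \<open>n\<close>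
    rows: linearity in the remaining rows, independence of the expanded rows, independence of the
    last row, dependence on entries up to \<open>k\<close> only, and the expansion itself.\<close>
  define R1 where "R1 = (\<lambda>n T. \<forall>fs\<in>lists_over n {..k}. \<forall>i. n \<le> i \<longrightarrow> i < k \<longrightarrow> row_linear k i (T fs))"
  define R2 where "R2 = (\<lambda>n (T :: nat list \<Rightarrow> (nat \<Rightarrow> nat \<Rightarrow> complex) \<Rightarrow> complex).
    \<forall>fs\<in>lists_over n {..k}. \<forall>i<n. \<forall>G r. T fs (G(i := r)) = T fs G)"
  define R3 where "R3 = (\<lambda>n (T :: nat list \<Rightarrow> (nat \<Rightarrow> nat \<Rightarrow> complex) \<Rightarrow> complex).
    \<forall>fs\<in>lists_over n {..k}. \<forall>G r. dominant k G \<longrightarrow> dominant_row k k r \<longrightarrow> T fs (G(k := r)) = T fs G)"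
  define R4 where "R4 = (\<lambda>n (T :: nat list \<Rightarrow> (nat \<Rightarrow> nat \<Rightarrow> complex) \<Rightarrow> complex).
    \<forall>fs\<in>lists_over n {..k}. \<forall>G H. (\<forall>a b. a \<le> k \<longrightarrow> b \<le> k \<longrightarrow> G a b = H a b) \<longrightarrow> T fs G = T fs H)"
  define R5 where "R5 = (\<lambda>n T. \<forall>G. dominant k G \<longrightarrow> h G = (\<Sum>fs\<in>lists_over n {..k}. (\<Prod>i<n. G i (fs ! i)) * T fs G))"
  have ex: "\<exists>T. R1 n T \<and> R2 n T \<and> R3 n T \<and> R4 n T \<and> R5 n T" if "n \<le> k" for n
    using that
  proof (induction n)
    case 0
    have "lists_over 0 {..k} = {[]}"
      by auto
    then have "R5 0 (\<lambda>_. h)"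
      by (simp add: R5_def)
    moreover have "R1 0 (\<lambda>_. h)" "R2 0 (\<lambda>_. h)" "R3 0 (\<lambda>_. h)"
      using lin last by (simp_all add: R1_def R2_def R3_def)
    moreover have "R4 0 (\<lambda>_. h)"
      unfolding R4_def using cong by blast
    ultimately show ?case
      by blast
  next
    case (Suc n)
    then obtain T where T: "R1 n T" "R2 n T" "R3 n T" "R4 n T" "R5 n T"
      by auto
    have T1: "\<And>fs i. fs \<in> lists_over n {..k} \<Longrightarrow> n \<le> i \<Longrightarrow> i < k \<Longrightarrow> row_linear k i (T fs)"
      using T(1) unfolding R1_def by blast
    have T2: "\<And>fs i G r. fs \<in> lists_over n {..k} \<Longrightarrow> i < n \<Longrightarrow> T fs (G(i := r)) = T fs G"
      using T(2) unfolding R2_def by blast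
    have T3: "\<And>fs G r. fs \<in> lists_over n {..k} \<Longrightarrow> dominant k G \<Longrightarrow> dominant_row k k r \<Longrightarrow> T fs (G(k := r)) = T fs G"
      using T(3) unfolding R3_def by blast
    have T4: "\<And>fs G H. fs \<in> lists_over n {..k} \<Longrightarrow> (\<And>a b. a \<le> k \<Longrightarrow> b \<le> k \<Longrightarrow> G a b = H a b) \<Longrightarrow> T fs G = T fs H"
      using T(4) unfolding R4_def by blast
    have T5: "\<And>G. dominant k G \<Longrightarrow> h G = (\<Sum>fs\<in>lists_over n {..k}. (\<Prod>i<n. G i (fs ! i)) * T fs G)"
      using T(5) unfolding R5_def by blast
    define T' where "T' = (\<lambda>fs. row_coeff n (last fs) (T (butlast fs)))"
    have mem: "butlast fs \<in> lists_over n {..k}" if "fs \<in> lists_over (Suc n) {..k}" for fs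
      using that by (auto dest: in_set_butlastD)
    show ?case
      unfolding R1_def R2_def R3_def R4_def R5_def
    proof (intro exI[of _ T'] conjI ballI allI impI)
      fix fs i assume "fs \<in> lists_over (Suc n) {..k}" "Suc n \<le> i" "i < k"
      then show "row_linear k i (T' fs)"
        unfolding T'_def by (intro row_linear_row_coeff T1 mem) auto
    next
      fix fs i and G :: "nat \<Rightarrow> nat \<Rightarrow> complex" and r assume "fs \<in> lists_over (Suc n) {..k}" "i < Suc n"
      then show "T' fs (G(i := r)) = T' fs G"
        unfolding T'_def by (cases "i = n") (auto simp: row_coeff_upd_same intro!: row_coeff_upd_other T2 mem)
    next
      fix fs and G :: "nat \<Rightarrow> nat \<Rightarrow> complex" and r
      assume fs: "fs \<in> lists_over (Suc n) {..k}" and G: "dominant k G" and r: "dominant_row k k r"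
      have "T (butlast fs) (G(k := r, n := r')) = T (butlast fs) (G(n := r'))" if "dominant_row k n r'" for r'
        using T3[OF mem[OF fs] dominant_upd[OF G that] r] Suc.prems by (simp add: fun_upd_twist)
      then show "T' fs (G(k := r)) = T' fs G"
        unfolding T'_def row_coeff_def using dominant_basis by simp
    next
      fix fs and G H :: "nat \<Rightarrow> nat \<Rightarrow> complex"
      assume "fs \<in> lists_over (Suc n) {..k}" "\<forall>a b. a \<le> k \<longrightarrow> b \<le> k \<longrightarrow> G a b = H a b"
      then show "T' fs G = T' fs H"
        unfolding T'_def by (intro row_coeff_cong[of k] T4[OF mem]) auto
    next
      fix G assume G: "dominant k G"
      have "h G = (\<Sum>fs\<in>lists_over n {..k}. \<Sum>j\<le>k. (\<Prod>i<Suc n. G i ((fs @ [j]) ! i)) * T' (fs @ [j]) G)"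
        unfolding T5[OF G]
      proof (intro sum.cong refl)
        fix fs assume fs: "fs \<in> lists_over n {..k}"
        have "T fs G = (\<Sum>j\<le>k. G n j * T' (fs @ [j]) G)"
          using T1[OF fs, of n] Suc.prems G by (simp add: row_linear_def T'_def)
        moreover have "(\<Prod>i<Suc n. G i ((fs @ [j]) ! i)) = (\<Prod>i<n. G i (fs ! i)) * G n j" for j
          using fs by (auto simp: nth_append intro!: prod.cong)
        ultimately show "(\<Prod>i<n. G i (fs ! i)) * T fs G =
            (\<Sum>j\<le>k. (\<Prod>i<Suc n. G i ((fs @ [j]) ! i)) * T' (fs @ [j]) G)"
          by (simp add: sum_distrib_left mult.assoc)
      qed
      then show "h G = (\<Sum>fs\<in>lists_over (Suc n) {..k}. (\<Prod>i<Suc n. G i (fs ! i)) * T' fs G)"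
        unfolding sum_lists_over_snoc .
    qed
  qed
  from ex[of k] obtain T where T: "R2 k T" "R3 k T" "R4 k T" "R5 k T"
    by auto
  have T2: "\<And>fs i G r. fs \<in> lists_over k {..k} \<Longrightarrow> i < k \<Longrightarrow> T fs (G(i := r)) = T fs G"
    using T(1) unfolding R2_def by blast
  have T3: "\<And>fs G r. fs \<in> lists_over k {..k} \<Longrightarrow> dominant k G \<Longrightarrow> dominant_row k k r \<Longrightarrow> T fs (G(k := r)) = T fs G"
    using T(2) unfolding R3_def by blast
  have T4: "\<And>fs G H. fs \<in> lists_over k {..k} \<Longrightarrow> (\<And>a b. a \<le> k \<Longrightarrow> b \<le> k \<Longrightarrow> G a b = H a b) \<Longrightarrow> T fs G = T fs H"
    using T(3) unfolding R4_def by blast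
  have T5: "\<And>G. dominant k G \<Longrightarrow> h G = (\<Sum>fs\<in>lists_over k {..k}. (\<Prod>i<k. G i (fs ! i)) * T fs G)"
    using T(4) unfolding R5_def by blast
  have const: "T fs G = T fs (\<lambda>i. basis_vec i)" if fs: "fs \<in> lists_over k {..k}" and G: "dominant k G" for fs G
  proof -
    have rows: "T fs (\<lambda>i. if i < n then basis_vec i else H i) = T fs H" if "n \<le> k" for n H
      using that
    proof (induction n)
      case (Suc n)
      have "(\<lambda>i. if i < Suc n then basis_vec i else H i) = (\<lambda>i. if i < n then basis_vec i else H i)(n := basis_vec n)"
        by auto
      then show ?case
        using Suc T2[OF fs, of n] by simp
    qed simp
    have "T fs G = T fs (G(k := basis_vec k))"
      using T3[OF fs G dominant_basis(1)] by simp
    also have "\<dots> = T fs (\<lambda>i. if i < k then basis_vec i else (G(k := basis_vec k)) i)"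
      by (rule rows[symmetric]) simp
    also have "\<dots> = T fs (\<lambda>i. basis_vec i)"
      by (rule T4[OF fs]) auto
    finally show ?thesis .
  qed
  have "h G = (\<Sum>fs\<in>lists_over k {..k}. (\<Prod>i<k. G i (fs ! i)) * T fs (\<lambda>i. basis_vec i))" if "dominant k G" for G
    unfolding T5[OF that] using const that by (intro sum.cong refl) auto
  then show ?thesis
    by (intro exI[of _ "\<lambda>fs. T fs (\<lambda>i. basis_vec i)"] allI impI)
qed

text \<open>What an element of the restriction kernel becomes once it is a function of Gram
  matrices. Degree two in a row or column reflects the two holomorphic or anti-holomorphic indices
  of a curvature variable, degree one in the last row the tensor slot.\<close>

locale divisible_form =
  fixes k :: nat and \<Phi> :: "(nat \<Rightarrow> nat \<Rightarrow> complex) \<Rightarrow> complex"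
  assumes curve: "\<And>G. (\<And>i j. polynomial_fun (\<lambda>z. G z i j)) \<Longrightarrow> polynomial_fun (\<lambda>z. \<Phi> (G z))"
    and cong: "\<And>G H. (\<And>i j. i \<le> k \<Longrightarrow> j \<le> k \<Longrightarrow> G i j = H i j) \<Longrightarrow> \<Phi> G = \<Phi> H"
    and det_zero: "\<And>G. det_fun (Suc k) G = 0 \<Longrightarrow> \<Phi> G = 0"
    and row: "\<And>i G s. i < k \<Longrightarrow> \<Phi> (G(i := (\<lambda>b. s * G i b))) = s\<^sup>2 * \<Phi> G"
    and last_row: "\<And>G s. \<Phi> (G(k := (\<lambda>b. s * G k b))) = s * \<Phi> G"
    and col: "\<And>j G s. j < k \<Longrightarrow> \<Phi> (\<lambda>a b. if b = j then s * G a b else G a b) = s\<^sup>2 * \<Phi> G"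
begin

abbreviation \<D> :: "(nat \<Rightarrow> nat \<Rightarrow> complex) \<Rightarrow> complex" where "\<D> \<equiv> det_fun (Suc k)"

lemma curve_row: "(\<And>b. polynomial_fun (\<lambda>z. r z b)) \<Longrightarrow> polynomial_fun (\<lambda>z. \<Phi> (G(i := r z)))"
proof (rule curve)
  fix a b assume "\<And>b. polynomial_fun (\<lambda>z. r z b)"
  then show "polynomial_fun (\<lambda>z. (G(i := r z)) a b)"
    by (cases "a = i") (auto intro: polynomial_const)
qed

lemma row_eq: "i < k \<Longrightarrow> \<Phi> (G(i := (\<lambda>b. s * r b))) = s\<^sup>2 * \<Phi> (G(i := r))"
  using row[of i "G(i := r)" s] by simp

lemma last_row_eq: "\<Phi> (G(k := (\<lambda>b. s * r b))) = s * \<Phi> (G(k := r))"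
  using last_row[of "G(k := r)" s] by simp

text \<open>
  As a function of row \<open>i\<close>, \<open>\<Phi>\<close> is a quadratic form vanishing on a hyperplane.
\<close>

lemma row_factor:
  assumes i: "i < k" and r0: "\<D> (G(i := r0)) \<noteq> 0"
  shows "\<exists>l. \<forall>r. \<Phi> (G(i := r)) = \<D> (G(i := r)) * (\<Sum>j\<le>k. r j * l j)"
proof -
  define f where "f = (\<lambda>r. \<Phi> (G(i := r)))"
  define l where "l = (\<lambda>r. \<D> (G(i := r)))"
  have "\<exists>C. \<forall>r. l r = (\<Sum>j<Suc k. r j * C j)"
    unfolding l_def by (rule det_fun_row) (use i in simp)
  then obtain C where C: "\<And>r. l r = (\<Sum>j<Suc k. r j * C j)"
    by blast
  have l_lin: "l (\<lambda>b. r b + z * r' b) = l r + z * l r'" for r r' z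
    unfolding C by (simp only: sum_distrib_left sum.distrib[symmetric] algebra_simps)
  have l0: "l r0 \<noteq> 0"
    using r0 by (simp add: l_def)
  have f_curve: "polynomial_fun (\<lambda>z. f (r z))" if "\<And>b. polynomial_fun (\<lambda>z. r z b)" for r
    unfolding f_def by (rule curve_row[OF that])
  have f_scale: "f (\<lambda>b. s * r b) = s\<^sup>2 * f r" for s r
    unfolding f_def by (rule row_eq[OF i])
  have f_zero: "f r = 0" if "l r = 0" for r
    using that unfolding f_def l_def by (rule det_zero)
  \<comment> \<open>Homogeneity of degree two forces an expansion of degree two along every line,
    with \<open>f r\<close> and \<open>f r'\<close> as outer coefficients.\<close>
  have "\<exists>b. \<forall>z. f (\<lambda>a. r a + z * r' a) = f r + z * b + z\<^sup>2 * f r'" for r r'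
  proof -
    have "\<exists>b. \<forall>z. f (\<lambda>a. r a + z * r' a) = f (\<lambda>a. r a + 0 * r' a) + z * b + z\<^sup>2 * f (\<lambda>a. 0 * r a + r' a)"
    proof (rule polynomial_reflect_2[where g = "\<lambda>z. f (\<lambda>a. z * r a + r' a)"])
      show "polynomial_fun (\<lambda>z. f (\<lambda>a. r a + z * r' a))" "polynomial_fun (\<lambda>z. f (\<lambda>a. z * r a + r' a))"
        by (rule f_curve, intro polynomial_intros)+
      fix z :: complex assume "z \<noteq> 0"
      then have "(\<lambda>a. z * r a + r' a) = (\<lambda>a. z * (r a + inverse z * r' a))"
        by (auto simp: algebra_simps)
      then show "f (\<lambda>a. z * r a + r' a) = z\<^sup>2 * f (\<lambda>a. r a + inverse z * r' a)"
        by (simp only: f_scale)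
    qed
    then show ?thesis
      by simp
  qed
  then obtain b where b: "\<And>r r' z. f (\<lambda>a. r a + z * r' a) = f r + z * b r r' + z\<^sup>2 * f r'"
    by metis
  \<comment> \<open>The polar form of \<open>f\<close> with second argument
    \<open>r0\<close>.\<close>
  define B where "B = (\<lambda>r. b r r0)"
  have B_eq: "B r = f (\<lambda>a. r a + r0 a) - f r - f r0" for r
    using b[of r 1 r0] by (simp add: B_def)
  have B_scale: "B (\<lambda>a. z * r a) = z * B r" if "z \<noteq> 0" for z r
  proof -
    have "(\<lambda>a. z * r a + r0 a) = (\<lambda>a. z * (r a + inverse z * r0 a))"
      using that by (auto simp: algebra_simps)
    then have "f (\<lambda>a. z * r a + r0 a) = z\<^sup>2 * (f r + inverse z * B r + (inverse z)\<^sup>2 * f r0)"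
      by (simp only: f_scale b B_def)
    also have "\<dots> = z\<^sup>2 * f r + z * B r + f r0"
      using that by (simp add: field_simps power2_eq_square)
    finally show ?thesis
      unfolding B_eq[of "\<lambda>a. z * r a"] f_scale by simp
  qed
  have B_curve: "polynomial_fun (\<lambda>z. B (r z))" if "\<And>b. polynomial_fun (\<lambda>z. r z b)" for r
    unfolding B_eq by (intro polynomial_diff f_curve polynomial_intros that)
  have B_lin: "B (\<lambda>a. r a + z * r' a) = B r + z * B r'" for r r' z
  proof -
    have "B (\<lambda>a. r a + z * r' a) = B (\<lambda>a. r a + 0 * r' a) + z * B (\<lambda>a. 0 * r a + r' a)"
    proof (rule polynomial_reflect_1[where g = "\<lambda>z. B (\<lambda>a. z * r a + r' a)"])
      show "polynomial_fun (\<lambda>z. B (\<lambda>a. r a + z * r' a))" "polynomial_fun (\<lambda>z. B (\<lambda>a. z * r a + r' a))"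
        by (rule B_curve, intro polynomial_intros)+
      fix z :: complex assume z: "z \<noteq> 0"
      then have "(\<lambda>a. z * r a + r' a) = (\<lambda>a. z * (r a + inverse z * r' a))"
        by (auto simp: algebra_simps)
      then show "B (\<lambda>a. z * r a + r' a) = z * B (\<lambda>a. r a + inverse z * r' a)"
        by (simp only: B_scale[OF z])
    qed
    then show ?thesis
      by simp
  qed
  have B_zero: "B (\<lambda>a. 0) = 0"
    using B_lin[of "\<lambda>a. 0" 1 "\<lambda>a. 0"] by simp
  have B_sum: "B r = (\<Sum>j\<le>k. r j * B (basis_vec j))" for r
  proof -
    have "B (\<lambda>a. \<Sum>j\<in>J. r j * basis_vec j a) = (\<Sum>j\<in>J. r j * B (basis_vec j))" if "finite J" for J
      using that
    proof (induction J rule: finite_induct)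
      case (insert x F)
      then have "(\<lambda>a. \<Sum>j\<in>insert x F. r j * basis_vec j a) = (\<lambda>a. (\<Sum>j\<in>F. r j * basis_vec j a) + r x * basis_vec x a)"
        by (simp add: add.commute)
      then show ?case
        using insert by (simp only: B_lin) (simp add: add.commute)
    qed (simp add: B_zero)
    moreover have "B r = B (\<lambda>a. \<Sum>j\<le>k. r j * basis_vec j a)"
    proof -
      have eq: "(\<Sum>j\<le>k. r j * basis_vec j a) = r a" if "a \<le> k" for a
      proof -
        have "(\<Sum>j\<le>k. r j * basis_vec j a) = (\<Sum>j\<le>k. if j = a then r a else 0)"
          by (intro sum.cong) auto
        with that show ?thesis
          by simp
      qed
      show ?thesis
        unfolding B_eq f_def
        by (intro arg_cong2[where f = "(-)"] refl cong) (auto simp: eq)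
    qed
    ultimately show ?thesis
      by simp
  qed
  define c where "c = (\<lambda>j. (B (basis_vec j) - C j * (f r0 / l r0)) / l r0)"
  have "f r = l r * (\<Sum>j\<le>k. r j * c j)" for r
  proof -
    \<comment> \<open>This value moves \<open>r\<close> along \<open>r0\<close> onto the hyperplane
      where \<open>l\<close>, and therefore \<open>f\<close>, vanishes.\<close>
    let ?z = "- l r / l r0"
    have "l (\<lambda>a. r a + ?z * r0 a) = 0"
      unfolding l_lin using l0 by simp
    then have "f r + ?z * B r + ?z\<^sup>2 * f r0 = 0"
      using f_zero b[of r ?z r0] by (simp add: B_def)
    then have "f r = l r * ((B r - l r * (f r0 / l r0)) / l r0)"
      using l0 by (simp add: field_simps power2_eq_square)
    also have "(B r - l r * (f r0 / l r0)) / l r0 =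
        (\<Sum>j\<le>k. r j * c j)"
      unfolding c_def B_sum[of r] C[of r] lessThan_Suc_atMost sum_distrib_right sum_subtractf[symmetric] sum_divide_distrib
      by (intro sum.cong refl) (simp add: algebra_simps)
    finally show ?thesis .
  qed
  then show ?thesis
    unfolding f_def l_def by (intro exI[of _ c] allI)
qed

text \<open>In the last row \<open>\<Phi>\<close> is linear, and a linear form that vanishes on the
  kernel of a nonzero linear form is a multiple of it.\<close>

lemma last_row_factor:
  assumes r0: "\<D> (G(k := r0)) \<noteq> 0"
  shows "\<exists>c. \<forall>r. \<Phi> (G(k := r)) = \<D> (G(k := r)) * c"
proof -
  define f where "f = (\<lambda>r. \<Phi> (G(k := r)))"
  define l where "l = (\<lambda>r. \<D> (G(k := r)))"
  have "\<exists>C. \<forall>r. l r = (\<Sum>j<Suc k. r j * C j)"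
    unfolding l_def by (rule det_fun_row) simp
  then obtain C where C: "\<And>r. l r = (\<Sum>j<Suc k. r j * C j)"
    by blast
  have l_lin: "l (\<lambda>b. r b + z * r' b) = l r + z * l r'" for r r' z
    unfolding C by (simp only: sum_distrib_left sum.distrib[symmetric] algebra_simps)
  have l0: "l r0 \<noteq> 0"
    using r0 by (simp add: l_def)
  have f_lin: "f (\<lambda>a. r a + z * r' a) = f r + z * f r'" for r r' z
  proof -
    have "f (\<lambda>a. r a + z * r' a) = f (\<lambda>a. r a + 0 * r' a) + z * f (\<lambda>a. 0 * r a + r' a)"
    proof (rule polynomial_reflect_1[where g = "\<lambda>z. f (\<lambda>a. z * r a + r' a)"])
      show "polynomial_fun (\<lambda>z. f (\<lambda>a. r a + z * r' a))" "polynomial_fun (\<lambda>z. f (\<lambda>a. z * r a + r' a))"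
        unfolding f_def by (rule curve_row, intro polynomial_intros)+
      fix z :: complex assume z: "z \<noteq> 0"
      then have "(\<lambda>a. z * r a + r' a) = (\<lambda>a. z * (r a + inverse z * r' a))"
        by (auto simp: algebra_simps)
      then show "f (\<lambda>a. z * r a + r' a) = z * f (\<lambda>a. r a + inverse z * r' a)"
        unfolding f_def by (simp only: last_row_eq)
    qed
    then show ?thesis
      by simp
  qed
  have "f r = l r * (f r0 / l r0)" for r
  proof -
    let ?z = "- l r / l r0"
    have "l (\<lambda>a. r a + ?z * r0 a) = 0"
      unfolding l_lin using l0 by simp
    then have "f (\<lambda>a. r a + ?z * r0 a) = 0"
      unfolding f_def l_def by (rule det_zero)
    then show ?thesis
      unfolding f_lin by (simp add: field_simps)
  qed
  then show ?thesis
    unfolding f_def l_def by blast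
qed

text \<open>On dominant matrices the determinant can be divided out, and the row factorizations make
  the quotient linear in each of the first \<open>k\<close> rows and independent of the
  last.\<close>

lemma quotient_expansion:
  "\<exists>d. \<forall>G. dominant k G \<longrightarrow> \<Phi> G / \<D> G = (\<Sum>fs\<in>lists_over k {..k}. (\<Prod>i<k. G i (fs ! i)) * d fs)"
proof (rule multi_row_expansion)
  fix i assume i: "i < k"
  show "row_linear k i (\<lambda>G. \<Phi> G / \<D> G)"
    unfolding row_linear_def
  proof (intro allI impI)
    fix G assume G: "dominant k G"
    have dom: "\<D> (G(i := r)) \<noteq> 0" if "dominant_row k i r" for r
      using dominant_det_nonzero[OF dominant_upd[OF G that]] .
    have Gi: "dominant_row k i (G i)"
      using G i by (simp add: dominant_def)
    obtain l where l: "\<And>r. \<Phi> (G(i := r)) = \<D> (G(i := r)) * (\<Sum>j\<le>k. r j * l j)"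
      using row_factor[OF i dom[OF Gi]] by auto
    define \<Psi> where "\<Psi> = (\<lambda>G. \<Phi> G / \<D> G)"
    have q: "\<Psi> (G(i := r)) = (\<Sum>j\<le>k. r j * l j)" if "dominant_row k i r" for r
      unfolding \<Psi>_def l using dom[OF that] by (rule nonzero_mult_div_cancel_left)
    have basis: "(\<Sum>a\<le>k. basis_vec j a * l a) = l j" if "j \<le> k" for j
    proof -
      have "(\<Sum>a\<le>k. basis_vec j a * l a) = (\<Sum>a\<le>k. if a = j then l j else 0)"
        by (intro sum.cong) auto
      with that show ?thesis
        by simp
    qed
    have coeff: "row_coeff i j \<Psi> G = l j" if "j \<le> k" for j
    proof (cases "j = i")
      case True
      then show ?thesis
        using q[OF dominant_basis(1)] basis[of i] i by (simp add: row_coeff_def)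
    next
      case False
      have "(\<Sum>a\<le>k. (basis_vec i a + basis_vec j a / 2) * l a) =
          (\<Sum>a\<le>k. basis_vec i a * l a) + (\<Sum>a\<le>k. basis_vec j a * l a) / 2"
        by (simp only: distrib_right sum.distrib sum_divide_distrib times_divide_eq_left)
      then show ?thesis
        using False q[OF dominant_basis(1)] q[OF dominant_basis(2)[of i j]] basis[of i] basis[OF that] i
        by (simp add: row_coeff_def)
    qed
    have "\<Psi> G = (\<Sum>j\<le>k. G i j * l j)"
      using q[OF Gi] by simp
    then have "\<Psi> G = (\<Sum>j\<le>k. G i j * row_coeff i j \<Psi> G)"
      using coeff by simp
    then show "\<Phi> G / \<D> G = (\<Sum>j\<le>k. G i j * row_coeff i j (\<lambda>G. \<Phi> G / \<D> G) G)"
      by (simp only: \<Psi>_def)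
  qed
next
  fix G r assume G: "dominant k G" and r: "dominant_row k k r"
  have Gk: "dominant_row k k (G k)"
    using G by (simp add: dominant_def)
  obtain c where c: "\<And>r. \<Phi> (G(k := r)) = \<D> (G(k := r)) * c"
    using last_row_factor[OF dominant_det_nonzero[OF dominant_upd[OF G Gk]]] by auto
  have "\<Phi> (G(k := r)) / \<D> (G(k := r)) = c"
    unfolding c using dominant_det_nonzero[OF dominant_upd[OF G r]] by (rule nonzero_mult_div_cancel_left)
  moreover have "\<Phi> G / \<D> G = c"
    using c[of "G k"] dominant_det_nonzero[OF G] by simp
  ultimately show "\<Phi> (G(k := r)) / \<D> (G(k := r)) = \<Phi> G / \<D> G"
    by simp
next
  fix G H :: "nat \<Rightarrow> nat \<Rightarrow> complex"
  assume "\<And>a b. a \<le> k \<Longrightarrow> b \<le> k \<Longrightarrow> G a b = H a b"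
  then have "\<Phi> G = \<Phi> H" "\<D> G = \<D> H"
    by (auto intro: cong det_fun_cong)
  then show "\<Phi> G / \<D> G = \<Phi> H / \<D> H"
    by simp
qed

text \<open>Supplies infinitely many dominant matrices on the segment from the identity to an
  arbitrary \<open>G\<close>.\<close>

lemma near_identity_dominant:
  fixes G :: "nat \<Rightarrow> nat \<Rightarrow> complex"
  defines "C \<equiv> (\<Sum>i\<le>k. \<Sum>j\<le>k. cmod (G i j))"
  assumes x: "0 < x" "x * (1 + C) < 1"
  shows "dominant k (\<lambda>i j. (1 - of_real x) * basis_vec i j + of_real x * G i j)"
  unfolding dominant_def dominant_row_def
proof (intro allI impI)
  fix i assume i: "i \<le> k"
  let ?H = "\<lambda>j. (1 - of_real x) * basis_vec i j + of_real x * G i j"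
  have "(\<Sum>j\<in>{..k} - {i}. cmod (?H j)) = (\<Sum>j\<in>{..k} - {i}. x * cmod (G i j))"
    using x by (intro sum.cong) (auto simp: norm_mult)
  moreover have "cmod (?H i) \<ge> 1 - x - x * cmod (G i i)"
  proof -
    have "cmod (1 - of_real x) \<le> cmod (?H i) + cmod (of_real x * G i i)"
      using norm_triangle_ineq4[of "?H i" "of_real x * G i i"] by simp
    moreover have "1 - x \<le> cmod (1 - complex_of_real x)"
      using norm_triangle_ineq2[of 1 "complex_of_real x"] x by simp
    ultimately show ?thesis
      using x by (simp add: norm_mult)
  qed
  moreover have "(\<Sum>j\<in>{..k} - {i}. x * cmod (G i j)) + x * cmod (G i i) = x * (\<Sum>j\<le>k. cmod (G i j))"
    using i by (simp add: sum.remove[of "{..k}" i] sum_distrib_left algebra_simps)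
  moreover have "(\<Sum>j\<le>k. cmod (G i j)) \<le> C"
    unfolding C_def using i by (intro member_le_sum) (auto intro: sum_nonneg)
  then have "x * (\<Sum>j\<le>k. cmod (G i j)) \<le> x * C"
    using x by simp
  ultimately show "(\<Sum>j\<in>{..k} - {i}. cmod (?H j)) < cmod (?H i)"
    using x(2) by (simp add: algebra_simps)
qed

text \<open>The identity on dominant matrices extends to every \<open>G\<close> along the segment
  from the identity matrix. Column homogeneity then leaves only permutations: in a column with index
  less than \<open>k\<close>, \<open>\<Phi>\<close> has degree two and the determinant degree one,
  so the quotient has degree one.\<close>

theorem det_factor:
  "\<exists>d. \<forall>G. \<Phi> G = \<D> G * (\<Sum>fs\<in>perm_lists k. d fs * (\<Prod>i<k. G i (fs ! i)))"
proof -
  obtain d where d: "\<And>G. dominant k G \<Longrightarrow> \<Phi> G / \<D> G = (\<Sum>fs\<in>lists_over k {..k}. (\<Prod>i<k. G i (fs ! i)) * d fs)"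
    using quotient_expansion by auto
  define R where "R = (\<lambda>G. \<Sum>fs\<in>lists_over k {..k}. (\<Prod>i<k. G i (fs ! i)) * d fs)"
  have R_curve: "polynomial_fun (\<lambda>z. R (G z))" if "\<And>i j. polynomial_fun (\<lambda>z. G z i j)" for G
    unfolding R_def by (intro polynomial_intros that)
  have factor: "\<Phi> G = \<D> G * R G" for G
  proof -
    let ?H = "\<lambda>z i j. (1 - z) * basis_vec i j + z * G i j"
    let ?C = "\<Sum>i\<le>k. \<Sum>j\<le>k. cmod (G i j)"
    have C: "0 \<le> ?C"
      by (intro sum_nonneg) auto
    have "\<Phi> (?H 1) - \<D> (?H 1) * R (?H 1) = 0"
    proof (rule polynomial_fun_zero_infinite[where Z = "complex_of_real ` {0<..<1 / (1 + ?C)}"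
          and f = "\<lambda>z. \<Phi> (?H z) - \<D> (?H z) * R (?H z)"])
      show "polynomial_fun (\<lambda>z. \<Phi> (?H z) - \<D> (?H z) * R (?H z))"
        by (intro polynomial_diff polynomial_mult polynomial_det curve R_curve polynomial_intros)
      have "infinite {0<..<1 / (1 + ?C)}"
        using C by (intro infinite_Ioo) auto
      then show "infinite (complex_of_real ` {0<..<1 / (1 + ?C)})"
        by (simp add: finite_image_iff inj_on_def)
      fix z assume "z \<in> complex_of_real ` {0<..<1 / (1 + ?C)}"
      then obtain x where x: "z = complex_of_real x" "0 < x" "x < 1 / (1 + ?C)"
        by auto
      then have "x * (1 + ?C) < 1"
        using C by (simp add: pos_less_divide_eq)
      then have "dominant k (?H z)"
        unfolding x(1) by (rule near_identity_dominant[OF x(2)])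
      then show "\<Phi> (?H z) - \<D> (?H z) * R (?H z) = 0"
        using d[of "?H z"] dominant_det_nonzero[of k "?H z"] by (simp add: R_def field_simps)
    qed
    then show ?thesis
      by simp
  qed
  let ?col = "\<lambda>j (s :: complex) G a b. if b = j then s * G a b else G a b"
  have det_col: "\<D> (?col j s G) = s * \<D> G" if "j < k" for j s G
  proof -
    have tr: "det_fun (Suc k) (\<lambda>a b. H b a) = det_fun (Suc k) H" for H :: "nat \<Rightarrow> nat \<Rightarrow> complex"
      by (subst det_transpose[symmetric, of _ "Suc k"]) (auto intro!: arg_cong[where f = Determinant.det] eq_matI)
    have eq: "(\<lambda>a b. ?col j s G b a) = (\<lambda>a b. G b a)(j := (\<lambda>b. s * G b j))"
      by auto
    have "\<exists>C. \<forall>r. det_fun (Suc k) ((\<lambda>a b. G b a)(j := r)) = (\<Sum>b<Suc k. r b * C b)"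
      by (rule det_fun_row) (use that in simp)
    then obtain C where C: "\<And>r. det_fun (Suc k) ((\<lambda>a b. G b a)(j := r)) = (\<Sum>b<Suc k. r b * C b)"
      by blast
    have "\<D> (?col j s G) = det_fun (Suc k) ((\<lambda>a b. G b a)(j := (\<lambda>b. s * G b j)))"
      unfolding tr[of "?col j s G", symmetric] eq ..
    also have "\<dots> = s * det_fun (Suc k) ((\<lambda>a b. G b a)(j := (\<lambda>b. G b j)))"
      unfolding C sum_distrib_left by (simp add: mult.assoc)
    also have "(\<lambda>a b. G b a)(j := (\<lambda>b. G b j)) = (\<lambda>a b. G b a)"
      by auto
    finally show ?thesis
      unfolding tr[of G] .
  qed
  have R_col: "R (?col j 2 G) = 2 * R G" if j: "j < k" for j G
  proof -
    let ?H = "\<lambda>z i j. (1 - z) * basis_vec i j + z * G i j"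
    have "R (?col j 2 (?H 1)) - 2 * R (?H 1) = 0"
    proof (rule polynomial_fun_zero[where f = "\<lambda>z. R (?col j 2 (?H z)) - 2 * R (?H z)" and g = "\<lambda>z. \<D> (?H z)" and ?z0.0 = 0])
      show "polynomial_fun (\<lambda>z. R (?col j 2 (?H z)) - 2 * R (?H z))" "polynomial_fun (\<lambda>z. \<D> (?H z))"
        by (intro polynomial_diff polynomial_mult polynomial_det R_curve polynomial_intros)+
      have "\<D> (?H 0) = \<D> (\<lambda>i j. if i = j then 1 else 0)"
        by (intro det_fun_cong) auto
      then show "\<D> (?H 0) \<noteq> 0"
        by (simp add: det_fun_one)
      fix z assume nz: "\<D> (?H z) \<noteq> 0"
      have "2\<^sup>2 * \<Phi> (?H z) = \<Phi> (?col j 2 (?H z))"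
        using col[OF j] by simp
      then have "2\<^sup>2 * (\<D> (?H z) * R (?H z)) = (2 * \<D> (?H z)) * R (?col j 2 (?H z))"
        unfolding factor det_col[OF j] .
      moreover have "D * (x - 2 * y) = 0" if "2\<^sup>2 * (D * y) = (2 * D) * x" for D x y :: complex
      proof -
        have "2 * (D * (x - 2 * y)) = (2 * D) * x - 2\<^sup>2 * (D * y)"
          by (simp add: algebra_simps power2_eq_square)
        also have "\<dots> = 0"
          unfolding that by simp
        finally show ?thesis
          by simp
      qed
      ultimately have "\<D> (?H z) * (R (?col j 2 (?H z)) - 2 * R (?H z)) = 0"
        by blast
      with nz show "R (?col j 2 (?H z)) - 2 * R (?H z) = 0"
        by simp
    qed
    then show ?thesis
      by (simp cong: if_cong)
  qed
  have d_zero: "d fs = 0" if fs: "fs \<in> lists_over k {..k}" and "fs \<notin> perm_lists k" for fs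
  proof -
    have "\<exists>j<k. j \<notin> set fs"
    proof (rule ccontr)
      assume "\<not> ?thesis"
      then have "{..<k} \<subseteq> set fs"
        by auto
      moreover have "card (set fs) \<le> card {..<k}"
        using fs card_length[of fs] by auto
      ultimately have "{..<k} = set fs"
        by (intro card_seteq) auto
      with fs that(2) show False
        by auto
    qed
    then obtain j where j: "j < k" "j \<notin> set fs"
      by auto
    \<comment> \<open>The indicator matrix of \<open>fs\<close> has the value \<open>d fs\<close>
      under \<open>R\<close>. Its column \<open>j\<close> is zero, so doubling that column changes
      nothing, although it should double the value.\<close>
    let ?G = "\<lambda>i b. if i < k \<and> b = fs ! i then 1 else 0 :: complex"
    have mem: "fs ! i \<noteq> j" if "i < k" for i
      using j fs that nth_mem[of i fs] by auto
    have R_G: "R ?G = d fs"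
    proof -
      have "R ?G = (\<Sum>fs'\<in>lists_over k {..k}. if fs' = fs then d fs else 0)"
        unfolding R_def
      proof (intro sum.cong refl)
        fix fs' assume fs': "fs' \<in> lists_over k {..k}"
        show "(\<Prod>i<k. ?G i (fs' ! i)) * d fs' = (if fs' = fs then d fs else 0)"
        proof (cases "fs' = fs")
          case False
          then obtain i where "i < k" "fs' ! i \<noteq> fs ! i"
            using fs fs' by (auto simp: list_eq_iff_nth_eq)
          then have "(\<Prod>i<k. ?G i (fs' ! i)) = 0"
            by (intro prod_zero) auto
          with False show ?thesis
            by simp
        qed simp
      qed
      also have "\<dots> = d fs"
        using fs by simp
      finally show ?thesis .
    qed
    have "R (?col j 2 ?G) = R ?G"
    proof -
      have "?col j 2 ?G = ?G"
        using mem by (auto simp: fun_eq_iff)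
      then show ?thesis
        by simp
    qed
    with R_col[OF j(1), of ?G] R_G show ?thesis
      by simp
  qed
  have "R G = (\<Sum>fs\<in>perm_lists k. d fs * (\<Prod>i<k. G i (fs ! i)))" for G
    unfolding R_def using d_zero by (intro sum.mono_neutral_cong_right) auto
  with factor show ?thesis
    by auto
qed

end

section \<open>Invariants as functions of Gram matrices\<close>

lemma prod_mset_cong: "(\<And>a. a \<in># A \<Longrightarrow> f a = g a) \<Longrightarrow> \<Prod>\<^sub># (image_mset f A) = \<Prod>\<^sub># (image_mset g A)"
  by (metis image_mset_cong)

lemma contraction_cong:
  assumes Q: "Q \<in> jet_tensors m"
    and u: "\<And>l a. l \<le> k \<Longrightarrow> a < m \<Longrightarrow> u l a = u' l a" and w: "\<And>l a. l \<le> k \<Longrightarrow> a < m \<Longrightarrow> w l a = w' l a"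
  shows "contraction m k Q t u w = contraction m k Q t u' w'"
  unfolding contraction_def
proof (intro sum.cong refl arg_cong2[where f = "(*)"])
  fix \<alpha> \<beta> assume "\<alpha> \<in> {..<m}" "\<beta> \<in> {..<m}"
  then show "u k \<alpha> = u' k \<alpha>" "w k \<beta> = w' k \<beta>"
    using u w by auto
  show "ev (jet_sum k t u w) (Q \<alpha> \<beta>) = ev (jet_sum k t u' w') (Q \<alpha> \<beta>)"
  proof (rule peval_cong)
    fix \<mu> v assume "\<mu> \<in> Poly_Mapping.keys (Q \<alpha> \<beta>)" and v\<mu>: "v \<in> Poly_Mapping.keys \<mu>"
    then have "jet_monom m \<mu>"
      using Q by (auto simp: jet_tensors_def)
    moreover obtain A B where v: "v = (A, B)"
      by (cases v)
    ultimately have AB: "set_mset A \<subseteq> {..<m}" "set_mset B \<subseteq> {..<m}"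
      using v\<mu> unfolding jet_monom_def by fastforce+
    have "\<Prod>\<^sub># (image_mset (u j) A) = \<Prod>\<^sub># (image_mset (u' j) A)"
      "\<Prod>\<^sub># (image_mset (w j) B) = \<Prod>\<^sub># (image_mset (w' j) B)" if "j < k" for j
      using AB u w that by (auto intro!: prod_mset_cong)
    then show "jet_sum k t u w v = jet_sum k t u' w' v"
      by (simp add: v jet_sum_def)
  qed
qed

text \<open>For unitary matrices this is invariance itself, since the conjugate transpose undoes the
  action on \<open>w\<close>. Both sides are polynomial in \<open>M\<close>, so density yields all
  matrices, singular ones included.\<close>

lemma invariant_transfer:
  assumes Q: "Q \<in> invariant_jet_tensors m k" and M: "M \<in> carrier_mat m m"
  shows "contraction m k Q t (transpose_act m M u) w = contraction m k Q t u (matrix_act m M w)"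
proof -
  have Qt: "Q \<in> jet_tensors m"
    using Q by (simp add: invariant_jet_tensors_def)
  \<comment> \<open>Beyond the first \<open>m\<close> coordinates the actions read unspecified
    matrix entries; cutting these off makes the difference polynomial in \<open>M\<close> and leaves
    the contractions unchanged.\<close>
  let ?cut = "\<lambda>u l a. if a < m then u l a else 0 :: complex"
  have cut: "contraction m k Q t (?cut u) w = contraction m k Q t u w"
    "contraction m k Q t u (?cut w) = contraction m k Q t u w" for u w
    by (rule contraction_cong[OF Qt]; simp)+
  let ?P = "\<lambda>M. contraction m k Q t (?cut (transpose_act m M u)) w - contraction m k Q t u (?cut (matrix_act m M w))"
  have "?P M = 0"
  proof (rule unitary_group_dense[OF _ _ M, where P = ?P])
    fix M :: "complex \<Rightarrow> complex mat"
    assume poly: "\<And>i j. i < m \<Longrightarrow> j < m \<Longrightarrow> polynomial_fun (\<lambda>z. M z $$ (i, j))"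
    show "polynomial_fun (\<lambda>z. ?P (M z))"
      unfolding transpose_act_def matrix_act_def by (intro polynomial_intros poly) auto
  next
    fix U assume U: "U \<in> unitary_group m"
    then have "contraction m k Q t u (matrix_act m U w) = contraction m k (act_tensor m U Q) t u (matrix_act m U w)"
      using Q by (simp add: invariant_jet_tensors_def)
    also have "\<dots> = contraction m k Q t (transpose_act m U u) w"
      unfolding contraction_act by (rule contraction_cong[OF Qt]) (simp_all add: conj_transpose_matrix_act[OF U])
    finally show "?P U = 0"
      by (simp add: cut)
  qed
  then show ?thesis
    by (simp add: cut)
qed

definition standard_frame :: "nat \<Rightarrow> nat \<Rightarrow> complex" where
  "standard_frame = (\<lambda>l a. if a = l then 1 else 0)"

text \<open>Pairing with the standard frame returns the coordinates, so these vectors realize a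
  prescribed Gram matrix of size \<open>k + 1\<close>, for which \<open>k < m\<close> provides the
  dimension.\<close>

definition gram_frame :: "nat \<Rightarrow> (nat \<Rightarrow> nat \<Rightarrow> complex) \<Rightarrow> nat \<Rightarrow> nat \<Rightarrow> complex" where
  "gram_frame k G = (\<lambda>l a. if a \<le> k then G a l else 0)"

lemma gram_standard_frame:
  assumes "i \<le> k" "k < m"
  shows "gram m standard_frame (gram_frame k G) i j = G i j"
proof -
  have "gram m standard_frame (gram_frame k G) i j = (\<Sum>a<m. if a = i then G i j else 0)"
    unfolding gram_def gram_frame_def standard_frame_def using assms by (intro sum.cong) auto
  with assms show ?thesis
    by simp
qed

text \<open>
  The vectors \<open>u\<close> are the images of the standard frame under a matrix, which can be moved to the
  other side of the pairing.
\<close>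

lemma contraction_gram:
  assumes Q: "Q \<in> invariant_jet_tensors m k" and km: "k < m"
  shows "contraction m k Q t u w = contraction m k Q t standard_frame (gram_frame k (gram m u w))"
proof -
  have Qt: "Q \<in> jet_tensors m"
    using Q by (simp add: invariant_jet_tensors_def)
  define M where "M = mat m m (\<lambda>(c, a). if c \<le> k then u c a else 0)"
  have M: "M \<in> carrier_mat m m"
    by (simp add: M_def)
  have "contraction m k Q t u w = contraction m k Q t (transpose_act m M standard_frame) w"
  proof (rule contraction_cong[OF Qt])
    fix l a assume la: "l \<le> k" "a < m"
    have "transpose_act m M standard_frame l a = (\<Sum>c<m. if c = l then u l a else 0)"
      unfolding transpose_act_def standard_frame_def using la by (intro sum.cong) (auto simp: M_def)
    then show "u l a = transpose_act m M standard_frame l a"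
      using la km by simp
  qed simp
  also have "\<dots> = contraction m k Q t standard_frame (matrix_act m M w)"
    by (rule invariant_transfer[OF Q M])
  also have "\<dots> = contraction m k Q t standard_frame (gram_frame k (gram m u w))"
    by (rule contraction_cong[OF Qt]) (auto simp: matrix_act_def gram_frame_def gram_def M_def)
  finally show ?thesis .
qed

lemma contraction_gram_cong:
  assumes "Q \<in> invariant_jet_tensors m k" "k < m" "\<And>i j. i \<le> k \<Longrightarrow> j \<le> k \<Longrightarrow> gram m u w i j = gram m u' w' i j"
  shows "contraction m k Q t u w = contraction m k Q t u' w'"
proof -
  have "contraction m k Q t standard_frame (gram_frame k (gram m u w)) =
      contraction m k Q t standard_frame (gram_frame k (gram m u' w'))"
    using assms by (intro contraction_cong) (auto simp: gram_frame_def invariant_jet_tensors_def)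
  then show ?thesis
    using contraction_gram[OF assms(1,2), of t] by simp
qed

lemma gram_scale_left: "gram m (u(i := (\<lambda>a. s * u i a))) w a b = (if a = i then s * gram m u w a b else gram m u w a b)"
  by (auto simp: gram_def sum_distrib_left mult.assoc)

lemma gram_scale_right: "gram m u (w(i := (\<lambda>a. s * w i a))) a b = (if b = i then s * gram m u w a b else gram m u w a b)"
  by (auto simp: gram_def sum_distrib_left mult.left_commute)

section \<open>Invariants in the restriction kernel\<close>

locale kernel_element =
  fixes m k :: nat and Q :: jet_tensor
  assumes k_pos: "1 \<le> k" and km: "k < m" and Q: "Q \<in> restriction_kernel m k"
begin

lemma invariant: "Q \<in> invariant_jet_tensors m k" and tensors: "Q \<in> jet_tensors m"
  and order: "homogeneous_of_order (2 * k) Q" and restrict: "restrict_tensor k Q = (\<lambda>\<alpha> \<beta>. 0)"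
  using Q by (simp_all add: restriction_kernel_def invariant_jet_tensors_def)

text \<open>Vectors supported in the first \<open>k\<close> coordinates see only the restricted
  tensor, which is zero.\<close>

lemma contraction_small:
  assumes "\<And>l a. k \<le> a \<Longrightarrow> u l a = 0" "\<And>l a. k \<le> a \<Longrightarrow> w l a = 0"
  shows "contraction m k Q t u w = 0"
  unfolding contraction_def
proof (intro sum.neutral ballI)
  fix \<alpha> \<beta>
  show "u k \<alpha> * w k \<beta> * ev (jet_sum k t u w) (Q \<alpha> \<beta>) = 0"
  proof (cases "\<alpha> < k \<and> \<beta> < k")
    case True
    have "jet_sum k t u w v = (if small_var k v then jet_sum k t u w v else 0)" for v
    proof (cases "small_var k v")
      case False
      obtain A B where v: "v = (A, B)"
        by (cases v)
      have "\<Prod>\<^sub># (image_mset (u j) A) * \<Prod>\<^sub># (image_mset (w j) B) = 0" for j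
      proof -
        from False v consider a where "a \<in># A" "k \<le> a" | a where "a \<in># B" "k \<le> a"
          by (auto simp: small_var_def subset_iff not_less)
        then show ?thesis
        proof cases
          case 1
          then have "0 \<in># image_mset (u j) A"
            using assms(1)[of a j] by (metis image_eqI set_image_mset)
          then show ?thesis
            by (simp add: prod_mset_zero_iff)
        next
          case 2
          then have "0 \<in># image_mset (w j) B"
            using assms(2)[of a j] by (metis image_eqI set_image_mset)
          then show ?thesis
            by (simp add: prod_mset_zero_iff)
        qed
      qed
      then have "jet_sum k t u w v = 0"
        by (auto simp: v jet_sum_def intro!: sum.neutral)
      then show ?thesis
        by simp
    qed simp
    then have "ev (jet_sum k t u w) (Q \<alpha> \<beta>) = ev (jet_sum k t u w) (restrict_poly k (Q \<alpha> \<beta>))"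
      unfolding ev_restrict_poly by presburger
    also have "restrict_poly k (Q \<alpha> \<beta>) = 0"
      using fun_cong[OF fun_cong[OF restrict, of \<alpha>], of \<beta>] True by (simp add: restrict_tensor_def)
    finally show ?thesis
      by simp
  next
    case False
    then show ?thesis
      using assms by (auto simp: not_less)
  qed
qed

text \<open>A kernel vector expresses one column of the Gram matrix through the others. The same
  Gram entries are therefore realized by vectors with \<open>k\<close> coordinates, where the
  restriction hypothesis applies.\<close>

lemma contraction_singular:
  assumes det: "det_fun (Suc k) (gram m u w) = 0"
  shows "contraction m k Q t u w = 0"
proof -
  define G where "G = gram m u w"
  obtain v where v: "v \<in> carrier_vec (Suc k)" "v \<noteq> 0\<^sub>v (Suc k)" "mat (Suc k) (Suc k) (\<lambda>(i, j). G i j) *\<^sub>v v = 0\<^sub>v (Suc k)"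
    using det det_0_iff_vec_prod_zero[of "mat (Suc k) (Suc k) (\<lambda>(i, j). G i j)" "Suc k"] by (auto simp: G_def)
  have Gv: "(\<Sum>j\<le>k. G i j * v $ j) = 0" if "i \<le> k" for i
  proof -
    have "0 = (mat (Suc k) (Suc k) (\<lambda>(i, j). G i j) *\<^sub>v v) $ i"
      unfolding v(3) using that by simp
    also have "\<dots> = (\<Sum>j\<le>k. G i j * v $ j)"
      using v(1) that by (auto simp: scalar_prod_def atLeast0LessThan lessThan_Suc_atMost intro!: sum.cong)
    finally show ?thesis
      by simp
  qed
  obtain p where p: "p \<le> k" "v $ p \<noteq> 0"
    using v(1,2) by (metis carrier_vecD eq_vecI index_zero_vec less_Suc_eq_le)
  \<comment> \<open>Lets \<open>{..<k}\<close> enumerate all indices up to \<open>k\<close> except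
    \<open>p\<close>.\<close>
  define \<iota> where "\<iota> = (\<lambda>a. if a = p then k else a)"
  have bij: "bij_betw \<iota> {..<k} ({..k} - {p})"
    unfolding \<iota>_def
    by (rule bij_betw_byWitness[where f' = "\<lambda>l. if l = k then p else l"]) (use p in auto)
  define u' where "u' = (\<lambda>c a. if a < k then G c (\<iota> a) else 0)"
  \<comment> \<open>The columns other than \<open>p\<close> become coordinate vectors, and column
    \<open>p\<close> gets its coefficients from the kernel vector.\<close>
  define w' where "w' = (\<lambda>l a. if a < k then if l = p then - v $ (\<iota> a) / v $ p else if \<iota> a = l then 1 else 0 else 0)"
  have "gram m u w i j = gram m u' w' i j" if ij: "i \<le> k" "j \<le> k" for i j
  proof -
    let ?h = "\<lambda>l. if j = p then - v $ l / v $ p else if l = j then 1 else 0"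
    have "gram m u' w' i j = (\<Sum>a<k. G i (\<iota> a) * ?h (\<iota> a))"
      unfolding gram_def using km by (intro sum.mono_neutral_cong_right) (auto simp: u'_def w'_def)
    also have "\<dots> = (\<Sum>l\<in>{..k} - {p}. G i l * ?h l)"
      by (rule sum.reindex_bij_betw[OF bij])
    also have "\<dots> = G i j"
    proof (cases "j = p")
      case True
      have "(\<Sum>l\<in>{..k} - {p}. G i l * v $ l) = - (G i p * v $ p)"
        using Gv[OF ij(1)] p(1) by (simp add: sum.remove[of "{..k}" p] eq_neg_iff_add_eq_0 add.commute)
      then have "(\<Sum>l\<in>{..k} - {p}. G i l * (- v $ l / v $ p)) = G i p"
        using p(2) by (simp add: sum_negf sum_divide_distrib[symmetric])
      then show ?thesis
        using True by simp
    next
      case False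
      have "(\<Sum>l\<in>{..k} - {p}. G i l * ?h l) = (\<Sum>l\<in>{..k} - {p}. if l = j then G i j else 0)"
        using False by (intro sum.cong) auto
      then show ?thesis
        using False ij by simp
    qed
    finally show ?thesis
      by (simp add: G_def)
  qed
  then have "contraction m k Q t u w = contraction m k Q t u' w'"
    by (rule contraction_gram_cong[OF invariant km])
  also have "\<dots> = 0"
    by (rule contraction_small) (auto simp: u'_def w'_def)
  finally show ?thesis .
qed

text \<open>The jet no longer sees \<open>u p\<close>, so \<open>u p\<close> may be replaced by
  zero; this makes a row of the Gram matrix zero.\<close>

lemma contraction_t_zero:
  assumes p: "p < k" "t p = 0"
  shows "contraction m k Q t u w = 0"
proof -
  let ?u = "u(p := (\<lambda>_. 0))"
  have "jet_sum k t u w = jet_sum k t ?u w"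
    unfolding jet_sum_def using p(2) by (intro ext) (auto intro!: sum.cong)
  then have "contraction m k Q t u w = contraction m k Q t ?u w"
    using p(1) by (simp add: contraction_def)
  also have "det_fun (Suc k) (gram m ?u w) = 0"
  proof -
    obtain C where "\<And>r. det_fun (Suc k) ((gram m ?u w)(p := r)) = (\<Sum>j<Suc k. r j * C j)"
      using det_fun_row[of p "Suc k" "gram m ?u w"] p(1) by (metis less_SucI)
    moreover have "gram m ?u w = (gram m ?u w)(p := (\<lambda>_. 0))"
      by (auto simp: gram_def fun_eq_iff)
    ultimately show ?thesis
      by (metis (no_types, lifting) mult_zero_left sum.neutral)
  qed
  then have "contraction m k Q t ?u w = 0"
    by (rule contraction_singular)
  finally show ?thesis .
qed

lemma keys_monom:
  assumes "\<mu> \<in> Poly_Mapping.keys (Q \<alpha> \<beta>)"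
  shows "jet_monom m \<mu>" "jet_order \<mu> = 2 * k" "\<alpha> < m" "\<beta> < m"
proof -
  show "jet_monom m \<mu>" "jet_order \<mu> = 2 * k"
    using assms tensors order by (auto simp: jet_tensors_def homogeneous_of_order_def)
  have "Q \<alpha> \<beta> \<noteq> 0"
    using assms by auto
  then show "\<alpha> < m" "\<beta> < m"
    using tensors by (auto simp: jet_tensors_def not_le[symmetric])
qed

text \<open>Every variable has order at least 2, so order \<open>2 * k\<close> allows at most
  \<open>k\<close> factors. Fewer factors would be detected by jets with fewer than \<open>k\<close>
  summands, on which all contractions vanish. With exactly \<open>k\<close> factors each has order
  2, hence two indices of either kind.\<close>

lemma keys_size:
  assumes \<mu>: "\<mu> \<in> Poly_Mapping.keys (Q \<alpha> \<beta>)"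
  shows "size (mono_mset \<mu>) = k" "Poly_Mapping.keys \<mu> \<subseteq> curvature_vars m"
proof -
  note mon = keys_monom[OF \<mu>]
  have v: "size (fst v) + size (snd v) - 2 \<ge> 2" "set_mset (fst v) \<subseteq> {..<m}" "set_mset (snd v) \<subseteq> {..<m}"
    "2 \<le> size (fst v)" "2 \<le> size (snd v)" if "v \<in> Poly_Mapping.keys \<mu>" for v
    using mon(1) that by (auto simp: jet_monom_def case_prod_beta)
  have order: "jet_order \<mu> = (\<Sum>v\<in>Poly_Mapping.keys \<mu>. Poly_Mapping.lookup \<mu> v * (size (fst v) + size (snd v) - 2))"
    by (simp add: jet_order_def case_prod_beta)
  have size2: "2 * size (mono_mset \<mu>) = (\<Sum>v\<in>Poly_Mapping.keys \<mu>. Poly_Mapping.lookup \<mu> v * 2)"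
    by (simp add: size_mono_mset sum_distrib_left mult.commute)
  have "2 * size (mono_mset \<mu>) \<le> jet_order \<mu>"
    unfolding order size2 using v by (intro sum_mono mult_le_mono2) auto
  then have le: "size (mono_mset \<mu>) \<le> k"
    using mon(2) by simp
  show eq: "size (mono_mset \<mu>) = k"
  proof (rule ccontr)
    assume "size (mono_mset \<mu>) \<noteq> k"
    with le have lt: "size (mono_mset \<mu>) < k"
      by simp
    let ?n = "size (mono_mset \<mu>)"
    have "?n \<noteq> ?n"
    proof (rule no_monomials_of_degree[OF _ \<mu>])
      fix t :: "nat \<Rightarrow> complex" and u w :: "nat \<Rightarrow> nat \<Rightarrow> complex"
      \<comment> \<open>Pads the shorter jet with summands whose coefficient is zero.\<close>
      let ?t = "\<lambda>j. if j < ?n then t j else 0"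
      have "jet_sum ?n t u w = jet_sum k ?t u w"
      proof
        fix v
        show "jet_sum ?n t u w v = jet_sum k ?t u w v"
          unfolding jet_sum_def case_prod_beta using lt by (intro sum.mono_neutral_cong_left) auto
      qed
      then have "ev (jet_sum ?n t u w) (Q \<alpha> \<beta>) = contraction m k Q ?t (u(k := basis_vec \<alpha>)) (w(k := basis_vec \<beta>))"
        using contraction_basis[OF mon(3,4)] by simp
      also have "\<dots> = 0"
        using lt by (rule contraction_t_zero) simp
      finally show "ev (jet_sum ?n t u w) (Q \<alpha> \<beta>) = 0" .
    qed
    then show False
      by simp
  qed
  have "v \<in> curvature_vars m" if vk: "v \<in> Poly_Mapping.keys \<mu>" for v
  proof -
    have "(\<Sum>v\<in>Poly_Mapping.keys \<mu>. Poly_Mapping.lookup \<mu> v * (size (fst v) + size (snd v) - 2) - Poly_Mapping.lookup \<mu> v * 2) =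
        jet_order \<mu> - 2 * size (mono_mset \<mu>)"
      unfolding order size2 using v by (intro sum_subtractf_nat mult_le_mono2) auto
    also have "\<dots> = 0"
      using mon(2) eq by simp
    finally have "Poly_Mapping.lookup \<mu> v * (size (fst v) + size (snd v) - 2) - Poly_Mapping.lookup \<mu> v * 2 = 0"
      using vk by (metis (no_types, lifting) finite_keys sum_eq_0_iff)
    moreover have "Poly_Mapping.lookup \<mu> v \<noteq> 0"
      using vk by (simp add: in_keys_iff)
    ultimately have "size (fst v) + size (snd v) - 2 \<le> 2"
      by simp
    then show ?thesis
      using v[OF vk] by (auto simp: curvature_vars_def case_prod_beta)
  qed
  then show "Poly_Mapping.keys \<mu> \<subseteq> curvature_vars m"
    by auto
qed

definition vlist :: "(jet_var \<Rightarrow>\<^sub>0 nat) \<Rightarrow> jet_var list" where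
  "vlist \<mu> = (SOME vs. mset vs = mono_mset \<mu>)"

lemma mset_vlist: "mset (vlist \<mu>) = mono_mset \<mu>"
  unfolding vlist_def by (rule someI_ex[OF ex_mset])

definition decomposable :: "(nat \<Rightarrow> nat \<Rightarrow> complex) \<Rightarrow> (nat \<Rightarrow> nat \<Rightarrow> complex) \<Rightarrow> nat \<Rightarrow> jet_var \<Rightarrow> complex" where
  "decomposable u w j v = \<Prod>\<^sub># (image_mset (u j) (fst v)) * \<Prod>\<^sub># (image_mset (w j) (snd v))"

text \<open>Only the terms containing each \<open>t j\<close> exactly once survive.\<close>

lemma contraction_multilinear:
  "contraction m k Q t u w = (\<Prod>j<k. t j) * (\<Sum>\<alpha><m. \<Sum>\<beta><m. u k \<alpha> * w k \<beta> *
    (\<Sum>\<mu>\<in>Poly_Mapping.keys (Q \<alpha> \<beta>). Poly_Mapping.lookup (Q \<alpha> \<beta>) \<mu> *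
      (\<Sum>js\<in>perm_lists k. \<Prod>i<k. decomposable u w (js ! i) (vlist \<mu> ! i))))"
proof -
  let ?t = "\<lambda>I j. if j \<in> I then t j else 0"
  have only_full: "contraction m k Q (?t I) u w = 0" if "I \<subseteq> {..<k}" "I \<noteq> {..<k}" for I
  proof -
    have "\<exists>p\<in>{..<k}. p \<notin> I"
      using that by blast
    then obtain p where "p < k" "p \<notin> I"
      by auto
    then show ?thesis
      by (intro contraction_t_zero[of p]) auto
  qed
  have "jet_sum k (?t {..<k}) u w = jet_sum k t u w"
    unfolding jet_sum_def by (intro ext) (auto intro!: sum.cong)
  then have full: "contraction m k Q (?t {..<k}) u w = contraction m k Q t u w"
    by (simp only: contraction_def)
  have "contraction m k Q t u w = (\<Sum>I\<in>{{..<k}}. (-1) ^ (k - card I) * contraction m k Q (?t I) u w)"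
    using full by simp
  \<comment> \<open>Proper subsets contribute zero, so the full alternating sum may be written, to
    which inclusion-exclusion applies.\<close>
  also have "\<dots> = (\<Sum>I\<in>Pow {..<k}. (-1) ^ (k - card I) * contraction m k Q (?t I) u w)"
    using only_full by (intro sum.mono_neutral_left) auto
  also have "\<dots> = (\<Sum>I\<in>Pow {..<k}. \<Sum>\<alpha><m. \<Sum>\<beta><m. \<Sum>\<mu>\<in>Poly_Mapping.keys (Q \<alpha> \<beta>).
      u k \<alpha> * w k \<beta> * (Poly_Mapping.lookup (Q \<alpha> \<beta>) \<mu> *
        ((-1) ^ (k - card I) * (\<Prod>i<k. \<Sum>j\<in>I. t j * decomposable u w j (vlist \<mu> ! i)))))"
    unfolding contraction_def sum_distrib_left peval_mset
  proof (intro sum.cong refl)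
    fix I \<alpha> \<beta> \<mu> assume I: "I \<in> Pow {..<k}" and \<mu>: "\<mu> \<in> Poly_Mapping.keys (Q \<alpha> \<beta>)"
    have len: "length (vlist \<mu>) = k"
      using keys_size(1)[OF \<mu>] mset_vlist[of \<mu>] by (metis size_mset)
    have "jet_sum k (?t I) u w v = (\<Sum>j\<in>I. t j * decomposable u w j v)" for v
      unfolding jet_sum_def decomposable_def case_prod_beta using I
      by (intro sum.mono_neutral_cong_right) (auto simp: mult.assoc)
    then have "\<Prod>\<^sub># (image_mset (jet_sum k (?t I) u w) (mono_mset \<mu>)) =
        (\<Prod>i<k. \<Sum>j\<in>I. t j * decomposable u w j (vlist \<mu> ! i))"
      unfolding mset_vlist[symmetric] prod_mset_list len by simp
    then show "(-1) ^ (k - card I) * (u k \<alpha> * w k \<beta> * (Poly_Mapping.lookup (Q \<alpha> \<beta>) \<mu> *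
        \<Prod>\<^sub># (image_mset (jet_sum k (?t I) u w) (mono_mset \<mu>)))) =
      u k \<alpha> * w k \<beta> * (Poly_Mapping.lookup (Q \<alpha> \<beta>) \<mu> *
        ((-1) ^ (k - card I) * (\<Prod>i<k. \<Sum>j\<in>I. t j * decomposable u w j (vlist \<mu> ! i))))"
      by (simp only: mult_ac)
  qed
  also have "\<dots> = (\<Sum>\<alpha><m. \<Sum>\<beta><m. \<Sum>\<mu>\<in>Poly_Mapping.keys (Q \<alpha> \<beta>). \<Sum>I\<in>Pow {..<k}.
      u k \<alpha> * w k \<beta> * (Poly_Mapping.lookup (Q \<alpha> \<beta>) \<mu> *
        ((-1) ^ (k - card I) * (\<Prod>i<k. \<Sum>j\<in>I. t j * decomposable u w j (vlist \<mu> ! i)))))"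
  proof -
    have sw: "(\<Sum>I\<in>S. \<Sum>\<alpha>\<in>A. \<Sum>\<beta>\<in>B. \<Sum>\<mu>\<in>C \<alpha> \<beta>. f I \<alpha> \<beta> \<mu>) = (\<Sum>\<alpha>\<in>A. \<Sum>\<beta>\<in>B. \<Sum>\<mu>\<in>C \<alpha> \<beta>. \<Sum>I\<in>S. f I \<alpha> \<beta> \<mu>)"
      for S :: "nat set set" and A B :: "nat set" and C :: "nat \<Rightarrow> nat \<Rightarrow> (jet_var \<Rightarrow>\<^sub>0 nat) set" and f :: "_ \<Rightarrow> _ \<Rightarrow> _ \<Rightarrow> _ \<Rightarrow> complex"
    proof -
      have "(\<Sum>I\<in>S. \<Sum>\<alpha>\<in>A. \<Sum>\<beta>\<in>B. \<Sum>\<mu>\<in>C \<alpha> \<beta>. f I \<alpha> \<beta> \<mu>) = (\<Sum>\<alpha>\<in>A. \<Sum>I\<in>S. \<Sum>\<beta>\<in>B. \<Sum>\<mu>\<in>C \<alpha> \<beta>. f I \<alpha> \<beta> \<mu>)"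
        by (rule sum.swap)
      also have "\<dots> = (\<Sum>\<alpha>\<in>A. \<Sum>\<beta>\<in>B. \<Sum>I\<in>S. \<Sum>\<mu>\<in>C \<alpha> \<beta>. f I \<alpha> \<beta> \<mu>)"
        by (intro sum.cong refl sum.swap)
      also have "\<dots> = (\<Sum>\<alpha>\<in>A. \<Sum>\<beta>\<in>B. \<Sum>\<mu>\<in>C \<alpha> \<beta>. \<Sum>I\<in>S. f I \<alpha> \<beta> \<mu>)"
        by (intro sum.cong refl sum.swap)
      finally show ?thesis .
    qed
    show ?thesis
      by (rule sw)
  qed
  also have "\<dots> = (\<Sum>\<alpha><m. \<Sum>\<beta><m. \<Sum>\<mu>\<in>Poly_Mapping.keys (Q \<alpha> \<beta>).
      u k \<alpha> * w k \<beta> * (Poly_Mapping.lookup (Q \<alpha> \<beta>) \<mu> *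
        ((\<Prod>j<k. t j) * (\<Sum>js\<in>perm_lists k. \<Prod>i<k. decomposable u w (js ! i) (vlist \<mu> ! i)))))"
  proof (intro sum.cong refl)
    fix \<alpha> \<beta> \<mu>
    have "(\<Sum>I\<in>Pow {..<k}. (-1) ^ (k - card I) * (\<Prod>i<k. \<Sum>j\<in>I. t j * decomposable u w j (vlist \<mu> ! i))) =
        (\<Sum>js\<in>perm_lists k. \<Prod>i<k. t (js ! i) * decomposable u w (js ! i) (vlist \<mu> ! i))"
      using inclusion_exclusion_perm_lists[of k "\<lambda>i j. t j * decomposable u w j (vlist \<mu> ! i)"] .
    also have "\<dots> = (\<Sum>js\<in>perm_lists k. (\<Prod>j<k. t j) * (\<Prod>i<k. decomposable u w (js ! i) (vlist \<mu> ! i)))"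
    proof (intro sum.cong refl)
      fix js assume js: "js \<in> perm_lists k"
      have "bij_betw (\<lambda>i. js ! i) {..<k} {..<k}"
        using js distinct_perm_list[OF js] by (intro bij_betw_nth) auto
      then have "(\<Prod>i<k. t (js ! i)) = (\<Prod>j<k. t j)"
        by (rule prod.reindex_bij_betw)
      then show "(\<Prod>i<k. t (js ! i) * decomposable u w (js ! i) (vlist \<mu> ! i)) =
          (\<Prod>j<k. t j) * (\<Prod>i<k. decomposable u w (js ! i) (vlist \<mu> ! i))"
        by (simp only: prod.distrib)
    qed
    finally show "(\<Sum>I\<in>Pow {..<k}. u k \<alpha> * w k \<beta> * (Poly_Mapping.lookup (Q \<alpha> \<beta>) \<mu> *
        ((-1) ^ (k - card I) * (\<Prod>i<k. \<Sum>j\<in>I. t j * decomposable u w j (vlist \<mu> ! i))))) =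
      u k \<alpha> * w k \<beta> * (Poly_Mapping.lookup (Q \<alpha> \<beta>) \<mu> *
        ((\<Prod>j<k. t j) * (\<Sum>js\<in>perm_lists k. \<Prod>i<k. decomposable u w (js ! i) (vlist \<mu> ! i))))"
      by (simp only: sum_distrib_left[symmetric])
  qed
  finally show ?thesis
    by (simp only: sum_distrib_left mult_ac)
qed

lemma contraction_t: "contraction m k Q t u w = (\<Prod>j<k. t j) * contraction m k Q (\<lambda>_. 1) u w"
  unfolding contraction_multilinear[of t] contraction_multilinear[of "\<lambda>_. 1"] by simp

lemma prod_perm_delta:
  assumes js: "js \<in> perm_lists k" and j: "j < k"
  shows "(\<Prod>i<k. if js ! i = j then c else 1) = (c :: complex)"
proof -
  have "bij_betw (\<lambda>i. js ! i) {..<k} {..<k}"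
    using js distinct_perm_list[OF js] by (intro bij_betw_nth) auto
  then have "(\<Prod>i<k. if js ! i = j then c else 1) = (\<Prod>i<k. if i = j then c else 1)"
    by (rule prod.reindex_bij_betw[where g = "\<lambda>i. if i = j then c else 1"])
  with j show ?thesis
    by simp
qed

lemma decomposable_scale_left:
  assumes "v \<in> curvature_vars m"
  shows "decomposable (u(j := (\<lambda>a. s * u j a))) w l v = (if l = j then s\<^sup>2 else 1) * decomposable u w l v"
proof -
  have "\<Prod>\<^sub># (image_mset (\<lambda>a. s * f a) A) = s ^ size A * \<Prod>\<^sub># (image_mset f A)" for f :: "nat \<Rightarrow> complex" and A
    by (induction A) auto
  then show ?thesis
    using assms by (auto simp: decomposable_def curvature_vars_def)
qed

lemma decomposable_scale_right:
  assumes "v \<in> curvature_vars m"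
  shows "decomposable u (w(j := (\<lambda>a. s * w j a))) l v = (if l = j then s\<^sup>2 else 1) * decomposable u w l v"
proof -
  have "\<Prod>\<^sub># (image_mset (\<lambda>a. s * f a) A) = s ^ size A * \<Prod>\<^sub># (image_mset f A)" for f :: "nat \<Rightarrow> complex" and A
    by (induction A) auto
  then show ?thesis
    using assms by (auto simp: decomposable_def curvature_vars_def)
qed

text \<open>In every surviving term the index \<open>j\<close> is taken by exactly one factor, so
  the scaling is felt exactly once.\<close>

lemma contraction_scale:
  assumes scale: "\<And>v l. v \<in> curvature_vars m \<Longrightarrow> decomposable u' w' l v = (if l = j then c else 1) * decomposable u w l v"
    and "u' k = u k" "w' k = w k" and j: "j < k"
  shows "contraction m k Q t u' w' = c * contraction m k Q t u w"
proof -
  have "(\<Sum>js\<in>perm_lists k. \<Prod>i<k. decomposable u' w' (js ! i) (vlist \<mu> ! i)) =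
      c * (\<Sum>js\<in>perm_lists k. \<Prod>i<k. decomposable u w (js ! i) (vlist \<mu> ! i))"
    if \<mu>: "\<mu> \<in> Poly_Mapping.keys (Q \<alpha> \<beta>)" for \<alpha> \<beta> \<mu>
    unfolding sum_distrib_left
  proof (intro sum.cong refl)
    fix js assume js: "js \<in> perm_lists k"
    have len: "length (vlist \<mu>) = k"
      using keys_size(1)[OF \<mu>] mset_vlist[of \<mu>] by (metis size_mset)
    have "set_mset (mset (vlist \<mu>)) \<subseteq> curvature_vars m"
      unfolding mset_vlist set_mono_mset by (rule keys_size(2)[OF \<mu>])
    then have "vlist \<mu> ! i \<in> curvature_vars m" if "i < k" for i
      using len that nth_mem[of i "vlist \<mu>"] by auto
    then have "(\<Prod>i<k. decomposable u' w' (js ! i) (vlist \<mu> ! i)) =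
        (\<Prod>i<k. (if js ! i = j then c else 1) * decomposable u w (js ! i) (vlist \<mu> ! i))"
      by (intro prod.cong refl scale) auto
    then show "(\<Prod>i<k. decomposable u' w' (js ! i) (vlist \<mu> ! i)) = c * (\<Prod>i<k. decomposable u w (js ! i) (vlist \<mu> ! i))"
      by (simp only: prod.distrib prod_perm_delta[OF js j])
  qed
  then show ?thesis
    unfolding contraction_multilinear using assms(2,3)
    by (simp add: sum_distrib_left mult_ac)
qed

definition \<Phi> :: "(nat \<Rightarrow> nat \<Rightarrow> complex) \<Rightarrow> complex" where
  "\<Phi> G = contraction m k Q (\<lambda>_. 1) standard_frame (gram_frame k G)"

lemma contraction_\<Phi>: "contraction m k Q (\<lambda>_. 1) u w = \<Phi> (gram m u w)"
  unfolding \<Phi>_def by (rule contraction_gram[OF invariant km])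

lemma \<Phi>_cong:
  assumes "\<And>i j. i \<le> k \<Longrightarrow> j \<le> k \<Longrightarrow> G i j = H i j"
  shows "\<Phi> G = \<Phi> H"
  unfolding \<Phi>_def using assms by (intro contraction_cong[OF tensors]) (auto simp: gram_frame_def)

text \<open>Scaling a row or a column of the Gram matrix means scaling one vector of the standard
  frame or of \<open>gram_frame\<close>; the square arises because a curvature variable contains two
  indices of either kind.\<close>

sublocale divisible_form k \<Phi>
proof
  fix G :: "complex \<Rightarrow> nat \<Rightarrow> nat \<Rightarrow> complex"
  assume "\<And>i j. polynomial_fun (\<lambda>z. G z i j)"
  then show "polynomial_fun (\<lambda>z. \<Phi> (G z))"
    unfolding \<Phi>_def gram_frame_def standard_frame_def by (intro polynomial_intros) auto
next
  fix G H :: "nat \<Rightarrow> nat \<Rightarrow> complex"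
  assume "\<And>i j. i \<le> k \<Longrightarrow> j \<le> k \<Longrightarrow> G i j = H i j"
  then show "\<Phi> G = \<Phi> H"
    by (rule \<Phi>_cong)
next
  fix G assume "det_fun (Suc k) G = 0"
  also have "det_fun (Suc k) G = det_fun (Suc k) (gram m standard_frame (gram_frame k G))"
    using km by (intro det_fun_cong) (simp add: gram_standard_frame[where k = k])
  finally show "\<Phi> G = 0"
    unfolding \<Phi>_def by (rule contraction_singular)
next
  fix i G and s :: complex assume i: "i < k"
  let ?u = "standard_frame(i := (\<lambda>a. s * standard_frame i a))"
  have "\<Phi> (G(i := (\<lambda>b. s * G i b))) = \<Phi> (gram m ?u (gram_frame k G))"
  proof (rule \<Phi>_cong)
    fix a b assume "a \<le> k" "b \<le> k"
    then show "(G(i := (\<lambda>b. s * G i b))) a b = gram m ?u (gram_frame k G) a b"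
      using km by (auto simp: gram_scale_left gram_standard_frame[OF _ km])
  qed
  also have "\<dots> = s\<^sup>2 * \<Phi> G"
    unfolding contraction_\<Phi>[symmetric] \<Phi>_def[of G]
    using i by (intro contraction_scale[where j = i] decomposable_scale_left) auto
  finally show "\<Phi> (G(i := (\<lambda>b. s * G i b))) = s\<^sup>2 * \<Phi> G" .
next
  fix G and s :: complex
  let ?u = "standard_frame(k := (\<lambda>a. s * standard_frame k a))"
  have "\<Phi> (G(k := (\<lambda>b. s * G k b))) = \<Phi> (gram m ?u (gram_frame k G))"
  proof (rule \<Phi>_cong)
    fix a b assume "a \<le> k" "b \<le> k"
    then show "(G(k := (\<lambda>b. s * G k b))) a b = gram m ?u (gram_frame k G) a b"
      using km by (auto simp: gram_scale_left gram_standard_frame[OF _ km])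
  qed
  also have "\<dots> = s * \<Phi> G"
  proof -
    have "jet_sum k (\<lambda>_. 1) ?u (gram_frame k G) = jet_sum k (\<lambda>_. 1) standard_frame (gram_frame k G)"
      unfolding jet_sum_def by (intro ext) (auto intro!: sum.cong)
    then show ?thesis
      unfolding contraction_\<Phi>[symmetric] \<Phi>_def[of G] contraction_def
      by (simp only: sum_distrib_left fun_upd_same mult.assoc)
  qed
  finally show "\<Phi> (G(k := (\<lambda>b. s * G k b))) = s * \<Phi> G" .
next
  fix j G and s :: complex assume j: "j < k"
  let ?w = "(gram_frame k G)(j := (\<lambda>a. s * gram_frame k G j a))"
  have "\<Phi> (\<lambda>a b. if b = j then s * G a b else G a b) = \<Phi> (gram m standard_frame ?w)"
  proof (rule \<Phi>_cong)
    fix a b assume "a \<le> k" "b \<le> k"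
    then show "(if b = j then s * G a b else G a b) = gram m standard_frame ?w a b"
      using km by (auto simp: gram_scale_right gram_standard_frame[OF _ km])
  qed
  also have "\<dots> = s\<^sup>2 * \<Phi> G"
    unfolding contraction_\<Phi>[symmetric] \<Phi>_def[of G]
    using j by (intro contraction_scale[where j = j] decomposable_scale_right) auto
  finally show "\<Phi> (\<lambda>a b. if b = j then s * G a b else G a b) = s\<^sup>2 * \<Phi> G" .
qed

text \<open>
  If the quotient of \<open>\<Phi>\<close> by the determinant is \<open>\<Sum> d f * G 0 (f 0) * \<dots> * G (k - 1) (f (k - 1))\<close>, then up to
  a constant factor \<open>Q\<close> is the image of the sum of products of traces in which the permutation \<open>f\<close>
  prescribes how the indices of the matrix entries are contracted.
\<close>

definition trace_poly :: "(nat list \<Rightarrow> complex) \<Rightarrow> (nat \<times> nat) poly_over" where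
  "trace_poly d = (\<Sum>fs\<in>perm_lists k. pconst (d fs) *
    (\<Sum>is\<in>lists_over k {..<m}. \<Prod>j<k. pvar (is ! j, is ! (fs ! j))))"

lemma ev_trace_poly:
  "ev x (trace_poly d) = (\<Sum>fs\<in>perm_lists k. d fs * (\<Sum>is\<in>lists_over k {..<m}. \<Prod>j<k. x (is ! j, is ! (fs ! j))))"
  by (simp add: trace_poly_def ev_hom.hom_sum ev_hom.hom_mult ev_hom.hom_prod)

lemma perm_list_lt: "fs \<in> perm_lists k \<Longrightarrow> j < k \<Longrightarrow> fs ! j < k"
  using nth_mem[of j fs] by auto

lemma trace_poly_keys:
  assumes \<mu>: "\<mu> \<in> Poly_Mapping.keys (trace_poly d)"
  shows "Poly_Mapping.keys \<mu> \<subseteq> {..<m} \<times> {..<m}" "size (mono_mset \<mu>) = k"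
proof -
  have lt: "is ! j < m" if "is \<in> lists_over k {..<m}" "j < k" for "is" j
    using that nth_mem[of j "is"] by blast
  show "Poly_Mapping.keys \<mu> \<subseteq> {..<m} \<times> {..<m}"
  proof (rule depends_only_imp_keys[OF _ \<mu>])
    fix x y :: "nat \<times> nat \<Rightarrow> complex"
    assume "\<And>v. v \<in> {..<m} \<times> {..<m} \<Longrightarrow> x v = y v"
    then show "ev x (trace_poly d) = ev y (trace_poly d)"
      unfolding ev_trace_poly using lt perm_list_lt
      by (intro sum.cong refl arg_cong2[where f = "(*)"] prod.cong) simp
  qed
  show "size (mono_mset \<mu>) = k"
    by (rule homogeneous_imp_size[OF _ \<mu>])
      (simp add: ev_trace_poly prod.distrib sum_distrib_left mult.left_commute)
qed

definition inv_list :: "nat list \<Rightarrow> nat \<Rightarrow> nat" where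
  "inv_list fs = inv_into {..<k} (\<lambda>j. fs ! j)"

lemma inv_list:
  assumes "fs \<in> perm_lists k"
  shows "bij_betw (\<lambda>j. fs ! j) {..<k} {..<k}"
    and "j < k \<Longrightarrow> inv_list fs (fs ! j) = j" "j < k \<Longrightarrow> fs ! inv_list fs j = j" "j < k \<Longrightarrow> inv_list fs j < k"
proof -
  show bij: "bij_betw (\<lambda>j. fs ! j) {..<k} {..<k}"
    using assms distinct_perm_list[OF assms] by (intro bij_betw_nth) auto
  show "j < k \<Longrightarrow> inv_list fs (fs ! j) = j"
    using bij by (simp add: inv_list_def bij_betw_def inv_into_f_f)
  show "j < k \<Longrightarrow> fs ! inv_list fs j = j"
    using bij by (simp add: inv_list_def bij_betw_def f_inv_into_f)
  show "j < k \<Longrightarrow> inv_list fs j < k"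
    using bij inv_into_into[of j "\<lambda>j. fs ! j" "{..<k}"] by (simp add: inv_list_def bij_betw_def)
qed

lemma prod_perm_reindex:
  assumes fs: "fs \<in> perm_lists k"
  shows "(\<Prod>j<k. h j (fs ! j)) = (\<Prod>j<k. h (inv_list fs j) j)"
proof -
  have "(\<Prod>j<k. h (inv_list fs j) j) = (\<Prod>j<k. h (inv_list fs (fs ! j)) (fs ! j))"
    by (rule prod.reindex_bij_betw[OF inv_list(1)[OF fs], symmetric])
  then show ?thesis
    using inv_list(2)[OF fs] by simp
qed

text \<open>The index \<open>is ! j\<close> occurs in \<open>p\<close> at position \<open>j\<close>
  and in \<open>q\<close> at the preimage of \<open>j\<close> under \<open>fs\<close>. Grouping the
  factors by this index turns the sum over index lists into a product of single sums.\<close>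

lemma sum_contract_indices:
  fixes p q :: "nat \<Rightarrow> nat \<Rightarrow> complex"
  assumes fs: "fs \<in> perm_lists k"
  shows "(\<Sum>is\<in>lists_over k {..<m}. \<Prod>j<k. p j (is ! j) * q j (is ! (fs ! j))) =
    (\<Prod>j<k. \<Sum>a<m. p j a * q (inv_list fs j) a)"
proof -
  have "(\<Prod>j<k. p j (is ! j) * q j (is ! (fs ! j))) = (\<Prod>j<k. p j (is ! j) * q (inv_list fs j) (is ! j))" for "is"
    using prod_perm_reindex[OF fs, of "\<lambda>i j. q i (is ! j)"] by (simp only: prod.distrib)
  then show ?thesis
    by (simp only: sum_prod_lists_over[where n = k and A = "{..<m}" and h = "\<lambda>j a. p j a * q (inv_list fs j) a"] finite_lessThan)
qed

text \<open>Every entry of the conjugated matrix is expanded. Summing over the outer indices joins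
  an entry of \<open>A'\<close> with one of \<open>A\<close> at each contraction, and
  \<open>A' * A = 1\<^sub>m m\<close> identifies the neighbouring indices of
  \<open>B\<close>.\<close>

lemma trace_poly_conj_invariant:
  assumes A: "A \<in> carrier_mat m m" "A' \<in> carrier_mat m m" "A' * A = 1\<^sub>m m" and B: "B \<in> carrier_mat m m"
  shows "mat_poly (trace_poly d) (A * B * A') = mat_poly (trace_poly d) B"
proof -
  have "(\<Sum>is\<in>lists_over k {..<m}. \<Prod>j<k. (A * B * A') $$ (is ! j, is ! (fs ! j))) =
      (\<Sum>is\<in>lists_over k {..<m}. \<Prod>j<k. B $$ (is ! j, is ! (fs ! j)))" if fs: "fs \<in> perm_lists k" for fs
  proof -
    let ?L = "lists_over k {..<m}" and ?P = "{..<m} \<times> {..<m}"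
    have lt: "is ! j < m" if "is \<in> ?L" "j < k" for "is" j
      using that nth_mem[of j "is"] by blast
    have entry: "(A * B * A') $$ (x, y) = (\<Sum>r\<in>?P. A $$ (x, fst r) * B $$ r * A' $$ (snd r, y))" if "x < m" "y < m" for x y
    proof -
      have "(A * B * A') $$ (x, y) = (\<Sum>q<m. (\<Sum>p<m. A $$ (x, p) * B $$ (p, q)) * A' $$ (q, y))"
        using A B that by (simp add: scalar_prod_def lessThan_atLeast0 del: assoc_mult_mat)
      also have "\<dots> = (\<Sum>p<m. \<Sum>q<m. A $$ (x, p) * B $$ (p, q) * A' $$ (q, y))"
        unfolding sum_distrib_right by (rule sum.swap)
      finally show ?thesis
        by (simp add: sum.cartesian_product case_prod_beta)
    qed
    have id: "(\<Sum>a<m. A' $$ (q, a) * A $$ (a, p)) = (if q = p then 1 else 0)" if "p < m" "q < m" for p q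
    proof -
      have "(\<Sum>a<m. A' $$ (q, a) * A $$ (a, p)) = (A' * A) $$ (q, p)"
        using A(1,2) that by (simp add: scalar_prod_def lessThan_atLeast0)
      then show ?thesis
        using A(3) that by auto
    qed
    have "(\<Sum>is\<in>?L. \<Prod>j<k. (A * B * A') $$ (is ! j, is ! (fs ! j))) =
        (\<Sum>is\<in>?L. \<Prod>j<k. \<Sum>r\<in>?P. A $$ (is ! j, fst r) * B $$ r * A' $$ (snd r, is ! (fs ! j)))"
      using lt perm_list_lt[OF fs] by (intro sum.cong prod.cong refl entry) auto
    also have "\<dots> = (\<Sum>is\<in>?L. \<Sum>rs\<in>lists_over k ?P.
        \<Prod>j<k. A $$ (is ! j, fst (rs ! j)) * B $$ (rs ! j) * A' $$ (snd (rs ! j), is ! (fs ! j)))"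
      using sum_prod_lists_over[where n = k and A = ?P and
        h = "\<lambda>j r. A $$ (is ! j, fst r) * B $$ r * A' $$ (snd r, is ! (fs ! j))" for "is", symmetric]
      by (intro sum.cong refl) auto
    also have "\<dots> = (\<Sum>rs\<in>lists_over k ?P. \<Sum>is\<in>?L.
        \<Prod>j<k. A $$ (is ! j, fst (rs ! j)) * B $$ (rs ! j) * A' $$ (snd (rs ! j), is ! (fs ! j)))"
      by (rule sum.swap)
    also have "\<dots> = (\<Sum>rs\<in>lists_over k ?P. (\<Prod>j<k. B $$ (rs ! j)) *
        (if \<forall>j<k. snd (rs ! (inv_list fs j)) = fst (rs ! j) then 1 else 0))"
    proof (intro sum.cong refl)
      fix rs assume rs: "rs \<in> lists_over k ?P"
      have "rs ! j \<in> ?P" if "j < k" for j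
        using rs that nth_mem[of j rs] by blast
      then have lt: "fst (rs ! j) < m" "snd (rs ! j) < m" if "j < k" for j
        using that by (auto simp: mem_Times_iff)
      have "(\<Sum>is\<in>?L. \<Prod>j<k. A $$ (is ! j, fst (rs ! j)) * B $$ (rs ! j) * A' $$ (snd (rs ! j), is ! (fs ! j))) =
          (\<Prod>j<k. B $$ (rs ! j)) * (\<Sum>is\<in>?L. \<Prod>j<k. A $$ (is ! j, fst (rs ! j)) * A' $$ (snd (rs ! j), is ! (fs ! j)))"
        unfolding sum_distrib_left prod.distrib[symmetric] by (intro sum.cong prod.cong refl) (simp only: mult_ac)
      also have "(\<Sum>is\<in>?L. \<Prod>j<k. A $$ (is ! j, fst (rs ! j)) * A' $$ (snd (rs ! j), is ! (fs ! j))) =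
          (\<Prod>j<k. \<Sum>a<m. A $$ (a, fst (rs ! j)) * A' $$ (snd (rs ! (inv_list fs j)), a))"
        by (rule sum_contract_indices[OF fs, where p = "\<lambda>j a. A $$ (a, fst (rs ! j))" and q = "\<lambda>j a. A' $$ (snd (rs ! j), a)"])
      also have "\<dots> = (\<Prod>j<k. if snd (rs ! (inv_list fs j)) = fst (rs ! j) then 1 else 0)"
        using id[OF lt(1) lt(2)] inv_list(4)[OF fs] by (intro prod.cong refl) (simp add: mult.commute)
      also have "\<dots> = (if \<forall>j<k. snd (rs ! (inv_list fs j)) = fst (rs ! j) then 1 else 0)"
        by (auto intro!: prod_zero prod.neutral)
      finally show "(\<Sum>is\<in>?L. \<Prod>j<k. A $$ (is ! j, fst (rs ! j)) * B $$ (rs ! j) * A' $$ (snd (rs ! j), is ! (fs ! j))) =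
          (\<Prod>j<k. B $$ (rs ! j)) * (if \<forall>j<k. snd (rs ! (inv_list fs j)) = fst (rs ! j) then 1 else 0)" .
    qed
    also have "\<dots> = (\<Sum>rs\<in>{rs \<in> lists_over k ?P. \<forall>j<k. snd (rs ! (inv_list fs j)) = fst (rs ! j)}. \<Prod>j<k. B $$ (rs ! j))"
      by (intro sum.mono_neutral_cong_right) auto
    also have "\<dots> = (\<Sum>is\<in>?L. \<Prod>j<k. B $$ (is ! j, is ! (fs ! j)))"
    \<comment> \<open>A list of index pairs whose ends match along \<open>fs\<close> is determined
      by its first components.\<close>
    proof (rule sum.reindex_bij_witness[where i = "\<lambda>is. map (\<lambda>j. (is ! j, is ! (fs ! j))) [0..<k]" and j = "map fst"])
      fix rs assume rs: "rs \<in> {rs \<in> lists_over k ?P. \<forall>j<k. snd (rs ! (inv_list fs j)) = fst (rs ! j)}"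
      have snd: "snd (rs ! j) = fst (rs ! (fs ! j))" if "j < k" for j
      proof -
        have "\<forall>j<k. snd (rs ! inv_list fs j) = fst (rs ! j)"
          using rs by blast
        then have "snd (rs ! inv_list fs (fs ! j)) = fst (rs ! (fs ! j))"
          using perm_list_lt[OF fs that] by blast
        then show ?thesis
          by (simp only: inv_list(2)[OF fs that])
      qed
      show "map (\<lambda>j. (map fst rs ! j, map fst rs ! (fs ! j))) [0..<k] = rs"
        using rs snd perm_list_lt[OF fs] by (intro nth_equalityI) (auto simp: prod_eq_iff)
      show "map fst rs \<in> ?L"
        using rs by auto
      show "(\<Prod>j<k. B $$ (map fst rs ! j, map fst rs ! (fs ! j))) = (\<Prod>j<k. B $$ (rs ! j))"
      proof (intro prod.cong refl)
        fix j assume "j \<in> {..<k}"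
        then have "(map fst rs ! j, map fst rs ! (fs ! j)) = rs ! j"
          using rs snd[of j] perm_list_lt[OF fs, of j] by (simp add: prod_eq_iff)
        then show "B $$ (map fst rs ! j, map fst rs ! (fs ! j)) = B $$ (rs ! j)"
          by simp
      qed
    next
      fix "is" assume "is": "is \<in> ?L"
      show "map fst (map (\<lambda>j. (is ! j, is ! (fs ! j))) [0..<k]) = is"
        using "is" by (intro nth_equalityI) auto
      show "map (\<lambda>j. (is ! j, is ! (fs ! j))) [0..<k] \<in>
          {rs \<in> lists_over k ?P. \<forall>j<k. snd (rs ! (inv_list fs j)) = fst (rs ! j)}"
        using lt[OF "is"] perm_list_lt[OF fs] inv_list(3,4)[OF fs] by auto
    qed
    finally show ?thesis .
  qed
  moreover have "ev (\<lambda>(i, j). C $$ (i, j)) (trace_poly d) =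
      (\<Sum>fs\<in>perm_lists k. d fs * (\<Sum>is\<in>lists_over k {..<m}. \<Prod>j<k. C $$ (is ! j, is ! (fs ! j))))" for C :: "complex mat"
    by (simp add: ev_trace_poly)
  ultimately show ?thesis
    unfolding mat_poly_def by simp
qed

lemma trace_poly_in_inv_polys: "trace_poly d \<in> inv_polys m k"
  using trace_poly_keys trace_poly_conj_invariant
  by (fastforce simp: inv_polys_def size_mono_mset[symmetric])

text \<open>With a rank one matrix in each position of a product of traces, every contraction
  becomes a pairing of some \<open>u\<close> with some \<open>w\<close>; \<open>ls\<close> records
  how the \<open>k\<close> matrices are distributed over the positions.\<close>

lemma polarized_trace_poly:
  "polarized m k (trace_poly d) u w =
    (\<Sum>fs\<in>perm_lists k. \<Sum>ls\<in>perm_lists k. d fs * (\<Prod>j<k. gram m u w (ls ! j) (ls ! (fs ! j))))"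
proof -
  let ?L = "lists_over k {..<m}"
  have lt: "is ! j < m" if "is \<in> ?L" "j < k" for "is" j
    using that nth_mem[of j "is"] by blast
  have poly: "mat_poly (trace_poly d) (mat m m (\<lambda>(\<delta>, \<gamma>). \<Sum>l\<in>I. w l \<delta> * u l \<gamma>)) =
      (\<Sum>fs\<in>perm_lists k. d fs * (\<Sum>is\<in>?L. \<Prod>j<k. \<Sum>l\<in>I. w l (is ! j) * u l (is ! (fs ! j))))" for I
    unfolding mat_poly_def ev_trace_poly using lt perm_list_lt
    by (intro sum.cong refl arg_cong2[where f = "(*)"] prod.cong) simp
  have "polarized m k (trace_poly d) u w = (\<Sum>fs\<in>perm_lists k. d fs * (\<Sum>is\<in>?L. \<Sum>I\<in>Pow {..<k}.
      (-1) ^ (k - card I) * (\<Prod>j<k. \<Sum>l\<in>I. w l (is ! j) * u l (is ! (fs ! j)))))"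
    unfolding polarized_def poly sum_distrib_left
    by (subst sum.swap, intro sum.cong refl, subst sum.swap, intro sum.cong refl) (simp only: mult_ac)
  also have "\<dots> = (\<Sum>fs\<in>perm_lists k. d fs * (\<Sum>is\<in>?L. \<Sum>ls\<in>perm_lists k.
      \<Prod>j<k. w (ls ! j) (is ! j) * u (ls ! j) (is ! (fs ! j))))"
    using inclusion_exclusion_perm_lists[of k "\<lambda>j l. w l (is ! j) * u l (is ! (fs ! j))" for "is" fs] by simp
  also have "\<dots> = (\<Sum>fs\<in>perm_lists k. \<Sum>ls\<in>perm_lists k. d fs * (\<Sum>is\<in>?L.
      \<Prod>j<k. w (ls ! j) (is ! j) * u (ls ! j) (is ! (fs ! j))))"
    by (intro sum.cong refl) (subst sum.swap, simp only: sum_distrib_left)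
  also have "\<dots> = (\<Sum>fs\<in>perm_lists k. \<Sum>ls\<in>perm_lists k. d fs * (\<Prod>j<k. gram m u w (ls ! j) (ls ! (fs ! j))))"
  proof (intro sum.cong refl arg_cong2[where f = "(*)"])
    fix fs ls assume fs: "fs \<in> perm_lists k"
    have "(\<Sum>is\<in>?L. \<Prod>j<k. w (ls ! j) (is ! j) * u (ls ! j) (is ! (fs ! j))) =
        (\<Prod>j<k. \<Sum>a<m. w (ls ! j) a * u (ls ! (inv_list fs j)) a)"
      by (rule sum_contract_indices[OF fs, where p = "\<lambda>j. w (ls ! j)" and q = "\<lambda>j. u (ls ! j)"])
    also have "\<dots> = (\<Prod>j<k. gram m u w (ls ! (inv_list fs j)) (ls ! j))"
      by (simp add: gram_def mult.commute)
    also have "\<dots> = (\<Prod>j<k. gram m u w (ls ! j) (ls ! (fs ! j)))"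
      by (rule prod_perm_reindex[OF fs, where h = "\<lambda>i j. gram m u w (ls ! i) (ls ! j)", symmetric])
    finally show "(\<Sum>is\<in>?L. \<Prod>j<k. w (ls ! j) (is ! j) * u (ls ! j) (is ! (fs ! j))) =
        (\<Prod>j<k. gram m u w (ls ! j) (ls ! (fs ! j)))" .
  qed
  finally show ?thesis .
qed

text \<open>With all \<open>t j\<close> equal to 1 the jet is symmetric in its summands.
  Consequently \<open>\<Phi>\<close> is invariant under simultaneous permutations of the first
  \<open>k\<close> rows and columns.\<close>

lemma contraction_permute:
  assumes ls: "ls \<in> perm_lists k"
  defines "l \<equiv> \<lambda>j. if j < k then ls ! j else j"
  shows "contraction m k Q (\<lambda>_. 1) (u \<circ> l) (w \<circ> l) = contraction m k Q (\<lambda>_. 1) u w"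
proof -
  have bij: "bij_betw (\<lambda>j. ls ! j) {..<k} {..<k}"
    by (rule inv_list(1)[OF ls])
  have "jet_sum k (\<lambda>_. 1) (u \<circ> l) (w \<circ> l) = jet_sum k (\<lambda>_. 1) u w"
  proof (intro ext)
    fix v :: jet_var
    have "(\<Sum>j<k. decomposable u w (ls ! j) v) = (\<Sum>j<k. decomposable u w j v)"
      by (rule sum.reindex_bij_betw[OF bij, of "\<lambda>j. decomposable u w j v"])
    then show "jet_sum k (\<lambda>_. 1) (u \<circ> l) (w \<circ> l) v = jet_sum k (\<lambda>_. 1) u w v"
      by (simp add: jet_sum_def decomposable_def case_prod_beta l_def)
  qed
  then show ?thesis
    by (simp add: contraction_def l_def)
qed

text \<open>Polarizing \<open>trace_poly d\<close> sums the cofactor of the determinant over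
  simultaneous permutations \<open>ls\<close> of rows and columns. As \<open>\<Phi>\<close> and the
  determinant are invariant under these, each term gives \<open>\<Phi>\<close> again.\<close>

lemma in_image: "Q \<in> Xi m k ` inv_polys m k"
proof -
  obtain d where d: "\<And>G. \<Phi> G = \<D> G * (\<Sum>fs\<in>perm_lists k. d fs * (\<Prod>i<k. G i (fs ! i)))"
    using det_factor by auto
  \<comment> \<open>Compensates for the constant and the sign in \<open>contraction_Xi\<close> and
    for the number of permutations summed over.\<close>
  define c where "c = 1 / (Xi_constant k * (-1) ^ k * of_nat (card (perm_lists k)))"
  let ?S = "trace_poly d"
  have card: "card (perm_lists k) \<noteq> 0"
  proof -
    have "[0..<k] \<in> perm_lists k"
      by auto
    then show ?thesis
      using finite_perm_lists[of k] by (metis card_0_eq empty_iff)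
  qed
  have S: "pconst c * ?S \<in> inv_polys m k"
  proof -
    have "pconst c * ?S = trace_poly (\<lambda>fs. c * d fs)"
      by (rule ev_eq_imp) (simp add: ev_hom.hom_mult ev_trace_poly sum_distrib_left mult.assoc)
    then show ?thesis
      using trace_poly_in_inv_polys by simp
  qed
  have sum: "det_fun (Suc k) (gram m u w) * polarized m k ?S u w = of_nat (card (perm_lists k)) * \<Phi> (gram m u w)" for u w
  proof -
    have "det_fun (Suc k) (gram m u w) * polarized m k ?S u w =
        (\<Sum>ls\<in>perm_lists k. det_fun (Suc k) (gram m u w) * (\<Sum>fs\<in>perm_lists k. d fs * (\<Prod>j<k. gram m u w (ls ! j) (ls ! (fs ! j)))))"
      unfolding polarized_trace_poly by (subst sum.swap) (simp only: sum_distrib_left)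
    also have "\<dots> = (\<Sum>ls\<in>perm_lists k. \<Phi> (gram m u w))"
    proof (intro sum.cong refl)
      fix ls assume ls: "ls \<in> perm_lists k"
      define l where "l = (\<lambda>j. if j < k then ls ! j else j)"
      let ?G = "gram m (u \<circ> l) (w \<circ> l)"
      have G: "?G i j = gram m u w (l i) (l j)" for i j
        by (simp add: gram_def)
      have l_nth: "l i = (ls @ [k]) ! i" if "i < Suc k" for i
        using that ls by (auto simp: l_def nth_append)
      have "\<D> ?G = det_fun (Suc k) (\<lambda>i j. gram m u w ((ls @ [k]) ! i) ((ls @ [k]) ! j))"
        by (intro det_fun_cong) (simp add: G l_nth)
      also have "\<dots> = \<D> (gram m u w)"
      proof -
        have "distinct (ls @ [k])"
          using ls distinct_perm_list[OF ls] by auto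
        then show ?thesis
          using ls by (subst det_fun_reindex) auto
      qed
      finally have "\<Phi> ?G = \<D> (gram m u w) * (\<Sum>fs\<in>perm_lists k. d fs * (\<Prod>j<k. ?G j (fs ! j)))"
        unfolding d by simp
      also have "(\<Sum>fs\<in>perm_lists k. d fs * (\<Prod>j<k. ?G j (fs ! j))) =
          (\<Sum>fs\<in>perm_lists k. d fs * (\<Prod>j<k. gram m u w (ls ! j) (ls ! (fs ! j))))"
      proof (intro sum.cong refl arg_cong2[where f = "(*)"] prod.cong)
        fix fs j assume "fs \<in> perm_lists k" "j \<in> {..<k}"
        then have "l j = ls ! j" "l (fs ! j) = ls ! (fs ! j)"
          using perm_list_lt by (auto simp: l_def)
        then show "?G j (fs ! j) = gram m u w (ls ! j) (ls ! (fs ! j))"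
          by (simp only: G)
      qed
      finally show "det_fun (Suc k) (gram m u w) * (\<Sum>fs\<in>perm_lists k. d fs * (\<Prod>j<k. gram m u w (ls ! j) (ls ! (fs ! j)))) =
          \<Phi> (gram m u w)"
        using contraction_permute[OF ls, of u w] unfolding contraction_\<Phi> l_def[symmetric] by (simp only:)
    qed
    finally show ?thesis
      by simp
  qed
  have "Q = Xi m k (pconst c * ?S)"
  proof (rule contraction_eq_imp[where m = m and k = k])
    fix \<alpha> \<beta> assume "m \<le> \<alpha> \<or> m \<le> \<beta>"
    then show "Q \<alpha> \<beta> = 0 \<and> Xi m k (pconst c * ?S) \<alpha> \<beta> = 0"
      using tensors by (auto simp: jet_tensors_def Xi_outside)
  next
    fix \<alpha> \<beta> \<mu> assume "\<mu> \<in> Poly_Mapping.keys (Q \<alpha> \<beta>) \<union> Poly_Mapping.keys (Xi m k (pconst c * ?S) \<alpha> \<beta>)"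
    then show "size (mono_mset \<mu>) = k"
      using keys_size(1) Xi_keys(2)[OF S] by blast
  next
    fix t u w
    have "contraction m k (Xi m k (pconst c * ?S)) t u w = c * contraction m k (Xi m k ?S) t u w"
      by (simp add: Xi_scale contraction_def ev_hom.hom_mult sum_distrib_left mult_ac)
    also have "contraction m k (Xi m k ?S) t u w =
        Xi_constant k * (-1) ^ k * (\<Prod>j<k. t j) * (det_fun (Suc k) (gram m u w) * polarized m k ?S u w)"
      using contraction_Xi[of ?S m k t u w] trace_poly_keys by (simp add: mult.assoc)
    also have "c * \<dots> = (\<Prod>j<k. t j) * \<Phi> (gram m u w)"
    proof -
      have "1 / (x * y) * (x * p * (y * q)) = p * q" if "x \<noteq> 0" "y \<noteq> 0" for x y p q :: complex
        using that by simp
      moreover have "Xi_constant k * (-1) ^ k \<noteq> 0"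
        using Xi_constant_nonzero[of k] by simp
      moreover have "of_nat (card (perm_lists k)) \<noteq> (0 :: complex)"
        unfolding of_nat_eq_0_iff by (rule card)
      ultimately show ?thesis
        unfolding sum c_def by blast
    qed
    also have "\<dots> = contraction m k Q t u w"
      unfolding contraction_t[of t] contraction_\<Phi> ..
    finally show "contraction m k Q t u w = contraction m k (Xi m k (pconst c * ?S)) t u w"
      by simp
  qed
  with S show ?thesis
    by blast
qed

end

theorem bij_betw_Xi:
  assumes "1 \<le> k" "k < m"
  shows "bij_betw (Xi m k) (inv_polys m k) (restriction_kernel m k)"
proof -
  have "Q \<in> Xi m k ` inv_polys m k" if "Q \<in> restriction_kernel m k" for Q
  proof -
    interpret kernel_element m k Q
      using assms that by unfold_locales
    show ?thesis
      by (rule in_image)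
  qed
  then show ?thesis
    using assms inj_on_Xi Xi_in_restriction_kernel unfolding bij_betw_def by blast
qed

section \<open>Partial derivatives\<close>

text \<open>The second difference over a square is an increment in \<open>s\<close> of an increment
  in \<open>t\<close>; the mean value theorem, applied in \<open>s\<close> and then in
  \<open>t\<close>, gives a mixed derivative at an interior point.\<close>

lemma mean_value_mixed:
  fixes g :: "real \<Rightarrow> real \<Rightarrow> real"
  assumes h: "0 < h" "h < r"
    and g1: "\<And>s t. \<bar>s\<bar> < r \<Longrightarrow> \<bar>t\<bar> < r \<Longrightarrow> ((\<lambda>s. g s t) has_real_derivative g1 s t) (at s)"
    and g12: "\<And>s t. \<bar>s\<bar> < r \<Longrightarrow> \<bar>t\<bar> < r \<Longrightarrow> ((\<lambda>t. g1 s t) has_real_derivative g12 s t) (at t)"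
  obtains s t where "0 < s" "s < h" "0 < t" "t < h" "g h h - g h 0 - g 0 h + g 0 0 = h * h * g12 s t"
proof -
  have "\<exists>s>0. s < h \<and> (g h h - g h 0) - (g 0 h - g 0 0) = (h - 0) * (g1 s h - g1 s 0)"
    by (rule MVT2) (use h in \<open>auto intro!: derivative_intros g1\<close>)
  then obtain s where s: "0 < s" "s < h" "(g h h - g h 0) - (g 0 h - g 0 0) = (h - 0) * (g1 s h - g1 s 0)"
    by auto
  have "\<exists>t>0. t < h \<and> g1 s h - g1 s 0 = (h - 0) * g12 s t"
    by (rule MVT2) (use h s in \<open>auto intro!: g12\<close>)
  then obtain t where "0 < t" "t < h" "g1 s h - g1 s 0 = (h - 0) * g12 s t"
    by auto
  with s show ?thesis
    by (intro that[of s t]) (auto simp: algebra_simps)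
qed

text \<open>The same second difference equals a mixed derivative of either order at some point of an
  arbitrarily small square; continuity at the origin forces the two to agree.\<close>

lemma mixed_derivatives_eq:
  fixes g :: "real \<Rightarrow> real \<Rightarrow> real"
  assumes r: "0 < r"
    and g1: "\<And>s t. \<bar>s\<bar> < r \<Longrightarrow> \<bar>t\<bar> < r \<Longrightarrow> ((\<lambda>s. g s t) has_real_derivative g1 s t) (at s)"
    and g12: "\<And>s t. \<bar>s\<bar> < r \<Longrightarrow> \<bar>t\<bar> < r \<Longrightarrow> ((\<lambda>t. g1 s t) has_real_derivative g12 s t) (at t)"
    and g2: "\<And>s t. \<bar>s\<bar> < r \<Longrightarrow> \<bar>t\<bar> < r \<Longrightarrow> ((\<lambda>t. g s t) has_real_derivative g2 s t) (at t)"
    and g21: "\<And>s t. \<bar>s\<bar> < r \<Longrightarrow> \<bar>t\<bar> < r \<Longrightarrow> ((\<lambda>s. g2 s t) has_real_derivative g21 s t) (at s)"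
    and cont12: "\<And>e. 0 < e \<Longrightarrow> \<exists>d>0. \<forall>s t. \<bar>s\<bar> < d \<longrightarrow> \<bar>t\<bar> < d \<longrightarrow> \<bar>g12 s t - g12 0 0\<bar> < e"
    and cont21: "\<And>e. 0 < e \<Longrightarrow> \<exists>d>0. \<forall>s t. \<bar>s\<bar> < d \<longrightarrow> \<bar>t\<bar> < d \<longrightarrow> \<bar>g21 s t - g21 0 0\<bar> < e"
  shows "g12 0 0 = g21 0 0"
proof (rule ccontr)
  assume ne: "g12 0 0 \<noteq> g21 0 0"
  define e where "e = \<bar>g12 0 0 - g21 0 0\<bar> / 2"
  have e: "0 < e"
    using ne by (simp add: e_def)
  obtain d1 where d1: "0 < d1" "\<And>s t. \<bar>s\<bar> < d1 \<Longrightarrow> \<bar>t\<bar> < d1 \<Longrightarrow> \<bar>g12 s t - g12 0 0\<bar> < e"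
    using cont12[OF e] by blast
  obtain d2 where d2: "0 < d2" "\<And>s t. \<bar>s\<bar> < d2 \<Longrightarrow> \<bar>t\<bar> < d2 \<Longrightarrow> \<bar>g21 s t - g21 0 0\<bar> < e"
    using cont21[OF e] by blast
  obtain h where h: "0 < h" "h < r" "h < d1" "h < d2"
    using field_lbound_gt_zero[of r "min d1 d2"] r d1(1) d2(1) by auto
  obtain s t where st: "0 < s" "s < h" "0 < t" "t < h" "g h h - g h 0 - g 0 h + g 0 0 = h * h * g12 s t"
    by (rule mean_value_mixed[of h r g g1 g12]) (use h g1 g12 in auto)
  obtain t' s' where st': "0 < t'" "t' < h" "0 < s'" "s' < h" "g h h - g 0 h - g h 0 + g 0 0 = h * h * g21 s' t'"
    by (rule mean_value_mixed[of h r "\<lambda>t s. g s t" "\<lambda>t s. g2 s t" "\<lambda>t s. g21 s t"]) (use h g2 g21 in auto)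
  have "h * h * g12 s t = h * h * g21 s' t'"
    using st(5) st'(5) by linarith
  then have "g12 s t = g21 s' t'"
    using h(1) by simp
  moreover have "\<bar>g12 s t - g12 0 0\<bar> < e" "\<bar>g21 s' t' - g21 0 0\<bar> < e"
    using d1(2)[of s t] d2(2)[of s' t'] st st' h by auto
  ultimately show False
    unfolding e_def by (simp add: abs_if split: if_splits)
qed

definition line_differentiable :: "nat \<Rightarrow> ((nat \<Rightarrow> complex) \<Rightarrow> complex) \<Rightarrow> (nat \<Rightarrow> complex) \<Rightarrow> bool" where
  "line_differentiable m f z \<longleftrightarrow> (\<forall>j<m. \<forall>u\<in>{1, \<i>}. (\<lambda>t. f (coord_line u j z t)) differentiable (at 0))"

lemma coord_line_0 [simp]: "coord_line u j z 0 = z"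
  by (simp add: coord_line_def)

lemma pderivative_works:
  assumes "line_differentiable m f z" "j < m" "u \<in> {1, \<i>}"
  shows "((\<lambda>t. f (coord_line u j z t)) has_vector_derivative pderivative u j f z) (at 0)"
  using assms unfolding line_differentiable_def pderivative_def by (blast intro: iffD1[OF vector_derivative_works])

lemma pderivative_eqI:
  "((\<lambda>t. f (coord_line u j z t)) has_vector_derivative D) (at 0) \<Longrightarrow> pderivative u j f z = D"
  unfolding pderivative_def by (rule vector_derivative_at)

lemma line_differentiable_const: "line_differentiable m (\<lambda>z. c) z"
  by (simp add: line_differentiable_def)

lemma line_differentiable_mult:
  "line_differentiable m f z \<Longrightarrow> line_differentiable m h z \<Longrightarrow> line_differentiable m (\<lambda>z. f z * h z) z"
  by (simp add: line_differentiable_def)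

section \<open>Rules for partial and frame derivatives\<close>

context
  fixes m :: nat and z :: "nat \<Rightarrow> complex" and j :: nat and u :: complex
  assumes j: "j < m" and u: "u \<in> {1, \<i>}"
begin

lemma pderivative_const: "pderivative u j (\<lambda>z. c) z = 0"
  by (rule pderivative_eqI) simp

lemma pderivative_sum:
  "(\<And>i. i \<in> I \<Longrightarrow> line_differentiable m (f i) z) \<Longrightarrow>
    pderivative u j (\<lambda>z. \<Sum>i\<in>I. f i z) z = (\<Sum>i\<in>I. pderivative u j (f i) z)"
  by (intro pderivative_eqI has_vector_derivative_sum pderivative_works[OF _ j u])

lemma pderivative_mult:
  assumes "line_differentiable m f z" "line_differentiable m h z"
  shows "pderivative u j (\<lambda>z. f z * h z) z = f z * pderivative u j h z + pderivative u j f z * h z"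
  using has_vector_derivative_mult[OF pderivative_works[OF assms(1) j u] pderivative_works[OF assms(2) j u]]
  by (intro pderivative_eqI) simp

end

lemma frame_deriv_pderivative:
  "frame_deriv a f z = (pderivative 1 (a div 2) f z - J_eigen a * pderivative \<i> (a div 2) f z) / 2"
  by (simp add: frame_deriv_def dz_def dzbar_def J_eigen_def)

context
  fixes m :: nat and z :: "nat \<Rightarrow> complex" and a :: nat
  assumes a: "a < 2 * m"
begin

lemma frame_deriv_const: "frame_deriv a (\<lambda>z. c) z = 0"
  using a pderivative_const[of "a div 2" m] by (simp add: frame_deriv_pderivative)

lemma frame_deriv_sum:
  "(\<And>i. i \<in> I \<Longrightarrow> line_differentiable m (f i) z) \<Longrightarrow>
    frame_deriv a (\<lambda>z. \<Sum>i\<in>I. f i z) z = (\<Sum>i\<in>I. frame_deriv a (f i) z)"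
  using a pderivative_sum[of "a div 2" m _ I f z]
  by (simp add: frame_deriv_pderivative sum_distrib_left sum_subtractf[symmetric] sum_divide_distrib)

lemma frame_deriv_mult:
  "line_differentiable m f z \<Longrightarrow> line_differentiable m h z \<Longrightarrow>
    frame_deriv a (\<lambda>z. f z * h z) z = f z * frame_deriv a h z + frame_deriv a f z * h z"
  using a pderivative_mult[of "a div 2" m _ f z h] by (simp add: frame_deriv_pderivative field_simps)

end

lemma smooth_zero: "smooth m U (\<lambda>z. 0)"
proof -
  have "times_cont_diff n m U (\<lambda>z. 0)" for n
  proof (induction n)
    case (Suc n)
    have "pderivative u j (\<lambda>z. 0) = (\<lambda>z. 0)" for u j
      by (intro ext pderivative_eqI) simp
    with Suc show ?case
      by simp
  qed simp
  then show ?thesis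
    by (simp add: smooth_def)
qed

lemma smooth_continuous: "smooth m U f \<Longrightarrow> continuous_on U f"
  unfolding smooth_def by (drule spec[of _ 0]) simp

lemma smooth_line_differentiable: "smooth m U f \<Longrightarrow> z \<in> U \<Longrightarrow> line_differentiable m f z"
  unfolding smooth_def line_differentiable_def by (drule spec[of _ 1]) auto

lemma smooth_pderivative: "smooth m U f \<Longrightarrow> j < m \<Longrightarrow> u \<in> {1, \<i>} \<Longrightarrow> smooth m U (pderivative u j f)"
  unfolding smooth_def by (metis times_cont_diff.simps(2))

lemma eventually_coord_line:
  assumes "z \<in> polydisc m \<epsilon>" "j < m"
  shows "eventually (\<lambda>t. coord_line u j z t \<in> polydisc m \<epsilon>) (nhds 0)"
proof -
  have "((\<lambda>t. cmod (z j + of_real t * u)) \<longlongrightarrow> cmod (z j + of_real 0 * u)) (nhds (0::real))"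
    by (intro tendsto_intros) (auto simp: filterlim_ident)
  moreover have "cmod (z j + of_real 0 * u) < \<epsilon>"
    using assms by (simp add: polydisc_def)
  ultimately have "eventually (\<lambda>t. cmod (z j + of_real t * u) < \<epsilon>) (nhds 0)"
    by (rule order_tendstoD(2))
  then show ?thesis
    by eventually_elim (use assms in \<open>auto simp: polydisc_def coord_line_def\<close>)
qed

text \<open>Coordinate lines stay in the polydisc for small parameters, so values outside it cannot
  influence the derivative.\<close>

lemma frame_deriv_cong:
  assumes eq: "\<And>z. z \<in> polydisc m \<epsilon> \<Longrightarrow> f z = h z" and z: "z \<in> polydisc m \<epsilon>" and a: "a < 2 * m"
  shows "frame_deriv a f z = frame_deriv a h z"
proof -
  have "pderivative u (a div 2) f z = pderivative u (a div 2) h z" for u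
  proof -
    have "eventually (\<lambda>t. coord_line u (a div 2) z t \<in> polydisc m \<epsilon>) (nhds 0)"
      using a by (intro eventually_coord_line[OF z]) simp
    then show ?thesis
      unfolding pderivative_def by (intro vector_derivative_cong_eq) (auto elim!: eventually_mono simp: eq)
  qed
  then show ?thesis
    by (simp add: frame_deriv_pderivative)
qed

lemma pderivative_along_line:
  assumes f: "smooth m U f" "j < m" "u \<in> {1, \<i>}" and Z: "Z s \<in> U" and line: "\<And>t. Z t = coord_line u j (Z s) (t - s)"
  shows "((\<lambda>t. f (Z t)) has_vector_derivative pderivative u j f (Z s)) (at s)"
proof -
  have "((\<lambda>t. t - s) has_vector_derivative 1) (at s)"
    by (auto intro!: derivative_eq_intros)
  moreover have "((\<lambda>t. f (coord_line u j (Z s) t)) has_vector_derivative pderivative u j f (Z s)) (at (s - s))"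
    using pderivative_works[OF smooth_line_differentiable[OF f(1) Z] f(2,3)] by simp
  ultimately have "((\<lambda>t. f (coord_line u j (Z s) t)) \<circ> (\<lambda>t. t - s) has_vector_derivative 1 *\<^sub>R pderivative u j f (Z s)) (at s)"
    by (rule vector_diff_chain_at)
  then show ?thesis
    unfolding comp_def line[symmetric] by simp
qed

text \<open>Reduces to the two-parameter family \<open>Z\<close>; real and imaginary parts are
  treated separately because the mean value theorem is a real statement.\<close>

lemma pderivative_commute:
  assumes f: "smooth m (polydisc m \<epsilon>) f" and z: "z \<in> polydisc m \<epsilon>"
    and j: "j < m" "u \<in> {1, \<i>}" and l: "l < m" "v \<in> {1, \<i>}"
  shows "pderivative u j (pderivative v l f) z = pderivative v l (pderivative u j f) z"
proof -
  let ?U = "polydisc m \<epsilon>"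
  define Z where "Z = (\<lambda>s t. coord_line v l (coord_line u j z s) t)"
  \<comment> \<open>Halved because both moves act on the same coordinate when
    \<open>j = l\<close>.\<close>
  define r where "r = min (\<epsilon> - cmod (z j)) (\<epsilon> - cmod (z l)) / 2"
  have r: "0 < r"
    using z j l by (auto simp: r_def polydisc_def)
  have norm: "cmod u = 1" "cmod v = 1"
    using j l by auto
  have ZU: "Z s t \<in> ?U" if st: "\<bar>s\<bar> < r" "\<bar>t\<bar> < r" for s t
  proof -
    have "cmod (Z s t i) < \<epsilon>" if i: "i < m" for i
    proof (cases "i = j \<or> i = l")
      case True
      have "cmod (Z s t i) \<le> cmod (z i) + \<bar>s\<bar> + \<bar>t\<bar>"
        using norm norm_triangle_ineq[of "z i" "of_real s * u"] norm_triangle_ineq[of "z i" "of_real t * v"]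
          norm_triangle_ineq[of "z i + of_real s * u" "of_real t * v"]
        by (auto simp: Z_def coord_line_def norm_mult)
      also have "\<dots> < cmod (z i) + 2 * r"
        using st by simp
      also have "\<dots> \<le> \<epsilon>"
        using True by (auto simp: r_def)
      finally show ?thesis .
    next
      case False
      then show ?thesis
        using z i by (simp add: Z_def coord_line_def polydisc_def)
    qed
    then show ?thesis
      using z j l by (auto simp: polydisc_def Z_def coord_line_def)
  qed
  have Zs: "Z s' t = coord_line u j (Z s t) (s' - s)" and Zt: "Z s t' = coord_line v l (Z s t) (t' - t)" for s s' t t'
    by (auto simp: Z_def coord_line_def fun_eq_iff algebra_simps)
  have s_deriv: "((\<lambda>s. h (Z s t)) has_vector_derivative pderivative u j h (Z s t)) (at s)"
    and t_deriv: "((\<lambda>t. h (Z s t)) has_vector_derivative pderivative v l h (Z s t)) (at t)"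
    if h: "smooth m ?U h" and st: "\<bar>s\<bar> < r" "\<bar>t\<bar> < r" for h s t
    by (rule pderivative_along_line[where Z = "\<lambda>s. Z s t", OF h j ZU[OF st] Zs])
      (rule pderivative_along_line[where Z = "\<lambda>t. Z s t", OF h l ZU[OF st] Zt])
  note fu = smooth_pderivative[OF f j] and fv = smooth_pderivative[OF f l]
  have cont: "\<exists>d>0. \<forall>s t. \<bar>s\<bar> < d \<longrightarrow> \<bar>t\<bar> < d \<longrightarrow> cmod (h (Z s t) - h (Z 0 0)) < e"
    if h: "smooth m ?U h" and e: "0 < e" for h e
  proof -
    let ?R = "{-r<..<r} \<times> {-r<..<r}"
    have "continuous_on ?R (\<lambda>x. Z (fst x) (snd x))"
    proof (rule continuous_on_coordinatewise_then_product)
      fix i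
      have eq: "(\<lambda>x. Z (fst x) (snd x) i) = (\<lambda>x. z i + (if i = j then of_real (fst x) * u else 0) + (if i = l then of_real (snd x) * v else 0))"
        by (auto simp: Z_def coord_line_def fun_eq_iff)
      show "continuous_on ?R (\<lambda>x. Z (fst x) (snd x) i)"
        unfolding eq by (cases "i = j"; cases "i = l") (auto intro!: continuous_intros)
    qed
    then have "continuous_on ?R (\<lambda>x. h (Z (fst x) (snd x)))"
      by (rule continuous_on_compose2[OF smooth_continuous[OF h]]) (auto intro!: ZU)
    moreover have "(0, 0) \<in> ?R"
      using r by simp
    ultimately obtain d where d: "0 < d" "\<And>x. x \<in> ?R \<Longrightarrow> dist x (0, 0) < d \<Longrightarrow> dist (h (Z (fst x) (snd x))) (h (Z 0 0)) < e"
      using e unfolding continuous_on_iff by fastforce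
    have "cmod (h (Z s t) - h (Z 0 0)) < e" if st: "\<bar>s\<bar> < min r (d / 2)" "\<bar>t\<bar> < min r (d / 2)" for s t
    proof -
      have "dist (s, t) (0, 0) \<le> \<bar>s\<bar> + \<bar>t\<bar>"
        using sqrt_sum_squares_le_sum_abs[of s t] by (simp add: dist_prod_def)
      then show ?thesis
        using d(2)[of "(s, t)"] st by (simp add: dist_norm abs_less_iff)
    qed
    then show ?thesis
      using d(1) r by (intro exI[of _ "min r (d / 2)"]) auto
  qed
  let ?fuv = "pderivative v l (pderivative u j f)" and ?fvu = "pderivative u j (pderivative v l f)"
  have contuv: "\<exists>d>0. \<forall>s t. \<bar>s\<bar> < d \<longrightarrow> \<bar>t\<bar> < d \<longrightarrow> cmod (?fuv (Z s t) - ?fuv (Z 0 0)) < e" if "0 < e" for e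
    using cont[OF smooth_pderivative[OF fu l] that] .
  have contvu: "\<exists>d>0. \<forall>s t. \<bar>s\<bar> < d \<longrightarrow> \<bar>t\<bar> < d \<longrightarrow> cmod (?fvu (Z s t) - ?fvu (Z 0 0)) < e" if "0 < e" for e
    using cont[OF smooth_pderivative[OF fv j] that] .
  have Re_less: "cmod (x - y) < e \<Longrightarrow> \<bar>Re x - Re y\<bar> < e" and Im_less: "cmod (x - y) < e \<Longrightarrow> \<bar>Im x - Im y\<bar> < e" for x y e
    using abs_Re_le_cmod[of "x - y"] abs_Im_le_cmod[of "x - y"] by auto
  have "Re (?fuv (Z 0 0)) = Re (?fvu (Z 0 0))"
  proof (rule mixed_derivatives_eq[OF r, where g = "\<lambda>s t. Re (f (Z s t))" and ?g12.0 = "\<lambda>s t. Re (?fuv (Z s t))" and ?g21.0 = "\<lambda>s t. Re (?fvu (Z s t))"])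
    show "((\<lambda>s. Re (f (Z s t))) has_real_derivative Re (pderivative u j f (Z s t))) (at s)"
      "((\<lambda>t. Re (pderivative u j f (Z s t))) has_real_derivative Re (?fuv (Z s t))) (at t)"
      "((\<lambda>t. Re (f (Z s t))) has_real_derivative Re (pderivative v l f (Z s t))) (at t)"
      "((\<lambda>s. Re (pderivative v l f (Z s t))) has_real_derivative Re (?fvu (Z s t))) (at s)"
      if "\<bar>s\<bar> < r" "\<bar>t\<bar> < r" for s t
      by (intro has_field_derivative_Re s_deriv[OF f that] s_deriv[OF fv that] t_deriv[OF f that] t_deriv[OF fu that])+
  next
    fix e :: real assume "0 < e"
    then show "\<exists>d>0. \<forall>s t. \<bar>s\<bar> < d \<longrightarrow> \<bar>t\<bar> < d \<longrightarrow> \<bar>Re (?fuv (Z s t)) - Re (?fuv (Z 0 0))\<bar> < e"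
      "\<exists>d>0. \<forall>s t. \<bar>s\<bar> < d \<longrightarrow> \<bar>t\<bar> < d \<longrightarrow> \<bar>Re (?fvu (Z s t)) - Re (?fvu (Z 0 0))\<bar> < e"
      using contuv[of e] contvu[of e] Re_less by meson+
  qed
  moreover have "Im (?fuv (Z 0 0)) = Im (?fvu (Z 0 0))"
  proof (rule mixed_derivatives_eq[OF r, where g = "\<lambda>s t. Im (f (Z s t))" and ?g12.0 = "\<lambda>s t. Im (?fuv (Z s t))" and ?g21.0 = "\<lambda>s t. Im (?fvu (Z s t))"])
    show "((\<lambda>s. Im (f (Z s t))) has_real_derivative Im (pderivative u j f (Z s t))) (at s)"
      "((\<lambda>t. Im (pderivative u j f (Z s t))) has_real_derivative Im (?fuv (Z s t))) (at t)"
      "((\<lambda>t. Im (f (Z s t))) has_real_derivative Im (pderivative v l f (Z s t))) (at t)"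
      "((\<lambda>s. Im (pderivative v l f (Z s t))) has_real_derivative Im (?fvu (Z s t))) (at s)"
      if "\<bar>s\<bar> < r" "\<bar>t\<bar> < r" for s t
      by (intro has_field_derivative_Im s_deriv[OF f that] s_deriv[OF fv that] t_deriv[OF f that] t_deriv[OF fu that])+
  next
    fix e :: real assume "0 < e"
    then show "\<exists>d>0. \<forall>s t. \<bar>s\<bar> < d \<longrightarrow> \<bar>t\<bar> < d \<longrightarrow> \<bar>Im (?fuv (Z s t)) - Im (?fuv (Z 0 0))\<bar> < e"
      "\<exists>d>0. \<forall>s t. \<bar>s\<bar> < d \<longrightarrow> \<bar>t\<bar> < d \<longrightarrow> \<bar>Im (?fvu (Z s t)) - Im (?fvu (Z 0 0))\<bar> < e"
      using contuv[of e] contvu[of e] Im_less by meson+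
  qed
  ultimately have "?fuv (Z 0 0) = ?fvu (Z 0 0)"
    by (rule complex_eqI)
  then show ?thesis
    by (simp add: Z_def)
qed

lemma frame_deriv_commute:
  assumes f: "smooth m (polydisc m \<epsilon>) f" and z: "z \<in> polydisc m \<epsilon>" and a: "a < 2 * m" and b: "b < 2 * m"
  shows "frame_deriv a (frame_deriv b f) z = frame_deriv b (frame_deriv a f) z"
proof -
  have expand: "pderivative u j (frame_deriv b f) z =
      (pderivative u j (pderivative 1 (b div 2) f) z - J_eigen b * pderivative u j (pderivative \<i> (b div 2) f) z) / 2"
    if u: "j < m" "u \<in> {1, \<i>}" and b: "b < 2 * m" for u j b
  proof -
    have diff: "line_differentiable m (pderivative v (b div 2) f) z" if "v \<in> {1, \<i>}" for v
      using f z b that by (intro smooth_line_differentiable smooth_pderivative) auto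
    have fd: "frame_deriv b f = (\<lambda>z. 1 / 2 * pderivative 1 (b div 2) f z + (- J_eigen b / 2) * pderivative \<i> (b div 2) f z)"
      by (auto simp: frame_deriv_pderivative field_simps)
    have "pderivative u j (frame_deriv b f) z =
        1 / 2 * pderivative u j (pderivative 1 (b div 2) f) z + (- J_eigen b / 2) * pderivative u j (pderivative \<i> (b div 2) f) z"
      unfolding fd
      by (intro pderivative_eqI has_vector_derivative_add has_vector_derivative_mult_right pderivative_works[OF diff u]) auto
    then show ?thesis
      by (simp add: field_simps)
  qed
  have comm: "pderivative u (a div 2) (pderivative v (b div 2) f) z = pderivative v (b div 2) (pderivative u (a div 2) f) z"
    if "u \<in> {1, \<i>}" "v \<in> {1, \<i>}" for u v
    using f z a b that by (intro pderivative_commute) auto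
  have "frame_deriv a (frame_deriv b f) z = (pderivative 1 (a div 2) (frame_deriv b f) z - J_eigen a * pderivative \<i> (a div 2) (frame_deriv b f) z) / 2"
    by (rule frame_deriv_pderivative)
  also have "\<dots> = (pderivative 1 (b div 2) (frame_deriv a f) z - J_eigen b * pderivative \<i> (b div 2) (frame_deriv a f) z) / 2"
    using a b by (simp add: expand comm algebra_simps diff_divide_distrib add_divide_distrib)
  also have "\<dots> = frame_deriv b (frame_deriv a f) z"
    by (rule frame_deriv_pderivative[symmetric])
  finally show ?thesis .
qed

section \<open>The curvature of a Kaehler metric in normal coordinates\<close>

lemma sum_even_odd: "(\<Sum>d<2 * m. f d) = (\<Sum>\<delta><m. f (2 * \<delta>) + f (2 * \<delta> + 1))"
  for f :: "nat \<Rightarrow> complex"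
  by (induction m) (simp_all add: algebra_simps)

locale kaehler_normal =
  fixes m n :: nat and \<epsilon> :: real and g :: hermitian_metric and \<Gamma> :: christoffel
  assumes \<epsilon>: "0 < \<epsilon>" and n: "2 \<le> n" and kaehler: "kaehler_metric m \<epsilon> g"
    and normal: "normal_coordinates m n g" and levi_civita: "levi_civita m \<epsilon> g \<Gamma>"
begin

abbreviation "U \<equiv> polydisc m \<epsilon>"
abbreviation "D \<equiv> frame_deriv"
abbreviation "G \<equiv> frame_metric g"

lemma origin: "(\<lambda>_. 0) \<in> U"
  using \<epsilon> by (simp add: polydisc_def)

lemma smooth_G:
  assumes "a < 2 * m" "b < 2 * m"
  shows "smooth m U (G a b)"
proof -
  have "a div 2 < m" "b div 2 < m"
    using assms by auto
  with kaehler show ?thesis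
    by (auto simp: kaehler_metric_def frame_metric_def smooth_zero)
qed

lemma smooth_\<Gamma>: "a < 2 * m \<Longrightarrow> b < 2 * m \<Longrightarrow> c < 2 * m \<Longrightarrow> smooth m U (\<Gamma> c a b)"
  using levi_civita by (simp add: levi_civita_def)

lemma G_sym: "G a b = G b a"
  by (auto simp: frame_metric_def)

lemma DG_same_type: "even a = even b \<Longrightarrow> c < 2 * m \<Longrightarrow> D c (G a b) z = 0"
  using frame_deriv_const[of c m 0] by (simp add: frame_metric_def)

lemma closed:
  assumes z: "z \<in> U" and abc: "a < 2 * m" "b < 2 * m" "c < 2 * m"
  shows "J_eigen c * D a (G b c) z + J_eigen a * D b (G c a) z + J_eigen b * D c (G a b) z = 0"
proof -
  have D: "D a (\<lambda>z. G b c z * J_eigen c) z = J_eigen c * D a (G b c) z" if "a < 2 * m" "b < 2 * m" "c < 2 * m" for a b c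
    using frame_deriv_mult[OF that(1) smooth_line_differentiable[OF smooth_G[OF that(2,3)] z] line_differentiable_const]
    by (simp add: frame_deriv_const[OF that(1)])
  have "D a (\<lambda>z. G b c z * J_eigen c) z + D b (\<lambda>z. G c a z * J_eigen a) z + D c (\<lambda>z. G a b z * J_eigen b) z = 0"
    using kaehler z abc by (simp add: kaehler_metric_def Let_def)
  then show ?thesis
    unfolding D[OF abc] D[OF abc(2,3,1)] D[OF abc(3,1,2)] .
qed

text \<open>The (1,0) part of \<open>X\<close> is tested against its own conjugate, which produces
  the Hermitian sum that is positive unless this part vanishes; the (0,1) part is treated in the
  same way after conjugation.\<close>

lemma nondegenerate:
  assumes z: "z \<in> U" and zero: "\<And>c. c < 2 * m \<Longrightarrow> (\<Sum>d<2 * m. X d * G d c z) = 0" and d: "d < 2 * m"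
  shows "X d = 0"
proof -
  have pos: "0 < Re (\<Sum>\<alpha><m. \<Sum>\<beta><m. g \<alpha> \<beta> z * v \<alpha> * cnj (v \<beta>))" if "\<alpha> < m" "v \<alpha> \<noteq> 0" for v \<alpha>
  proof -
    have "\<forall>v. (\<exists>\<alpha><m. v \<alpha> \<noteq> 0) \<longrightarrow> 0 < Re (\<Sum>\<alpha><m. \<Sum>\<beta><m. g \<alpha> \<beta> z * v \<alpha> * cnj (v \<beta>))"
      by (rule conjunct2[OF bspec[OF conjunct1[OF conjunct2[OF kaehler[unfolded kaehler_metric_def]]] z]])
    then show ?thesis
      using that by blast
  qed
  have even: "X (2 * \<delta>) = 0" if "\<delta> < m" for \<delta>
  proof (rule ccontr)
    assume "X (2 * \<delta>) \<noteq> 0"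
    then have "0 < Re (\<Sum>\<alpha><m. \<Sum>\<beta><m. g \<alpha> \<beta> z * X (2 * \<alpha>) * cnj (X (2 * \<beta>)))"
      using pos[of \<delta> "\<lambda>\<delta>. X (2 * \<delta>)"] that by simp
    also have "(\<Sum>\<alpha><m. \<Sum>\<beta><m. g \<alpha> \<beta> z * X (2 * \<alpha>) * cnj (X (2 * \<beta>))) =
        (\<Sum>\<beta><m. \<Sum>\<alpha><m. g \<alpha> \<beta> z * X (2 * \<alpha>) * cnj (X (2 * \<beta>)))"
      by (rule sum.swap)
    also have "\<dots> = (\<Sum>\<beta><m. cnj (X (2 * \<beta>)) * (\<Sum>d<2 * m. X d * G d (2 * \<beta> + 1) z))"
      unfolding sum_even_odd sum_distrib_left by (intro sum.cong refl) (simp add: frame_metric_def)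
    also have "\<dots> = 0"
      using zero by simp
    finally show False
      by simp
  qed
  have odd: "X (2 * \<delta> + 1) = 0" if "\<delta> < m" for \<delta>
  proof (rule ccontr)
    assume "X (2 * \<delta> + 1) \<noteq> 0"
    then have "0 < Re (\<Sum>\<alpha><m. \<Sum>\<beta><m. g \<alpha> \<beta> z * cnj (X (2 * \<alpha> + 1)) * cnj (cnj (X (2 * \<beta> + 1))))"
      using pos[of \<delta> "\<lambda>\<delta>. cnj (X (2 * \<delta> + 1))"] that by simp
    also have "(\<Sum>\<alpha><m. \<Sum>\<beta><m. g \<alpha> \<beta> z * cnj (X (2 * \<alpha> + 1)) * cnj (cnj (X (2 * \<beta> + 1)))) =
        (\<Sum>\<alpha><m. cnj (X (2 * \<alpha> + 1)) * (\<Sum>d<2 * m. X d * G d (2 * \<alpha>) z))"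
      unfolding sum_even_odd sum_distrib_left by (intro sum.cong refl) (simp add: frame_metric_def)
    also have "\<dots> = 0"
      using zero by simp
    finally show False
      by simp
  qed
  show ?thesis
    using even[of "d div 2"] odd[of "d div 2"] d by (cases "even d") auto
qed

text \<open>The Christoffel symbols of the first kind.\<close>

definition lowered :: "nat \<Rightarrow> nat \<Rightarrow> nat \<Rightarrow> (nat \<Rightarrow> complex) \<Rightarrow> complex" where
  "lowered a b c z = (\<Sum>d<2 * m. \<Gamma> d a b z * G d c z)"

text \<open>The Koszul formula: metric compatibility in three arrangements, combined by means of the
  symmetry in the first two indices; in a coordinate frame no bracket terms occur.\<close>

lemma koszul:
  assumes z: "z \<in> U" and abc: "a < 2 * m" "b < 2 * m" "c < 2 * m"
  shows "2 * lowered a b c z = D a (G b c) z + D b (G a c) z - D c (G a b) z"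
proof -
  have compat: "D a (G b c) z = lowered a b c z + lowered a c b z" if "a < 2 * m" "b < 2 * m" "c < 2 * m" for a b c
  proof -
    have "D a (G b c) z = (\<Sum>d<2 * m. \<Gamma> d a b z * G d c z + \<Gamma> d a c z * G b d z)"
      using levi_civita z that by (simp add: levi_civita_def)
    then show ?thesis
      by (simp add: lowered_def sum.distrib G_sym[of b])
  qed
  have sym: "lowered a b c z = lowered b a c z" if "a < 2 * m" "b < 2 * m" for a b c
    using levi_civita z that unfolding lowered_def levi_civita_def by (intro sum.cong refl) auto
  show ?thesis
    using compat[of a b c] compat[of b a c] compat[of c a b] sym[of a b c] sym[of a c b] sym[of b c a] abc
    by simp
qed

text \<open>In the closedness equation the derivative of \<open>G a b\<close> drops out when
  \<open>a\<close> and \<open>b\<close> have equal type; with \<open>c\<close> of the other type the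
  two remaining terms carry opposite factors.\<close>

lemma DG_symmetric:
  assumes z: "z \<in> U" and abc: "a < 2 * m" "b < 2 * m" "c < 2 * m" and type: "even a = even b"
  shows "D a (G b c) z = D b (G a c) z"
proof (cases "even a = even c")
  case True
  then show ?thesis
    using type abc by (simp add: DG_same_type)
next
  case False
  then show ?thesis
    using closed[OF z abc] type DG_same_type[OF type abc(3), of z]
    by (cases "even a") (simp_all add: J_eigen_def G_sym[of c a])
qed

text \<open>For mixed types the Koszul expression is a multiple of the closedness equation, so the
  lowered symbol vanishes and nondegeneracy removes the metric. In this form the Kaehler condition
  makes the connection respect types.\<close>

lemma mixed_zero:
  assumes z: "z \<in> U" and ab: "a < 2 * m" "b < 2 * m" "odd a" "even b" and d: "d < 2 * m"
  shows "\<Gamma> d a b z = 0"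
proof (rule nondegenerate[OF z _ d])
  fix c assume c: "c < 2 * m"
  have "2 * lowered a b c z = 0"
  proof (cases "even c")
    case True
    then show ?thesis
      using koszul[OF z ab(1,2) c] closed[OF z ab(1,2) c] ab c
      by (simp add: DG_same_type J_eigen_def G_sym[of c a])
  next
    case False
    then show ?thesis
      using koszul[OF z ab(1,2) c] closed[OF z ab(1,2) c] ab c
      by (simp add: DG_same_type J_eigen_def)
  qed
  then show "(\<Sum>d<2 * m. \<Gamma> d a b z * G d c z) = 0"
    by (simp add: lowered_def)
qed

text \<open>The first two Koszul terms agree by \<open>DG_symmetric\<close>, and the third
  differentiates a zero entry of the metric.\<close>

lemma lowered_even:
  assumes z: "z \<in> U" and abc: "a < 2 * m" "b < 2 * m" "c < 2 * m" and type: "even a" "even b"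
  shows "lowered a b c z = D a (G b c) z"
  using koszul[OF z abc] DG_symmetric[OF z abc] DG_same_type[of a b c z] abc type by simp

lemma metric_origin: "\<alpha> < m \<Longrightarrow> \<beta> < m \<Longrightarrow> g \<alpha> \<beta> (\<lambda>_. 0) = (if \<alpha> = \<beta> then 1 else 0)"
  using normal by (simp add: normal_coordinates_def)

text \<open>\<open>metric_jet\<close> sorts its indices, so normality speaks about one of the two
  orders; \<open>DG_symmetric\<close> supplies the other.\<close>

lemma DG_origin:
  assumes "\<alpha> < m" "\<gamma> < m" "\<delta> < m"
  shows "D (2 * \<alpha>) (G (2 * \<gamma>) (2 * \<delta> + 1)) (\<lambda>_. 0) = 0"
proof -
  have "metric_jet g ({#\<alpha>, \<gamma>#}, {#\<delta>#}) = 0"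
    using normal assms n by (simp add: normal_coordinates_def)
  then have "D (2 * max \<alpha> \<gamma>) (G (2 * min \<alpha> \<gamma>) (2 * \<delta> + 1)) (\<lambda>_. 0) = 0"
    unfolding metric_jet_def by (auto simp: frame_deriv_def frame_metric_def max_def min_def split: if_splits)
  then show ?thesis
    using DG_symmetric[OF origin, of "2 * \<alpha>" "2 * \<gamma>" "2 * \<delta> + 1"] assms
    by (auto simp: max_def min_def split: if_splits)
qed

text \<open>For even \<open>b\<close> the lowered symbol is a first derivative of the metric, zero
  at the origin; for odd \<open>b\<close> the symbol is mixed and vanishes on the whole
  polydisc.\<close>

lemma \<Gamma>_origin:
  assumes b: "b < 2 * m" and \<gamma>: "\<gamma> < m" and d: "d < 2 * m"
  shows "\<Gamma> d b (2 * \<gamma>) (\<lambda>_. 0) = 0"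
proof (cases "even b")
  case True
  show ?thesis
  proof (rule nondegenerate[OF origin _ d])
    fix c assume c: "c < 2 * m"
    have "D b (G (2 * \<gamma>) c) (\<lambda>_. 0) = 0"
    proof (cases "even c")
      case True
      then show ?thesis
        using b by (simp add: DG_same_type)
    next
      case False
      then show ?thesis
        using DG_origin[of "b div 2" \<gamma> "c div 2"] \<open>even b\<close> b c \<gamma> by auto
    qed
    then show "(\<Sum>d<2 * m. \<Gamma> d b (2 * \<gamma>) (\<lambda>_. 0) * G d c (\<lambda>_. 0)) = 0"
      using lowered_even[OF origin, of b "2 * \<gamma>" c] True b c \<gamma> by (simp add: lowered_def)
  qed
next
  case False
  then show ?thesis
    using mixed_zero[OF origin, of b "2 * \<gamma>" d] b \<gamma> d by simp
qed

text \<open>When the formula for the lowered symbol is differentiated, terms with an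
  undifferentiated symbol vanish at the origin. The metric there pairs each index only with its
  conjugate, so a single component is left.\<close>

lemma D\<Gamma>_origin:
  assumes ab: "a < 2 * m" "b < 2 * m" and "\<gamma> < m" "\<delta> < m"
  shows "D a (\<Gamma> (2 * \<delta>) b (2 * \<gamma>)) (\<lambda>_. 0) =
    (if even b then D a (D b (G (2 * \<gamma>) (2 * \<delta> + 1))) (\<lambda>_. 0) else 0)"
proof (cases "even b")
  case True
  let ?o = "\<lambda>_ :: nat. 0 :: complex"
  have \<gamma>\<delta>: "2 * \<gamma> < 2 * m" "2 * \<delta> + 1 < 2 * m" "2 * \<delta> < 2 * m"
    using assms by auto
  have diff: "line_differentiable m (\<Gamma> d b (2 * \<gamma>)) ?o" "line_differentiable m (G d (2 * \<delta> + 1)) ?o" if "d < 2 * m" for d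
    using smooth_line_differentiable[OF smooth_\<Gamma> origin] smooth_line_differentiable[OF smooth_G origin] that ab \<gamma>\<delta>
    by auto
  have "D a (D b (G (2 * \<gamma>) (2 * \<delta> + 1))) ?o = D a (\<lambda>z. \<Sum>d<2 * m. \<Gamma> d b (2 * \<gamma>) z * G d (2 * \<delta> + 1) z) ?o"
  proof (rule frame_deriv_cong[OF _ origin ab(1)])
    fix z assume "z \<in> U"
    then show "D b (G (2 * \<gamma>) (2 * \<delta> + 1)) z = (\<Sum>d<2 * m. \<Gamma> d b (2 * \<gamma>) z * G d (2 * \<delta> + 1) z)"
      using lowered_even[of z b "2 * \<gamma>" "2 * \<delta> + 1"] ab \<gamma>\<delta> True by (simp add: lowered_def)
  qed
  also have "\<dots> = (\<Sum>d<2 * m. D a (\<lambda>z. \<Gamma> d b (2 * \<gamma>) z * G d (2 * \<delta> + 1) z) ?o)"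
    using diff by (intro frame_deriv_sum[OF ab(1)] line_differentiable_mult) auto
  also have "\<dots> = (\<Sum>d<2 * m. if d = 2 * \<delta> then D a (\<Gamma> (2 * \<delta>) b (2 * \<gamma>)) ?o else 0)"
  proof (intro sum.cong refl)
    fix d assume d: "d \<in> {..<2 * m}"
    have "G d (2 * \<delta> + 1) ?o = (if d = 2 * \<delta> then 1 else 0)"
    proof (cases "even d")
      case True
      then show ?thesis
        using metric_origin[of "d div 2" \<delta>] d assms(4) by (auto simp: frame_metric_def)
    qed (auto simp: frame_metric_def)
    then show "D a (\<lambda>z. \<Gamma> d b (2 * \<gamma>) z * G d (2 * \<delta> + 1) z) ?o =
        (if d = 2 * \<delta> then D a (\<Gamma> (2 * \<delta>) b (2 * \<gamma>)) ?o else 0)"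
      using d frame_deriv_mult[OF ab(1) diff] \<Gamma>_origin[OF ab(2) assms(3)] by simp
  qed
  finally show ?thesis
    using True \<gamma>\<delta> by simp
next
  case False
  have "D a (\<Gamma> (2 * \<delta>) b (2 * \<gamma>)) (\<lambda>_. 0) = D a (\<lambda>_. 0) (\<lambda>_. 0)"
    using False assms by (intro frame_deriv_cong[OF _ origin ab(1)] mixed_zero) auto
  then show ?thesis
    using False frame_deriv_const[OF ab(1)] by simp
qed

text \<open>\<open>metric_jet\<close> picks the sorted order of both index pairs; closedness and
  commuting derivatives make the second derivative symmetric within each pair, so every order gives
  the same value.\<close>

lemma metric_jet_pair:
  assumes "\<alpha> < m" "\<gamma> < m" "\<beta> < m" "\<delta> < m"
  shows "metric_jet g ({#\<alpha>, \<gamma>#}, {#\<beta>, \<delta>#}) = D (2 * \<beta> + 1) (D (2 * \<alpha>) (G (2 * \<gamma>) (2 * \<delta> + 1))) (\<lambda>_. 0)"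
proof -
  define T where "T \<alpha> \<gamma> \<beta> \<delta> = D (2 * \<beta> + 1) (D (2 * \<alpha>) (G (2 * \<gamma>) (2 * \<delta> + 1))) (\<lambda>_. 0)" for \<alpha> \<gamma> \<beta> \<delta>
  have T': "T \<alpha> \<gamma> \<beta> \<delta> = D (2 * \<alpha>) (D (2 * \<beta> + 1) (G (2 * \<gamma>) (2 * \<delta> + 1))) (\<lambda>_. 0)"
    if "\<alpha> < m" "\<gamma> < m" "\<beta> < m" "\<delta> < m" for \<alpha> \<gamma> \<beta> \<delta>
    unfolding T_def using that by (intro frame_deriv_commute[OF smooth_G origin]) auto
  have T_hol: "T \<alpha> \<gamma> \<beta> \<delta> = T \<gamma> \<alpha> \<beta> \<delta>" if "\<alpha> < m" "\<gamma> < m" "\<beta> < m" "\<delta> < m" for \<alpha> \<gamma> \<beta> \<delta>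
    unfolding T_def using that by (intro frame_deriv_cong[OF _ origin] DG_symmetric) auto
  have T_antihol: "T \<alpha> \<gamma> \<beta> \<delta> = T \<alpha> \<gamma> \<delta> \<beta>" if "\<alpha> < m" "\<gamma> < m" "\<beta> < m" "\<delta> < m" for \<alpha> \<gamma> \<beta> \<delta>
    unfolding T'[OF that] T'[OF that(1,2,4,3)] G_sym[of "2 * \<gamma>"]
    using that by (intro frame_deriv_cong[OF _ origin] DG_symmetric) auto
  have "metric_jet g ({#\<alpha>, \<gamma>#}, {#\<beta>, \<delta>#}) =
      D (2 * max \<alpha> \<gamma>) (D (2 * max \<beta> \<delta> + 1) (G (2 * min \<alpha> \<gamma>) (2 * min \<beta> \<delta> + 1))) (\<lambda>_. 0)"
    unfolding metric_jet_def by (simp add: frame_deriv_def frame_metric_def max_def min_def)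
  also have "\<dots> = T (max \<alpha> \<gamma>) (min \<alpha> \<gamma>) (max \<beta> \<delta>) (min \<beta> \<delta>)"
    using assms by (intro T'[symmetric]) auto
  also have "\<dots> = T \<alpha> \<gamma> \<beta> \<delta>"
    using assms T_hol[of \<gamma> \<alpha> \<beta> \<delta>] T_hol[of \<gamma> \<alpha> \<delta> \<beta>] T_antihol[of \<alpha> \<gamma> \<delta> \<beta>]
    by (simp add: max_def min_def)
  finally show ?thesis
    by (simp add: T_def)
qed

text \<open>The quadratic terms vanish at the origin, and the derivatives of the symbols are second
  derivatives of the metric. For \<open>a\<close> and \<open>b\<close> of equal type these cancel or
  are both zero; for mixed type exactly one survives, and its position in the difference fixes the
  sign.\<close>

lemma curvature_origin:
  assumes ab: "a < 2 * m" "b < 2 * m" and "\<gamma> < m" "\<delta> < m"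
  shows "curvature m \<Gamma> (2 * \<delta>) a b (2 * \<gamma>) (\<lambda>_. 0) =
    (if even a \<and> odd b then - metric_jet g ({#a div 2, \<gamma>#}, {#b div 2, \<delta>#})
     else if odd a \<and> even b then metric_jet g ({#b div 2, \<gamma>#}, {#a div 2, \<delta>#})
     else 0)"
proof -
  have ab2: "a div 2 < m" "b div 2 < m"
    using ab by auto
  have "D a (D b (G (2 * \<gamma>) (2 * \<delta> + 1))) (\<lambda>_. 0) = D b (D a (G (2 * \<gamma>) (2 * \<delta> + 1))) (\<lambda>_. 0)"
    using assms by (intro frame_deriv_commute[OF smooth_G origin]) auto
  moreover have "(\<Sum>e<2 * m. \<Gamma> (2 * \<delta>) a e (\<lambda>_. 0) * \<Gamma> e b (2 * \<gamma>) (\<lambda>_. 0) -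
      \<Gamma> (2 * \<delta>) b e (\<lambda>_. 0) * \<Gamma> e a (2 * \<gamma>) (\<lambda>_. 0)) = 0"
    using assms by (simp add: \<Gamma>_origin)
  ultimately show ?thesis
    unfolding curvature_def D\<Gamma>_origin[OF ab assms(3,4)] D\<Gamma>_origin[OF ab(2,1) assms(3,4)]
    using metric_jet_pair[OF ab2(1) assms(3) ab2(2) assms(4)] metric_jet_pair[OF ab2(2) assms(3) ab2(1) assms(4)]
    by auto
qed

lemma local_formula_Xi: "local_formula (Xi m k S) g = Xi_geometric m k \<Gamma> S"
proof -
  have "curvature_matrix m \<Gamma> \<delta> \<gamma> = curvature_values m (metric_jet g) \<delta> \<gamma>" if "\<delta> < m" "\<gamma> < m" for \<delta> \<gamma>
    unfolding curvature_matrix_def curvature_values_def two_form_def using that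
    by (intro ext sum.cong refl arg_cong2[where f = "(*)"] curvature_origin) auto
  then have "Xi_of_curvature (\<lambda>c. c) m k (curvature_values m (metric_jet g)) S =
      Xi_of_curvature (\<lambda>c. c) m k (curvature_matrix m \<Gamma>) S"
    by (intro Xi_of_curvature_cong) simp
  then show ?thesis
    by (simp add: local_formula_def Xi_geometric_def ev_Xi fun_eq_iff)
qed

end

theorem theorem1p2:
  fixes m k :: nat
  assumes "1 \<le> k" and "k < m"
  shows
    "(\<forall>S\<in>inv_polys m k. \<forall>\<epsilon> g \<Gamma>.
        0 < \<epsilon> \<and> kaehler_metric m \<epsilon> g \<and> normal_coordinates m (2 * k + 2) g \<and> levi_civita m \<epsilon> g \<Gamma> \<longrightarrow>
        local_formula (Xi m k S) g = Xi_geometric m k \<Gamma> S) \<and>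
     (\<forall>S\<in>inv_polys m k. \<forall>S'\<in>inv_polys m k.
        Xi m k (S + S') = (\<lambda>\<alpha> \<beta>. Xi m k S \<alpha> \<beta> + Xi m k S' \<alpha> \<beta>)) \<and>
     (\<forall>c. \<forall>S\<in>inv_polys m k.
        Xi m k (pconst c * S) = (\<lambda>\<alpha> \<beta>. pconst c * Xi m k S \<alpha> \<beta>)) \<and>
     bij_betw (Xi m k) (inv_polys m k) (restriction_kernel m k)"
proof (intro conjI ballI allI impI)
  fix S \<epsilon> g \<Gamma>
  assume "0 < \<epsilon> \<and> kaehler_metric m \<epsilon> g \<and> normal_coordinates m (2 * k + 2) g \<and> levi_civita m \<epsilon> g \<Gamma>"
  then interpret kaehler_normal m "2 * k + 2" \<epsilon> g \<Gamma>
    by unfold_locales auto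
  show "local_formula (Xi m k S) g = Xi_geometric m k \<Gamma> S"
    by (rule local_formula_Xi)
qed (rule Xi_add Xi_scale bij_betw_Xi[OF assms])+

end
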